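(* Let $G\subseteq S_n$ be any permutation group, $\phi_i$ the given permutation character and $\phi_r$ the regular character. Let $\mathrm{fix}(G)$ be the maximal number of fixed points of a non-identity element of $G$. Then the left tame-wild principle holds for $(G,\phi_i,\phi_r)$, with \[\underline\alpha(G,\phi_i,\phi_r)=1-\frac{\mathrm{fix}(G)}{n}.\] Thus for any $(K,K^{\rm gal})$ of type $(G,\phi_i,\phi_r)$ over any base field $F$, one has $\mathfrak r_{K^{\rm gal}/F}^{1-\mathrm{fix}(G)/n}\mid\mathfrak r_{K/F}$.
   Context: Base fields $F$ are number fields or finite extensions of some $\mathbb{Q}_p$. A tuple $(K_1,\dots,K_r)$ of étale $F$-algebras has type $(G,\phi_1,\dots,\phi_r)$ if for a joint splitting field $L$ one can identify $\mathrm{Gal}(L/F)$ with a subgroup of $G$ so that its action on $\mathrm{Hom}_F(K_j,L)$ has character $\phi_j$; for type $(G,\phi_i,\phi_r)$ the pair is written $(K,K^{\rm gal})$. $c_\mathfrak p(K)$ is the exponent of the prime $\mathfrak p$ of $F$ in the discriminant $\mathfrak d_{K/F}$; the root discriminant is $\mathfrak r_{K/F}=\mathfrak d_{K/F}^{1/[K:F]}$, in the group of fractional ideals tensored with $\mathbb Q$, where divisibility means inequality of all prime exponents. For a non-identity power-conjugacy class $\tau$ of $G$ (elements power-conjugate if each is conjugate to a power of the other) and $\phi$ the character of a permutation representation $\rho$, $c_\tau(\phi)$ is the degree of $\rho$ minus the number of cycles of $\rho(g)$, $g\in\tau$. Set $\alpha(G,\phi_1,\phi_2)=\min_\tau c_\tau(\phi_1)/c_\tau(\phi_2)$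 (over non-identity classes) and $\underline\alpha=\frac{\phi_2(e)}{\phi_1(e)}\alpha$. The left tame-wild principle holds for $(G,\phi_1,\phi_2)$ if for every $F$, every pair $(K_1,K_2)$ of type $(G,\phi_1,\phi_2)$ and every prime $\mathfrak p$ of $F$, $\alpha(G,\phi_1,\phi_2)\,c_\mathfrak p(K_2)\le c_\mathfrak p(K_1)$. *)

theory Defs
  imports "HOL-Combinatorics.Orbits" "HOL-Algebra.Algebra"
begin

section \<open>Finite-dimensional and etale algebras over a field\<close>

text \<open>Algebras over \<open>F\<close> are those of the library locale \<^locale>\<open>algebra\<close>, whose second argument
  is a \<open>module\<close> record, i.e.\ a ring together with a scalar multiplication.\<close>

definition alg_basis :: "'f ring \<Rightarrow> ('f, 'k) module \<Rightarrow> nat \<Rightarrow> (nat \<Rightarrow> 'k) \<Rightarrow> bool" where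
  "alg_basis F K m b \<longleftrightarrow>
     (\<forall>i<m. b i \<in> carrier K) \<and>
     (\<forall>x\<in>carrier K. \<exists>!c. c \<in> {..<m} \<rightarrow>\<^sub>E carrier F \<and>
        x = (\<Oplus>\<^bsub>K\<^esub> i\<in>{..<m}. c i \<odot>\<^bsub>K\<^esub> b i))"

definition alg_degree :: "'f ring \<Rightarrow> ('f, 'k) module \<Rightarrow> nat" where
  "alg_degree F K = (THE m. \<exists>b. alg_basis F K m b)"

definition alg_coord :: "'f ring \<Rightarrow> ('f, 'k) module \<Rightarrow> nat \<Rightarrow> (nat \<Rightarrow> 'k) \<Rightarrow> 'k \<Rightarrow> nat \<Rightarrow> 'f" where
  "alg_coord F K m b x =
     (THE c. c \<in> {..<m} \<rightarrow>\<^sub>E carrier F \<and> x = (\<Oplus>\<^bsub>K\<^esub> i\<in>{..<m}. c i \<odot>\<^bsub>K\<^esub> b i))"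

text \<open>The trace of multiplication by \<open>x\<close>; the choice of the basis is immaterial.\<close>

definition alg_trace :: "'f ring \<Rightarrow> ('f, 'k) module \<Rightarrow> 'k \<Rightarrow> 'f" where
  "alg_trace F K x =
     (let m = alg_degree F K; b = (SOME b. alg_basis F K m b)
      in \<Oplus>\<^bsub>F\<^esub> i\<in>{..<m}. alg_coord F K m b (x \<otimes>\<^bsub>K\<^esub> b i) i)"

definition alg_hom :: "'f ring \<Rightarrow> ('f, 'k) module \<Rightarrow> ('f, 'l) module \<Rightarrow> ('k \<Rightarrow> 'l) set" where
  "alg_hom F K L =
     {h \<in> ring_hom K L \<inter> extensional (carrier K).
        \<forall>c\<in>carrier F. \<forall>x\<in>carrier K. h (c \<odot>\<^bsub>K\<^esub> x) = c \<odot>\<^bsub>L\<^esub> h x}"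

definition alg_prod :: "'i set \<Rightarrow> ('i \<Rightarrow> ('f, 'k) module) \<Rightarrow> ('f, 'i \<Rightarrow> 'k) module" where
  "alg_prod I E =
     \<lparr>carrier = (\<Pi>\<^sub>E i\<in>I. carrier (E i)),
      monoid.mult = (\<lambda>x y. \<lambda>i\<in>I. x i \<otimes>\<^bsub>E i\<^esub> y i),
      monoid.one = (\<lambda>i\<in>I. \<one>\<^bsub>E i\<^esub>),
      ring.zero = (\<lambda>i\<in>I. \<zero>\<^bsub>E i\<^esub>),
      ring.add = (\<lambda>x y. \<lambda>i\<in>I. x i \<oplus>\<^bsub>E i\<^esub> y i),
      module.smult = (\<lambda>c x. \<lambda>i\<in>I. c \<odot>\<^bsub>E i\<^esub> x i)\<rparr>"

text \<open>A finite product of finite field extensions of \<open>F\<close>. The definition is meant for fields \<open>F\<close> of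
  characteristic 0, where separability of the factors is automatic. Each factor of \<open>K\<close> is
  isomorphic to an ideal of \<open>K\<close>, so taking the factors in the type of \<open>K\<close> is no restriction.\<close>

definition etale_algebra :: "'f ring \<Rightarrow> ('f, 'k) module \<Rightarrow> bool" where
  "etale_algebra F K \<longleftrightarrow>
     algebra F K \<and>
     (\<exists>(m::nat) (E :: nat \<Rightarrow> ('f, 'k) module).
        (\<forall>i<m. algebra F (E i) \<and> field (E i) \<and> (\<exists>d b. alg_basis F (E i) d b)) \<and>
        (\<exists>h\<in>alg_hom F K (alg_prod {..<m} E).
           bij_betw h (carrier K) (carrier (alg_prod {..<m} E))))"


section \<open>Base fields and their rings of integers\<close>

definition integral_closure :: "('a, 'm) ring_scheme \<Rightarrow> 'a set \<Rightarrow> 'a set" where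
  "integral_closure R B =
     {x \<in> carrier R. \<exists>(m::nat) a. (\<forall>i<m. a i \<in> B) \<and>
        x [^]\<^bsub>R\<^esub> m \<oplus>\<^bsub>R\<^esub> (\<Oplus>\<^bsub>R\<^esub> i\<in>{..<m}. a i \<otimes>\<^bsub>R\<^esub> x [^]\<^bsub>R\<^esub> i) = \<zero>\<^bsub>R\<^esub>}"

text \<open>The \<open>p\<close>-adic integers as the inverse limit of the residue rings modulo \<open>p ^ k\<close>.\<close>

definition padic_int_ring :: "nat \<Rightarrow> (nat \<Rightarrow> int) ring" where
  "padic_int_ring p =
     \<lparr>carrier = {x. \<forall>k. x k \<in> {0..<int p ^ k} \<and> x (Suc k) mod int p ^ k = x k},
      monoid.mult = (\<lambda>x y k. (x k * y k) mod int p ^ k),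
      monoid.one = (\<lambda>k. 1 mod int p ^ k),
      ring.zero = (\<lambda>k. 0),
      ring.add = (\<lambda>x y k. (x k + y k) mod int p ^ k)\<rparr>"

text \<open>\<open>F\<close> is a finite extension of the fraction field of (an embedded copy of) \<open>R\<close>, and \<open>\<O>\<close> is the
  integral closure of \<open>R\<close> in \<open>F\<close>.\<close>

definition finite_ext_of_frac :: "'r ring \<Rightarrow> 'f ring \<Rightarrow> 'f set \<Rightarrow> bool" where
  "finite_ext_of_frac R F \<O> \<longleftrightarrow>
     field F \<and>
     (\<exists>\<iota>\<in>ring_hom R F. inj_on \<iota> (carrier R) \<and>
        ring.finite_dimension F (generate_field F (\<iota> ` carrier R)) (carrier F) \<and>
        \<O> = integral_closure F (\<iota> ` carrier R))"

text \<open>\<open>F\<close> is a number field, or a finite extension of the field of \<open>p\<close>-adic numbers for some prime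
  \<open>p\<close>, with ring of integers \<open>\<O>\<close>.\<close>

definition base_field :: "'f ring \<Rightarrow> 'f set \<Rightarrow> bool" where
  "base_field F \<O> \<longleftrightarrow>
     finite_ext_of_frac int_ring F \<O> \<or>
     (\<exists>p::nat. Factorial_Ring.prime p \<and> finite_ext_of_frac (padic_int_ring p) F \<O>)"

text \<open>From here on \<open>\<O>\<close> denotes the ring of integers of \<open>F\<close>.\<close>

abbreviation int_subring :: "'f ring \<Rightarrow> 'f set \<Rightarrow> 'f ring" where
  "int_subring F \<O> \<equiv> F\<lparr>carrier := \<O>\<rparr>"

definition prime_of :: "'f ring \<Rightarrow> 'f set \<Rightarrow> 'f set \<Rightarrow> bool" where
  "prime_of F \<O> P \<longleftrightarrow> primeideal P (int_subring F \<O>) \<and> P \<noteq> {\<zero>\<^bsub>F\<^esub>}"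

definition integers_of :: "'f set \<Rightarrow> ('f, 'k) module \<Rightarrow> 'k set" where
  "integers_of \<O> K = integral_closure K ((\<lambda>c. c \<odot>\<^bsub>K\<^esub> \<one>\<^bsub>K\<^esub>) ` \<O>)"


section \<open>Discriminants\<close>

definition ring_det :: "'f ring \<Rightarrow> nat \<Rightarrow> (nat \<Rightarrow> nat \<Rightarrow> 'f) \<Rightarrow> 'f" where
  "ring_det F m A =
     (\<Oplus>\<^bsub>F\<^esub> p\<in>{p. p permutes {..<m}}.
        (if evenperm p then \<one>\<^bsub>F\<^esub> else \<ominus>\<^bsub>F\<^esub> \<one>\<^bsub>F\<^esub>) \<otimes>\<^bsub>F\<^esub> (\<Otimes>\<^bsub>F\<^esub> i\<in>{..<m}. A i (p i)))"

definition basis_disc :: "'f ring \<Rightarrow> ('f, 'k) module \<Rightarrow> nat \<Rightarrow> (nat \<Rightarrow> 'k) \<Rightarrow> 'f" where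
  "basis_disc F K m b = ring_det F m (\<lambda>i j. alg_trace F K (b i \<otimes>\<^bsub>K\<^esub> b j))"

text \<open>The discriminant ideal: generated by the discriminants of all \<open>F\<close>-bases of \<open>K\<close> that consist
  of integral elements.\<close>

definition disc_ideal :: "'f ring \<Rightarrow> 'f set \<Rightarrow> ('f, 'k) module \<Rightarrow> 'f set" where
  "disc_ideal F \<O> K =
     Idl\<^bsub>int_subring F \<O>\<^esub> {basis_disc F K m b | m b.
        alg_basis F K m b \<and> (\<forall>i<m. b i \<in> integers_of \<O> K)}"

definition ideal_exponent :: "'f ring \<Rightarrow> 'f set \<Rightarrow> 'f set \<Rightarrow> nat" where
  "ideal_exponent R P I =
     Max {k::nat. (P [^]\<^bsub>ideals_set R\<^esub> k) divides\<^bsub>ideals_set R\<^esub> I}"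

definition disc_exponent :: "'f ring \<Rightarrow> 'f set \<Rightarrow> 'f set \<Rightarrow> ('f, 'k) module \<Rightarrow> nat" where
  "disc_exponent F \<O> P K = ideal_exponent (int_subring F \<O>) P (disc_ideal F \<O> K)"

text \<open>Fractional ideals tensored with \<open>\<rat>\<close>: the group of fractional ideals is free abelian on the
  primes of \<open>F\<close>, so an element of its tensor product with \<open>\<rat>\<close> (written multiplicatively) is given by
  its rational exponents at the primes. Values at sets that are not primes are irrelevant.\<close>

type_synonym 'f rat_ideal = "'f set \<Rightarrow> rat"

definition to_rat_ideal :: "'f ring \<Rightarrow> 'f set \<Rightarrow> 'f set \<Rightarrow> 'f rat_ideal" where
  "to_rat_ideal F \<O> I = (\<lambda>P. of_nat (ideal_exponent (int_subring F \<O>) P I))"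

definition rat_ideal_pow :: "'f rat_ideal \<Rightarrow> rat \<Rightarrow> 'f rat_ideal" where
  "rat_ideal_pow \<aa> q = (\<lambda>P. q * \<aa> P)"

definition rat_ideal_dvd :: "'f ring \<Rightarrow> 'f set \<Rightarrow> 'f rat_ideal \<Rightarrow> 'f rat_ideal \<Rightarrow> bool" where
  "rat_ideal_dvd F \<O> \<aa> \<bb> \<longleftrightarrow> (\<forall>P. prime_of F \<O> P \<longrightarrow> \<aa> P \<le> \<bb> P)"

definition root_disc :: "'f ring \<Rightarrow> 'f set \<Rightarrow> ('f, 'k) module \<Rightarrow> 'f rat_ideal" where
  "root_disc F \<O> K =
     rat_ideal_pow (to_rat_ideal F \<O> (disc_ideal F \<O> K)) (1 / of_nat (alg_degree F K))"


section \<open>Permutation representations\<close>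

text \<open>A pair of the set acted upon and the action, in the sense of \<^locale>\<open>group_action\<close>.\<close>

type_synonym ('g, 'x) perm_rep = "'x set \<times> ('g \<Rightarrow> 'x \<Rightarrow> 'x)"

definition perm_char :: "('g, 'x) perm_rep \<Rightarrow> 'g \<Rightarrow> nat" where
  "perm_char \<rho> g = card (invariants (fst \<rho>) (snd \<rho>) g)"

definition num_cycles :: "('g, 'x) perm_rep \<Rightarrow> 'g \<Rightarrow> nat" where
  "num_cycles \<rho> g = card (Orbits.orbit (snd \<rho> g) ` fst \<rho>)"

definition permutation_group :: "nat \<Rightarrow> (nat \<Rightarrow> nat) monoid \<Rightarrow> bool" where
  "permutation_group n G \<longleftrightarrow>
     subgroup (carrier G) (sym_group n) \<and> G = (sym_group n)\<lparr>carrier := carrier G\<rparr>"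

definition given_rep :: "nat \<Rightarrow> (nat \<Rightarrow> nat, nat) perm_rep" where
  "given_rep n = ({1..n}, \<lambda>g. \<lambda>x\<in>{1..n}. g x)"

definition regular_rep :: "'g monoid \<Rightarrow> ('g, 'g) perm_rep" where
  "regular_rep G = (carrier G, \<lambda>g. \<lambda>x\<in>carrier G. g \<otimes>\<^bsub>G\<^esub> x)"

definition max_fixed_points :: "nat \<Rightarrow> (nat \<Rightarrow> nat) monoid \<Rightarrow> nat" where
  "max_fixed_points n G =
     Max ((\<lambda>g. card {x \<in> {1..n}. g x = x}) ` (carrier G - {\<one>\<^bsub>G\<^esub>}))"

definition conj_to_power :: "'g monoid \<Rightarrow> 'g \<Rightarrow> 'g \<Rightarrow> bool" where
  "conj_to_power G g h \<longleftrightarrow>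
     (\<exists>x\<in>carrier G. \<exists>k::nat. g = x \<otimes>\<^bsub>G\<^esub> h [^]\<^bsub>G\<^esub> k \<otimes>\<^bsub>G\<^esub> inv\<^bsub>G\<^esub> x)"

definition power_conj_rel :: "'g monoid \<Rightarrow> ('g \<times> 'g) set" where
  "power_conj_rel G =
     {(g, h) \<in> carrier G \<times> carrier G. conj_to_power G g h \<and> conj_to_power G h g}"

definition nonid_power_conj_classes :: "'g monoid \<Rightarrow> 'g set set" where
  "nonid_power_conj_classes G = carrier G // power_conj_rel G - {{\<one>\<^bsub>G\<^esub>}}"

text \<open>The image below is a singleton: power-conjugate elements have the same cycle type.\<close>

definition c_class :: "('g, 'x) perm_rep \<Rightarrow> 'g set \<Rightarrow> nat" where
  "c_class \<rho> \<tau> = the_elem ((\<lambda>g. card (fst \<rho>) - num_cycles \<rho> g) ` \<tau>)"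

definition tw_alpha :: "'g monoid \<Rightarrow> ('g, 'x) perm_rep \<Rightarrow> ('g, 'y) perm_rep \<Rightarrow> rat" where
  "tw_alpha G \<rho>1 \<rho>2 =
     Min ((\<lambda>\<tau>. of_nat (c_class \<rho>1 \<tau>) / of_nat (c_class \<rho>2 \<tau>)) ` nonid_power_conj_classes G)"

definition tw_alpha_bar :: "'g monoid \<Rightarrow> ('g, 'x) perm_rep \<Rightarrow> ('g, 'y) perm_rep \<Rightarrow> rat" where
  "tw_alpha_bar G \<rho>1 \<rho>2 =
     of_nat (perm_char \<rho>2 \<one>\<^bsub>G\<^esub>) / of_nat (perm_char \<rho>1 \<one>\<^bsub>G\<^esub>) * tw_alpha G \<rho>1 \<rho>2"


section \<open>The type of a tuple of etale algebras and the left tame-wild principle\<close>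

definition galois_group :: "'f ring \<Rightarrow> ('f, 'l) module \<Rightarrow> ('l \<Rightarrow> 'l) monoid" where
  "galois_group F L = (BijGroup (carrier L))\<lparr>carrier := alg_hom F L L \<inter> Bij (carrier L)\<rparr>"

definition hom_rep :: "'f ring \<Rightarrow> ('f, 'k) module \<Rightarrow> ('f, 'l) module \<Rightarrow> ('l \<Rightarrow> 'l, 'k \<Rightarrow> 'l) perm_rep" where
  "hom_rep F K L = (alg_hom F K L, \<lambda>\<sigma>. \<lambda>h\<in>alg_hom F K L. compose (carrier K) \<sigma> h)"

text \<open>\<open>L\<close> splits \<open>K\<close> if there are \<open>[K : F]\<close> many \<open>F\<close>-homomorphisms from \<open>K\<close> to \<open>L\<close>; a joint splitting
  field is moreover generated over \<open>F\<close> by the images of all these homomorphisms.\<close>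

definition joint_splitting_field :: "'f ring \<Rightarrow> ('f, 'k) module list \<Rightarrow> ('f, 'l) module \<Rightarrow> bool" where
  "joint_splitting_field F Ks L \<longleftrightarrow>
     algebra F L \<and> field L \<and>
     (\<forall>K\<in>set Ks. finite (alg_hom F K L) \<and> card (alg_hom F K L) = alg_degree F K) \<and>
     carrier L = generate_field L
       ((\<lambda>c. c \<odot>\<^bsub>L\<^esub> \<one>\<^bsub>L\<^esub>) ` carrier F \<union>
        (\<Union>K\<in>set Ks. \<Union>h\<in>alg_hom F K L. h ` carrier K))"

text \<open>The tuple \<open>Ks\<close> has type \<open>(G, \<phi>s)\<close>, as witnessed by the joint splitting field \<open>L\<close>.\<close>

definition has_type ::
  "'g monoid \<Rightarrow> ('g \<Rightarrow> nat) list \<Rightarrow> 'f ring \<Rightarrow> ('f, 'k) module list \<Rightarrow> ('f, 'l) module \<Rightarrow> bool" where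
  "has_type G \<phi>s F Ks L \<longleftrightarrow>
     (\<forall>K\<in>set Ks. etale_algebra F K) \<and>
     joint_splitting_field F Ks L \<and>
     (\<exists>\<iota>\<in>hom (galois_group F L) G. inj_on \<iota> (carrier (galois_group F L)) \<and>
        list_all2 (\<lambda>\<phi> K. \<forall>\<sigma>\<in>carrier (galois_group F L). perm_char (hom_rep F K L) \<sigma> = \<phi> (\<iota> \<sigma>))
          \<phi>s Ks)"

text \<open>The first argument only names the types in which the carriers of the base field, of the
  etale algebras and of the splitting field live.\<close>

definition left_tame_wild_principle ::
  "('f \<times> 'k \<times> 'l) itself \<Rightarrow> 'g monoid \<Rightarrow> ('g, 'x) perm_rep \<Rightarrow> ('g, 'y) perm_rep \<Rightarrow> bool" where
  "left_tame_wild_principle _ G \<rho>1 \<rho>2 \<longleftrightarrow>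
     (\<forall>(F :: 'f ring) \<O> (K1 :: ('f, 'k) module) (K2 :: ('f, 'k) module) (L :: ('f, 'l) module) P.
        base_field F \<O> \<longrightarrow> has_type G [perm_char \<rho>1, perm_char \<rho>2] F [K1, K2] L \<longrightarrow>
        prime_of F \<O> P \<longrightarrow>
        tw_alpha G \<rho>1 \<rho>2 * of_nat (disc_exponent F \<O> P K2) \<le> of_nat (disc_exponent F \<O> P K1))"

end

theory Submission
  imports Defs "Jordan_Normal_Form.Char_Poly"
begin

text \<open>
  Only the inequality between the discriminant exponents has content; the formula for \<open>\<alpha>\<close> is a
  count of fixed points. Let \<open>Q\<close> be a prime of the splitting field \<open>L\<close> above the given prime, \<open>D\<close> its
  decomposition group, \<open>N\<close> the absolute value at \<open>Q\<close>, and choose an integer \<open>\<alpha>\<close> of \<open>L\<close> such that the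
  polynomials in \<open>\<alpha>\<close> with integer coefficients are \<open>Q\<close>-adically dense in the integers. Put
  \<open>M = \<Prod> N (\<alpha> - g \<alpha>)\<close> over the \<open>g \<noteq> 1\<close> in \<open>D\<close>.

  If \<open>b\<close> is an integral basis of \<open>K\<close>, replacing the rows of the matrix of the conjugates of \<open>b\<close> by divided
  differences along the orbits of \<open>D\<close> at the points \<open>g \<alpha>\<close> leaves an integral matrix. Hence the
  absolute value of the discriminant is at most the product of \<open>N (\<alpha> - g \<alpha>)\<close> to the number of
  homomorphisms moved by \<open>g\<close>, and so at most \<open>M\<close> to the power \<open>n - fix(G)\<close>. For the algebra with
  regular character the action is free, \<open>\<alpha>\<close> lifts to the algebra, and a triangular system of integral
  elements built from products of differences gives the lower bound \<open>M\<close> to the power \<open>|G|\<close> for a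
  basis whose discriminant has minimal valuation. No ramification theory is needed, and tame and wild primes
  are treated alike.
\<close>

section \<open>Integral elements\<close>

text \<open>The number M is the absolute value at Q of the different of L over F: the completed ring
  of integers is generated by one element, and the different is generated by the product of the
  differences between it and its conjugates. Density of the polynomials in \<alpha> takes the place
  of the completion, so no complete field is constructed. The bound for K to the power |G| and the
  bound for the regular algebra to the power n - fix(G) meet in the same power of M. Integral bases
  need not exist over a number field; a basis with discriminant of least valuation at the given
  prime behaves like one at that prime. Number fields and p-adic fields are treated together through
  a few properties of the image of the ground ring, the integers or the p-adic integers. The field L
  is only known to be generated by values of homomorphisms; what is needed of Galois theory, that
  every F-linear map of L is a combination of automorphisms, is obtained from the coordinates of the
  two algebras. Determinants are available over types of a field class while the statement speaks of
  records, so both fields are copied to types.\<close>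

definition is_subring :: "'a::comm_ring_1 set => bool" where
  "is_subring R \<longleftrightarrow> 1 \<in> R \<and> (\<forall>x\<in>R. \<forall>y\<in>R. x - y \<in> R \<and> x * y \<in> R)"

lemma is_subring_closed:
  assumes "is_subring R"
  shows "1 \<in> R" "0 \<in> R" "x \<in> R ==> y \<in> R ==> x - y \<in> R" "x \<in> R ==> y \<in> R ==> x * y \<in> R"
    "x \<in> R ==> - x \<in> R" "x \<in> R ==> y \<in> R ==> x + y \<in> R"
proof -
  show 1: "1 \<in> R" using assms by (auto simp: is_subring_def)
  show d: "x \<in> R ==> y \<in> R ==> x - y \<in> R" for x y using assms by (auto simp: is_subring_def)
  show "x \<in> R ==> y \<in> R ==> x * y \<in> R" using assms by (auto simp: is_subring_def)
  show 0: "0 \<in> R" using d[OF 1 1] by simp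
  show n: "x \<in> R ==> - x \<in> R" for x using d[OF 0, of x] by simp
  show "x \<in> R ==> y \<in> R ==> x + y \<in> R" using d[of x "- y"] n[of y] by simp
qed

lemma is_subring_sum: "is_subring R ==> (\<And>i. i \<in> I ==> f i \<in> R) ==> sum f I \<in> R"
  by (induction I rule: infinite_finite_induct) (auto intro: is_subring_closed)

lemma is_subring_prod: "is_subring R ==> (\<And>i. i \<in> I ==> f i \<in> R) ==> prod f I \<in> R"
  by (induction I rule: infinite_finite_induct) (auto intro: is_subring_closed)

lemma is_subring_power: "is_subring R ==> x \<in> R ==> x ^ n \<in> R"
  by (induction n) (auto intro: is_subring_closed)

lemma is_subring_of_nat: "is_subring R ==> of_nat n \<in> R"
  by (induction n) (auto intro: is_subring_closed)

lemma is_subring_of_int: "is_subring R ==> of_int n \<in> R"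
  by (cases n) (auto intro: is_subring_closed is_subring_of_nat)

lemma det_in_subring:
  assumes "is_subring R" "A \<in> carrier_mat n n" "\<And>i j. i < n ==> j < n ==> A $$ (i,j) \<in> R"
  shows "det A \<in> R"
  unfolding det_def'[OF assms(2)]
proof (intro is_subring_sum is_subring_closed is_subring_prod assms(1))
  fix p i assume "p \<in> {p. p permutes {0..<n}}" "i \<in> {0..<n}"
  thus "A $$ (i, p i) \<in> R" using assms(3)[of i "p i"] permutes_in_image[of p "{0..<n}" i] by auto
next
  fix p show "signof p \<in> R" using assms(1)
    by (auto simp: sign_def is_subring_closed)
qed

lemma is_subring_polys:
  assumes "is_subring R" shows "is_subring {q. \<forall>i. Polynomial.coeff q i \<in> R}"
  using assms unfolding is_subring_def[of "{q. _ q}"]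
  by (auto simp: coeff_mult Polynomial.coeff_1 intro!: is_subring_closed is_subring_sum)

text \<open>The characteristic polynomial is itself a determinant, over the subring of polynomials
  with coefficients in \<open>R\<close>.\<close>

lemma char_poly_coeff_in_subring:
  assumes "is_subring R" "A \<in> carrier_mat n n" "\<And>i j. i < n ==> j < n ==> A $$ (i,j) \<in> R"
  shows "Polynomial.coeff (char_poly A) i \<in> R"
proof -
  have "char_poly A \<in> {q. \<forall>i. Polynomial.coeff q i \<in> R}"
    unfolding char_poly_def
  proof (rule det_in_subring[OF is_subring_polys[OF assms(1)]])
    show "char_poly_matrix A \<in> carrier_mat n n" using assms(2) by simp
    fix i j assume "i < n" "j < n"
    thus "char_poly_matrix A $$ (i, j) \<in> {q. \<forall>i. Polynomial.coeff q i \<in> R}"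
      using assms by (auto simp: char_poly_matrix_def coeff_pCons split: nat.split
        intro!: is_subring_closed)
  qed
  thus ?thesis by auto
qed

text \<open>Bezout's identity, with the inverse reduced to a natural number and the error kept as an
  integer multiple of \<open>p\<close>: in this form the identity can be carried by
  \<open>of_int\<close> into any field.\<close>

lemma inverse_mod_prime:
  assumes "Factorial_Ring.prime p" "0 < a" "a < p"
  obtains u :: nat and q :: int where "int a * int u = 1 + int p * q"
proof -
  have "coprime a p" using assms
    by (metis coprime_commute nat_dvd_not_less prime_imp_coprime)
  hence "gcd (int a) (int p) = 1" by (simp add: coprime_iff_gcd_eq_1)
  then obtain x y where xy: "x * int a + y * int p = 1" using bezout_int[of "int a" "int p"] by auto
  define u where "u = nat (x mod int p)"
  have "int u = x mod int p" using assms by (simp add: u_def)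
  hence "int u = x - int p * (x div int p)" by (simp add: minus_mult_div_eq_mod)
  hence "int a * int u = x * int a - int p * (int a * (x div int p))" by (simp only:) (simp add: algebra_simps)
  also have "x * int a = 1 - y * int p" using xy by simp
  finally have "int a * int u = 1 + int p * (- y - int a * (x div int p))" by (simp add: algebra_simps)
  thus ?thesis using that by blast
qed

section \<open>Integrality and stable finitely generated modules\<close>

definition integral_over :: "'a::field set => 'a => bool" where
  "integral_over R z \<longleftrightarrow> (\<exists>m a. (\<forall>i<m. a i \<in> R) \<and> z ^ m + (\<Sum>i<m. a i * z ^ i) = 0)"

definition lspan :: "'a::field set => 'a set => 'a set" where
  "lspan R B = {\<Sum>b\<in>B. c b * b | c. \<forall>b\<in>B. c b \<in> R}"

lemma lspan_add:
  assumes "is_subring R" "x \<in> lspan R B" "y \<in> lspan R B" shows "x + y \<in> lspan R B"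
proof -
  obtain c d where "x = (\<Sum>b\<in>B. c b * b)" "\<forall>b\<in>B. c b \<in> R" "y = (\<Sum>b\<in>B. d b * b)" "\<forall>b\<in>B. d b \<in> R"
    using assms unfolding lspan_def by blast
  thus ?thesis unfolding lspan_def using assms(1)
    by (auto intro!: exI[of _ "\<lambda>b. c b + d b"] simp: sum.distrib ring_distribs is_subring_closed)
qed

lemma lspan_smult:
  assumes "is_subring R" "x \<in> lspan R B" "r \<in> R" shows "r * x \<in> lspan R B"
proof -
  obtain c where "x = (\<Sum>b\<in>B. c b * b)" "\<forall>b\<in>B. c b \<in> R"
    using assms unfolding lspan_def by blast
  thus ?thesis unfolding lspan_def using assms
    by (auto intro!: exI[of _ "\<lambda>b. r * c b"] simp: sum_distrib_left mult.assoc is_subring_closed)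
qed

lemma lspan_zero: "is_subring R ==> 0 \<in> lspan R B"
  unfolding lspan_def by (auto intro!: exI[of _ "\<lambda>b. 0"] simp: is_subring_closed)

lemma lspan_sum: "is_subring R ==> (\<And>i. i \<in> I ==> f i \<in> lspan R B) ==> sum f I \<in> lspan R B"
  by (induction I rule: infinite_finite_induct) (auto intro: lspan_add lspan_zero)

lemma lspan_base:
  assumes "is_subring R" "finite B" "b \<in> B" shows "b \<in> lspan R B"
proof -
  have "(\<Sum>x\<in>B. (if x = b then 1 else 0) * x) = (\<Sum>x\<in>B. if x = b then x else 0)"
    by (intro sum.cong) auto
  hence "b = (\<Sum>x\<in>B. (if x = b then 1 else 0) * x)" using assms by simp
  thus ?thesis unfolding lspan_def using assms(1) by (auto simp: is_subring_closed)
qed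

lemma lspan_mult:
  assumes "is_subring R" "x \<in> lspan R B" "\<And>b. b \<in> B ==> t * b \<in> lspan R B'"
  shows "t * x \<in> lspan R B'"
proof -
  obtain c where c: "x = (\<Sum>b\<in>B. c b * b)" "\<forall>b\<in>B. c b \<in> R"
    using assms unfolding lspan_def by blast
  have "t * x = (\<Sum>b\<in>B. c b * (t * b))" unfolding c by (simp add: sum_distrib_left ac_simps)
  also have "... \<in> lspan R B'"
    by (intro lspan_sum lspan_smult assms(1,3)) (use c(2) in auto)
  finally show ?thesis .
qed

text \<open>The determinant trick: multiplication by \<open>z\<close> on the generators is a matrix
  over \<open>R\<close>, the vector of generators is an eigenvector for \<open>z\<close>, and the
  characteristic polynomial is monic over \<open>R\<close>. A nonzero generator makes the
  eigenvector nonzero.\<close>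

lemma integral_over_if_stable_lspan:
  fixes z :: "'a::field"
  assumes R: "is_subring R" and B: "finite B" and nz: "\<exists>b\<in>B. b ~= 0"
    and st: "\<And>b. b \<in> B ==> z * b \<in> lspan R B"
  shows "integral_over R z"
proof -
  obtain bs where bs: "set bs = B" "distinct bs" using B finite_distinct_list by blast
  define n where "n = length bs"
  have "\<forall>b\<in>B. \<exists>c. (\<forall>x\<in>B. c x \<in> R) \<and> z * b = (\<Sum>x\<in>B. c x * x)" 
    using st unfolding lspan_def by blast
  then obtain c where c: "\<And>b x. b \<in> B ==> x \<in> B ==> c b x \<in> R"
     "\<And>b. b \<in> B ==> z * b = (\<Sum>x\<in>B. c b x * x)" by metis
  define A where "A = mat n n (\<lambda>(i,j). c (bs ! i) (bs ! j))"
  define v where "v = vec n (\<lambda>i. bs ! i)"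
  have A: "A \<in> carrier_mat n n" unfolding A_def by simp
  have inB: "i < n ==> bs ! i \<in> B" for i using bs n_def by auto
  have sumB: "(\<Sum>x\<in>B. f x) = (\<Sum>i<n. f (bs ! i))" for f :: "'a => 'a"
    unfolding bs(1)[symmetric] n_def
    by (rule sum.reindex_bij_betw[symmetric]) (use bs(2) in \<open>auto simp: bij_betw_nth\<close>)
  have "A *\<^sub>v v = z \<cdot>\<^sub>v v"
  proof (rule eq_vecI)
    fix i assume "i < dim_vec (z \<cdot>\<^sub>v v)"
    hence i: "i < n" by (simp add: v_def)
    have "(A *\<^sub>v v) $ i = (\<Sum>j<n. c (bs!i) (bs!j) * (bs ! j))"
      using i unfolding A_def v_def by (simp add: scalar_prod_def atLeast0LessThan)
    also have "... = z * (bs ! i)" using c(2)[OF inB[OF i]] sumB[of "\<lambda>x. c (bs!i) x * x"] by simp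
    finally show "(A *\<^sub>v v) $ i = (z \<cdot>\<^sub>v v) $ i" using i by (simp add: v_def)
  qed (simp add: A_def v_def)
  moreover have "v ~= 0\<^sub>v n"
  proof -
    obtain i where "i < n" "bs ! i ~= 0" using nz bs n_def by (metis in_set_conv_nth)
    hence "v $ i ~= 0\<^sub>v n $ i" by (simp add: v_def)
    thus ?thesis by metis
  qed
  ultimately have "eigenvalue A z" unfolding eigenvalue_def eigenvector_def
    using A by (intro exI[of _ v]) (auto simp: v_def)
  hence root: "poly (char_poly A) z = 0" using eigenvalue_root_char_poly[OF A] by simp
  have deg: "Polynomial.degree (char_poly A) = n" "Polynomial.coeff (char_poly A) n = 1"
    using degree_monic_char_poly[OF A] by auto
  have "(\<Sum>i\<le>n. Polynomial.coeff (char_poly A) i * z ^ i) = 0"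
    using root unfolding poly_altdef deg .
  hence "z ^ n + (\<Sum>i<n. Polynomial.coeff (char_poly A) i * z ^ i) = 0"
    using deg(2) by (simp add: lessThan_Suc_atMost[symmetric] add.commute)
  moreover have "Polynomial.coeff (char_poly A) i \<in> R" for i
    by (rule char_poly_coeff_in_subring[OF R A]) (use c(1) inB in \<open>simp add: A_def\<close>)
  ultimately show ?thesis unfolding integral_over_def by blast
qed

lemma integral_over_mem: "is_subring R ==> r \<in> R ==> integral_over R r"
  unfolding integral_over_def
  by (intro exI[of _ 1] exI[of _ "\<lambda>_. - r"]) (auto simp: is_subring_closed)

lemma integral_over_degree_pos:
  assumes "integral_over R (z :: 'a::field)"
  obtains m a where "m > 0" "\<forall>i<m. a i \<in> R" "z ^ m = - (\<Sum>i<m. a i * z ^ i)"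
proof -
  obtain m a where *: "\<forall>i<m. a i \<in> R" "z ^ m + (\<Sum>i<m. a i * z ^ i) = 0"
    using assms unfolding integral_over_def by blast
  hence "m > 0" by (cases m) auto
  thus ?thesis using * that[of m a] by (simp add: add_eq_0_iff2)
qed

text \<open>Adjoining \<open>z\<close> to a module: the new generators are the products of
  \<open>z ^ i\<close>, \<open>i < m\<close>, with the old ones. The coefficients of the equation
  are asked to stabilise the span of \<open>B\<close> instead of lying in \<open>R\<close>; this is
  the form that makes integrality transitive.\<close>

lemma lspan_powers_stable:
  assumes R: "is_subring R" and B: "finite B" and m: "m > 0"
    and z: "z ^ m = - (\<Sum>i<m. a i * z ^ i)"
    and a: "\<And>i b. i < m ==> b \<in> B ==> a i * b \<in> lspan R B"
    and B': "B' = (\<lambda>(i, b). z ^ i * b) ` ({..<m} \<times> B)"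
  shows "\<And>x. x \<in> B' ==> z * x \<in> lspan R B'"
    and "\<And>t x. (\<And>b. b \<in> B ==> t * b \<in> lspan R B) ==> x \<in> B' ==> t * x \<in> lspan R B'"
proof -
  have fB': "finite B'" using B B' by auto
  have up: "z ^ i * x \<in> lspan R B'" if "i < m" "x \<in> lspan R B" for i x
    by (rule lspan_mult[OF R that(2)], rule lspan_base[OF R fB']) (use that(1) B' in auto)
  show "z * x \<in> lspan R B'" if x: "x \<in> B'" for x
  proof -
    obtain i b where ib: "i < m" "b \<in> B" "x = z ^ i * b" using x B' by auto
    show ?thesis
    proof (cases "Suc i < m")
      case True
      hence "z ^ Suc i * b \<in> B'" unfolding B' using ib by (intro image_eqI[of _ _ "(Suc i, b)"]) auto
      moreover have "z * x = z ^ Suc i * b" using ib by (simp add: ac_simps)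
      ultimately show ?thesis using lspan_base[OF R fB'] by metis
    next
      case False
      hence "m = Suc i" using ib by auto
      hence "z * x = z ^ m * b" using ib by (simp add: ac_simps)
      also have "... = (-1) * (\<Sum>j<m. z ^ j * (a j * b))"
        unfolding z by (simp add: sum_distrib_left sum_negf ac_simps)
      also have "... \<in> lspan R B'"
        by (intro lspan_smult[OF R] lspan_sum[OF R] up a ib) (auto simp: is_subring_closed[OF R])
      finally show ?thesis .
    qed
  qed
  show "t * x \<in> lspan R B'" if t: "\<And>b. b \<in> B ==> t * b \<in> lspan R B" and x: "x \<in> B'" for t x
  proof -
    obtain i b where ib: "i < m" "b \<in> B" "x = z ^ i * b" using x B' by auto
    have "t * x = z ^ i * (t * b)" using ib by (simp add: ac_simps)
    thus ?thesis using up[OF ib(1) t[OF ib(2)]] by metis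
  qed
qed

text \<open>One module serves all elements of \<open>A\<close> at once, as sums and products
  require. Keeping 1 among the generators makes the module nonzero.\<close>

lemma finite_integral_stable_lspan:
  assumes R: "is_subring R" and "finite A" "\<And>a. a \<in> A ==> integral_over R a"
  shows "\<exists>B. finite B \<and> (1::'a::field) \<in> B \<and> (\<forall>a\<in>A. \<forall>b\<in>B. a * b \<in> lspan R B)"
  using assms(2,3)
proof (induction A rule: finite_induct)
  case empty
  show ?case by (intro exI[of _ "{1}"]) auto
next
  case (insert z A)
  then obtain B where B: "finite B" "1 \<in> B" "\<forall>a\<in>A. \<forall>b\<in>B. a * b \<in> lspan R B" by auto
  obtain m a where m: "m > 0" "\<forall>i<m. a i \<in> R" "z ^ m = - (\<Sum>i<m. a i * z ^ i)"
    using integral_over_degree_pos[of R z] insert.prems by auto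
  define B' where "B' = (\<lambda>(i, b). z ^ i * b) ` ({..<m} \<times> B)"
  have a: "a i * b \<in> lspan R B" if "i < m" "b \<in> B" for i b
    using that m(2) B(1) R by (intro lspan_smult lspan_base) auto
  note st = lspan_powers_stable[OF R B(1) m(1) m(3) a B'_def]
  have "1 \<in> B'" using m(1) B(2) unfolding B'_def by (intro image_eqI[of _ _ "(0,1)"]) auto
  moreover have "finite B'" using B(1) by (auto simp: B'_def)
  ultimately show ?case using st B(3) by (intro exI[of _ B']) auto
qed

lemma is_subring_integral_closure:
  assumes R: "is_subring R" shows "is_subring {z::'a::field. integral_over R z}"
  unfolding is_subring_def
proof (intro conjI ballI)
  show "1 \<in> {z. integral_over R z}" using integral_over_mem[OF R] is_subring_closed[OF R] by auto
  fix x y assume "x \<in> {z. integral_over R z}" "y \<in> {z. integral_over R z}"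
  then obtain B where B: "finite B" "1 \<in> B" "\<And>a b. a \<in> {x,y} ==> b \<in> B ==> a * b \<in> lspan R B"
    using finite_integral_stable_lspan[OF R, of "{x,y}"] by fastforce
  have nz: "\<exists>b\<in>B. b ~= 0" using B(2) by (intro bexI[of _ 1]) auto
  have "(x - y) * b \<in> lspan R B" if "b \<in> B" for b
  proof -
    have "(x - y) * b = x * b + (-1) * (y * b)" by (simp add: algebra_simps)
    thus ?thesis using B(3) that is_subring_closed[OF R]
      by (metis insertCI lspan_add[OF R] lspan_smult[OF R])
  qed
  thus "x - y \<in> {z. integral_over R z}" using integral_over_if_stable_lspan[OF R B(1) nz] by simp
  have "(x * y) * b \<in> lspan R B" if "b \<in> B" for b
    using lspan_mult[OF R B(3)[of y b], of x B] B(3) that by (simp add: mult.assoc)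
  thus "x * y \<in> {z. integral_over R z}" using integral_over_if_stable_lspan[OF R B(1) nz] by simp
qed

text \<open>The finitely many coefficients of the equation stabilise a common module over
  \<open>R\<close>, and adjoining the powers of \<open>z\<close> to it makes it stable under
  \<open>z\<close> too.\<close>

lemma integral_over_trans:
  assumes R: "is_subring R" and "integral_over {z. integral_over R z} (z::'a::field)"
  shows "integral_over R z"
proof -
  obtain m a where m: "m > 0" "\<forall>i<m. a i \<in> {z. integral_over R z}" "z ^ m = - (\<Sum>i<m. a i * z ^ i)"
    using integral_over_degree_pos[OF assms(2)] by metis
  then obtain B where B: "finite B" "1 \<in> B" "\<forall>x\<in>a ` {..<m}. \<forall>b\<in>B. x * b \<in> lspan R B"
    using finite_integral_stable_lspan[OF R, of "a ` {..<m}"] by auto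
  define B' where "B' = (\<lambda>(i, b). z ^ i * b) ` ({..<m} \<times> B)"
  have "\<And>x. x \<in> B' ==> z * x \<in> lspan R B'"
    by (rule lspan_powers_stable(1)[OF R B(1) m(1) m(3) _ B'_def]) (use B(3) in auto)
  moreover have "1 \<in> B'" using m(1) B(2) unfolding B'_def by (intro image_eqI[of _ _ "(0,1)"]) auto
  moreover have "finite B'" using B(1) by (auto simp: B'_def)
  ultimately show ?thesis by (intro integral_over_if_stable_lspan[OF R, of B']) (auto intro!: bexI[of _ 1])
qed

text \<open>The equation is \<open>X ^ l - X ^ j + (c ^ j - c ^ l) = 0\<close>. Applied to two
  congruent powers found by a pigeonhole argument, it shows that an element is integral without any
  chain condition.\<close>

lemma integral_over_power_diff:
  assumes R: "is_subring R" and "j < l" "c ^ j - c ^ l \<in> R" shows "integral_over R (c::'a::field)"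
proof -
  \<comment> \<open>A sum of two cases rather than a case distinction, so that \<open>j = 0\<close>
    is covered as well.\<close>
  define a where "a i = (if i = 0 then c ^ j - c ^ l else 0) + (if i = j then -1 else 0)" for i
  have "(\<Sum>i<l. a i * c ^ i) = (\<Sum>i<l. (if i = 0 then c ^ j - c ^ l else 0)) + (\<Sum>i<l. if i = j then - (c ^ j) else 0)"
    unfolding sum.distrib[symmetric] a_def by (intro sum.cong) (auto simp: algebra_simps)
  also have "... = - (c ^ l)" using assms(2) by auto
  finally show ?thesis using assms is_subring_closed[OF R] unfolding integral_over_def
    by (intro exI[of _ l] exI[of _ a]) (auto simp: a_def)
qed

section \<open>Rings of integers and their primes\<close>

text \<open>Common properties of the ground ring \<open>R\<close>, which will be the image of the
  integers, with any prime \<open>p\<close>, or of the \<open>p\<close>-adic integers. Residues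
  modulo \<open>p\<close> are represented by \<open>0, ..., p - 1\<close>, no nonzero element is
  divisible by every power of \<open>p\<close>, and any \<open>d + 1\<close> field elements are
  linearly dependent over \<open>R\<close>.\<close>

locale arith_ring =
  fixes R :: "'a::field_char_0 set" and p :: nat
  assumes subring: "is_subring R"
    and prime_p: "Factorial_Ring.prime p"
    and residue: "\<And>r. r \<in> R ==> \<exists>i<p. \<exists>s\<in>R. r = of_nat i + of_nat p * s"
    and separated: "\<And>r. r \<in> R ==> r ~= 0 ==> \<exists>k. \<forall>s\<in>R. r ~= of_nat p ^ k * s"
    and rank: "\<exists>d::nat. \<forall>y::nat => 'a. \<exists>r. (\<forall>i\<le>d. r i \<in> R) \<and> (\<exists>i\<le>d. r i ~= 0) \<and> (\<Sum>i\<le>d. r i * y i) = 0"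
begin

definition ints :: "'a set" where "ints = {z. integral_over R z}"

lemma ints_subring: "is_subring ints"
  unfolding ints_def by (rule is_subring_integral_closure[OF subring])

lemmas ints_closed = is_subring_closed[OF ints_subring] is_subring_power[OF ints_subring]
  is_subring_of_nat[OF ints_subring] is_subring_of_int[OF ints_subring]

lemma R_ints: "R \<subseteq> ints" unfolding ints_def using integral_over_mem[OF subring] by auto

lemma ints_integrally_closed: "integral_over ints z ==> z \<in> ints"
  unfolding ints_def using integral_over_trans[OF subring] by auto

lemma p_neq_0: "(of_nat p :: 'a) ~= 0" using prime_p by (auto simp: prime_gt_0_nat)

text \<open>A dependence between the powers of \<open>z\<close>, cut off at its last nonzero
  coefficient \<open>r m\<close>, becomes a monic equation for \<open>r m * z\<close> after
  multiplication by a power of \<open>r m\<close>.\<close>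

lemma integral_multiple:
  fixes z :: 'a
  shows "\<exists>r\<in>R. r ~= 0 \<and> r * z \<in> ints"
proof -
  obtain d :: nat where "\<forall>y::nat => 'a. \<exists>r. (\<forall>i\<le>d. r i \<in> R) \<and> (\<exists>i\<le>d. r i ~= 0) \<and> (\<Sum>i\<le>d. r i * y i) = 0"
    using rank by blast
  from this[rule_format, of "\<lambda>i. z ^ i"] obtain r where
    r: "\<forall>i\<le>d. r i \<in> R" "\<exists>i\<le>d. r i ~= 0" "(\<Sum>i\<le>d. r i * z ^ i) = 0" by blast
  define m where "m = Max {i. i \<le> d \<and> r i ~= 0}"
  have fin: "finite {i. i \<le> d \<and> r i ~= 0}" by (rule finite_subset[of _ "{..d}"]) auto
  have m: "m \<le> d" "r m ~= 0" using Max_in[OF fin] r(2) unfolding m_def by auto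
  have above: "r i = 0" if "m < i" "i \<le> d" for i
  proof (rule ccontr)
    assume "r i ~= 0"
    hence "i \<le> m" unfolding m_def using that fin by (intro Max_ge) auto
    thus False using that by simp
  qed
  have sum0: "(\<Sum>i\<le>m. r i * z ^ i) = 0"
    using r(3) sum.mono_neutral_left[of "{..d}" "{..m}" "\<lambda>i. r i * z ^ i"] m above by auto
  show ?thesis
  proof (cases m)
    case 0
    thus ?thesis using sum0 m by auto
  next
    case (Suc m')
    define a where "a i = r i * r m ^ (m - 1 - i)" for i
    have aR: "a i \<in> R" if "i < m" for i using that r(1) m subring unfolding a_def
      by (intro is_subring_closed(4)[OF subring] is_subring_power[OF subring]) auto
    have "(r m * z) ^ m + (\<Sum>i<m. a i * (r m * z) ^ i) = r m ^ (m-1) * (\<Sum>i\<le>m. r i * z ^ i)"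
    proof -
      have "a i * (r m * z) ^ i = r m ^ (m-1) * (r i * z ^ i)" if "i < m" for i
      proof -
        have "m - 1 = (m - 1 - i) + i" using that by simp
        hence "r m ^ (m-1) = r m ^ (m - 1 - i) * r m ^ i" by (metis power_add)
        thus ?thesis by (simp add: a_def power_mult_distrib)
      qed
      moreover have "(r m * z) ^ m = r m ^ (m-1) * (r m * z ^ m)"
        using Suc by (simp add: power_mult_distrib)
      ultimately show ?thesis 
        by (simp add: lessThan_Suc_atMost[symmetric] sum_distrib_left distrib_left)
    qed
    hence "integral_over R (r m * z)" unfolding integral_over_def using aR sum0 by auto
    thus ?thesis using r(1) m by (auto simp: ints_def)
  qed
qed

text \<open>In an equation of least degree the constant term is nonzero, since otherwise
  \<open>x\<close> could be cancelled; and up to sign it is \<open>x\<close> times a polynomial in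
  \<open>x\<close> over \<open>R\<close>.\<close>

lemma nonzero_multiple_in_R:
  assumes "x \<in> ints" "x ~= 0"
  shows "\<exists>w\<in>ints. x * w \<in> R \<and> x * w ~= 0"
proof -
  have "\<exists>m a. (\<forall>i<m. a i \<in> R) \<and> x ^ m + (\<Sum>i<m. a i * x ^ i) = 0"
    using assms unfolding ints_def integral_over_def by auto
  then obtain m where m: "\<exists>a. (\<forall>i<m. a i \<in> R) \<and> x ^ m + (\<Sum>i<m. a i * x ^ i) = 0"
    and least: "\<And>m'. m' < m ==> \<not> (\<exists>a. (\<forall>i<m'. a i \<in> R) \<and> x ^ m' + (\<Sum>i<m'. a i * x ^ i) = 0)"
    using exists_least_iff[of "\<lambda>m. \<exists>a. (\<forall>i<m. a i \<in> R) \<and> x ^ m + (\<Sum>i<m. a i * x ^ i) = 0"] by auto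
  then obtain a where a: "\<forall>i<m. a i \<in> R" "x ^ m + (\<Sum>i<m. a i * x ^ i) = 0" by auto
  obtain m' where m': "m = Suc m'" using a by (cases m) auto
  define w where "w = - (x ^ m' + (\<Sum>i<m'. a (Suc i) * x ^ i))"
  have eq: "x * (- w) + a 0 = 0"
    using a(2) unfolding m' w_def sum.lessThan_Suc_shift by (simp add: algebra_simps sum_distrib_left)
  have "a 0 ~= 0"
  proof
    assume "a 0 = 0"
    hence "x ^ m' + (\<Sum>i<m'. a (Suc i) * x ^ i) = 0" using eq assms w_def by (simp add: add.commute)
    moreover have "\<forall>i<m'. a (Suc i) \<in> R" using a(1) m' by simp
    ultimately have "\<exists>b. (\<forall>i<m'. b i \<in> R) \<and> x ^ m' + (\<Sum>i<m'. b i * x ^ i) = 0"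
      by (intro exI[of _ "\<lambda>i. a (Suc i)"]) simp
    thus False using least[of m'] m' by simp
  qed
  moreover have "w \<in> ints" unfolding w_def using a(1) m' R_ints assms
    by (intro ints_closed is_subring_sum[OF ints_subring]) auto
  moreover have "x * w = a 0" using eq by simp
  moreover have "a 0 \<in> R" using a(1) m' by simp
  ultimately show ?thesis by metis
qed

text \<open>Division by the highest power of \<open>p\<close> common to all coefficients;
  \<open>separated\<close> guarantees that there is one.\<close>

lemma primitive_relation:
  fixes d :: nat
  assumes "\<forall>i\<le>d. r i \<in> R" "\<exists>i\<le>d. r i ~= 0" "(\<Sum>i\<le>d. r i * y i) = 0"
  shows "\<exists>s. (\<forall>i\<le>d. s i \<in> R) \<and> (\<exists>i\<le>d. \<forall>t\<in>R. s i ~= of_nat p * t) \<and> (\<Sum>i\<le>d. s i * y i) = 0"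
proof -
  define Q where "Q K \<longleftrightarrow> (\<exists>i\<le>d. \<forall>t\<in>R. r i ~= of_nat p ^ K * t)" for K
  obtain i K where "i \<le> d" "\<forall>s\<in>R. r i ~= of_nat p ^ K * s"
    using assms(1,2) separated by metis
  hence "Q K" by (auto simp: Q_def)
  then obtain K where K: "Q K" "\<And>K'. K' < K ==> \<not> Q K'" using exists_least_iff[of Q] by auto
  have "\<not> Q 0" using assms(1) by (auto simp: Q_def)
  hence "K ~= 0" using K(1) by (cases K) auto
  then obtain K' where K': "K = Suc K'" by (cases K) auto
  have "\<forall>i. \<exists>t. i \<le> d --> t \<in> R \<and> r i = of_nat p ^ K' * t" using K(2)[of K'] K' unfolding Q_def by auto
  then obtain s where s: "\<And>i. i \<le> d ==> s i \<in> R \<and> r i = of_nat p ^ K' * s i" by metis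
  have "of_nat p ^ K' * (\<Sum>i\<le>d. s i * y i) = (\<Sum>i\<le>d. r i * y i)"
    using s by (auto simp: sum_distrib_left mult.assoc intro!: sum.cong)
  hence "(\<Sum>i\<le>d. s i * y i) = 0" using assms(3) p_neq_0 by simp
  moreover obtain i where i: "i \<le> d" "\<forall>t\<in>R. r i ~= of_nat p ^ K * t" using K(1) by (auto simp: Q_def)
  have "s i ~= of_nat p * t" if "t \<in> R" for t using i s[OF i(1)] that K' by auto
  ultimately show ?thesis using s i by (intro exI[of _ s]) auto
qed

text \<open>Modulo \<open>p\<close> the integral elements form a vector space over the field with
  \<open>p\<close> elements. Its dimension is at most \<open>d\<close>, because a primitive relation
  between \<open>d + 1\<close> elements stays nontrivial modulo \<open>p\<close>. The combinations
  of a maximal independent system are then representatives.\<close>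

lemma finite_residues: "\<exists>T. finite T \<and> T \<subseteq> ints \<and> (\<forall>z\<in>ints. \<exists>t\<in>T. \<exists>w\<in>ints. z = t + of_nat p * w)"
proof -
  \<comment> \<open>Independence modulo \<open>p\<close>, with the scalars written as natural
    numbers below \<open>p\<close>.\<close>
  define indep where "indep y m \<longleftrightarrow> (\<forall>a::nat => nat. (\<forall>i<m. a i < p) --> (\<exists>w\<in>ints. (\<Sum>i<m. of_nat (a i) * y i) = of_nat p * w) --> (\<forall>i<m. a i = 0))"
    for y :: "nat => 'a" and m
  define Q where "Q m \<longleftrightarrow> (\<exists>y. (\<forall>i<m. y i \<in> ints) \<and> indep y m)" for m
  obtain d :: nat where d: "\<forall>y::nat => 'a. \<exists>r. (\<forall>i\<le>d. r i \<in> R) \<and> (\<exists>i\<le>d. r i ~= 0) \<and> (\<Sum>i\<le>d. r i * y i) = 0"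
    using rank by blast
  have bound: "m \<le> d" if "Q m" for m
  proof (rule ccontr)
    assume "\<not> m \<le> d" hence md: "d < m" by simp
    obtain y where y: "\<forall>i<m. y i \<in> ints" "indep y m" using \<open>Q m\<close> by (auto simp: Q_def)
    obtain s where s: "\<forall>i\<le>d. s i \<in> R" "\<exists>i\<le>d. \<forall>t\<in>R. s i ~= of_nat p * t" "(\<Sum>i\<le>d. s i * y i) = 0"
    proof -
      obtain r where "\<forall>i\<le>d. r i \<in> R" "\<exists>i\<le>d. r i ~= 0" "(\<Sum>i\<le>d. r i * y i) = 0" using d by blast
      from primitive_relation[OF this] show ?thesis using that by blast
    qed
    have "\<forall>i. \<exists>a t. i \<le> d --> a < p \<and> t \<in> R \<and> s i = of_nat a + of_nat p * t"
      using s(1) residue by metis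
    then obtain a t where at: "\<And>i. i \<le> d ==> a i < p \<and> t i \<in> R \<and> s i = of_nat (a i) + of_nat p * t i" by metis
    define a' where "a' i = (if i \<le> d then a i else 0)" for i
    have "(\<Sum>i<m. of_nat (a' i) * y i) = (\<Sum>i\<le>d. of_nat (a i) * y i)"
      using md by (intro sum.mono_neutral_cong_right) (auto simp: a'_def)
    also have "... = (\<Sum>i\<le>d. s i * y i) - of_nat p * (\<Sum>i\<le>d. t i * y i)"
      unfolding sum_distrib_left sum_subtractf[symmetric] using at by (intro sum.cong) (auto simp: algebra_simps)
    also have "... = of_nat p * (- (\<Sum>i\<le>d. t i * y i))" using s(3) by simp
    finally have "(\<Sum>i<m. of_nat (a' i) * y i) = of_nat p * (- (\<Sum>i\<le>d. t i * y i))" .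
    moreover have "- (\<Sum>i\<le>d. t i * y i) \<in> ints"
      using at y(1) md R_ints by (intro ints_closed is_subring_sum[OF ints_subring]) auto
    moreover have "\<forall>i<m. a' i < p" using at prime_gt_0_nat[OF prime_p] by (auto simp: a'_def)
    ultimately have "\<forall>i<m. a' i = 0" using y(2) unfolding indep_def by blast
    hence "a i = 0" if "i \<le> d" for i using that md by (metis a'_def le_less_trans)
    hence "s i = of_nat p * t i" if "i \<le> d" for i using at that by simp
    thus False using s(2) at by blast
  qed
  have "Q 0" by (auto simp: Q_def indep_def)
  then obtain m where m: "Q m" "\<And>k. Q k ==> k \<le> m"
    using Nat.ex_has_greatest_nat[of Q 0 d] bound by blast
  obtain y where y: "\<forall>i<m. y i \<in> ints" "indep y m" using m(1) by (auto simp: Q_def)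
  define T where "T = (\<lambda>e. \<Sum>i<m. of_nat (e i) * y i) ` ({..<m} \<rightarrow>\<^sub>E {..<p})"
  have "finite T" unfolding T_def by (intro finite_imageI finite_PiE) auto
  moreover have "T \<subseteq> ints" unfolding T_def using y(1)
    by (auto intro!: ints_closed is_subring_sum[OF ints_subring])
  moreover have "\<exists>t\<in>T. \<exists>w\<in>ints. z = t + of_nat p * w" if z: "z \<in> ints" for z
  proof -
    define y' where "y' = y(m := z)"
    have "\<not> indep y' (Suc m)"
    proof
      assume "indep y' (Suc m)"
      moreover have "\<forall>i<Suc m. y' i \<in> ints" using y(1) z by (auto simp: y'_def less_Suc_eq)
      ultimately have "Q (Suc m)" by (auto simp: Q_def)
      thus False using m(2)[of "Suc m"] by simp
    qed
    then obtain a w where a: "\<forall>i<Suc m. a i < p" "w \<in> ints" "(\<Sum>i<Suc m. of_nat (a i) * y' i) = of_nat p * w"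
      "\<exists>i<Suc m. a i ~= 0" unfolding indep_def by blast
    have rel: "(\<Sum>i<m. of_nat (a i) * y i) + of_nat (a m) * z = of_nat p * w"
      using a(3) by (simp add: y'_def)
    have "a m ~= 0"
    proof
      assume "a m = 0"
      hence "(\<Sum>i<m. of_nat (a i) * y i) = of_nat p * w" using rel by simp
      moreover have "\<forall>i<m. a i < p" using a(1) by simp
      ultimately have "\<forall>i<m. a i = 0" using y(2) a(2) unfolding indep_def by blast
      thus False using a(4) \<open>a m = 0\<close> by (auto simp: less_Suc_eq)
    qed
    \<comment> \<open>The coefficient \<open>a m\<close> of \<open>z\<close> is inverted modulo
      \<open>p\<close>, so that the relation can be solved for \<open>z\<close>; \<open>e i\<close>
      and \<open>h i\<close> are remainder and quotient of the new coefficients by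
      \<open>p\<close>.\<close>
    then obtain u q where q: "int (a m) * int u = 1 + int p * q"
      using inverse_mod_prime[OF prime_p, of "a m"] a(1) by auto
    define e where "e i = nat ((- (int u * int (a i))) mod int p)" for i
    define h where "h i = (- (int u * int (a i))) div int p" for i
    have p0: "int p > 0" using prime_gt_0_nat[OF prime_p] by simp
    have e: "e i < p" "- (int u * int (a i)) = int (e i) + int p * h i" for i
      using p0 pos_mod_bound[OF p0] by (auto simp: e_def h_def nat_less_iff)
    have e': "- (of_nat u * of_nat (a i)) = (of_nat (e i) + of_nat p * of_int (h i) :: 'a)" for i
      using arg_cong[OF e(2)[of i], of "of_int :: int => 'a"] by simp
    have q': "of_nat (a m) * of_nat u = (1 + of_nat p * of_int q :: 'a)"
      using arg_cong[OF q, of "of_int :: int => 'a"] by simp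
    have "of_nat u * (of_nat (a m) * z) = (of_nat (a m) * of_nat u) * z" by (simp add: ac_simps)
    hence "z = of_nat u * (of_nat (a m) * z) - of_nat p * of_int q * z"
      unfolding q' by (simp add: algebra_simps)
    also have "of_nat (a m) * z = of_nat p * w - (\<Sum>i<m. of_nat (a i) * y i)" using rel by (simp add: algebra_simps)
    also have "of_nat u * (of_nat p * w - (\<Sum>i<m. of_nat (a i) * y i)) - of_nat p * of_int q * z
       = (\<Sum>i<m. (- (of_nat u * of_nat (a i))) * y i) + of_nat p * (of_nat u * w - of_int q * z)"
      by (simp add: algebra_simps sum_distrib_left sum_negf)
    also have "(\<Sum>i<m. (- (of_nat u * of_nat (a i))) * y i) = (\<Sum>i<m. of_nat (e i) * y i) + of_nat p * (\<Sum>i<m. of_int (h i) * y i)"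
      unfolding e' sum_distrib_left sum.distrib[symmetric] by (intro sum.cong) (auto simp: algebra_simps)
    finally have "z = (\<Sum>i<m. of_nat (e i) * y i) + of_nat p * ((\<Sum>i<m. of_int (h i) * y i) + (of_nat u * w - of_int q * z))"
      by (simp add: algebra_simps)
    moreover have "(\<Sum>i<m. of_int (h i) * y i) + (of_nat u * w - of_int q * z) \<in> ints"
      using y(1) z a(2) by (intro ints_closed is_subring_sum[OF ints_subring]) auto
    moreover have "(\<Sum>i<m. of_nat (e i) * y i) \<in> T" unfolding T_def
      using e(1) by (intro image_eqI[of _ _ "restrict e {..<m}"]) auto
    ultimately show ?thesis by blast
  qed
  ultimately show ?thesis by blast
qed

lemma finite_residues_power:
  "\<exists>T. finite T \<and> T \<subseteq> ints \<and> (\<forall>z\<in>ints. \<exists>t\<in>T. \<exists>w\<in>ints. z = t + of_nat p ^ j * w)"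
proof (induction j)
  case 0
  show ?case by (intro exI[of _ "{0}"]) (auto simp: ints_closed)
next
  case (Suc j)
  then obtain U where U: "finite U" "U \<subseteq> ints" "\<And>z. z \<in> ints ==> \<exists>t\<in>U. \<exists>w\<in>ints. z = t + of_nat p ^ j * w" by auto
  obtain T where T: "finite T" "T \<subseteq> ints" "\<And>z. z \<in> ints ==> \<exists>t\<in>T. \<exists>w\<in>ints. z = t + of_nat p * w"
    using finite_residues by auto
  define S where "S = (\<lambda>(t,u). t + of_nat p * u) ` (T \<times> U)"
  have "finite S" "S \<subseteq> ints" using T U by (auto simp: S_def intro!: ints_closed)
  moreover have "\<exists>t\<in>S. \<exists>w\<in>ints. z = t + of_nat p ^ Suc j * w" if z: "z \<in> ints" for z
  proof -
    obtain t w where t: "t \<in> T" "w \<in> ints" "z = t + of_nat p * w" using T(3)[OF z] by blast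
    obtain u v where u: "u \<in> U" "v \<in> ints" "w = u + of_nat p ^ j * v" using U(3)[OF t(2)] by blast
    have "z = (t + of_nat p * u) + of_nat p ^ Suc j * v" using t u by (simp add: algebra_simps)
    moreover have "t + of_nat p * u \<in> S" using t u by (auto simp: S_def)
    ultimately show ?thesis using u(2) by blast
  qed
  ultimately show ?case by blast
qed

text \<open>There are finitely many residues modulo \<open>p ^ j\<close>. Applied to sequences of
  powers, this yields inverses modulo \<open>P\<close>, the integrality of elements and the
  finiteness of valuations below.\<close>

lemma pigeonhole_residues:
  fixes f :: "nat => 'a"
  assumes "\<And>k. f k \<in> ints"
  shows "\<exists>k l. k < l \<and> (\<exists>w\<in>ints. f k - f l = of_nat p ^ j * w)"
proof -
  obtain T where T: "finite T" "T \<subseteq> ints" "\<And>z. z \<in> ints ==> \<exists>t\<in>T. \<exists>w\<in>ints. z = t + of_nat p ^ j * w"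
    using finite_residues_power by metis
  have "\<forall>k. \<exists>t w. t \<in> T \<and> w \<in> ints \<and> f k = t + of_nat p ^ j * w" using T(3) assms by blast
  then obtain t w where tw: "\<And>k. t k \<in> T \<and> w k \<in> ints \<and> f k = t k + of_nat p ^ j * w k" by metis
  have "\<not> inj t" using T(1) tw by (metis finite_subset image_subsetI infinite_UNIV_nat range_inj_infinite)
  then obtain k l where kl: "k ~= l" "t k = t l" by (auto simp: inj_def)
  have *: "f k - f l = of_nat p ^ j * (w k - w l)" if "t k = t l" for k l using tw[of k] tw[of l] that by (simp add: algebra_simps)
  show ?thesis
  proof (cases "k < l")
    case True thus ?thesis using *[of k l] kl tw ints_closed(3)[of "w k" "w l"] by blast
  next
    case False
    hence "l < k" using kl by simp
    thus ?thesis using *[of l k] kl tw ints_closed(3)[of "w l" "w k"] by (metis (no_types))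
  qed
qed

end

section \<open>Primes of the ring of integers and their valuations\<close>

locale arith_place = arith_ring +
  fixes P :: "'a set"
  assumes P_ints: "P \<subseteq> ints"
    and P_add: "\<And>x y. x \<in> P ==> y \<in> P ==> x + y \<in> P"
    and P_mult: "\<And>z x. z \<in> ints ==> x \<in> P ==> z * x \<in> P"
    and P_prime: "\<And>x y. x \<in> ints ==> y \<in> ints ==> x * y \<in> P ==> x \<in> P \<or> y \<in> P"
    and one_notin_P: "1 \<notin> P"
    and p_P: "of_nat p \<in> P"
begin

lemma zero_P: "0 \<in> P" using P_mult[OF _ p_P, of 0] ints_closed by simp

lemma P_uminus: "x \<in> P ==> - x \<in> P" using P_mult[of "-1" x] ints_closed by simp

lemma P_diff: "x \<in> P ==> y \<in> P ==> x - y \<in> P" using P_add[of x "- y"] P_uminus by simp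

lemma P_mult': "x \<in> P ==> z \<in> ints ==> x * z \<in> P" using P_mult by (metis mult.commute)

lemma P_prime': "x \<in> ints - P ==> y \<in> ints - P ==> x * y \<in> ints - P"
  using P_prime[of x y] ints_closed(4)[of x y] by blast

lemma P_prime_power: "x \<in> ints - P ==> x ^ n \<in> ints - P"
  by (induction n) (use one_notin_P P_prime'[of x] ints_closed(1) in auto)

lemma one_ints_P: "1 \<in> ints - P" using one_notin_P ints_closed by auto

lemma P_power: "x \<in> P ==> n > 0 ==> x ^ n \<in> P"
  by (cases n) (use P_ints P_mult'[of x "x ^ (n - 1)"] ints_closed(7)[of x] in auto)

text \<open>Two powers of \<open>x\<close> are congruent modulo \<open>p\<close>, hence modulo
  \<open>P\<close>, and the smaller power cancels because \<open>P\<close> is prime.\<close>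

lemma P_maximal:
  assumes x: "x \<in> ints - P" shows "\<exists>y\<in>ints. x * y - 1 \<in> P"
proof -
  obtain k l w where kl: "k < l" "w \<in> ints" "x ^ k - x ^ l = of_nat p ^ 1 * w"
    using pigeonhole_residues[of "\<lambda>k. x ^ k" 1] x ints_closed by auto
  obtain e where l: "l = k + Suc e" using kl(1) less_iff_Suc_add by auto
  have "x ^ k * (1 - x ^ Suc e) = x ^ k - x ^ l" unfolding l power_add by (simp add: algebra_simps)
  hence "x ^ k * (1 - x ^ Suc e) \<in> P" using kl P_mult'[OF p_P] by simp
  moreover have "1 - x ^ Suc e \<in> ints" using x by (intro ints_closed) auto
  ultimately have "1 - x ^ Suc e \<in> P" using P_prime[of "x ^ k" "1 - x ^ Suc e"] P_prime_power[OF x, of k] by blast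
  hence "x * x ^ e - 1 \<in> P" using P_uminus[of "1 - x ^ Suc e"] by simp
  thus ?thesis using x ints_closed(7)[of x e] by blast
qed

text \<open>The annihilator of \<open>b\<close> in \<open>\<O>/p\<O>\<close> is kept inside \<open>P\<close> while the finitely many residue
  classes of \<open>P\<close> modulo \<open>p\<close> are killed one after the other.\<close>

lemma annihilator_of_P:
  "\<exists>b\<in>ints. (\<forall>x\<in>P. \<exists>w\<in>ints. b * x = of_nat p * w) \<and> (\<forall>t\<in>ints. (\<exists>w\<in>ints. b * t = of_nat p * w) --> t \<in> P)"
proof -
  define dv where "dv x \<longleftrightarrow> (\<exists>w\<in>ints. x = of_nat p * w)" for x :: 'a
  have dv_mult: "dv (x * y)" if "dv x" "y \<in> ints" for x y
    using that ints_closed unfolding dv_def by (metis mult.assoc)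
  have dv_add: "dv (x + y)" if "dv x" "dv y" for x y
    using that ints_closed unfolding dv_def by (metis distrib_left)
  have dv_P: "x \<in> P" if "dv x" for x using that P_mult'[OF p_P] unfolding dv_def by auto
  obtain T where T: "finite T" "T \<subseteq> ints" "\<And>z. z \<in> ints ==> \<exists>t\<in>T. \<exists>w\<in>ints. z = t + of_nat p * w"
    using finite_residues by auto
  have "\<exists>b\<in>ints. (\<forall>x\<in>S. dv (b * x)) \<and> (\<forall>t\<in>ints. dv (b * t) --> t \<in> P)" if "finite S" "S \<subseteq> P" for S
    using that
  proof (induction S rule: finite_induct)
    case empty
    show ?case using dv_P ints_closed by (intro bexI[of _ 1]) auto
  next
    case (insert r S)
    then obtain b where b: "b \<in> ints" "\<forall>x\<in>S. dv (b * x)" "\<forall>t\<in>ints. dv (b * t) --> t \<in> P" by auto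
    have r: "r \<in> P" "r \<in> ints" using insert.prems P_ints by auto
    \<comment> \<open>\<open>Q j\<close> says that \<open>b * r ^ j\<close> becomes divisible by
      \<open>p\<close> after multiplication by some \<open>t\<close> outside \<open>P\<close>. At
      the least such \<open>j\<close>, the element \<open>b * r ^ (j - 1) * t\<close> kills
      \<open>r\<close> modulo \<open>p\<close> and still kills nothing outside \<open>P\<close>;
      \<open>j\<close> is positive because of the invariant on \<open>b\<close>.\<close>
    define Q where "Q j \<longleftrightarrow> (\<exists>t\<in>ints - P. dv (b * r ^ j * t))" for j
    obtain k l w where kl: "k < l" "w \<in> ints" "b * r ^ k - b * r ^ l = of_nat p ^ 1 * w"
      using pigeonhole_residues[of "\<lambda>k. b * r ^ k" 1] b r ints_closed by auto
    obtain e where l: "l = k + Suc e" using kl(1) less_iff_Suc_add by auto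
    have "b * r ^ k * (1 - r ^ (l - k)) = b * r ^ k - b * r ^ l" unfolding l by (simp add: power_add algebra_simps)
    also have "... = of_nat p * w" using kl(3) by simp
    finally have "b * r ^ k * (1 - r ^ (l - k)) = of_nat p * w" .
    hence "dv (b * r ^ k * (1 - r ^ (l - k)))" unfolding dv_def using kl by auto
    moreover have "1 - r ^ (l - k) \<in> ints - P"
    proof -
      have rP: "r ^ (l - k) \<in> P" using P_power r kl by simp
      have "1 - r ^ (l - k) \<notin> P"
      proof
        assume "1 - r ^ (l - k) \<in> P"
        from P_add[OF this rP] show False using one_notin_P by simp
      qed
      thus ?thesis using r by (auto intro!: ints_closed)
    qed
    ultimately have "Q k" unfolding Q_def by blast
    then obtain j where j: "Q j" "\<And>i. i < j ==> \<not> Q i" using exists_least_iff[of Q] by auto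
    have "\<not> Q 0" using b(3) by (auto simp: Q_def)
    then obtain i where i: "j = Suc i" using j(1) by (cases j) auto
    obtain t where t: "t \<in> ints - P" "dv (b * r ^ j * t)" using j(1) by (auto simp: Q_def)
    define b' where "b' = b * r ^ i * t"
    have b': "b' \<in> ints" unfolding b'_def using b r t by (auto intro!: ints_closed)
    have "dv (b' * r)" using t(2) i by (simp add: b'_def ac_simps)
    moreover have "dv (b' * x)" if "x \<in> S" for x
    proof -
      have "b' * x = (b * x) * (r ^ i * t)" by (simp add: b'_def ac_simps)
      moreover have "r ^ i * t \<in> ints" using r t by (intro ints_closed) auto
      ultimately show ?thesis using dv_mult[of "b * x" "r ^ i * t"] b(2) that by metis
    qed
    moreover have "t' \<in> P" if "t' \<in> ints" "dv (b' * t')" for t'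
    proof (rule ccontr)
      assume "t' \<notin> P"
      hence "t * t' \<in> ints - P" using t that P_prime' by auto
      moreover have "dv (b * r ^ i * (t * t'))" using that by (simp add: b'_def ac_simps)
      ultimately have "Q i" by (auto simp: Q_def)
      thus False using j(2)[of i] i by simp
    qed
    ultimately show ?case using b' by (intro bexI[of _ b']) auto
  qed
  from this[of "T \<inter> P"] T(1) obtain b where
    b: "b \<in> ints" "\<forall>x\<in>T \<inter> P. dv (b * x)" "\<forall>t\<in>ints. dv (b * t) --> t \<in> P" by auto
  have "dv (b * x)" if x: "x \<in> P" for x
  proof -
    obtain t w where tw: "t \<in> T" "w \<in> ints" "x = t + of_nat p * w" using T(3)[of x] x P_ints by blast
    have "t = x - of_nat p * w" using tw by simp
    hence "t \<in> P" using P_diff[OF x P_mult'[OF p_P tw(2)]] by simp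
    hence "dv (b * t)" using b(2) tw(1) by auto
    moreover have "dv (of_nat p * (w * b))" unfolding dv_def using tw b ints_closed by blast
    ultimately have "dv (b * t + of_nat p * (w * b))" by (rule dv_add)
    thus ?thesis using tw(3) by (simp add: algebra_simps)
  qed
  thus ?thesis using b unfolding dv_def by blast
qed

text \<open>The element is \<open>b / p\<close> with \<open>b\<close> from the annihilator of
  \<open>P\<close> modulo \<open>p\<close>. It lies in the inverse of \<open>P\<close> but not in
  the ring, and serves as the inverse of a uniformizer.\<close>

lemma ex_inverse_generator: "\<exists>c. \<forall>x\<in>ints. c * x \<in> ints \<longleftrightarrow> x \<in> P"
proof -
  obtain b where b: "b \<in> ints" "\<forall>x\<in>P. \<exists>w\<in>ints. b * x = of_nat p * w"
    "\<forall>t\<in>ints. (\<exists>w\<in>ints. b * t = of_nat p * w) --> t \<in> P" using annihilator_of_P by blast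
  have "b / of_nat p * x \<in> ints \<longleftrightarrow> (\<exists>w\<in>ints. b * x = of_nat p * w)" for x
  proof -
    have "b * x = of_nat p * w \<longleftrightarrow> b / of_nat p * x = w" for w using p_neq_0 by (auto simp: field_simps)
    thus ?thesis by auto
  qed
  thus ?thesis using b by (intro exI[of _ "b / of_nat p"]) auto
qed

definition cc :: 'a where "cc = (SOME c. \<forall>x\<in>ints. c * x \<in> ints \<longleftrightarrow> x \<in> P)"

lemma cc_iff: "x \<in> ints ==> cc * x \<in> ints \<longleftrightarrow> x \<in> P"
  using someI_ex[OF ex_inverse_generator] unfolding cc_def by blast

lemma cc_notin_ints: "cc \<notin> ints" using cc_iff[of 1] one_ints_P by auto

text \<open>If \<open>cc\<close> mapped \<open>P\<close> into itself, all \<open>cc ^ j * p\<close>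
  would be integral; two of them are congruent modulo \<open>p\<close>, so
  \<open>cc ^ k - cc ^ l\<close> would be integral and with it \<open>cc\<close>.\<close>

lemma ex_uniformizer: "\<exists>\<pi>\<in>P. cc * \<pi> \<in> ints - P"
proof (rule ccontr)
  assume "\<not> ?thesis"
  hence *: "cc * x \<in> P" if "x \<in> P" for x using that cc_iff[of x] P_ints by auto
  have "cc ^ j * of_nat p \<in> P" for j by (induction j) (use p_P * in \<open>auto simp: mult.assoc\<close>)
  hence "cc ^ j * of_nat p \<in> ints" for j using P_ints by auto
  then obtain k l w where kl: "k < l" "w \<in> ints" "cc ^ k * of_nat p - cc ^ l * of_nat p = of_nat p ^ 1 * w"
    using pigeonhole_residues[of "\<lambda>k. cc ^ k * of_nat p" 1] by auto
  hence "of_nat p * (cc ^ k - cc ^ l) = of_nat p * w" by (simp add: algebra_simps)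
  hence "cc ^ k - cc ^ l \<in> ints" using kl p_neq_0 by simp
  hence "cc \<in> ints" using integral_over_power_diff[OF ints_subring kl(1)] ints_integrally_closed by blast
  thus False using cc_notin_ints by simp
qed

definition unif :: 'a where "unif = (SOME \<pi>. \<pi> \<in> P \<and> cc * \<pi> \<in> ints - P)"

lemma unif: "unif \<in> P" "cc * unif \<in> ints - P" "unif \<in> ints"
proof -
  have "\<exists>\<pi>. \<pi> \<in> P \<and> cc * \<pi> \<in> ints - P" using ex_uniformizer by blast
  from someI_ex[OF this] show "unif \<in> P" "cc * unif \<in> ints - P" "unif \<in> ints"
    using P_ints unfolding unif_def by auto
qed

text \<open>\<open>P\<close> times the module generated by 1 and \<open>cc\<close> contains 1, so
  this module is the inverse of \<open>P\<close>. The division of ideals by \<open>P\<close> rests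
  on it.\<close>

lemma one_split: "\<exists>a\<in>P. \<exists>b\<in>P. a + cc * b = 1"
proof -
  obtain y where y: "y \<in> ints" "(cc * unif) * y - 1 \<in> P" using P_maximal[OF unif(2)] by blast
  show ?thesis using P_uminus[OF y(2)] P_mult'[OF unif(1) y(1)]
    by (intro bexI[of _ "-((cc * unif) * y - 1)"] bexI[of _ "unif * y"]) (auto simp: algebra_simps)
qed

lemma cc_power_notin:
  assumes "a \<in> ints - P" "m > 0" shows "cc ^ m * a \<notin> ints"
proof
  assume "cc ^ m * a \<in> ints"
  hence "(cc ^ m * a) * unif ^ m \<in> P" using P_mult P_power unif assms by simp
  moreover have "(cc ^ m * a) * unif ^ m = (cc * unif) ^ m * a" by (simp add: power_mult_distrib ac_simps)
  moreover have "(cc * unif) ^ m * a \<in> ints - P" using P_prime' P_prime_power unif(2) assms by blast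
  ultimately show False by simp
qed

text \<open>A number \<open>i\<close> with \<open>0 < i < p\<close> is invertible modulo
  \<open>p\<close> and so cannot lie in \<open>P\<close>; hence an element of \<open>R\<close> that
  is not divisible by \<open>p\<close> in \<open>R\<close> is outside \<open>P\<close>.\<close>

lemma R_unit_part:
  assumes "r \<in> R" "r ~= 0"
  shows "\<exists>j. \<exists>s\<in>R. r = of_nat p ^ j * s \<and> s \<notin> P"
proof -
  obtain K where K: "\<forall>s\<in>R. r ~= of_nat p ^ K * s" and least: "\<And>k. k < K ==> \<not> (\<forall>s\<in>R. r ~= of_nat p ^ k * s)"
    using separated[OF assms] exists_least_iff[of "\<lambda>K. \<forall>s\<in>R. r ~= of_nat p ^ K * s"] by auto
  have "K ~= 0" using K assms by (cases K) auto
  then obtain j where j: "K = Suc j" by (cases K) auto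
  obtain s where s: "s \<in> R" "r = of_nat p ^ j * s" using least[of j] j by auto
  have "s \<notin> P"
  proof
    assume sP: "s \<in> P"
    obtain i t where it: "i < p" "t \<in> R" "s = of_nat i + of_nat p * t" using residue s(1) by metis
    have iP: "of_nat i \<in> P" using P_diff[OF sP P_mult'[OF p_P, of t]] it R_ints by auto
    have "i ~= 0" using K s j it by auto
    then obtain u q where q: "int i * int u = 1 + int p * q"
      using inverse_mod_prime[OF prime_p, of i] it(1) by auto
    have "of_nat i * of_nat u = (1 + of_nat p * of_int q :: 'a)"
      using arg_cong[OF q, of "of_int :: int => 'a"] by simp
    hence "(1::'a) = of_nat i * of_nat u - of_nat p * of_int q" by simp
    moreover have "of_nat i * of_nat u - of_nat p * of_int q \<in> P"
      by (intro P_diff P_mult' iP p_P ints_closed)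
    ultimately show False using one_notin_P by simp
  qed
  thus ?thesis using s by blast
qed

text \<open>A multiple of \<open>x\<close> is \<open>p ^ j * s\<close> with \<open>s\<close> in
  \<open>R\<close> outside \<open>P\<close>. If all its products with powers of \<open>cc\<close>
  were integral, two of them would agree modulo \<open>p ^ j\<close>; cancelling
  \<open>p ^ j\<close> and multiplying by a power of the uniformizer would make a positive power of
  \<open>cc\<close> times an element outside \<open>P\<close> integral.\<close>

lemma cc_power_escapes:
  assumes x: "x \<in> ints" "x ~= 0" shows "\<exists>k. cc ^ k * x \<notin> ints"
proof (rule ccontr)
  assume "\<not> ?thesis" hence all: "cc ^ k * x \<in> ints" for k by blast
  obtain w where w: "w \<in> ints" "x * w \<in> R" "x * w ~= 0" using nonzero_multiple_in_R[OF x] by blast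
  obtain j s where s: "s \<in> R" "x * w = of_nat p ^ j * s" "s \<notin> P" using R_unit_part[OF w(2,3)] by blast
  have "cc ^ k * (of_nat p ^ j * s) \<in> ints" for k
  proof -
    have "cc ^ k * (of_nat p ^ j * s) = (cc ^ k * x) * w" using s(2) by (metis mult.assoc)
    thus ?thesis using ints_closed(4)[OF all w(1)] by metis
  qed
  then obtain k l v where kl: "k < l" "v \<in> ints"
    "cc ^ k * (of_nat p ^ j * s) - cc ^ l * (of_nat p ^ j * s) = of_nat p ^ j * v"
    using pigeonhole_residues[of "\<lambda>k. cc ^ k * (of_nat p ^ j * s)" j] by blast
  have "of_nat p ^ j * (s * (cc ^ k - cc ^ l)) = of_nat p ^ j * v" using kl(3) by (simp add: algebra_simps)
  hence v: "s * (cc ^ k - cc ^ l) = v" using p_neq_0 by simp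
  define t where "t = s * (cc * unif) ^ k"
  have t: "t \<in> ints - P" unfolding t_def using s R_ints P_prime' P_prime_power unif(2) by blast
  obtain e where l: "l = k + e" using kl(1) less_imp_add_positive by blast
  have "v * unif ^ k = t - t * cc ^ (l - k)" unfolding v[symmetric] l t_def
    by (simp add: algebra_simps power_mult_distrib power_add)
  hence "cc ^ (l - k) * t = t - v * unif ^ k" by (simp add: algebra_simps)
  moreover have "t - v * unif ^ k \<in> ints" using t kl unif by (auto intro!: ints_closed)
  ultimately show False using cc_power_notin[OF t, of "l - k"] kl by simp
qed

lemma ints_factor:
  assumes x: "x \<in> ints" "x ~= 0" shows "\<exists>k. cc ^ k * x \<in> ints - P"
proof -
  obtain K where K: "cc ^ K * x \<notin> ints" "\<And>k. k < K ==> cc ^ k * x \<in> ints"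
    using cc_power_escapes[OF x] exists_least_iff[of "\<lambda>k. cc ^ k * x \<notin> ints"] by auto
  have "K ~= 0" using K(1) x by (cases K) auto
  then obtain k where k: "K = Suc k" by (cases K) auto
  hence "cc ^ k * x \<in> ints" using K(2) by simp
  moreover have "cc ^ k * x \<notin> P" using cc_iff[OF calculation] K(1) k by (simp add: mult.assoc)
  ultimately show ?thesis by blast
qed

lemma cc_neq_0: "cc ~= 0" using cc_notin_ints ints_closed by auto

text \<open>The units of the localisation at \<open>P\<close>.\<close>

definition lunits :: "'a set" where "lunits = {s / t | s t. s \<in> ints - P \<and> t \<in> ints - P}"

lemma nonzero_ints_P: "s \<in> ints - P ==> s ~= 0" using zero_P by auto

lemma lunits_mult: "u \<in> lunits ==> v \<in> lunits ==> u * v \<in> lunits"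
proof -
  assume "u \<in> lunits" "v \<in> lunits"
  then obtain s t s' t' where *: "s \<in> ints - P" "t \<in> ints - P" "u = s / t" "s' \<in> ints - P" "t' \<in> ints - P" "v = s' / t'"
    unfolding lunits_def by auto
  hence "u * v = (s * s') / (t * t')" by (simp add: times_divide_times_eq)
  thus "u * v \<in> lunits" unfolding lunits_def using P_prime'[OF *(1,4)] P_prime'[OF *(2,5)] by blast
qed

lemma lunits_nonzero: "u \<in> lunits ==> u ~= 0"
  unfolding lunits_def using nonzero_ints_P by auto

lemma ints_P_lunits: "s \<in> ints - P ==> s \<in> lunits"
  unfolding lunits_def using one_ints_P by (intro CollectI exI[of _ s] exI[of _ 1]) simp

lemma factor_unique_aux:
  assumes "u \<in> lunits" "cc powi k * u \<in> lunits" shows "k \<le> 0"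
proof (rule ccontr)
  assume "\<not> k \<le> 0"
  then obtain m where m: "k = int m" "m > 0" by (metis not_le zero_less_imp_eq_int)
  obtain s t where st: "s \<in> ints - P" "t \<in> ints - P" "u = s / t" using assms by (auto simp: lunits_def)
  obtain s' t' where st': "s' \<in> ints - P" "t' \<in> ints - P" "cc ^ m * u = s' / t'"
    using assms(2) m by (auto simp: lunits_def)
  have "t ~= 0" "t' ~= 0" using st st' nonzero_ints_P by auto
  hence "cc ^ m * (s * t') = s' * t" using st'(3) st(3) by (simp add: field_simps)
  thus False using cc_power_notin[of "s * t'" m] P_prime' st st' m by (metis DiffD1)
qed

lemma ex1_factor: assumes "z ~= 0" shows "\<exists>!k. cc powi k * z \<in> lunits"
proof -
  obtain r where r: "r \<in> R" "r ~= 0" "r * z \<in> ints" using integral_multiple by blast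
  obtain k where k: "cc ^ k * (r * z) \<in> ints - P" using ints_factor[OF r(3)] r assms by auto
  obtain l where l: "cc ^ l * r \<in> ints - P" using ints_factor[of r] r R_ints by auto
  have "cc powi (int k - int l) * z = (cc ^ k * (r * z)) / (cc ^ l * r)"
    using cc_neq_0 r by (simp add: power_int_diff field_simps)
  hence ex: "cc powi (int k - int l) * z \<in> lunits" using k l unfolding lunits_def by blast
  show ?thesis
  proof (rule ex1I[of _ "int k - int l"])
    show "cc powi (int k - int l) * z \<in> lunits" by (rule ex)
    fix i assume i: "cc powi i * z \<in> lunits"
    have *: "a \<le> b" if "cc powi a * z \<in> lunits" "cc powi b * z \<in> lunits" for a b
    proof -
      have "cc powi (a - b) * (cc powi b * z) = cc powi a * z"
        using cc_neq_0 by (simp add: power_int_diff)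
      thus ?thesis using factor_unique_aux[OF that(2), of "a - b"] that(1) by (metis diff_le_0_iff_le)
    qed
    show "i = int k - int l" using *[OF i ex] *[OF ex i] by simp
  qed
qed

text \<open>\<open>cc\<close> has valuation -1, so the exponent that turns \<open>z\<close> into a
  local unit is the valuation of \<open>z\<close>. The value at 0 is unspecified.\<close>

definition val :: "'a => int" where "val z = (THE k. cc powi k * z \<in> lunits)"

lemma val: "z ~= 0 ==> cc powi (val z) * z \<in> lunits"
  unfolding val_def by (rule theI') (rule ex1_factor)

lemma val_eqI: "cc powi k * z \<in> lunits ==> val z = k"
  using ex1_factor[of z] val[of z] lunits_nonzero by (cases "z = 0") auto

lemma val_mult: assumes "x ~= 0" "y ~= 0" shows "val (x * y) = val x + val y"
proof (rule val_eqI)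
  have "cc powi (val x + val y) * (x * y) = (cc powi (val x) * x) * (cc powi (val y) * y)"
    unfolding power_int_add[OF disjI1[OF cc_neq_0]] by (simp only: ac_simps)
  thus "cc powi (val x + val y) * (x * y) \<in> lunits"
    using lunits_mult[OF val[OF assms(1)] val[OF assms(2)]] by metis
qed

lemma val_ints: assumes "x \<in> ints" "x ~= 0" shows "val x \<ge> 0" and "val x = 0 \<longleftrightarrow> x \<notin> P"
proof -
  obtain k where k: "cc ^ k * x \<in> ints - P" using ints_factor[OF assms] by auto
  have v: "val x = int k" using val_eqI[of "int k" x] k ints_P_lunits by simp
  show "val x \<ge> 0" using v by simp
  show "val x = 0 \<longleftrightarrow> x \<notin> P"
  proof
    assume "val x = 0" thus "x \<notin> P" using v k by simp
  next
    assume "x \<notin> P"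
    thus "val x = 0" using val_eqI[of 0 x] ints_P_lunits assms by simp
  qed
qed

lemma val_one: "val 1 = 0" using val_eqI[of 0 1] ints_P_lunits[OF one_ints_P] by simp

lemma val_cc: "val cc = -1" using val_eqI[of "-1" cc] cc_neq_0 ints_P_lunits[OF one_ints_P] by simp

text \<open>The localisation is the valuation ring: if \<open>cc ^ k * z = s / t\<close> then
  \<open>z = (s * unif ^ k) / ((cc * unif) ^ k * t)\<close>, and \<open>cc * unif\<close> is outside
  \<open>P\<close>.\<close>

lemma val_nonneg_iff:
  assumes "z ~= 0" shows "val z \<ge> 0 \<longleftrightarrow> (\<exists>s\<in>ints. \<exists>t\<in>ints - P. z = s / t)"
proof
  assume "val z \<ge> 0"
  then obtain k where k: "val z = int k" by (metis nonneg_int_cases)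
  obtain s t where st: "s \<in> ints - P" "t \<in> ints - P" "cc ^ k * z = s / t"
    using val[OF assms] k by (auto simp: lunits_def)
  have nz: "t ~= 0" "cc * unif ~= 0" using nonzero_ints_P[OF st(2)] nonzero_ints_P[OF unif(2)] by auto
  have "z * ((cc * unif) ^ k * t) = s * unif ^ k"
  proof -
    have "z * ((cc * unif) ^ k * t) = (cc ^ k * z) * t * unif ^ k" by (simp add: power_mult_distrib ac_simps)
    thus ?thesis using st(3) nz by simp
  qed
  hence "z = (s * unif ^ k) / ((cc * unif) ^ k * t)" using nz by (simp add: eq_divide_eq)
  moreover have "(cc * unif) ^ k * t \<in> ints - P" using P_prime' P_prime_power unif(2) st by blast
  moreover have "s * unif ^ k \<in> ints" using st unif by (auto intro!: ints_closed)
  ultimately show "\<exists>s\<in>ints. \<exists>t\<in>ints - P. z = s / t" by blast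
next
  assume "\<exists>s\<in>ints. \<exists>t\<in>ints - P. z = s / t"
  then obtain s t where st: "s \<in> ints" "t \<in> ints - P" "z = s / t" by blast
  have t: "t ~= 0" using st nonzero_ints_P by auto
  have s: "s ~= 0" using assms st by auto
  have "val (z * t) = val z + val t" using val_mult assms t by simp
  hence "val s = val z" using val_ints(2)[of t] st t by simp
  thus "val z \<ge> 0" using val_ints(1)[OF st(1) s] by simp
qed

text \<open>A real absolute value instead of the integer valuation gives 0 its natural place and
  lets determinants be estimated by products. The base 2 is a normalisation: a uniformizer has the
  value 1/2.\<close>

definition nv :: "'a => real" where "nv z = (if z = 0 then 0 else 2 powr (- real_of_int (val z)))"

lemma nv_zero [simp]: "nv 0 = 0" by (simp add: nv_def)

lemma nv_pos: "z ~= 0 ==> nv z > 0" by (simp add: nv_def)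

lemma nv_nonneg: "nv z \<ge> 0" by (simp add: nv_def)

lemma nv_eq_0 [simp]: "nv z = 0 \<longleftrightarrow> z = 0" by (simp add: nv_def)

lemma nv_mult: "nv (x * y) = nv x * nv y"
  by (auto simp: nv_def val_mult powr_add[symmetric])

lemma nv_one [simp]: "nv 1 = 1" by (simp add: nv_def val_one)

lemma nv_discrete: assumes "nv x < nv y" shows "nv x \<le> nv y / 2"
proof (cases "x = 0")
  case False
  hence y: "y ~= 0" using assms nv_pos[of x] by auto
  have "val x > val y" using assms False y by (simp add: nv_def)
  hence "(2::real) powr (- real_of_int (val x)) \<le> 2 powr (- real_of_int (val y) - 1)" by simp
  thus ?thesis using False y by (simp add: nv_def powr_diff)
qed (simp add: nv_nonneg)

lemma nv_le_one_iff: "nv z \<le> 1 \<longleftrightarrow> (\<exists>s\<in>ints. \<exists>t\<in>ints - P. z = s / t)"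
proof (cases "z = 0")
  case True
  hence "z = 0 / 1" by simp
  thus ?thesis using ints_closed(2) one_ints_P True by (metis nv_zero zero_le_one)
next
  case False
  have "nv z \<le> 1 \<longleftrightarrow> val z \<ge> 0"
    using False powr_le_cancel_iff[of 2 "- real_of_int (val z)" 0] by (simp add: nv_def)
  thus ?thesis using val_nonneg_iff[OF False] by simp
qed

lemma nv_ints: "x \<in> ints ==> nv x \<le> 1"
  unfolding nv_le_one_iff using one_ints_P by (intro bexI[of _ x] bexI[of _ 1]) simp_all

lemma nv_P_iff: assumes "x \<in> ints" shows "nv x < 1 \<longleftrightarrow> x \<in> P"
proof (cases "x = 0")
  case True thus ?thesis using zero_P by simp
next
  case False
  have "nv x < 1 \<longleftrightarrow> val x > 0"
    using False powr_less_cancel_iff[of 2 "- real_of_int (val x)" 0] by (simp add: nv_def)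
  thus ?thesis using val_ints[OF assms False] by auto
qed

lemma nv_add: "nv (x + y) \<le> max (nv x) (nv y)"
proof -
  \<comment> \<open>The case of the summand 1; the general case follows by dividing by the larger
    summand.\<close>
  have V: "nv (z + 1) \<le> 1" if z: "nv z \<le> 1" for z
  proof -
    obtain s t where st: "s \<in> ints" "t \<in> ints - P" "z = s / t" using z nv_le_one_iff by auto
    hence "z + 1 = (s + t) / t" using nonzero_ints_P by (auto simp: field_simps)
    moreover have "s + t \<in> ints" using st by (auto intro!: ints_closed)
    ultimately show ?thesis using st nv_le_one_iff by blast
  qed
  have *: "nv (x + y) \<le> nv y" if "nv x \<le> nv y" for x y
  proof (cases "y = 0")
    case True thus ?thesis using that nv_nonneg[of x] by (simp add: order.antisym)
  next
    case False
    have "nv (x / y) * nv y = nv x" using nv_mult[of "x / y" y] False by simp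
    hence "nv (x / y) \<le> 1" using that nv_pos[OF False] by (metis mult_le_cancel_right_pos mult_1)
    from V[OF this] have "nv (x / y + 1) * nv y \<le> 1 * nv y" by (intro mult_right_mono nv_nonneg)
    moreover have "(x / y + 1) * y = x + y" using False by (simp add: field_simps)
    ultimately show ?thesis using nv_mult[of "x / y + 1" y] by simp
  qed
  show ?thesis using *[of x y] *[of y x] by (cases "nv x \<le> nv y") (auto simp: add.commute)
qed

lemma nv_cc: "nv cc = 2" using cc_neq_0 by (simp add: nv_def val_cc)

end

lemma half_powi: "(1/2::real) powi k = 2 powr (- real_of_int k)"
proof (cases k)
  case (nonneg n)
  thus ?thesis by (simp add: powr_minus powr_realpow power_one_over inverse_eq_divide)
next
  case (neg n)
  hence "(1/2::real) powi k = 2 ^ Suc n"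
    by (simp add: power_int_minus power_one_over del: of_nat_Suc power_Suc)
  moreover have "(2::real) powr (- real_of_int k) = 2 ^ Suc n"
    using neg powr_realpow[of 2 "Suc n"] by (simp add: add.commute del: power_Suc)
  ultimately show ?thesis by simp
qed

section \<open>The residue field and a dense generator\<close>

context arith_place begin

text \<open>As a record the ring of integers has quotients by maximal ideals, and the unit group of
  a finite residue field is known to be cyclic.\<close>

definition int_record :: "'a ring" where
  "int_record = \<lparr>carrier = ints, monoid.mult = (*), one = 1, ring.zero = 0, add = (+)\<rparr>"

lemma int_record_simps [simp]:
  "carrier int_record = ints" "x \<otimes>\<^bsub>int_record\<^esub> y = x * y" "\<one>\<^bsub>int_record\<^esub> = 1"
  "\<zero>\<^bsub>int_record\<^esub> = 0" "x \<oplus>\<^bsub>int_record\<^esub> y = x + y"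
  by (simp_all add: int_record_def)

lemma cring_int_record: "cring int_record"
proof (rule cringI)
  show "abelian_group int_record"
  proof (rule abelian_groupI)
    fix x assume "x \<in> carrier int_record"
    thus "\<exists>y\<in>carrier int_record. y \<oplus>\<^bsub>int_record\<^esub> x = \<zero>\<^bsub>int_record\<^esub>"
      using ints_closed(5)[of x] by (intro bexI[of _ "- x"]) auto
  qed (simp_all add: ints_closed(1,2) ints_closed(6) algebra_simps)
  show "comm_monoid int_record"
    by (rule comm_monoidI) (simp_all add: ints_closed(1) ints_closed(4) algebra_simps)
qed (simp add: algebra_simps)

lemma int_record_minus: assumes "x \<in> ints" "y \<in> ints" shows "x \<ominus>\<^bsub>int_record\<^esub> y = x - y"
proof -
  interpret cring int_record by (rule cring_int_record)
  have "- y = \<ominus>\<^bsub>int_record\<^esub> y"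
    using minus_equality[of "- y" y] assms ints_closed(5)[of y] by simp
  thus ?thesis by (simp add: a_minus_def)
qed

lemma int_record_pow: "x \<in> ints ==> x [^]\<^bsub>int_record\<^esub> (k::nat) = x ^ k"
proof -
  interpret cring int_record by (rule cring_int_record)
  show ?thesis by (induction k) (simp_all add: nat_pow_Suc mult.commute)
qed

lemma ideal_P: "ideal P int_record"
proof (rule idealI)
  show "ring int_record" using cring_int_record by (simp add: cring_def)
  interpret cring int_record by (rule cring_int_record)
  have "\<ominus>\<^bsub>int_record\<^esub> x = - x" if "x \<in> P" for x
    using minus_equality[of "- x" x] that P_ints ints_closed(5)[of x] by auto
  hence "inv\<^bsub>add_monoid int_record\<^esub> x = - x" if "x \<in> P" for x using that by (simp add: a_inv_def)
  thus "subgroup P (add_monoid int_record)"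
    using P_ints P_add zero_P P_uminus by unfold_locales auto
qed (use P_mult P_mult' in auto)

lemma maximalideal_P: "maximalideal P int_record"
proof (rule maximalidealI[OF ideal_P])
  show "carrier int_record ~= P" using one_ints_P by auto
  fix J assume J: "ideal J int_record" "P \<subseteq> J" "J \<subseteq> carrier int_record"
  interpret J: ideal J int_record by (rule J(1))
  show "J = P \<or> J = carrier int_record"
  proof (cases "J = P")
    case False
    then obtain x where x: "x \<in> J" "x \<notin> P" using J(2) by blast
    hence "x \<in> ints - P" using J(3) by auto
    then obtain y where y: "y \<in> ints" "x * y - 1 \<in> P" using P_maximal by blast
    have "x * y \<in> J" using J.I_r_closed[OF x(1), of y] y by simp
    moreover have "- (x * y - 1) \<in> J" using P_uminus[OF y(2)] J(2) by blast
    ultimately have "x * y + (- (x * y - 1)) \<in> J" using additive_subgroup.a_closed[OF ideal.axioms(1)[OF J(1)], of "x * y" "- (x * y - 1)"] by simp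
    hence "1 \<in> J" by simp
    thus ?thesis using J.one_imp_carrier by simp
  qed simp
qed

text \<open>The residue field is finite, so its unit group is cyclic, generated by the class of
  \<alpha>. Its size \<open>q\<close> lies in \<open>P\<close> because the additive group has order
  \<open>q\<close>.\<close>

lemma residue_generator:
  "\<exists>\<alpha>\<in>ints - P. \<exists>q::nat. q > 0 \<and> of_nat q \<in> P \<and> \<alpha> ^ q - \<alpha> \<in> P \<and> (\<forall>x\<in>ints - P. \<exists>k::nat. x - \<alpha> ^ k \<in> P)"
proof -
  interpret O: cring int_record by (rule cring_int_record)
  interpret P: maximalideal P int_record by (rule maximalideal_P)
  let ?S = "int_record Quot P"
  let ?c = "\<lambda>x. P +>\<^bsub>int_record\<^esub> x"
  interpret S: field ?S by (rule P.quotient_is_field[OF cring_int_record])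
  have hom: "?c \<in> Ring.ring_hom int_record ?S" by (rule P.rcos_ring_hom)
  have eq: "?c x = ?c y \<longleftrightarrow> x - y \<in> P" if "x \<in> ints" "y \<in> ints" for x y
    using O.quotient_eq_iff_same_a_r_cos[OF ideal_P, of x y] that int_record_minus[OF that] by simp
  have carr: "carrier ?S = ?c ` ints" by (auto simp: FactRing_def A_RCOSETS_def')
  have fin: "finite (carrier ?S)"
  proof -
    obtain T where T: "finite T" "T \<subseteq> ints" "\<And>z. z \<in> ints ==> \<exists>t\<in>T. \<exists>w\<in>ints. z = t + of_nat p * w"
      using finite_residues by auto
    have "?c ` ints \<subseteq> ?c ` T"
    proof
      fix s assume "s \<in> ?c ` ints"
      then obtain z where z: "z \<in> ints" "s = ?c z" by blast
      then obtain t w where tw: "t \<in> T" "w \<in> ints" "z = t + of_nat p * w" using T(3) by blast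
      hence "z - t \<in> P" using P_mult'[OF p_P] by simp
      hence "?c z = ?c t" using eq z tw T(2) by blast
      thus "s \<in> ?c ` T" using z tw by auto
    qed
    thus ?thesis using T(1) carr by (metis finite_imageI finite_subset)
  qed
  define q where "q = card (carrier ?S)"
  have q: "q > 0" unfolding q_def using fin S.zero_closed by (auto simp: card_gt_0_iff)
  obtain g where g: "g \<in> carrier (Multiplicative_Group.mult_of ?S)" "carrier (Multiplicative_Group.mult_of ?S) = {g [^]\<^bsub>?S\<^esub> i | i::nat. i \<in> UNIV}"
    using S.finite_field_mult_group_has_gen[OF fin] by (elim bexE)
  obtain \<alpha> where \<alpha>: "\<alpha> \<in> ints" "g = ?c \<alpha>" using g(1) carr by (auto simp: Multiplicative_Group.carrier_mult_of)
  have zero: "\<zero>\<^bsub>?S\<^esub> = ?c 0" using ring_hom_zero[OF hom O.ring_axioms S.ring_axioms] by simp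
  have memP: "x \<in> P \<longleftrightarrow> ?c x = \<zero>\<^bsub>?S\<^esub>" if "x \<in> ints" for x
    using eq[OF that ints_closed(2)] zero by simp
  have pow: "?c (x ^ k) = ?c x [^]\<^bsub>?S\<^esub> k" if "x \<in> ints" for x and k :: nat
  proof -
    have "?c (x [^]\<^bsub>int_record\<^esub> k) = ?c x [^]\<^bsub>?S\<^esub> k"
    proof -
      interpret h: ring_hom_ring int_record ?S ?c
        by (rule ring_hom_ringI2[OF O.ring_axioms S.ring_axioms hom])
      show ?thesis using h.hom_nat_pow[of x k] that by simp
    qed
    thus ?thesis using int_record_pow[OF that] by simp
  qed
  have "\<alpha> \<notin> P" using memP[OF \<alpha>(1)] \<alpha>(2) g(1) by (auto simp: Multiplicative_Group.carrier_mult_of)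
  moreover have "of_nat q \<in> P"
  proof -
    have "?c (of_nat k) = \<one>\<^bsub>?S\<^esub> [^]\<^bsub>add_monoid ?S\<^esub> k" for k :: nat
    proof (induction k)
      case 0 show ?case using zero by simp
    next
      case (Suc k)
      have "?c (of_nat (Suc k)) = ?c (of_nat k) \<oplus>\<^bsub>?S\<^esub> ?c 1"
        using ring_hom_add[OF hom, of "of_nat k" 1] ints_closed(1,8) by (simp add: add.commute)
      also have "?c 1 = \<one>\<^bsub>?S\<^esub>" using ring_hom_one[OF hom] by simp
      finally show ?case using Suc by simp
    qed
    moreover have "\<one>\<^bsub>?S\<^esub> [^]\<^bsub>add_monoid ?S\<^esub> q = \<zero>\<^bsub>?S\<^esub>"
      using group.pow_order_eq_1[OF S.add.group_axioms, of "\<one>\<^bsub>?S\<^esub>"] fin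
      by (simp add: q_def Coset.order_def)
    ultimately show ?thesis using memP[OF ints_closed(8)] by simp
  qed
  moreover have "\<alpha> ^ q - \<alpha> \<in> P"
  proof -
    have "g [^]\<^bsub>?S\<^esub> (q - 1) = \<one>\<^bsub>?S\<^esub>"
    proof -
      have "g [^]\<^bsub>Multiplicative_Group.mult_of ?S\<^esub> Coset.order (Multiplicative_Group.mult_of ?S) = \<one>\<^bsub>Multiplicative_Group.mult_of ?S\<^esub>"
        using group.pow_order_eq_1[OF S.field_mult_group g(1)] .
      moreover have "Coset.order (Multiplicative_Group.mult_of ?S) = q - 1" using fin by (simp add: Coset.order_def Multiplicative_Group.carrier_mult_of q_def)
      ultimately show ?thesis by (simp add: Multiplicative_Group.nat_pow_mult_of Multiplicative_Group.one_mult_of)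
    qed
    moreover have "g \<in> carrier ?S" using g(1) by (auto simp: Multiplicative_Group.carrier_mult_of)
    ultimately have "g [^]\<^bsub>?S\<^esub> (Suc (q - 1)) = g" by (simp add: S.nat_pow_Suc)
    hence "g [^]\<^bsub>?S\<^esub> q = g" using q by simp
    hence "?c (\<alpha> ^ q) = ?c \<alpha>" using pow[OF \<alpha>(1)] \<alpha>(2) by simp
    thus ?thesis using eq[OF ints_closed(7)[OF \<alpha>(1)] \<alpha>(1)] by simp
  qed
  moreover have "\<exists>k::nat. x - \<alpha> ^ k \<in> P" if x: "x \<in> ints - P" for x
  proof -
    have "?c x \<in> carrier (Multiplicative_Group.mult_of ?S)" using x memP[of x] carr by (auto simp: Multiplicative_Group.carrier_mult_of)
    then obtain k :: nat where "?c x = g [^]\<^bsub>?S\<^esub> k" using g(2) by auto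
    hence "?c x = ?c (\<alpha> ^ k)" using pow[OF \<alpha>(1)] \<alpha>(2) by simp
    thus ?thesis using eq[of x "\<alpha> ^ k"] x ints_closed(7)[OF \<alpha>(1)] by auto
  qed
  ultimately show ?thesis using \<alpha>(1) q by blast
qed

text \<open>Taylor expansion to first order with integral remainder; the exponent is a successor so
  that its derivative needs no truncated subtraction.\<close>

lemma power_add_taylor:
  assumes "a \<in> ints" "b \<in> ints"
  shows "\<exists>w\<in>ints. (a + b) ^ Suc q = a ^ Suc q + of_nat (Suc q) * a ^ q * b + b\<^sup>2 * w"
proof (induction q)
  case 0 show ?case using ints_closed(2) by (intro bexI[of _ 0]) auto
next
  case (Suc q)
  then obtain w where w: "w \<in> ints" "(a + b) ^ Suc q = a ^ Suc q + of_nat (Suc q) * a ^ q * b + b\<^sup>2 * w" by blast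
  have "(a + b) ^ Suc (Suc q) = (a + b) * (a ^ Suc q + of_nat (Suc q) * a ^ q * b + b\<^sup>2 * w)"
    unfolding w(2)[symmetric] by simp
  also have "... = a ^ Suc (Suc q) + of_nat (Suc (Suc q)) * a ^ Suc q * b + b\<^sup>2 * (of_nat (Suc q) * a ^ q + (a + b) * w)"
    by (simp add: algebra_simps power2_eq_square)
  finally show ?case using w(1) assms
    by (intro bexI[of _ "of_nat (Suc q) * a ^ q + (a + b) * w"] ints_closed)
qed

lemma nv_unif: "nv unif = 1 / 2"
proof -
  have "nv (cc * unif) = 1" using nv_P_iff[of "cc * unif"] nv_ints[of "cc * unif"] unif(2) by auto
  thus ?thesis using nv_mult[of cc unif] nv_cc by simp
qed

lemma nv_P: "x \<in> P ==> nv x \<le> 1 / 2"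
  using nv_discrete[of x 1] nv_P_iff[of x] subsetD[OF P_ints, of x] by simp

lemma nv_uminus: "nv (- x) = nv x"
proof -
  have "nv (-1) * nv (-1) = 1" using nv_mult[of "-1" "-1"] by simp
  hence "nv (-1) = 1" using nv_nonneg[of "-1"] by (metis abs_of_nonneg abs_square_eq_1 power2_eq_square)
  thus ?thesis using nv_mult[of "-1" x] by simp
qed

lemma nv_diff: "nv (x - y) \<le> max (nv x) (nv y)"
  using nv_add[of x "- y"] by (simp add: nv_uminus)

lemma nv_power: "nv (x ^ n) = nv x ^ n" by (induction n) (auto simp: nv_mult)

lemma nv_prod: "nv (prod f I) = (\<Prod>i\<in>I. nv (f i))"
  by (induction I rule: infinite_finite_induct) (auto simp: nv_mult)

lemma nv_sum_le: "(\<And>i. i \<in> I ==> nv (f i) \<le> B) ==> B \<ge> 0 ==> nv (sum f I) \<le> B"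
proof (induction I rule: infinite_finite_induct)
  case (insert x F)
  have "nv (f x + sum f F) \<le> max (nv (f x)) (nv (sum f F))" by (rule nv_add)
  also have "... \<le> B" using insert by auto
  finally show ?case using insert by simp
qed auto

lemma nv_inverse: "nv (inverse x) = inverse (nv x)"
proof (cases "x = 0")
  case False
  have "nv x * nv (inverse x) = 1" using nv_mult[of x "inverse x"] False by simp
  thus ?thesis by (metis inverse_unique)
qed simp

lemma nv_divide: "nv (x / y) = nv x / nv y"
  by (simp add: divide_inverse nv_mult nv_inverse)

text \<open>If \<open>\<alpha>\<close> generates the residue field then either \<open>\<alpha>\<close> or \<open>\<alpha> + \<pi>\<close> makes \<open>X ^ q - X\<close> a uniformizer,
  where \<open>q\<close> is the size of the residue field.\<close>

lemma ex_residue_generator_uniformizer: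
  "\<exists>\<alpha>\<in>ints. \<exists>q::nat. nv (\<alpha> ^ q - \<alpha>) = 1 / 2 \<and> (\<forall>x\<in>ints - P. \<exists>k::nat. x - \<alpha> ^ k \<in> P)"
proof -
  obtain \<alpha> q where a: "\<alpha> \<in> ints" "q > 0" "of_nat q \<in> P" "\<alpha> ^ q - \<alpha> \<in> P" "\<And>x. x \<in> ints - P ==> \<exists>k::nat. x - \<alpha> ^ k \<in> P"
    using residue_generator by blast
  show ?thesis
  proof (cases "nv (\<alpha> ^ q - \<alpha>) = 1 / 2")
    case True thus ?thesis using a by blast
  next
    case False
    hence "nv (\<alpha> ^ q - \<alpha>) < nv unif" using nv_P[OF a(4)] nv_unif by simp
    hence small: "nv (\<alpha> ^ q - \<alpha>) \<le> 1 / 4" using nv_discrete[of "\<alpha> ^ q - \<alpha>" unif] nv_unif by simp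
    define \<beta> where "\<beta> = \<alpha> + unif"
    obtain r where r: "q = Suc r" using a(2) by (cases q) auto
    obtain w where w: "w \<in> ints" "\<beta> ^ q = \<alpha> ^ q + of_nat q * \<alpha> ^ r * unif + unif\<^sup>2 * w"
      using power_add_taylor[OF a(1) unif(3), of r] unfolding \<beta>_def r by blast
    \<comment> \<open>What is left of \<open>\<beta> ^ q - \<beta>\<close> besides
      \<open>- unif\<close>. It is at most 1/4, as both \<open>of_nat q\<close> and
      \<open>unif\<close> lie in \<open>P\<close> and the case assumption bounds
      \<open>\<alpha> ^ q - \<alpha>\<close>; so \<open>unif\<close> dominates.\<close>
    define s where "s = (\<alpha> ^ q - \<alpha>) + (of_nat q * \<alpha> ^ r * unif + unif\<^sup>2 * w)"
    have eq: "\<beta> ^ q - \<beta> = s - unif" unfolding s_def w(2) by (simp add: \<beta>_def)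
    have "nv (of_nat q * \<alpha> ^ r * unif) \<le> 1/4"
    proof -
      have "nv (of_nat q) * nv (\<alpha> ^ r) \<le> (1/2) * 1"
        using nv_P[OF a(3)] nv_ints[OF ints_closed(7)[OF a(1)]] nv_nonneg by (intro mult_mono) auto
      thus ?thesis by (simp add: nv_mult nv_unif)
    qed
    moreover have "nv (unif\<^sup>2 * w) \<le> 1/4"
      using nv_ints[OF w(1)] by (simp add: nv_mult nv_power nv_unif power2_eq_square)
    ultimately have "nv (of_nat q * \<alpha> ^ r * unif + unif\<^sup>2 * w) \<le> 1/4"
      using nv_add[of "of_nat q * \<alpha> ^ r * unif" "unif\<^sup>2 * w"] by simp
    hence s: "nv s \<le> 1/4" using small nv_add[of "\<alpha> ^ q - \<alpha>" "of_nat q * \<alpha> ^ r * unif + unif\<^sup>2 * w"]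
      unfolding s_def by simp
    have "nv (\<beta> ^ q - \<beta>) \<le> 1/2" using nv_diff[of s unif] s nv_unif unfolding eq by simp
    moreover have "nv unif \<le> max (nv s) (nv (\<beta> ^ q - \<beta>))" using nv_diff[of s "\<beta> ^ q - \<beta>"] eq by simp
    ultimately have "nv (\<beta> ^ q - \<beta>) = 1/2" using s nv_unif by simp
    moreover have "\<exists>k::nat. x - \<beta> ^ k \<in> P" if x: "x \<in> ints - P" for x
    proof -
      obtain k where k: "x - \<alpha> ^ k \<in> P" using a(5)[OF x] by blast
      have "\<alpha> ^ k - \<beta> ^ k \<in> P"
      proof (cases k)
        case (Suc j)
        obtain v where v: "v \<in> ints" "\<beta> ^ k = \<alpha> ^ k + of_nat k * \<alpha> ^ j * unif + unif\<^sup>2 * v"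
          using power_add_taylor[OF a(1) unif(3), of j] unfolding \<beta>_def Suc by blast
        have "\<alpha> ^ k - \<beta> ^ k = (- (of_nat k * \<alpha> ^ j + unif * v)) * unif"
          unfolding v by (simp add: algebra_simps power2_eq_square)
        moreover have "- (of_nat k * \<alpha> ^ j + unif * v) \<in> ints" by (intro ints_closed a v unif)
        ultimately show ?thesis using P_mult unif(1) by metis
      qed (simp add: zero_P)
      from P_add[OF k this] show ?thesis by (intro exI[of _ k]) simp
    qed
    moreover have "\<beta> \<in> ints" unfolding \<beta>_def by (intro ints_closed a unif)
    ultimately show ?thesis by blast
  qed
qed

text \<open>The element \<open>\<theta> = \<alpha> ^ q - \<alpha>\<close> is a uniformizer and an
  integral polynomial in \<alpha>, and each nonzero residue class contains a power of \<alpha>. The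
  \<theta>-adic expansion of \<open>y\<close> with such powers and 0 as digits has partial sums that
  are integral polynomials in \<alpha>.\<close>

lemma ex_dense_generator:
  "\<exists>\<alpha>\<in>ints. \<forall>y N. nv y \<le> 1 --> (\<exists>f. (\<forall>i. Polynomial.coeff f i \<in> \<int>) \<and> nv (y - poly f \<alpha>) \<le> (1/2) ^ N)"
proof -
  obtain \<alpha> q where a: "\<alpha> \<in> ints" "nv (\<alpha> ^ q - \<alpha>) = 1 / 2" "\<And>x. x \<in> ints - P ==> \<exists>k::nat. x - \<alpha> ^ k \<in> P"
    using ex_residue_generator_uniformizer by blast
  define \<theta> where "\<theta> = \<alpha> ^ q - \<alpha>"
  have \<theta>: "nv \<theta> = 1/2" "\<theta> ~= 0" using a(2) by (auto simp: \<theta>_def)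
  have sub: "is_subring {f :: 'a poly. \<forall>i. Polynomial.coeff f i \<in> \<int>}"
    by (rule is_subring_polys) (auto simp: is_subring_def)
  have X: "Polynomial.monom 1 k \<in> {f :: 'a poly. \<forall>i. Polynomial.coeff f i \<in> \<int>}" for k by auto
  have step: "\<exists>k::nat. nv (z - \<alpha> ^ k) \<le> 1/2" if z: "nv z = 1" for z
  proof -
    obtain s t where st: "s \<in> ints" "t \<in> ints - P" "z = s / t" using z nv_le_one_iff[of z] by auto
    have t0: "t ~= 0" using nonzero_ints_P[OF st(2)] .
    obtain t' where t': "t' \<in> ints" "t * t' - 1 \<in> P" using P_maximal[OF st(2)] by blast
    have nt: "nv t = 1" using nv_P_iff[of t] nv_ints[of t] st(2) by auto
    have st': "s * t' \<in> ints" by (intro ints_closed st t')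
    have "s * t' - z = z * (t * t' - 1)" using st(3) t0 by (simp add: field_simps)
    hence d: "nv (s * t' - z) \<le> 1/2" using nv_P[OF t'(2)] z by (simp add: nv_mult)
    hence "nv (s * t') = 1" using nv_add[of "s * t' - z" z] nv_diff[of "s * t'" "s * t' - z"] z
      by (auto simp: max_def split: if_splits)
    hence "s * t' \<in> ints - P" using nv_P_iff[OF st'] st' by auto
    then obtain k where "s * t' - \<alpha> ^ k \<in> P" using a(3) by blast
    from nv_P[OF this] have "nv (s * t' - \<alpha> ^ k) \<le> 1/2" .
    hence "nv (z - \<alpha> ^ k) \<le> 1/2" using d nv_diff[of "s * t' - \<alpha> ^ k" "s * t' - z"] by simp
    thus ?thesis by blast
  qed
  have "\<exists>f. (\<forall>i. Polynomial.coeff f i \<in> \<int>) \<and> nv (y - poly f \<alpha>) \<le> (1/2) ^ N" if y: "nv y \<le> 1" for y N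
  proof (induction N)
    case 0 show ?case using y by (intro exI[of _ 0]) auto
  next
    case (Suc N)
    then obtain f where f: "\<forall>i. Polynomial.coeff f i \<in> \<int>" "nv (y - poly f \<alpha>) \<le> (1/2) ^ N" by blast
    define z where "z = (y - poly f \<alpha>) / \<theta> ^ N"
    have zeq: "y - poly f \<alpha> = \<theta> ^ N * z" using \<theta> by (simp add: z_def)
    have "nv z = nv (y - poly f \<alpha>) / (1/2)^N" unfolding z_def by (simp add: nv_divide nv_power \<theta>)
    hence "nv z \<le> 1" using f(2) by (simp add: field_simps)
    then consider "nv z < nv 1" | "nv z = 1" by fastforce
    thus ?case
    proof cases
      case 1
      from nv_discrete[OF 1] have "nv z \<le> 1/2" by simp
      hence "nv (y - poly f \<alpha>) \<le> (1/2) ^ Suc N" unfolding zeq by (simp add: nv_mult nv_power \<theta>)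
      thus ?thesis using f(1) by blast
    next
      case 2
      obtain k where k: "nv (z - \<alpha> ^ k) \<le> 1/2" using step[OF 2] by blast
      define f' where "f' = f + (Polynomial.monom 1 q - Polynomial.monom 1 1) ^ N * Polynomial.monom 1 k"
      have "f' \<in> {f :: 'a poly. \<forall>i. Polynomial.coeff f i \<in> \<int>}"
        unfolding f'_def by (intro is_subring_closed[OF sub] is_subring_power[OF sub] X) (use f in simp)
      moreover have "poly f' \<alpha> = poly f \<alpha> + \<theta> ^ N * \<alpha> ^ k"
        by (simp add: f'_def \<theta>_def poly_monom)
      hence "y - poly f' \<alpha> = \<theta> ^ N * (z - \<alpha> ^ k)" using zeq by (simp add: algebra_simps)
      hence "nv (y - poly f' \<alpha>) \<le> (1/2) ^ Suc N" using k by (simp add: nv_mult nv_power \<theta>)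
      ultimately show ?thesis by blast
    qed
  qed
  thus ?thesis using a(1) by blast
qed

text \<open>Every nonzero \<open>z\<close> is a power of the uniformizer times a quotient of two
  elements outside \<open>P\<close>. The lemma is applied to the absolute value composed with an
  automorphism and to the absolute value of a bigger field restricted to the small one.\<close>

lemma multiplicative_compare:
  fixes w :: "'a => real"
  assumes mult: "\<And>x y. w (x * y) = w x * w y" and unit: "\<And>s. s \<in> ints - P ==> w s = 1"
    and z: "z ~= 0"
  shows "w z = w unif powi (val z)"
proof -
  have w1: "w 1 = 1" using unit[OF one_ints_P] .
  have winv: "w x ~= 0 \<and> w (inverse x) = inverse (w x)" if "x ~= 0" for x
  proof -
    have "w x * w (inverse x) = 1" using mult[of x "inverse x"] that w1 by simp
    thus ?thesis by (metis inverse_unique mult_zero_left zero_neq_one)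
  qed
  have wpow: "w (x ^ n) = w x ^ n" for x n by (induction n) (auto simp: mult w1)
  have wpowi: "w (x powi k) = w x powi k" if "x ~= 0" for x k
  proof (cases "k \<ge> 0")
    case True thus ?thesis by (auto simp: power_int_def wpow)
  next
    case False
    thus ?thesis using winv[of "x ^ nat (-k)"] that by (simp add: power_int_def wpow power_inverse[symmetric])
  qed
  have u0: "unif ~= 0" using nv_unif by auto
  define u where "u = z * unif powi (- val z)"
  have unz: "u ~= 0" using z u0 by (simp add: u_def)
  have "val unif = 1"
  proof -
    have "val (cc * unif) = 0" using val_ints(2)[of "cc * unif"] unif(2) nonzero_ints_P[OF unif(2)] by auto
    thus ?thesis using val_mult[OF cc_neq_0 u0] val_cc by simp
  qed
  hence nvu: "nv (unif powi k) = 2 powr (- real_of_int k)" for k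
  proof -
    have "nv (unif powi k) = (1/2) powi k"
      by (cases "k \<ge> 0") (auto simp: power_int_def nv_power nv_inverse nv_unif)
    thus ?thesis using half_powi by simp
  qed
  have nu1: "nv u = 1" unfolding u_def nv_mult nvu using z by (simp add: nv_def powr_add[symmetric])
  then obtain s t where st: "s \<in> ints" "t \<in> ints - P" "u = s / t" using nv_le_one_iff[of u] by auto
  have t0: "t ~= 0" using nonzero_ints_P[OF st(2)] .
  have "nv t = 1" using nv_P_iff[of t] nv_ints[of t] st(2) by auto
  hence "nv s = 1" using nu1 st(3) by (simp add: nv_divide)
  hence "s \<in> ints - P" using nv_P_iff[of s] st(1) by auto
  hence "w s = 1" "w t = 1" using unit st by auto
  hence "w u = 1" using st(3) winv[OF t0] mult[of s "inverse t"] by (simp add: divide_inverse)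
  moreover have "z = u * unif powi (val z)" unfolding u_def using u0 by (simp add: power_int_minus)
  ultimately show ?thesis using mult[of u "unif powi (val z)"] wpowi[OF u0] by simp
qed

text \<open>The absolute value \<open>a\<close> of \<open>\<sigma> unif\<close> is at most 1/2.
  Since \<open>unif\<close> is the image of an element of \<open>P\<close>, a positive power of
  \<open>a\<close> equals 1/2, so \<open>a\<close> is also at least 1/2.\<close>

lemma nv_automorphism:
  assumes mult: "\<And>x y. \<sigma> (x * y) = \<sigma> x * \<sigma> y" and bij: "bij \<sigma>"
    and O: "\<sigma> ` ints = ints" and QP: "\<sigma> ` P = P" 
  shows "nv (\<sigma> z) = nv z"
proof (cases "z = 0")
  case True
  have "\<sigma> 0 = \<sigma> 0 * \<sigma> x" for x using mult[of 0 x] by simp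
  moreover obtain x where "\<sigma> x = 0" using bij by (metis bij_pointE)
  ultimately have "\<sigma> 0 = 0" by (metis mult_zero_right)
  thus ?thesis using True by simp
next
  case False
  have OP: "\<sigma> s \<in> ints - P" if "s \<in> ints - P" for s
    using that O QP bij by (metis Diff_iff bij_is_inj image_eqI inj_image_mem_iff)
  have unit: "nv (\<sigma> s) = 1" if "s \<in> ints - P" for s
    using nv_P_iff[of "\<sigma> s"] nv_ints[of "\<sigma> s"] OP[OF that] by auto
  have cmp: "nv (\<sigma> z) = nv (\<sigma> unif) powi (val z)" if "z ~= 0" for z
    by (rule multiplicative_compare[where w = "\<lambda>x. nv (\<sigma> x)"]) (simp_all add: mult nv_mult unit that)
  have "unif \<in> \<sigma> ` P" using QP unif(1) by simp
  then obtain x where x: "x \<in> P" "\<sigma> x = unif" by (elim imageE) simp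
  have \<sigma>u: "\<sigma> unif \<in> P" using imageI[OF unif(1), of \<sigma>] QP by simp
  have x0: "x ~= 0"
  proof
    assume "x = 0"
    hence "unif = unif * \<sigma> y" for y using mult[of 0 y] x by simp
    moreover obtain y where "\<sigma> y = 0" using bij by (metis bij_pointE)
    ultimately have "unif = 0" by (metis mult_zero_right)
    thus False using nv_unif by simp
  qed
  define a where "a = nv (\<sigma> unif)"
  have a: "0 \<le> a" "a \<le> 1/2" using nv_P[OF \<sigma>u] nv_nonneg by (auto simp: a_def)
  have "val x > 0" using val_ints[of x] x(1) x0 subsetD[OF P_ints x(1)] by linarith
  then obtain n where n: "val x = int (Suc n)" using zero_less_imp_eq_int[of "val x"] gr0_implies_Suc by metis
  have "1/2 = a powi (int (Suc n))" using cmp[OF x0] x nv_unif n by (simp only: a_def)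
  also have "... = a ^ Suc n" by (rule power_int_of_nat)
  also have "... \<le> a ^ 1" using a by (intro power_decreasing) auto
  finally have "a = 1/2" using a by simp
  hence "nv (\<sigma> z) = (1/2) powi (val z)" using cmp[OF False] by (simp only: a_def)
  also have "... = nv z" using False
    by (simp add: nv_def half_powi)
  finally show ?thesis .
qed

end

text \<open>\<open>Q\<close> is maximal among the ideals that contain the image of \<open>P\<close>
  and omit 1. Such ideals exist because \<open>cc\<close> is not integral: the integral elements
  that \<open>\<psi> cc\<close> multiplies into the ring of integers form one.\<close>

lemma ex_place_above:
  fixes \<psi> :: "'a::field_char_0 => 'b::field_char_0"
  assumes "arith_place R p P" "arith_ring (\<psi> ` R) p"
    and hom: "\<psi> 1 = 1" "\<And>x y. \<psi> (x + y) = \<psi> x + \<psi> y" "\<And>x y. \<psi> (x * y) = \<psi> x * \<psi> y"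
  shows "\<exists>Q. arith_place (\<psi> ` R) p Q \<and> (\<forall>x\<in>arith_ring.ints R. \<psi> x \<in> arith_ring.ints (\<psi> ` R) \<and> (\<psi> x \<in> Q \<longleftrightarrow> x \<in> P))"
proof -
  interpret F: arith_place R p P by fact
  interpret L: arith_ring "\<psi> ` R" p by fact
  have \<psi>0: "\<psi> 0 = 0" using hom(2)[of 0 0] by simp
  have \<psi>diff: "\<psi> (x - y) = \<psi> x - \<psi> y" for x y using hom(2)[of "x - y" y] by simp
  have \<psi>inj: "x = y" if "\<psi> x = \<psi> y" for x y
  proof (rule ccontr)
    assume "x ~= y"
    hence "\<psi> (x - y) * \<psi> (inverse (x - y)) = 1" using hom(1) hom(3)[of "x - y" "inverse (x - y)"] by simp
    thus False using that \<psi>diff by simp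
  qed
  have \<psi>pow: "\<psi> (x ^ n) = \<psi> x ^ n" for x n by (induction n) (auto simp: hom)
  have \<psi>sum: "\<psi> (sum f I) = (\<Sum>i\<in>I. \<psi> (f i))" for f and I :: "nat set"
    by (induction I rule: infinite_finite_induct) (auto simp: hom \<psi>0)
  have int_iff: "\<psi> x \<in> L.ints \<longleftrightarrow> x \<in> F.ints" for x
  proof
    assume "\<psi> x \<in> L.ints"
    then obtain m a where ma: "\<forall>i<m. a i \<in> \<psi> ` R" "\<psi> x ^ m + (\<Sum>i<m. a i * \<psi> x ^ i) = 0"
      unfolding L.ints_def integral_over_def by auto
    have "\<forall>i. \<exists>b. i < m --> b \<in> R \<and> a i = \<psi> b" using ma(1) by blast
    then obtain b where b: "\<And>i. i < m ==> b i \<in> R \<and> a i = \<psi> (b i)" by metis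
    have "\<psi> (x ^ m + (\<Sum>i<m. b i * x ^ i)) = \<psi> 0" using ma(2) b by (simp add: hom \<psi>pow \<psi>sum \<psi>0)
    from \<psi>inj[OF this] show "x \<in> F.ints" using b unfolding F.ints_def integral_over_def by blast
  next
    assume "x \<in> F.ints"
    then obtain m a where ma: "\<forall>i<m. a i \<in> R" "x ^ m + (\<Sum>i<m. a i * x ^ i) = 0"
      unfolding F.ints_def integral_over_def by auto
    have "\<psi> x ^ m + (\<Sum>i<m. \<psi> (a i) * \<psi> x ^ i) = 0"
      using arg_cong[OF ma(2), of \<psi>] by (simp add: hom \<psi>pow \<psi>sum \<psi>0)
    thus "\<psi> x \<in> L.ints" using ma(1) unfolding L.ints_def integral_over_def
      by (intro CollectI exI[of _ m] exI[of _ "\<lambda>i. \<psi> (a i)"]) auto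
  qed
  define idl where "idl J \<longleftrightarrow> J \<subseteq> L.ints \<and> \<psi> ` P \<subseteq> J \<and> (\<forall>x\<in>J. \<forall>y\<in>J. x + y \<in> J) \<and> (\<forall>z\<in>L.ints. \<forall>x\<in>J. z * x \<in> J)" for J
  have idl_add: "x + y \<in> J" if "idl J" "x \<in> J" "y \<in> J" for J x y using that unfolding idl_def by blast
  define I where "I = {x \<in> L.ints. \<psi> F.cc * x \<in> L.ints}"
  have "idl I" unfolding idl_def
  proof (intro conjI ballI)
    show "I \<subseteq> L.ints" by (auto simp: I_def)
    show "\<psi> ` P \<subseteq> I"
    proof
      fix y assume "y \<in> \<psi> ` P"
      then obtain x where x: "x \<in> P" "y = \<psi> x" by blast
      hence "F.cc * x \<in> F.ints" "x \<in> F.ints" using F.cc_iff[of x] F.P_ints by auto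
      thus "y \<in> I" unfolding I_def using x int_iff[of "F.cc * x"] int_iff[of x] by (simp add: hom)
    qed
    fix x y assume "x \<in> I" "y \<in> I"
    thus "x + y \<in> I" unfolding I_def using L.ints_closed(6) by (auto simp: distrib_left)
  next
    fix z x assume "z \<in> L.ints" "x \<in> I"
    thus "z * x \<in> I" unfolding I_def using L.ints_closed(4)[of z x] L.ints_closed(4)[of z "\<psi> F.cc * x"]
      by (auto simp: ac_simps)
  qed
  moreover have "1 \<notin> I" using int_iff[of F.cc] F.cc_notin_ints by (auto simp: I_def)
  ultimately have "{J. idl J \<and> 1 \<notin> J} ~= {}" by blast
  moreover have "\<Union>C \<in> {J. idl J \<and> 1 \<notin> J}" if C: "C ~= {}" "subset.chain {J. idl J \<and> 1 \<notin> J} C" for C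
  proof -
    have CJ: "idl J \<and> 1 \<notin> J" if "J \<in> C" for J using C(2) that unfolding subset.chain_def by blast
    have "idl (\<Union>C)" unfolding idl_def
    proof (intro conjI ballI)
      show "\<Union>C \<subseteq> L.ints" "\<psi> ` P \<subseteq> \<Union>C" using CJ C(1) unfolding idl_def by blast+
      fix x y assume "x \<in> \<Union>C" "y \<in> \<Union>C"
      then obtain J J' where J: "J \<in> C" "x \<in> J" "J' \<in> C" "y \<in> J'" by blast
      have "J \<subseteq> J' \<or> J' \<subseteq> J" using C(2) J unfolding subset.chain_def by blast
      thus "x + y \<in> \<Union>C"
      proof
        assume "J \<subseteq> J'"
        hence "x + y \<in> J'" using idl_add[of J' x y] CJ[OF J(3)] J by blast
        thus ?thesis using J(3) by blast
      next
        assume "J' \<subseteq> J"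
        hence "x + y \<in> J" using idl_add[of J x y] CJ[OF J(1)] J by blast
        thus ?thesis using J(1) by blast
      qed
    next
      fix z x assume "z \<in> L.ints" "x \<in> \<Union>C"
      thus "z * x \<in> \<Union>C" using CJ unfolding idl_def by blast
    qed
    thus ?thesis using CJ by blast
  qed
  ultimately obtain Q where Q: "idl Q" "1 \<notin> Q" and max: "\<And>J. idl J ==> 1 \<notin> J ==> Q \<subseteq> J ==> J = Q"
    using subset_Zorn_nonempty[of "{J. idl J \<and> 1 \<notin> J}"] by blast
  have Qc: "Q \<subseteq> L.ints" "\<psi> ` P \<subseteq> Q" "\<And>x y. x \<in> Q ==> y \<in> Q ==> x + y \<in> Q" "\<And>z x. z \<in> L.ints ==> x \<in> Q ==> z * x \<in> Q"
    using Q(1) unfolding idl_def by blast+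
  have "\<psi> 0 \<in> Q" using Qc(2) F.zero_P by blast
  hence Q0: "0 \<in> Q" by (simp add: \<psi>0)
  \<comment> \<open>Maximality in the form that elements outside \<open>Q\<close> are invertible
    modulo \<open>Q\<close>; primality follows by multiplying two such relations.\<close>
  have inv: "\<exists>z\<in>L.ints. \<exists>j\<in>Q. z * x + j = 1" if x: "x \<in> L.ints" "x \<notin> Q" for x
  proof -
    define J where "J = {z * x + j | z j. z \<in> L.ints \<and> j \<in> Q}"
    have "idl J" unfolding idl_def
    proof (intro conjI ballI)
      show "J \<subseteq> L.ints"
      proof
        fix y assume "y \<in> J"
        then obtain z j where "z \<in> L.ints" "j \<in> Q" "y = z * x + j" unfolding J_def by blast
        thus "y \<in> L.ints" using x(1) Qc(1) L.ints_closed(4)[of z x] L.ints_closed(6)[of "z * x" j] by (metis subsetD)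
      qed
      have QJ: "j \<in> J" if "j \<in> Q" for j unfolding J_def using that L.ints_closed(2)
        by (intro CollectI exI[of _ 0] exI[of _ j]) simp
      show "\<psi> ` P \<subseteq> J" using Qc(2) QJ by blast
      fix y y' assume "y \<in> J" "y' \<in> J"
      then obtain z j z' j' where *: "z \<in> L.ints" "j \<in> Q" "y = z * x + j" "z' \<in> L.ints" "j' \<in> Q" "y' = z' * x + j'"
        unfolding J_def by blast
      have "y + y' = (z + z') * x + (j + j')" using * by (simp add: algebra_simps)
      thus "y + y' \<in> J" unfolding J_def using L.ints_closed(6)[OF *(1,4)] Qc(3)[OF *(2,5)] by blast
    next
      fix t y assume "t \<in> L.ints" "y \<in> J"
      then obtain z j where *: "t \<in> L.ints" "z \<in> L.ints" "j \<in> Q" "y = z * x + j" unfolding J_def by blast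
      have "t * y = (t * z) * x + t * j" using * by (simp add: algebra_simps)
      thus "t * y \<in> J" unfolding J_def using L.ints_closed(4)[OF *(1,2)] Qc(4)[OF *(1,3)] by blast
    qed
    moreover have "Q \<subseteq> J"
    proof
      fix j assume "j \<in> Q"
      thus "j \<in> J" unfolding J_def using L.ints_closed(2) by (intro CollectI exI[of _ 0] exI[of _ j]) simp
    qed
    moreover have "x \<in> J" unfolding J_def using L.ints_closed(1) Q0 by (intro CollectI exI[of _ 1] exI[of _ 0]) simp
    ultimately have "1 \<in> J" using max[of J] x(2) by blast
    thus ?thesis unfolding J_def by force
  qed
  have "arith_place (\<psi> ` R) p Q"
  proof unfold_locales
    show "1 \<notin> Q" by (rule Q(2))
    show "of_nat p \<in> Q"
    proof -
      have "\<psi> (of_nat k) = of_nat k" for k by (induction k) (auto simp: hom \<psi>0)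
      thus ?thesis using F.p_P Qc(2) by (metis image_subset_iff)
    qed
    fix x y assume xy: "x \<in> L.ints" "y \<in> L.ints" "x * y \<in> Q"
    show "x \<in> Q \<or> y \<in> Q"
    proof (rule ccontr)
      assume "\<not> (x \<in> Q \<or> y \<in> Q)"
      then obtain z j z' j' where *: "z \<in> L.ints" "j \<in> Q" "z * x + j = 1" "z' \<in> L.ints" "j' \<in> Q" "z' * y + j' = 1"
        using inv[of x] inv[of y] xy by blast
      have "(1::'b) = (z * x + j) * (z' * y + j')" using * by simp
      also have "... = (z * z') * (x * y) + (z' * y) * j + (z * x + j) * j'" by (simp add: algebra_simps)
      also have "... = (z * z') * (x * y) + (z' * y) * j + 1 * j'" using *(3) by simp
      also have "... \<in> Q"
        by (intro Qc(3) Qc(4)[OF L.ints_closed(4)[OF *(1,4)] xy(3)] Qc(4)[OF L.ints_closed(4)[OF *(4) xy(2)] *(2)]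
            Qc(4)[OF L.ints_closed(1) *(5)])
      finally show False using Q(2) by simp
    qed
  qed (use Qc in auto)
  moreover have "\<psi> x \<in> Q \<longleftrightarrow> x \<in> P" if x: "x \<in> F.ints" for x
  proof
    assume xQ: "\<psi> x \<in> Q"
    show "x \<in> P"
    proof (rule ccontr)
      assume "x \<notin> P"
      then obtain y where y: "y \<in> F.ints" "x * y - 1 \<in> P" using F.P_maximal[of x] x by blast
      have "1 - x * y \<in> P" using F.P_uminus[OF y(2)] by simp
      hence "\<psi> (1 - x * y) \<in> Q" using Qc(2) by blast
      moreover have "\<psi> y * \<psi> x \<in> Q" using Qc(4)[of "\<psi> y" "\<psi> x"] int_iff[of y] y(1) xQ by simp
      ultimately have "\<psi> (1 - x * y) + \<psi> y * \<psi> x \<in> Q" using Qc(3) by blast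
      thus False using Q(2) by (simp add: hom \<psi>diff)
    qed
  qed (use Qc(2) in blast)
  ultimately show ?thesis using int_iff by blast
qed

section \<open>Bounds for discriminants\<close>

text \<open>The divided difference in Lagrange form: for distinct nodes \<open>t s\<close> it is the
  coefficient of degree \<open>card S - 1\<close> of the polynomial interpolating \<open>f\<close>.
  Nodes and values are indexed by \<open>s\<close>, which will be a group element.\<close>

definition divided_difference :: "('i => 'a::field) => ('i => 'a) => 'i set => 'a" where
  "divided_difference t f S = (\<Sum>s\<in>S. f s / (\<Prod>s'\<in>S - {s}. t s - t s'))"

lemma divided_difference_add:
  "divided_difference t (\<lambda>s. f s + g s) S = divided_difference t f S + divided_difference t g S"
  by (simp add: divided_difference_def add_divide_distrib sum.distrib)

lemma divided_difference_diff:
  "divided_difference t (\<lambda>s. f s - g s) S = divided_difference t f S - divided_difference t g S"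
  by (simp add: divided_difference_def diff_divide_distrib sum_subtractf)

lemma divided_difference_scale:
  "divided_difference t (\<lambda>s. c * f s) S = c * divided_difference t f S"
  by (simp add: divided_difference_def sum_distrib_left)

lemma divided_difference_sum:
  "divided_difference t (\<lambda>s. \<Sum>i\<in>I. f i s) S = (\<Sum>i\<in>I. divided_difference t (f i) S)"
  unfolding divided_difference_def sum_divide_distrib by (rule sum.swap)

lemma divided_difference_cong:
  "(\<And>s. s \<in> S ==> f s = g s) ==> divided_difference t f S = divided_difference t g S"
  by (simp add: divided_difference_def)

text \<open>The factor \<open>t s - t a\<close> vanishes at the new node and cancels against the
  denominator at the others.\<close>

lemma divided_difference_insert:
  assumes "finite S" "a \<notin> S" "inj_on t (insert a S)"
  shows "divided_difference t (\<lambda>s. (t s - t a) * f s) (insert a S) = divided_difference t f S"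
proof -
  have "(t s - t a) * f s / (\<Prod>s'\<in>insert a S - {s}. t s - t s') = f s / (\<Prod>s'\<in>S - {s}. t s - t s')"
    if s: "s \<in> S" for s
  proof -
    have "insert a S - {s} = insert a (S - {s})" using s assms(2) by auto
    hence "(\<Prod>s'\<in>insert a S - {s}. t s - t s') = (t s - t a) * (\<Prod>s'\<in>S - {s}. t s - t s')"
      using assms by simp
    moreover have "t s - t a ~= 0" using assms s by (auto simp: inj_on_def)
    ultimately show ?thesis by simp
  qed
  thus ?thesis using assms by (simp add: divided_difference_def)
qed

text \<open>For two nodes \<open>a\<close> and \<open>b\<close> the constant
  \<open>t a - t b\<close> is the difference of \<open>t s - t b\<close> and
  \<open>t s - t a\<close>. These factors drop the node \<open>b\<close> or \<open>a\<close>, and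
  both smaller divided differences agree by induction.\<close>

lemma divided_difference_const:
  assumes "finite S" "inj_on t S" "S ~= {}"
  shows "divided_difference t (\<lambda>_. 1) S = (if card S = 1 then 1 else 0)"
  using assms
proof (induction "card S" arbitrary: S)
  case 0 thus ?case by simp
next
  case (Suc m)
  show ?case
  proof (cases "m = 0")
    case True
    then obtain a where "S = {a}" using Suc(2) by (metis One_nat_def card_1_singletonE)
    thus ?thesis by (simp add: divided_difference_def)
  next
    case False
    obtain a where a: "a \<in> S" using Suc.prems by blast
    have "S - {a} ~= {}" using Suc(2) False a Suc.prems(1) by (metis card.empty card_Suc_Diff1 Suc_inject)
    then obtain b where b: "b \<in> S" "b ~= a" by blast
    have dd: "divided_difference t (\<lambda>s. (t s - t x) * 1) S = divided_difference t (\<lambda>_. 1) (S - {x})" if "x \<in> S" for x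
      using divided_difference_insert[of "S - {x}" x t "\<lambda>_. 1"] Suc.prems that by (simp add: insert_absorb)
    have IH: "divided_difference t (\<lambda>_. 1) (S - {x}) = (if m = 1 then 1 else 0)" if x: "x \<in> S" for x
    proof -
      have c: "card (S - {x}) = m" using Suc(2) x Suc.prems(1) by simp
      hence "S - {x} ~= {}" using False by (metis card.empty)
      moreover have "inj_on t (S - {x})" using Suc.prems(2) by (rule inj_on_subset) auto
      ultimately show ?thesis using Suc(1)[of "S - {x}"] c Suc.prems by simp
    qed
    have "(t a - t b) * divided_difference t (\<lambda>_. 1) S = divided_difference t (\<lambda>s. (t a - t b) * 1) S"
      by (rule divided_difference_scale[symmetric])
    also have "... = divided_difference t (\<lambda>s. (t s - t b) * 1 - (t s - t a) * 1) S"
      by (rule divided_difference_cong) simp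
    also have "... = 0" unfolding divided_difference_diff dd[OF a] dd[OF b(1)] IH[OF a] IH[OF b(1)] by simp
    finally have "divided_difference t (\<lambda>_. 1) S = 0" using Suc.prems a b by (auto simp: inj_on_def)
    thus ?thesis using Suc(2) False by simp
  qed
qed

context arith_place begin

lemma is_subring_nv: "is_subring {z. nv z \<le> 1}"
proof -
  have "nv (x - y) \<le> 1 \<and> nv (x * y) \<le> 1" if "nv x \<le> 1" "nv y \<le> 1" for x y
    using nv_diff[of x y] that nv_nonneg mult_le_one[of "nv x" "nv y"] by (auto simp: nv_mult)
  thus ?thesis by (auto simp: is_subring_def)
qed

text \<open>Divided differences of powers are complete homogeneous polynomials in the nodes. The
  induction uses \<open>t s = (t s - t a) + t a\<close>, whose first part removes the node
  \<open>a\<close>.\<close>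

lemma nv_divided_difference_power:
  assumes "finite S" "inj_on t S" "\<And>s. s \<in> S ==> nv (t s) \<le> 1"
  shows "nv (divided_difference t (\<lambda>s. t s ^ m) S) \<le> 1"
  using assms
proof (induction m arbitrary: S)
  case 0
  show ?case
  proof (cases "S = {}")
    case False
    thus ?thesis using divided_difference_const[OF 0(1,2) False] by simp
  qed (simp add: divided_difference_def)
next
  case (Suc m)
  show ?case
  proof (cases "S = {}")
    case False
    then obtain a where a: "a \<in> S" by blast
    have "divided_difference t (\<lambda>s. t s ^ Suc m) S = divided_difference t (\<lambda>s. (t s - t a) * t s ^ m + t a * t s ^ m) S"
      by (rule divided_difference_cong) (simp add: algebra_simps)
    also have "... = divided_difference t (\<lambda>s. (t s - t a) * t s ^ m) S + t a * divided_difference t (\<lambda>s. t s ^ m) S"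
      by (simp add: divided_difference_add divided_difference_scale)
    also have "divided_difference t (\<lambda>s. (t s - t a) * t s ^ m) S = divided_difference t (\<lambda>s. t s ^ m) (S - {a})"
      using divided_difference_insert[of "S - {a}" a t "\<lambda>s. t s ^ m"] Suc.prems a by (simp add: insert_absorb)
    finally have eq: "divided_difference t (\<lambda>s. t s ^ Suc m) S
       = divided_difference t (\<lambda>s. t s ^ m) (S - {a}) + t a * divided_difference t (\<lambda>s. t s ^ m) S" .
    have "nv (divided_difference t (\<lambda>s. t s ^ m) (S - {a})) \<le> 1"
      using Suc.prems by (intro Suc.IH) (auto intro: inj_on_diff)
    moreover have "nv (divided_difference t (\<lambda>s. t s ^ m) S) \<le> 1" using Suc.prems by (intro Suc.IH) auto
    ultimately show ?thesis unfolding eq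
      using is_subring_closed(4,6)[OF is_subring_nv] Suc.prems(3)[OF a] by simp
  qed (simp add: divided_difference_def)
qed

lemma nv_divided_difference_poly:
  assumes "finite S" "inj_on t S" "\<And>s. s \<in> S ==> nv (t s) \<le> 1" "\<And>i. nv (Polynomial.coeff f i) \<le> 1"
  shows "nv (divided_difference t (\<lambda>s. poly f (t s)) S) \<le> 1"
proof -
  have "divided_difference t (\<lambda>s. poly f (t s)) S
    = (\<Sum>i\<le>Polynomial.degree f. Polynomial.coeff f i * divided_difference t (\<lambda>s. t s ^ i) S)"
    unfolding poly_altdef divided_difference_sum divided_difference_scale ..
  also have "... \<in> {z. nv z \<le> 1}"
    using assms nv_divided_difference_power[OF assms(1-3)]
    by (intro is_subring_sum[OF is_subring_nv] is_subring_closed(4)[OF is_subring_nv]) auto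
  finally show ?thesis by simp
qed

lemma small_imp_zero: assumes "\<And>N. nv z \<le> (1/2) ^ N" shows "z = 0"
proof (rule ccontr)
  assume "z ~= 0"
  then obtain N where "(1/2::real) ^ N < nv z" using real_arch_pow_inv[of "nv z" "1/2"] nv_pos by auto
  thus False using assms[of N] by simp
qed

end

section \<open>The upper bound for a determinant\<close>

abbreviation finv :: "('a => 'a) => 'a => 'a" where "finv \<equiv> inv_into UNIV"

locale decomposition_group = arith_place +
  fixes D :: "('a => 'a) set" and \<alpha> :: 'a
  assumes D_finite: "finite D" and D_id: "id \<in> D"
    and D_comp: "\<And>g h. g \<in> D ==> h \<in> D ==> g \<circ> h \<in> D"
    and D_inv: "\<And>g. g \<in> D ==> bij g \<and> finv g \<in> D"
    and D_add: "\<And>g x y. g \<in> D ==> g (x + y) = g x + g y"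
    and D_mult: "\<And>g x y. g \<in> D ==> g (x * y) = g x * g y"
    and D_nv: "\<And>g x. g \<in> D ==> nv (g x) = nv x"
    and alpha_nv: "nv \<alpha> \<le> 1"
    and dense: "\<And>y N. nv y \<le> 1 ==> \<exists>f. (\<forall>i. Polynomial.coeff f i \<in> \<int>) \<and> nv (y - poly f \<alpha>) \<le> (1/2) ^ N"
begin

lemma D_hom: assumes g: "g \<in> D"
  shows "g 0 = 0" "g 1 = 1" "g (x - y) = g x - g y" "g (inverse x) = inverse (g x)" "g (x ^ n) = g x ^ n"
proof -
  show g0: "g 0 = 0" using D_add[OF g, of 0 0] by simp
  have "g 1 ~= 0" using D_nv[OF g, of 1] by auto
  thus g1: "g 1 = 1" using D_mult[OF g, of 1 1] by simp
  show "g (x - y) = g x - g y" using D_add[OF g, of "x - y" y] by simp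
  show "g (inverse x) = inverse (g x)"
  proof (cases "x = 0")
    case False
    hence "g x * g (inverse x) = 1" using D_mult[OF g, of x "inverse x"] g1 by simp
    thus ?thesis by (metis inverse_unique)
  qed (simp add: g0)
  show "g (x ^ n) = g x ^ n" by (induction n) (auto simp: g1 D_mult[OF g])
qed

lemma D_poly:
  assumes g: "g \<in> D" and f: "\<forall>i. Polynomial.coeff f i \<in> \<int>"
  shows "g (poly f x) = poly f (g x)"
proof -
  have sum: "g (sum h I) = (\<Sum>i\<in>I. g (h i))" for h and I :: "nat set"
    by (induction I rule: infinite_finite_induct) (auto simp: D_add[OF g] D_hom(1)[OF g])
  have nat: "g (of_nat k) = of_nat k" for k by (induction k) (auto simp: D_add[OF g] D_hom(1,2)[OF g])
  have int: "g (of_int k) = of_int k" for k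
    using D_hom(3)[OF g, of 0 "of_nat (nat (-k))"] nat[of "nat k"] nat[of "nat (-k)"] D_hom(1)[OF g]
    by (cases "k \<ge> 0") auto
  have "g (Polynomial.coeff f i) = Polynomial.coeff f i" for i using f int by (metis Ints_cases)
  thus ?thesis unfolding poly_altdef sum by (simp add: D_mult[OF g] D_hom(5)[OF g])
qed

text \<open>An automorphism fixing \<alpha> fixes the integral polynomials in \<alpha>, hence by
  continuity all elements of absolute value at most 1, and the others through their
  inverses.\<close>

lemma D_faithful:
  assumes g: "g \<in> D" and fx: "g \<alpha> = \<alpha>" shows "g = id"
proof
  have *: "g y = y" if y: "nv y \<le> 1" for y
  proof -
    have "nv (g y - y) \<le> (1/2) ^ N" for N
    proof -
      obtain f where f: "\<forall>i. Polynomial.coeff f i \<in> \<int>" "nv (y - poly f \<alpha>) \<le> (1/2) ^ N" using dense[OF y] by blast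
      have "g (y - poly f \<alpha>) = g y - poly f \<alpha>" using D_hom(3)[OF g] D_poly[OF g f(1)] fx by simp
      hence "g y - y = g (y - poly f \<alpha>) - (y - poly f \<alpha>)" by simp
      also have "nv ... \<le> (1/2) ^ N" using nv_diff[of "g (y - poly f \<alpha>)" "y - poly f \<alpha>"] f(2) D_nv[OF g] by simp
      finally show ?thesis .
    qed
    thus ?thesis using small_imp_zero[of "g y - y"] by simp
  qed
  fix y
  show "g y = id y"
  proof (cases "nv y \<le> 1")
    case False
    hence "nv (inverse y) \<le> 1" by (simp add: nv_inverse inverse_le_1_iff)
    hence "inverse (g y) = inverse y" using * D_hom(4)[OF g] by metis
    thus ?thesis by simp
  qed (simp add: *)
qed

lemma D_inj_alpha: "inj_on (\<lambda>g. g \<alpha>) D"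
proof (rule inj_onI)
  fix g h assume gh: "g \<in> D" "h \<in> D" "g \<alpha> = h \<alpha>"
  have "(finv h \<circ> g) \<alpha> = \<alpha>" using gh D_inv[of h] by (simp add: bij_is_inj)
  hence "finv h \<circ> g = id" using D_faithful D_comp D_inv gh by blast
  hence "h \<circ> (finv h \<circ> g) = h" by simp
  moreover have "h \<circ> (finv h \<circ> g) = g" using D_inv[OF gh(2)] by (auto simp: fun_eq_iff bij_is_surj surj_f_inv_f)
  ultimately show "g = h" by simp
qed

text \<open>In ramification theory the valuation of \<open>\<alpha> - g \<alpha>\<close> is the
  function \<open>i(g)\<close> that defines the lower numbering of the ramification groups.\<close>

definition m :: "('a => 'a) => real" where "m g = nv (\<alpha> - g \<alpha>)"

lemma m_inv: assumes "g \<in> D" shows "m (finv g) = m g"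
proof -
  have "nv (\<alpha> - finv g \<alpha>) = nv (g (\<alpha> - finv g \<alpha>))" using D_nv[OF assms] by simp
  also have "g (\<alpha> - finv g \<alpha>) = - (\<alpha> - g \<alpha>)"
    using D_hom(3)[OF assms] D_inv[OF assms] by (simp add: bij_is_surj surj_f_inv_f)
  finally show ?thesis using nv_uminus[of "\<alpha> - g \<alpha>"] by (simp only: m_def)
qed

lemma m_bounds: "g \<in> D ==> 0 \<le> m g \<and> m g \<le> 1"
  using nv_diff[of \<alpha> "g \<alpha>"] D_nv[of g \<alpha>] alpha_nv nv_nonneg[of "\<alpha> - g \<alpha>"] by (simp add: m_def)

lemma inv_inv_D: "g \<in> D ==> finv (finv g) = g" using D_inv[of g] by (simp add: inv_inv_eq)

lemma inv_bij_D: "bij_betw finv (D - {id}) (D - {id})"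
proof -
  have "finv (id :: 'a => 'a) = id" by (rule Hilbert_Choice.inv_id)
  hence "g = id" if "g \<in> D" "finv g = id" for g using inv_inv_D[OF that(1)] that(2) by simp
  thus ?thesis by (intro bij_betwI[where g = finv]) (use D_inv inv_inv_D in auto)
qed

text \<open>Row \<open>k\<close> of the matrix is replaced by the divided difference of \<open>g \<mapsto> g (B k j)\<close>
  at the points \<open>g \<alpha>\<close> where \<open>g\<close> runs over \<open>id\<close> and the \<open>g\<close> that move row \<open>k\<close> to an earlier row.
  Since \<open>B k j\<close> is a limit of integral polynomials in \<open>\<alpha>\<close>, the new rows are integral.\<close>

lemma nv_det_upper_bound:
  fixes B :: "nat => nat => 'a" and act :: "('a => 'a) => nat => nat"
  assumes act: "\<And>g i. g \<in> D ==> i < n ==> act g i < n"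
    "\<And>g i j. g \<in> D ==> i < n ==> j < n ==> g (B i j) = B (act g i) j"
    and act_id: "\<And>i. i < n ==> act id i = i"
    and act_inv: "\<And>g i. g \<in> D ==> i < n ==> act (finv g) (act g i) = i"
    and B: "\<And>i j. i < n ==> j < n ==> nv (B i j) \<le> 1"
  shows "(nv (det (mat n n (\<lambda>(i,j). B i j))))\<^sup>2 \<le> (\<Prod>g\<in>D - {id}. m g ^ card {i. i < n \<and> act g i ~= i})"
proof -
  define S where "S k = insert id {g \<in> D. act g k < k}" for k
  define t where "t = (\<lambda>g :: 'a => 'a. g \<alpha>)"
  \<comment> \<open>The weights of the divided difference for row \<open>k\<close>.
    \<open>Z k i\<close> collects those of the \<open>g\<close> that move row \<open>k\<close> to
    row \<open>i\<close>, so \<open>Z\<close> times the given matrix consists of divided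
    differences. Only \<open>i \<le> k\<close> occurs, which makes \<open>Z\<close> lower
    triangular.\<close>
  define w where "w k g = 1 / (\<Prod>g'\<in>S k - {g}. t g - t g')" for k g
  define Z where "Z k i = (\<Sum>g\<in>{g \<in> S k. act g k = i}. w k g)" for k i
  have SD: "S k \<subseteq> D" for k using D_id by (auto simp: S_def)
  have finS: "finite (S k)" for k using finite_subset[OF SD D_finite] .
  have inj: "inj_on t (S k)" for k using inj_on_subset[OF D_inj_alpha SD] by (simp add: t_def)
  define MB where "MB = mat n n (\<lambda>(i,j). B i j)"
  define MZ where "MZ = mat n n (\<lambda>(k,i). Z k i)"
  have carr: "MB \<in> carrier_mat n n" "MZ \<in> carrier_mat n n" by (auto simp: MB_def MZ_def)
  have prod: "(MZ * MB) $$ (k, j) = divided_difference t (\<lambda>g. g (B k j)) (S k)" if kj: "k < n" "j < n" for k j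
  proof -
    have "(MZ * MB) $$ (k, j) = (\<Sum>i<n. Z k i * B i j)"
      using kj by (simp add: MZ_def MB_def scalar_prod_def atLeast0LessThan)
    also have "... = (\<Sum>i<n. \<Sum>g\<in>{g \<in> S k. act g k = i}. w k g * B (act g k) j)"
      unfolding Z_def sum_distrib_right by (intro sum.cong) auto
    also have "... = (\<Sum>g\<in>S k. w k g * B (act g k) j)"
    proof -
      have "(\<lambda>g. act g k) ` S k \<subseteq> {..<n}" using act(1) SD[of k] kj(1) by blast
      thus ?thesis using sum.group[OF finS, of "{..<n}" "\<lambda>g. act g k" k "\<lambda>g. w k g * B (act g k) j"] by simp
    qed
    also have "... = (\<Sum>g\<in>S k. g (B k j) * w k g)"
      using act(2) SD kj by (intro sum.cong) (auto simp: subset_iff mult.commute)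
    finally show ?thesis by (simp add: divided_difference_def w_def)
  qed
  have int: "nv ((MZ * MB) $$ (k, j)) \<le> 1" if kj: "k < n" "j < n" for k j
  proof -
    \<comment> \<open>The bound on the weights fixes the precision \<open>N\<close> of the
      approximation: the divided difference of the error is at most
      \<open>(1 / M) * M\<close>.\<close>
    define M where "M = 1 + (\<Sum>g\<in>S k. nv (w k g))"
    have M1: "M \<ge> 1" unfolding M_def using sum_nonneg[of "S k" "\<lambda>g. nv (w k g)"] nv_nonneg by simp
    have Mw: "nv (w k g) \<le> M" if "g \<in> S k" for g
      using member_le_sum[of g "S k" "\<lambda>g. nv (w k g)"] that finS nv_nonneg by (simp add: M_def)
    obtain N where N: "(1/2::real) ^ N < 1 / M" using real_arch_pow_inv[of "1 / M" "1/2"] M1 by auto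
    obtain f where f: "\<forall>i. Polynomial.coeff f i \<in> \<int>" "nv (B k j - poly f \<alpha>) \<le> (1/2) ^ N"
      using dense[OF B[OF kj]] by blast
    define r where "r = B k j - poly f \<alpha>"
    have "divided_difference t (\<lambda>g. g (B k j)) (S k) = divided_difference t (\<lambda>g. poly f (t g) + g r) (S k)"
    proof (rule divided_difference_cong)
      fix g assume "g \<in> S k"
      hence g: "g \<in> D" using SD by blast
      show "g (B k j) = poly f (t g) + g r"
        using D_hom(3)[OF g, of "B k j" "poly f \<alpha>"] D_poly[OF g f(1), of \<alpha>] by (simp add: r_def t_def)
    qed
    also have "... = divided_difference t (\<lambda>g. poly f (t g)) (S k) + divided_difference t (\<lambda>g. g r) (S k)"
      by (rule divided_difference_add)
    finally have eq: "(MZ * MB) $$ (k, j) = ..." using prod[OF kj] by simp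
    have "nv (divided_difference t (\<lambda>g. poly f (t g)) (S k)) \<le> 1"
    proof (rule nv_divided_difference_poly[OF finS inj])
      show "nv (t s) \<le> 1" if "s \<in> S k" for s using D_nv[OF subsetD[OF SD that]] alpha_nv by (simp add: t_def)
      show "nv (Polynomial.coeff f i) \<le> 1" for i
        using f(1) nv_ints ints_closed(9) by (metis Ints_cases)
    qed
    moreover have "nv (divided_difference t (\<lambda>g. g r) (S k)) \<le> 1"
      unfolding divided_difference_def
    proof (rule nv_sum_le)
      fix g assume g: "g \<in> S k"
      have "nv (g r / (\<Prod>s'\<in>S k - {g}. t g - t s')) = nv (g r) * nv (w k g)"
        unfolding w_def nv_mult[symmetric] by simp
      also have "nv (g r) = nv r" using D_nv g SD by blast
      also have "nv r * nv (w k g) \<le> (1 / M) * M"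
        using f(2) N Mw[OF g] nv_nonneg M1 unfolding r_def[symmetric] by (intro mult_mono) auto
      finally show "nv (g r / (\<Prod>s'\<in>S k - {g}. t g - t s')) \<le> 1" using M1 by simp
    qed simp
    ultimately show ?thesis unfolding eq using is_subring_closed(6)[OF is_subring_nv] by simp
  qed
  \<comment> \<open>The other elements of \<open>S k\<close> move row \<open>k\<close> to an earlier
    row, so the diagonal entry is the weight of \<open>id\<close>.\<close>
  have Zkk: "Z k k = 1 / (\<Prod>g\<in>{g \<in> D. act g k < k}. \<alpha> - g \<alpha>)" if k: "k < n" for k
  proof -
    have "{g \<in> S k. act g k = k} = {id}" using act_id[OF k] by (auto simp: S_def)
    moreover have "S k - {id} = {g \<in> D. act g k < k}" using act_id[OF k] by (auto simp: S_def)
    ultimately show ?thesis unfolding Z_def by (simp add: w_def t_def)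
  qed
  have "det MZ = prod_list (diag_mat MZ)"
  proof (rule det_lower_triangular[OF _ carr(2)])
    fix k i :: nat assume ki: "k < i" "i < n"
    hence "{g \<in> S k. act g k = i} = {}" using act_id[of k] by (auto simp: S_def)
    hence "Z k i = 0" by (simp only: Z_def sum.empty)
    thus "MZ $$ (k, i) = 0" using ki by (simp add: MZ_def)
  qed
  also have "... = (\<Prod>k<n. Z k k)" using carr(2)
    by (simp add: diag_mat_def MZ_def prod.list_conv_set_nth atLeast0LessThan)
  finally have detZ: "det MZ = (\<Prod>k<n. 1 / (\<Prod>g\<in>{g \<in> D. act g k < k}. \<alpha> - g \<alpha>))" using Zkk by simp
  have "nv (det (MZ * MB)) \<le> 1"
    using det_in_subring[OF is_subring_nv, of "MZ * MB" n] int carr by auto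
  hence le: "nv (det MZ) * nv (det MB) \<le> 1" using det_mult[OF carr(2,1)] by (simp add: nv_mult)
  define lt where "lt g = card {k. k < n \<and> act g k < k}" for g
  have nvZ: "nv (det MZ) = 1 / (\<Prod>k<n. \<Prod>g\<in>{g \<in> D. act g k < k}. m g)"
    unfolding detZ nv_prod nv_divide m_def by (simp add: prod_dividef)
  have "(\<Prod>k<n. \<Prod>g\<in>{g \<in> D. act g k < k}. m g) = (\<Prod>k<n. \<Prod>g\<in>D - {id}. if act g k < k then m g else 1)"
  proof (rule prod.cong[OF refl])
    fix k assume "k \<in> {..<n}"
    hence "{g \<in> D. act g k < k} = {g \<in> D - {id}. act g k < k}" using act_id by auto
    thus "(\<Prod>g\<in>{g \<in> D. act g k < k}. m g) = (\<Prod>g\<in>D - {id}. if act g k < k then m g else 1)"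
      using prod.inter_filter[of "D - {id}" m "\<lambda>g. act g k < k"] D_finite by (simp only: finite_Diff)
  qed
  also have "... = (\<Prod>g\<in>D - {id}. \<Prod>k<n. if act g k < k then m g else 1)" by (rule prod.swap)
  also have "... = (\<Prod>g\<in>D - {id}. m g ^ lt g)"
  proof (rule prod.cong[OF refl])
    fix g
    have "(\<Prod>k<n. if act g k < k then m g else 1) = (\<Prod>k\<in>{k \<in> {..<n}. act g k < k}. m g)"
      by (rule prod.inter_filter[symmetric]) simp
    thus "(\<Prod>k<n. if act g k < k then m g else 1) = m g ^ lt g" by (simp add: lt_def lessThan_def)
  qed
  finally have PP: "(\<Prod>k<n. \<Prod>g\<in>{g \<in> D. act g k < k}. m g) = (\<Prod>g\<in>D - {id}. m g ^ lt g)" .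
  have mpos: "m g > 0" if "g \<in> D - {id}" for g
    using that D_faithful[of g] nv_pos[of "\<alpha> - g \<alpha>"] by (metis DiffE singletonI m_def right_minus_eq)
  have "(\<Prod>g\<in>D - {id}. m g ^ lt g) > 0" using mpos by (intro prod_pos) auto
  hence bound: "nv (det MB) \<le> (\<Prod>g\<in>D - {id}. m g ^ lt g)" using le unfolding nvZ PP by (simp add: field_simps)
  \<comment> \<open>Inversion exchanges the indices moved down with those moved up. As
    \<open>m\<close> is invariant under inversion, the square of the bound counts every index moved
    by \<open>g\<close> exactly once.\<close>
  have lt_inv: "lt (finv g) = card {k. k < n \<and> k < act g k}" if g: "g \<in> D" for g
    unfolding lt_def
  proof (rule bij_betw_same_card[OF bij_betwI[where f = "act (finv g)" and g = "act g"]])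
    have gi: "finv g \<in> D" using D_inv g by blast
    show "act (finv g) \<in> {k. k < n \<and> act (finv g) k < k} \<rightarrow> {k. k < n \<and> k < act g k}"
      using act(1)[OF gi] act_inv[OF gi] inv_inv_D[OF g] by auto
    show "act g \<in> {k. k < n \<and> k < act g k} \<rightarrow> {k. k < n \<and> act (finv g) k < k}"
      using act(1)[OF g] act_inv[OF g] by auto
    show "\<And>x. x \<in> {k. k < n \<and> act (finv g) k < k} ==> act g (act (finv g) x) = x"
      using act_inv[OF gi] inv_inv_D[OF g] by auto
    show "\<And>y. y \<in> {k. k < n \<and> k < act g k} ==> act (finv g) (act g y) = y" using act_inv[OF g] by auto
  qed
  have "(\<Prod>g\<in>D - {id}. m g ^ lt g) = (\<Prod>g\<in>D - {id}. m (finv g) ^ lt (finv g))"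
    by (rule prod.reindex_bij_betw[OF inv_bij_D, symmetric])
  also have "... = (\<Prod>g\<in>D - {id}. m g ^ card {k. k < n \<and> k < act g k})"
    by (intro prod.cong) (auto simp: m_inv lt_inv)
  finally have "(\<Prod>g\<in>D - {id}. m g ^ lt g)\<^sup>2 = (\<Prod>g\<in>D - {id}. m g ^ lt g * m g ^ card {k. k < n \<and> k < act g k})"
    by (simp add: power2_eq_square prod.distrib)
  also have "... = (\<Prod>g\<in>D - {id}. m g ^ card {i. i < n \<and> act g i ~= i})"
  proof (rule prod.cong[OF refl])
    fix g
    have "{i. i < n \<and> act g i ~= i} = {k. k < n \<and> act g k < k} \<union> {k. k < n \<and> k < act g k}" by auto
    moreover have "card ... = lt g + card {k. k < n \<and> k < act g k}"
      unfolding lt_def by (intro card_Un_disjoint) auto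
    ultimately show "m g ^ lt g * m g ^ card {k. k < n \<and> k < act g k} = m g ^ card {i. i < n \<and> act g i ~= i}"
      by (simp add: power_add)
  qed
  finally show ?thesis using power_mono[OF bound nv_nonneg, of 2] by (simp add: MB_def)
qed

end

section \<open>The lower bound for a determinant\<close>

context arith_place begin

text \<open>For each \<open>k\<close> the product over \<open>l < k\<close> of \<open>a k l\<close>
  minus its value at \<open>l\<close> vanishes at all indices below \<open>k\<close>. The matrix of
  values of these products is triangular, with products of the separating differences on the
  diagonal; it is an integral matrix times the transpose of the given one.\<close>

lemma nv_det_lower_bound:
  fixes B :: "nat => nat => 'a" and V :: "(nat => 'a) set"
  assumes V_mult: "\<And>a a'. a \<in> V ==> a' \<in> V ==> (\<lambda>i. a i * a' i) \<in> V" and V_one: "(\<lambda>i. 1) \<in> V"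
    and V_nv: "\<And>a i. a \<in> V ==> i < n ==> nv (a i) \<le> 1"
    and V_span: "\<And>a. a \<in> V ==> \<exists>c. (\<forall>j<n. nv (c j) \<le> 1) \<and> (\<forall>i<n. a i = (\<Sum>j<n. c j * B i j))"
    and sep: "\<And>k l. l < k ==> k < n ==> \<exists>a\<in>V. M k l \<le> nv (a k - a l)"
    and M: "\<And>k l. M k l \<ge> 0"
  shows "(\<Prod>k<n. \<Prod>l<k. M k l) \<le> nv (det (mat n n (\<lambda>(i,j). B i j)))"
proof -
  \<comment> \<open>The constants \<open>a k l l\<close> to be subtracted lie in the big field. So
    the products are formed in the span of the basis with integral coefficients from the big field,
    which is larger than \<open>V\<close>.\<close>
  define W where "W = {a. \<exists>c. (\<forall>j<n. nv (c j) \<le> 1) \<and> (\<forall>i<n. a i = (\<Sum>j<n. c j * B i j))}"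
  have W_comb: "(\<lambda>i. a i - x * a' i) \<in> W" if W: "a \<in> W" "a' \<in> W" and x: "nv x \<le> 1" for a a' x
  proof -
    obtain c c' where c: "\<forall>j<n. nv (c j) \<le> 1" "\<forall>i<n. a i = (\<Sum>j<n. c j * B i j)"
      "\<forall>j<n. nv (c' j) \<le> 1" "\<forall>i<n. a' i = (\<Sum>j<n. c' j * B i j)" using W unfolding W_def by blast
    have "nv (c j - x * c' j) \<le> 1" if "j < n" for j
      using is_subring_closed(3)[OF is_subring_nv, of "c j" "x * c' j"]
        is_subring_closed(4)[OF is_subring_nv, of x "c' j"] c that x by simp
    moreover have "a i - x * a' i = (\<Sum>j<n. (c j - x * c' j) * B i j)" if "i < n" for i
      using c that by (simp add: algebra_simps sum_distrib_left sum_subtractf)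
    ultimately show ?thesis unfolding W_def by (intro CollectI exI[of _ "\<lambda>j. c j - x * c' j"]) auto
  qed
  have "\<forall>k l. \<exists>a. l < k --> k < n --> a \<in> V \<and> M k l \<le> nv (a k - a l)" using sep by blast
  then obtain a where a: "\<And>k l. l < k ==> k < n ==> a k l \<in> V \<and> M k l \<le> nv (a k l k - a k l l)" by metis
  \<comment> \<open>The induction carries an arbitrary factor \<open>v\<close> from
    \<open>V\<close>, which absorbs \<open>a k l\<close> when the factor for \<open>l\<close> is
    expanded.\<close>
  have prodW: "(\<lambda>i. v i * (\<Prod>l\<in>I. a k l i - a k l l)) \<in> W" if "finite I" "I \<subseteq> {..<k}" "k < n" "v \<in> V" for I k v
    using that
  proof (induction I arbitrary: v rule: finite_induct)
    case empty thus ?case using V_span by (auto simp: W_def)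
  next
    case (insert l I)
    have akl: "a k l \<in> V" using a[of l k] insert.prems by auto
    have "(\<lambda>i. (\<lambda>i. (v i * a k l i) * (\<Prod>l\<in>I. a k l i - a k l l)) i - a k l l * (\<lambda>i. v i * (\<Prod>l\<in>I. a k l i - a k l l)) i) \<in> W"
      using insert akl V_mult[OF _ akl] V_nv[OF akl, of l] by (intro W_comb) auto
    moreover have "(\<lambda>i. (\<lambda>i. (v i * a k l i) * (\<Prod>l\<in>I. a k l i - a k l l)) i - a k l l * (\<lambda>i. v i * (\<Prod>l\<in>I. a k l i - a k l l)) i)
      = (\<lambda>i. v i * (\<Prod>l\<in>insert l I. a k l i - a k l l))"
      using insert by (auto simp: fun_eq_iff algebra_simps)
    ultimately show ?case by simp
  qed
  have "\<forall>k. \<exists>c. k < n --> (\<forall>j<n. nv (c j) \<le> 1) \<and> (\<forall>i<n. (\<Prod>l<k. a k l i - a k l l) = (\<Sum>j<n. c j * B i j))"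
    using prodW[OF _ _ _ V_one, of "{..<k}" k for k] unfolding W_def by auto
  then obtain c where c: "\<And>k j. k < n ==> j < n ==> nv (c k j) \<le> 1"
    "\<And>k i. k < n ==> i < n ==> (\<Prod>l<k. a k l i - a k l l) = (\<Sum>j<n. c k j * B i j)" by metis
  define MB where "MB = mat n n (\<lambda>(i,j). B i j)"
  define MC where "MC = mat n n (\<lambda>(i,j). c i j)"
  have carr: "MB \<in> carrier_mat n n" "MC \<in> carrier_mat n n" "transpose_mat MB \<in> carrier_mat n n" by (auto simp: MB_def MC_def)
  have ent: "(MC * transpose_mat MB) $$ (k, i) = (\<Prod>l<k. a k l i - a k l l)" if "k < n" "i < n" for k i
    using that by (simp add: MB_def MC_def scalar_prod_def atLeast0LessThan c(2))
  have "det (MC * transpose_mat MB) = prod_list (diag_mat (MC * transpose_mat MB))"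
  proof (rule det_upper_triangular)
    show "MC * transpose_mat MB \<in> carrier_mat n n" using carr by simp
    show "upper_triangular (MC * transpose_mat MB)"
    proof
      fix k i assume "k < dim_row (MC * transpose_mat MB)" "i < k"
      hence ik: "i < k" "k < n" using carr by auto
      have "(\<Prod>l<k. a k l i - a k l l) = 0" using ik by (intro prod_zero) auto
      thus "(MC * transpose_mat MB) $$ (k, i) = 0" using ent[of k i] ik by simp
    qed
  qed
  also have "... = (\<Prod>k<n. (MC * transpose_mat MB) $$ (k, k))" using carr
    by (simp add: diag_mat_def prod.list_conv_set_nth atLeast0LessThan del: index_mult_mat)
      (simp add: MC_def)
  also have "... = (\<Prod>k<n. \<Prod>l<k. a k l k - a k l l)" using ent by (intro prod.cong) auto
  finally have "nv (det MC) * nv (det MB) = (\<Prod>k<n. \<Prod>l<k. nv (a k l k - a k l l))"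
    unfolding det_mult[OF carr(2,3)] det_transpose[OF carr(1)] by (simp add: nv_mult[symmetric] nv_prod)
  moreover have "nv (det MC) \<le> 1"
    using det_in_subring[OF is_subring_nv carr(2)] c(1) by (auto simp: MC_def)
  moreover have "(\<Prod>k<n. \<Prod>l<k. M k l) \<le> (\<Prod>k<n. \<Prod>l<k. nv (a k l k - a k l l))"
    using a M by (intro prod_mono conjI prod_nonneg) auto
  ultimately show ?thesis using mult_left_le_one_le[of "nv (det MB)" "nv (det MC)"] nv_nonneg
    by (simp add: MB_def)
qed

end

section \<open>Split algebras over a field extension\<close>

text \<open>Dedekind's argument: a relation evaluated at a product minus a multiple of itself is a
  shorter one. The domain is an abstract set with a product, because the lemma serves homomorphisms
  out of a record as well as automorphisms restricted to a subset of a field.\<close>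

lemma dedekind_independence:
  fixes g :: "'i => 'm => 'c::field"
  assumes "finite S" and M: "\<And>x y. x \<in> M ==> y \<in> M ==> mul x y \<in> M" "u \<in> M"
    and mult: "\<And>i x y. i \<in> S ==> x \<in> M ==> y \<in> M ==> g i (mul x y) = g i x * g i y" and one: "\<And>i. i \<in> S ==> g i u = 1"
    and dist: "\<And>i j. i \<in> S ==> j \<in> S ==> i ~= j ==> \<exists>x\<in>M. g i x ~= g j x"
    and zero: "\<And>x. x \<in> M ==> (\<Sum>i\<in>S. c i * g i x) = 0"
    and i: "i \<in> S"
  shows "c i = 0"
  using assms(1) mult one dist zero i
proof (induction S arbitrary: c i rule: finite_induct)
  case (insert h S)
  have S0: "c i = 0" if i: "i \<in> S" for i
  proof -
    have "i ~= h" using i insert.hyps by blast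
    then obtain y where y: "y \<in> M" "g i y ~= g h y" using insert.prems(3)[of i h] i by blast
    have "c i * (g i y - g h y) = 0"
    proof (rule insert.IH[of "\<lambda>i. c i * (g i y - g h y)"])
      fix x assume x: "x \<in> M"
      have "0 = (\<Sum>i\<in>insert h S. c i * g i (mul y x)) - g h y * (\<Sum>i\<in>insert h S. c i * g i x)"
        using insert.prems(4)[OF M(1)[OF y(1) x]] insert.prems(4)[OF x] by simp
      also have "... = (\<Sum>i\<in>insert h S. c i * (g i y - g h y) * g i x)"
        unfolding sum_distrib_left sum_subtractf[symmetric]
        using insert.prems(1) x y(1) by (intro sum.cong) (auto simp: algebra_simps)
      also have "... = (\<Sum>i\<in>S. c i * (g i y - g h y) * g i x)" using insert.hyps by simp
      finally show "(\<Sum>i\<in>S. c i * (g i y - g h y) * g i x) = 0" by simp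
    qed (use insert.prems i in auto)
    thus ?thesis using y by simp
  qed
  have "(\<Sum>i\<in>insert h S. c i * g i u) = c h" using insert.hyps S0 insert.prems(2)[of h] by simp
  hence "c h = 0" using insert.prems(4)[OF M(2)] by simp
  thus ?case using S0 insert.prems(5) by auto
qed simp

section \<open>Algebras given by matrices of conjugates\<close>

locale field_extension =
  fixes \<psi> :: "'a::field_char_0 => 'b::field_char_0"
  assumes psi_1: "\<psi> 1 = 1" and psi_add: "\<And>x y. \<psi> (x + y) = \<psi> x + \<psi> y"
    and psi_mult: "\<And>x y. \<psi> (x * y) = \<psi> x * \<psi> y"
begin

lemma psi_0: "\<psi> 0 = 0" using psi_add[of 0 0] by simp

lemma psi_diff: "\<psi> (x - y) = \<psi> x - \<psi> y" using psi_add[of "x - y" y] by simp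

lemma psi_uminus: "\<psi> (- x) = - \<psi> x" using psi_diff[of 0 x] psi_0 by simp

lemma psi_eq_0: "\<psi> x = 0 \<longleftrightarrow> x = 0"
proof
  assume "\<psi> x = 0"
  show "x = 0"
  proof (rule ccontr)
    assume "x ~= 0"
    hence "\<psi> x * \<psi> (inverse x) = 1" using psi_1 psi_mult[of x "inverse x"] by simp
    thus False using \<open>\<psi> x = 0\<close> by simp
  qed
qed (simp add: psi_0)

lemma psi_inj: "\<psi> x = \<psi> y ==> x = y" using psi_eq_0[of "x - y"] psi_diff by simp

lemma psi_sum: "\<psi> (sum f I) = (\<Sum>i\<in>I. \<psi> (f i))"
  by (induction I rule: infinite_finite_induct) (auto simp: psi_0 psi_add)

lemma psi_power: "\<psi> (x ^ n) = \<psi> x ^ n" by (induction n) (auto simp: psi_1 psi_mult)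

lemma psi_inverse: "\<psi> (inverse x) = inverse (\<psi> x)"
proof (cases "x = 0")
  case False
  hence "\<psi> x * \<psi> (inverse x) = 1" using psi_1 psi_mult[of x "inverse x"] by simp
  thus ?thesis by (metis inverse_unique)
qed (simp add: psi_0)

lemma range_subring: "is_subring (range \<psi>)"
  unfolding is_subring_def
proof (intro conjI ballI)
  show "1 \<in> range \<psi>" using psi_1 by (metis rangeI)
  fix x y assume "x \<in> range \<psi>" "y \<in> range \<psi>"
  then obtain a b where "x = \<psi> a" "y = \<psi> b" by blast
  thus "x - y \<in> range \<psi>" "x * y \<in> range \<psi>" using psi_diff[of a b] psi_mult[of a b] by (metis rangeI)+
qed

definition Gal :: "('b => 'b) set" where
  "Gal = {g. bij g \<and> (\<forall>x y. g (x + y) = g x + g y) \<and> (\<forall>x y. g (x * y) = g x * g y) \<and> (\<forall>c. g (\<psi> c) = \<psi> c)}"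

lemma Gal_closed: "id \<in> Gal" "g \<in> Gal ==> h \<in> Gal ==> g \<circ> h \<in> Gal" "g \<in> Gal ==> finv g \<in> Gal"
proof -
  show "id \<in> Gal" by (simp add: Gal_def)
  show "g \<in> Gal ==> h \<in> Gal ==> g \<circ> h \<in> Gal" by (auto simp: Gal_def bij_comp)
  assume g: "g \<in> Gal"
  hence b: "bij g" by (simp add: Gal_def)
  have e: "finv g x = y \<longleftrightarrow> x = g y" for x y using b by (metis bij_inv_eq_iff)
  have f: "g (finv g x) = x" for x using e[of x "finv g x"] by simp
  show "finv g \<in> Gal" using g bij_imp_bij_inv[OF b] by (simp add: Gal_def e f)
qed

definition lin :: "('b => 'b) => bool" where
  "lin f \<longleftrightarrow> (\<forall>x y. f (x + y) = f x + f y) \<and> (\<forall>c x. f (\<psi> c * x) = \<psi> c * f x)"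

lemma lin_sum: assumes "lin f" shows "f (sum h I) = (\<Sum>i\<in>I. f (h i))"
proof -
  have "f (\<psi> 0 * 0) = \<psi> 0 * f 0" using assms unfolding lin_def by blast
  hence "f 0 = 0" by (simp add: psi_0)
  thus ?thesis using assms by (induction I rule: infinite_finite_induct) (auto simp: lin_def)
qed

text \<open>An \<open>n\<close>-dimensional algebra with \<open>n\<close> homomorphisms into the big field, given by the matrix of
  the values of the homomorphisms (rows) at a basis (columns).\<close>

definition split_alg :: "nat => (nat => nat => 'b) => bool" where
  "split_alg n B \<longleftrightarrow> det (mat n n (\<lambda>(i,j). B i j)) ~= 0 \<and>
     (\<exists>c. \<forall>i<n. 1 = (\<Sum>j<n. \<psi> (c j) * B i j)) \<and>
     (\<forall>j<n. \<forall>k<n. \<exists>c. \<forall>i<n. B i j * B i k = (\<Sum>l<n. \<psi> (c l) * B i l))"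

text \<open>The algebra embedded into a power of the big field by its \<open>n\<close>
  homomorphisms. Entries at indices from \<open>n\<close> on are arbitrary.\<close>

definition alg_vecs :: "nat => (nat => nat => 'b) => (nat => 'b) set" where
  "alg_vecs n B = {v. \<exists>c. \<forall>i<n. v i = (\<Sum>j<n. \<psi> (c j) * B i j)}"

lemma alg_vecs_lincomb:
  assumes "\<And>k. k \<in> I ==> v k \<in> alg_vecs n B"
  shows "(\<lambda>i. \<Sum>k\<in>I. \<psi> (a k) * v k i) \<in> alg_vecs n B"
proof -
  have "\<forall>k. \<exists>c. k \<in> I --> (\<forall>i<n. v k i = (\<Sum>j<n. \<psi> (c j) * B i j))" using assms by (auto simp: alg_vecs_def)
  then obtain c where c: "\<And>k i. k \<in> I ==> i < n ==> v k i = (\<Sum>j<n. \<psi> (c k j) * B i j)" by metis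
  have "(\<Sum>k\<in>I. \<psi> (a k) * v k i) = (\<Sum>j<n. \<psi> (\<Sum>k\<in>I. a k * c k j) * B i j)" if "i < n" for i
  proof -
    have "(\<Sum>k\<in>I. \<psi> (a k) * v k i) = (\<Sum>k\<in>I. \<Sum>j<n. \<psi> (a k * c k j) * B i j)"
      using c that by (intro sum.cong) (auto simp: sum_distrib_left psi_mult mult.assoc)
    also have "... = (\<Sum>j<n. \<Sum>k\<in>I. \<psi> (a k * c k j) * B i j)" by (rule sum.swap)
    finally show ?thesis by (simp add: psi_sum sum_distrib_right)
  qed
  thus ?thesis unfolding alg_vecs_def by (intro CollectI exI[of _ "\<lambda>j. \<Sum>k\<in>I. a k * c k j"]) blast
qed

lemma alg_vecs_scale: assumes "v \<in> alg_vecs n B" shows "(\<lambda>i. \<psi> c * v i) \<in> alg_vecs n B"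
  using alg_vecs_lincomb[of "{()}" "\<lambda>_. v" n B "\<lambda>_. c"] assms by simp

lemma alg_vecs_add:
  assumes "v \<in> alg_vecs n B" "w \<in> alg_vecs n B" shows "(\<lambda>i. v i + w i) \<in> alg_vecs n B"
  using alg_vecs_lincomb[of UNIV "\<lambda>b. if b then v else w" n B "\<lambda>_. 1"] assms by (simp add: UNIV_bool psi_1 add.commute)

lemma alg_vecs_cong: "v \<in> alg_vecs n B ==> (\<And>i. i < n ==> w i = v i) ==> w \<in> alg_vecs n B"
  by (auto simp: alg_vecs_def)

lemma alg_vecs_base: "k < n ==> (\<lambda>i. B i k) \<in> alg_vecs n B"
proof -
  assume k: "k < n"
  have "(\<Sum>j<n. \<psi> (if j = k then 1 else 0) * B i j) = (\<Sum>j<n. if j = k then B i j else 0)" for i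
    by (intro sum.cong) (auto simp: psi_0 psi_1)
  thus ?thesis using k unfolding alg_vecs_def by (intro CollectI exI[of _ "\<lambda>j. if j = k then 1 else 0"]) simp
qed

lemma alg_vecs_one: "split_alg n B ==> (\<lambda>i. 1) \<in> alg_vecs n B"
  by (auto simp: split_alg_def alg_vecs_def)

lemma alg_vecs_mult:
  assumes "split_alg n B" "v \<in> alg_vecs n B" "w \<in> alg_vecs n B"
  shows "(\<lambda>i. v i * w i) \<in> alg_vecs n B"
proof -
  obtain c d where c: "\<And>i. i < n ==> v i = (\<Sum>j<n. \<psi> (c j) * B i j)"
    and d: "\<And>i. i < n ==> w i = (\<Sum>j<n. \<psi> (d j) * B i j)" using assms(2,3) by (auto simp: alg_vecs_def)
  have "(\<lambda>i. B i j * B i k) \<in> alg_vecs n B" if "j < n" "k < n" for j k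
    using assms(1) that by (auto simp: split_alg_def alg_vecs_def)
  hence "(\<lambda>i. \<Sum>k<n. \<psi> (d k) * (B i j * B i k)) \<in> alg_vecs n B" if "j < n" for j
    using that alg_vecs_lincomb[of "{..<n}" "\<lambda>k i. B i j * B i k" n B d] by simp
  hence "(\<lambda>i. \<Sum>j<n. \<psi> (c j) * (\<Sum>k<n. \<psi> (d k) * (B i j * B i k))) \<in> alg_vecs n B"
    using alg_vecs_lincomb[of "{..<n}" "\<lambda>j i. \<Sum>k<n. \<psi> (d k) * (B i j * B i k)" n B c] by simp
  moreover have "v i * w i = (\<Sum>j<n. \<psi> (c j) * (\<Sum>k<n. \<psi> (d k) * (B i j * B i k)))" if "i < n" for i
    unfolding c[OF that] d[OF that] sum_product by (intro sum.cong refl) (simp add: sum_distrib_left algebra_simps)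
  ultimately show ?thesis using alg_vecs_cong by (metis (no_types, lifting))
qed

lemma split_alg_inverse:
  assumes "split_alg n B"
  shows "\<exists>C. \<forall>j<n. \<forall>k<n. (\<Sum>i<n. C j i * B i k) = (if j = k then 1 else 0) \<and>
    (\<Sum>i<n. B j i * C i k) = (if j = k then 1 else 0)"
proof -
  let ?B = "mat n n (\<lambda>(i,j). B i j)"
  have cB: "?B \<in> carrier_mat n n" by simp
  define A where "A = inverse (det ?B) \<cdot>\<^sub>m adj_mat ?B"
  have dt: "det ?B ~= 0" using assms by (simp add: split_alg_def)
  have cA: "A \<in> carrier_mat n n" unfolding A_def using adj_mat(1)[OF cB] by simp
  hence dA: "dim_row A = n" "dim_col A = n" by auto
  have 1: "(A * ?B) $$ (j, k) = (\<Sum>i<n. A $$ (j,i) * B i k)" if "j < n" "k < n" for j k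
    using that dA by (simp add: scalar_prod_def atLeast0LessThan)
  have 2: "(?B * A) $$ (j, k) = (\<Sum>i<n. B j i * A $$ (i,k))" if "j < n" "k < n" for j k
    using that dA by (simp add: scalar_prod_def atLeast0LessThan)
  have "A * ?B = inverse (det ?B) \<cdot>\<^sub>m (adj_mat ?B * ?B)"
    unfolding A_def by (rule mult_smult_assoc_mat[OF adj_mat(1)[OF cB] cB])
  also have "... = 1\<^sub>m n" unfolding adj_mat(3)[OF cB] using dt by (intro eq_matI) auto
  finally have "A * ?B = 1\<^sub>m n" .
  moreover have "?B * A = inverse (det ?B) \<cdot>\<^sub>m (?B * adj_mat ?B)"
    unfolding A_def by (rule mult_smult_distrib[OF cB adj_mat(1)[OF cB]])
  moreover have "inverse (det ?B) \<cdot>\<^sub>m (?B * adj_mat ?B) = 1\<^sub>m n"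
    unfolding adj_mat(2)[OF cB] using dt by (intro eq_matI) auto
  ultimately have "A * ?B = 1\<^sub>m n" "?B * A = 1\<^sub>m n" by simp_all
  thus ?thesis using 1 2 by (intro exI[of _ "\<lambda>j i. A $$ (j,i)"]) simp
qed

text \<open>The matrix of conjugates is invertible, so its rows satisfy no linear relation with
  coefficients in the big field.\<close>

lemma split_alg_separates:
  assumes "split_alg n B" "\<And>v. v \<in> alg_vecs n B ==> (\<Sum>i<n. a i * v i) = 0" "k < n"
  shows "a k = 0"
proof -
  obtain C where C: "\<And>j k. j < n ==> k < n ==> (\<Sum>i<n. C j i * B i k) = (if j = k then 1 else 0)"
    "\<And>j k. j < n ==> k < n ==> (\<Sum>i<n. B j i * C i k) = (if j = k then 1 else 0)"
    using split_alg_inverse[OF assms(1)] by blast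
  have z: "(\<Sum>i<n. a i * B i j) = 0" if "j < n" for j using assms(2)[OF alg_vecs_base[OF that]] .
  have "0 = (\<Sum>j<n. (\<Sum>i<n. a i * B i j) * C j k)" using z by simp
  also have "... = (\<Sum>j<n. \<Sum>i<n. a i * (B i j * C j k))" by (simp add: sum_distrib_right mult.assoc)
  also have "... = (\<Sum>i<n. \<Sum>j<n. a i * (B i j * C j k))" by (rule sum.swap)
  also have "... = (\<Sum>i<n. a i * (if i = k then 1 else 0))"
    unfolding sum_distrib_left[symmetric] using C(2) assms(3) by (intro sum.cong) auto
  also have "... = (\<Sum>i<n. if i = k then a i else 0)" by (intro sum.cong) auto
  also have "... = a k" using assms(3) by simp
  finally show ?thesis by simp
qed

text \<open>A pair \<open>u\<close>, \<open>u'\<close> with \<open>f (z * u) = f z * u'\<close> for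
  all \<open>z\<close> is a direction in which \<open>f\<close> is semilinear. Further decomposition
  of \<open>f\<close> must not destroy what has been reached for other rows; this relation records
  that.\<close>

definition keeps :: "('b => 'b) => ('b => 'b) => bool" where
  "keeps f h \<longleftrightarrow> (\<forall>u u'. (\<forall>z. f (z * u) = f z * u') --> (\<forall>z. h (z * u) = h z * u'))"

text \<open>Semilinearity along the row \<open>i0\<close>: multiplication of the argument by the
  value of an algebra element at \<open>i0\<close> becomes multiplication of the result by its value
  at one other row \<open>i\<close>.\<close>

definition semilin :: "nat => (nat => nat => 'b) => nat => ('b => 'b) => bool" where
  "semilin n B i0 h \<longleftrightarrow> (\<exists>i<n. \<forall>v\<in>alg_vecs n B. \<forall>z. h (z * v i0) = h z * v i)"

lemma semilin_keeps: "semilin n B i0 f ==> keeps f h ==> semilin n B i0 h"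
  unfolding semilin_def keeps_def by meson

text \<open>For fixed \<open>z\<close> the linear form \<open>v \<mapsto> f (z * v i0)\<close> on the algebra is a combination of the rows;
  its coefficients are again linear in \<open>z\<close>, and they are semilinear over the algebra.\<close>

lemma semilin_decomposition:
  assumes sa: "split_alg n B" and i0: "i0 < n" and f: "lin f"
  shows "\<exists>H. (\<forall>h\<in>set H. lin h \<and> keeps f h \<and> semilin n B i0 h) \<and> (\<forall>z. f z = (\<Sum>h\<leftarrow>H. h z))"
proof -
  obtain C where C: "\<And>j k. j < n ==> k < n ==> (\<Sum>i<n. C j i * B i k) = (if j = k then 1 else 0)"
    "\<And>j k. j < n ==> k < n ==> (\<Sum>i<n. B j i * C i k) = (if j = k then 1 else 0)"
    using split_alg_inverse[OF sa] by blast
  \<comment> \<open>The values of the linear form at the basis determine its coefficients with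
    respect to the rows, through the inverse matrix \<open>C\<close>.\<close>
  define F where "F i z = (\<Sum>j<n. C j i * f (z * B i0 j))" for i z
  have main: "f (z * v i0) = (\<Sum>i<n. F i z * v i)" if v: "v \<in> alg_vecs n B" for v z
  proof -
    obtain c where c: "\<And>i. i < n ==> v i = (\<Sum>j<n. \<psi> (c j) * B i j)" using v by (auto simp: alg_vecs_def)
    have "(\<Sum>i<n. F i z * v i) = (\<Sum>i<n. \<Sum>j<n. \<Sum>k<n. f (z * B i0 j) * \<psi> (c k) * (C j i * B i k))"
    proof (rule sum.cong[OF refl])
      fix i assume "i \<in> {..<n}"
      hence i: "i < n" by simp
      show "F i z * v i = (\<Sum>j<n. \<Sum>k<n. f (z * B i0 j) * \<psi> (c k) * (C j i * B i k))"
        unfolding F_def c[OF i] sum_product by (intro sum.cong refl) (simp only: ac_simps)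
    qed
    also have "... = (\<Sum>j<n. \<Sum>i<n. \<Sum>k<n. f (z * B i0 j) * \<psi> (c k) * (C j i * B i k))" by (rule sum.swap)
    also have "... = (\<Sum>j<n. \<Sum>k<n. \<Sum>i<n. f (z * B i0 j) * \<psi> (c k) * (C j i * B i k))"
      by (intro sum.cong refl sum.swap)
    also have "... = (\<Sum>j<n. \<Sum>k<n. f (z * B i0 j) * \<psi> (c k) * (if j = k then 1 else 0))"
      unfolding sum_distrib_left[symmetric] using C(1) by (intro sum.cong refl) auto
    also have "... = (\<Sum>j<n. \<Sum>k<n. if j = k then f (z * B i0 j) * \<psi> (c k) else 0)"
      by (intro sum.cong refl) auto
    also have "... = (\<Sum>j<n. \<psi> (c j) * f (z * B i0 j))" by (intro sum.cong refl) (auto simp: mult.commute)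
    also have "... = (\<Sum>j<n. f (\<psi> (c j) * (z * B i0 j)))" using f by (simp add: lin_def)
    also have "... = f (\<Sum>j<n. \<psi> (c j) * (z * B i0 j))" by (rule lin_sum[OF f, symmetric])
    also have "(\<Sum>j<n. \<psi> (c j) * (z * B i0 j)) = z * v i0"
      unfolding c[OF i0] sum_distrib_left by (intro sum.cong) (auto simp: algebra_simps)
    finally show ?thesis by simp
  qed
  have "lin (F i)" for i
  proof -
    have add: "f (x + y) = f x + f y" and sc: "f (\<psi> c * x) = \<psi> c * f x" for x y c using f by (auto simp: lin_def)
    have "F i (x + y) = F i x + F i y" for x y
      by (simp add: F_def distrib_right add distrib_left sum.distrib)
    moreover have "F i (\<psi> c * x) = \<psi> c * F i x" for c x
      by (simp add: F_def mult.assoc sc sum_distrib_left) (simp add: mult.left_commute)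
    ultimately show ?thesis by (simp add: lin_def)
  qed
  moreover have "keeps f (F i)" for i
    unfolding keeps_def
  proof (intro allI impI)
    fix u u' z assume *: "\<forall>z. f (z * u) = f z * u'"
    have "f (z * u * B i0 j) = f (z * B i0 j) * u'" for j using *[rule_format, of "z * B i0 j"] by (simp add: ac_simps)
    thus "F i (z * u) = F i z * u'" by (simp add: F_def sum_distrib_right mult.assoc)
  qed
  moreover have "semilin n B i0 (F i)" if i: "i < n" for i
    unfolding semilin_def
  proof (intro exI[of _ i] conjI ballI allI i)
    fix w z assume w: "w \<in> alg_vecs n B"
    \<comment> \<open>The value of \<open>f\<close> at \<open>z * w i0 * v i0\<close> is expanded in
      two ways, with \<open>v\<close> and with the product of \<open>w\<close> and \<open>v\<close>
      as the algebra element. Independence of the rows identifies the coefficients.\<close>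
    have "F i (z * w i0) - F i z * w i = 0"
    proof (rule split_alg_separates[OF sa _ i, of "\<lambda>i. F i (z * w i0) - F i z * w i"])
      fix v assume v: "v \<in> alg_vecs n B"
      have "(\<Sum>i<n. F i (z * w i0) * v i) = f (z * w i0 * v i0)" using main[OF v] by simp
      also have "... = f (z * (w i0 * v i0))" by (simp add: mult.assoc)
      also have "... = (\<Sum>i<n. F i z * (w i * v i))" using main[OF alg_vecs_mult[OF sa w v]] .
      finally show "(\<Sum>i<n. (F i (z * w i0) - F i z * w i) * v i) = 0"
        by (simp add: left_diff_distrib sum_subtractf mult.assoc)
    qed
    thus "F i (z * w i0) = F i z * w i" by simp
  qed
  moreover have "f z = (\<Sum>h\<leftarrow>map F [0..<n]. h z)" for z
    using main[OF alg_vecs_one[OF sa], of z] by (simp add: sum_list_sum_nth atLeast0LessThan comp_def)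
  ultimately show ?thesis by (intro exI[of _ "map F [0..<n]"]) auto
qed

text \<open>Each row refines the decomposition once more. Taking the rows as a list of predicates
  lets a single induction run through the rows of both algebras.\<close>

lemma semilin_decomposition_list:
  assumes "\<And>\<Phi>. \<Phi> \<in> set \<Phi>s ==> \<exists>n B i0. split_alg n B \<and> i0 < n \<and> \<Phi> = semilin n B i0" and f: "lin f"
  shows "\<exists>H. (\<forall>h\<in>set H. lin h \<and> (\<forall>\<Phi>\<in>set \<Phi>s. \<Phi> h)) \<and> (\<forall>z. f z = (\<Sum>h\<leftarrow>H. h z))"
  using assms(1)
proof (induction \<Phi>s)
  case Nil
  show ?case using f by (intro exI[of _ "[f]"]) simp
next
  case (Cons \<Phi> \<Phi>s)
  then obtain H where H: "\<And>h. h \<in> set H ==> lin h \<and> (\<forall>\<Phi>\<in>set \<Phi>s. \<Phi> h)" "\<And>z. f z = (\<Sum>h\<leftarrow>H. h z)" by auto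
  obtain n B i0 where P: "split_alg n B" "i0 < n" "\<Phi> = semilin n B i0" using Cons.prems[of \<Phi>] by auto
  have "\<forall>h. \<exists>H'. h \<in> set H --> (\<forall>h'\<in>set H'. lin h' \<and> keeps h h' \<and> \<Phi> h') \<and> (\<forall>z. h z = (\<Sum>h'\<leftarrow>H'. h' z))"
    using semilin_decomposition[OF P(1,2)] H(1) unfolding P(3) by blast
  then obtain K where K: "\<And>h h'. h \<in> set H ==> h' \<in> set (K h) ==> lin h' \<and> keeps h h' \<and> \<Phi> h'"
    "\<And>h z. h \<in> set H ==> h z = (\<Sum>h'\<leftarrow>K h. h' z)" by metis
  have "f z = (\<Sum>h\<leftarrow>concat (map K H). h z)" for z
  proof -
    have "f z = (\<Sum>h\<leftarrow>H. \<Sum>h'\<leftarrow>K h. h' z)" using H(2) K(2) by (auto intro!: arg_cong[where f = sum_list])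
    also have "... = (\<Sum>h\<leftarrow>concat (map K H). h z)" by (induction H) auto
    finally show ?thesis .
  qed
  moreover have "\<Psi> h'" if "h' \<in> set (K h)" "h \<in> set H" "\<Psi> \<in> set \<Phi>s" for h h' \<Psi>
  proof -
    obtain n B i0 where "\<Psi> = semilin n B i0" using Cons.prems[of \<Psi>] \<open>\<Psi> \<in> set \<Phi>s\<close> by auto
    moreover have "\<Psi> h" using H(1)[OF that(2)] that(3) by blast
    ultimately show ?thesis using semilin_keeps[of n B i0 h h'] K(1)[OF that(2,1)] by simp
  qed
  ultimately show ?case using K(1) by (intro exI[of _ "concat (map K H)"]) fastforce
qed

end

section \<open>Linear maps as combinations of automorphisms\<close>

context field_extension begin

lemma rows_distinct:
  assumes sa: "split_alg n B" and ik: "i < n" "k < n" and eq: "\<And>v. v \<in> alg_vecs n B ==> v i = v k"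
  shows "i = k"
proof (rule ccontr)
  assume ne: "i ~= k"
  define a where "a j = (if j = i then 1 else 0) - (if j = k then 1 else (0::'b))" for j
  have "a i = 0"
  proof (rule split_alg_separates[OF sa _ ik(1)])
    fix v assume v: "v \<in> alg_vecs n B"
    have "(\<Sum>j<n. a j * v j) = (\<Sum>j<n. if j = i then v j else 0) - (\<Sum>j<n. if j = k then v j else 0)"
      unfolding sum_subtractf[symmetric] by (intro sum.cong) (auto simp: a_def)
    also have "... = v i - v k" using ik by simp
    finally show "(\<Sum>j<n. a j * v j) = 0" using eq[OF v] by simp
  qed
  thus False using ne by (simp add: a_def)
qed

text \<open>The big field is the smallest subfield that contains the base field and all conjugates
  of elements of both algebras.\<close>

definition generates :: "nat => (nat => nat => 'b) => nat => (nat => nat => 'b) => bool" where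
  "generates n B n' B' \<longleftrightarrow> (\<forall>S. (\<forall>x\<in>S. \<forall>y\<in>S. x - y \<in> S \<and> x * y \<in> S) \<and> (\<forall>x\<in>S. inverse x \<in> S) \<and> range \<psi> \<subseteq> S \<and>
     (\<forall>v\<in>alg_vecs n B. \<forall>i<n. v i \<in> S) \<and> (\<forall>v\<in>alg_vecs n' B'. \<forall>i<n'. v i \<in> S) --> S = UNIV)"

text \<open>The \<open>u\<close> for which \<open>h (z * u)\<close> is \<open>h z\<close> times a
  factor independent of \<open>z\<close> form a subfield containing all generators, hence are
  everything. The factor, as a function of \<open>u\<close>, is the automorphism \<open>g\<close>;
  putting 1 for the other argument gives the formula.\<close>

lemma semilin_imp_Gal:
  assumes sa: "split_alg n B" "split_alg n' B'" and gen: "generates n B n' B'" and h: "lin h"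
    and sl: "\<And>i. i < n ==> semilin n B i h" "\<And>i. i < n' ==> semilin n' B' i h"
  shows "\<exists>g\<in>Gal. \<forall>z. h z = h 1 * g z"
proof (cases "\<forall>z. h z = 0")
  case True thus ?thesis using Gal_closed(1) by (intro bexI[of _ id]) simp
next
  case False
  then obtain z0 where z0: "h z0 ~= 0" by blast
  define ev where "ev u u' \<longleftrightarrow> (\<forall>z. h (z * u) = h z * u')" for u u'
  have add: "h (x + y) = h x + h y" and sc: "h (\<psi> c * x) = \<psi> c * h x" for x y c using h by (auto simp: lin_def)
  have h0: "h 0 = 0" using add[of 0 0] by simp
  have diff: "h (x - y) = h x - h y" for x y using add[of "x - y" y] by simp
  have uniq: "u' = u''" if "ev u u'" "ev u u''" for u u' u'' using that z0 unfolding ev_def by (metis mult_left_cancel)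
  have ev_diff: "ev (u - w) (u' - w')" if "ev u u'" "ev w w'" for u w u' w'
    using that by (simp add: ev_def right_diff_distrib diff)
  have ev_add: "ev (u + w) (u' + w')" if "ev u u'" "ev w w'" for u w u' w'
    using that by (simp add: ev_def distrib_left add)
  have ev_mult: "ev (u * w) (u' * w')" if "ev u u'" "ev w w'" for u w u' w'
    unfolding ev_def
  proof
    fix z
    have "h (z * (u * w)) = h ((z * u) * w)" by (simp add: mult.assoc)
    also have "... = h (z * u) * w'" using that(2) unfolding ev_def by blast
    also have "... = h z * u' * w'" using that(1) unfolding ev_def by simp
    finally show "h (z * (u * w)) = h z * (u' * w')" by (simp add: mult.assoc)
  qed
  have ev_psi: "ev (\<psi> c) (\<psi> c)" for c unfolding ev_def using sc by (metis mult.commute)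
  have ev_inv: "ev (inverse u) (inverse u')" if e: "ev u u'" for u u'
  proof (cases "u = 0")
    case True
    hence "u' = 0" using e z0 h0 by (auto simp: ev_def)
    thus ?thesis using True e by simp
  next
    case False
    have "h z = h (z * inverse u) * u'" for z using e False unfolding ev_def by (metis mult.assoc left_inverse mult.right_neutral)
    moreover from this have "u' ~= 0" using z0 by (metis mult_zero_right)
    ultimately show ?thesis unfolding ev_def by (metis mult.assoc right_inverse mult.right_neutral)
  qed
  have sl1: "\<exists>i'<n. \<forall>v\<in>alg_vecs n B. ev (v i) (v i')" if "i < n" for i
    using sl(1)[OF that] by (simp add: semilin_def ev_def)
  have sl2: "\<exists>i'<n'. \<forall>v\<in>alg_vecs n' B'. ev (v i) (v i')" if "i < n'" for i
    using sl(2)[OF that] by (simp add: semilin_def ev_def)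
  have "{u. \<exists>u'. ev u u'} = UNIV"
  proof (rule gen[unfolded generates_def, rule_format, of "{u. \<exists>u'. ev u u'}"], intro conjI ballI allI impI)
    fix x y assume "x \<in> {u. \<exists>u'. ev u u'}" "y \<in> {u. \<exists>u'. ev u u'}"
    thus "x - y \<in> {u. \<exists>u'. ev u u'}" "x * y \<in> {u. \<exists>u'. ev u u'}" using ev_diff ev_mult by blast+
  next
    fix x assume "x \<in> {u. \<exists>u'. ev u u'}"
    thus "inverse x \<in> {u. \<exists>u'. ev u u'}" using ev_inv by blast
  next
    show "range \<psi> \<subseteq> {u. \<exists>u'. ev u u'}" using ev_psi by blast
  next
    fix v i assume "v \<in> alg_vecs n B" "i < n" thus "v i \<in> {u. \<exists>u'. ev u u'}" using sl1 by blast
  next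
    fix v i assume "v \<in> alg_vecs n' B'" "i < n'" thus "v i \<in> {u. \<exists>u'. ev u u'}" using sl2 by blast
  qed
  hence "\<forall>u. \<exists>u'. ev u u'" by blast
  then obtain g where g: "\<And>u. ev u (g u)" by metis
  have g_eq: "g u = u'" if "ev u u'" for u u' using uniq[OF g that] .
  have gadd: "g (x + y) = g x + g y" for x y using g_eq ev_add g by blast
  have gdiff: "g (x - y) = g x - g y" for x y using g_eq ev_diff g by blast
  have gmult: "g (x * y) = g x * g y" for x y using g_eq ev_mult g by blast
  have gpsi: "g (\<psi> c) = \<psi> c" for c using g_eq ev_psi by blast
  have ginv: "g (inverse x) = inverse (g x)" for x using g_eq ev_inv g by blast
  have g1: "g 1 = 1" using gpsi[of 1] psi_1 by simp
  have ginj: "inj g"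
  proof (rule injI)
    fix x y assume xy: "g x = g y"
    show "x = y"
    proof (rule ccontr)
      assume "x ~= y"
      hence "g (x - y) * g (inverse (x - y)) = 1" using gmult[of "x - y" "inverse (x - y)"] g1 by simp
      thus False using xy gdiff by simp
    qed
  qed
  \<comment> \<open>\<open>g\<close> maps the values of row \<open>i\<close> to those of row
    \<open>\<pi> i\<close>. Distinct rows have distinct images, so \<pi> permutes the finitely many
    rows and every row value is also in the image of \<open>g\<close>.\<close>
  have rows: "v i \<in> range g"
    if sa: "split_alg m C" and sl: "\<And>i. i < m ==> \<exists>i'<m. \<forall>v\<in>alg_vecs m C. ev (v i) (v i')"
      and v: "v \<in> alg_vecs m C" "i < m" for m C v i
  proof -
    obtain \<pi> where \<pi>: "\<And>i. i < m ==> \<pi> i < m" "\<And>i v. i < m ==> v \<in> alg_vecs m C ==> g (v i) = v (\<pi> i)"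
      using sl g_eq by metis
    have "inj_on \<pi> {..<m}"
    proof (rule inj_onI)
      fix i k assume ik: "i \<in> {..<m}" "k \<in> {..<m}" "\<pi> i = \<pi> k"
      show "i = k"
      proof (rule rows_distinct[OF sa])
        fix v assume "v \<in> alg_vecs m C"
        hence "g (v i) = g (v k)" using \<pi>(2) ik by simp
        thus "v i = v k" using ginj by (simp add: inj_eq)
      qed (use ik in auto)
    qed
    hence "\<pi> ` {..<m} = {..<m}" using \<pi>(1) by (intro endo_inj_surj) auto
    then obtain k where "k < m" "i = \<pi> k" using v(2) by blast
    thus ?thesis using \<pi>(2)[of k v] v(1) by (metis rangeI)
  qed
  have "range g = UNIV"
  proof (rule gen[unfolded generates_def, rule_format, of "range g"], intro conjI ballI allI impI)
    fix x y assume "x \<in> range g" "y \<in> range g"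
    then obtain a b where "x = g a" "y = g b" by blast
    hence "x - y = g (a - b)" "x * y = g (a * b)" by (simp_all add: gdiff gmult)
    thus "x - y \<in> range g" "x * y \<in> range g" by simp_all
  next
    fix x assume "x \<in> range g"
    then obtain a where "x = g a" by blast
    hence "inverse x = g (inverse a)" by (simp add: ginv)
    thus "inverse x \<in> range g" by simp
  next
    show "range \<psi> \<subseteq> range g"
    proof
      fix x assume "x \<in> range \<psi>"
      then obtain c where "x = g (\<psi> c)" using gpsi by fastforce
      thus "x \<in> range g" by simp
    qed
  next
    fix v i assume "v \<in> alg_vecs n B" "i < n"
    thus "v i \<in> range g" using rows[OF sa(1) sl1] by blast
  next
    fix v i assume "v \<in> alg_vecs n' B'" "i < n'"
    thus "v i \<in> range g" using rows[OF sa(2) sl2] by blast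
  qed
  hence "g \<in> Gal" using ginj gadd gmult gpsi by (simp add: Gal_def bij_def)
  moreover have "h z = h 1 * g z" for z using g[of z] unfolding ev_def by (metis mult_1)
  ultimately show ?thesis by blast
qed

text \<open>The part of Galois theory used below. The map splits into summands semilinear along all
  rows of both algebras, and each summand is a multiple of an automorphism.\<close>

lemma lin_in_span_Gal:
  assumes fin: "finite Gal" and sa: "split_alg n B" "split_alg n' B'" and gen: "generates n B n' B'" and f: "lin f"
  shows "\<exists>c. \<forall>z. f z = (\<Sum>g\<in>Gal. c g * g z)"
proof -
  define \<Phi>s where "\<Phi>s = map (semilin n B) [0..<n] @ map (semilin n' B') [0..<n']"
  have "\<exists>H. (\<forall>h\<in>set H. lin h \<and> (\<forall>\<Phi>\<in>set \<Phi>s. \<Phi> h)) \<and> (\<forall>z. f z = (\<Sum>h\<leftarrow>H. h z))"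
  proof (rule semilin_decomposition_list[OF _ f])
    fix \<Phi> assume "\<Phi> \<in> set \<Phi>s"
    hence "(\<exists>x<n. \<Phi> = semilin n B x) \<or> (\<exists>x<n'. \<Phi> = semilin n' B' x)" by (auto simp: \<Phi>s_def)
    thus "\<exists>n B i0. split_alg n B \<and> i0 < n \<and> \<Phi> = semilin n B i0" using sa by metis
  qed
  then obtain H where H: "\<And>h. h \<in> set H ==> lin h \<and> (\<forall>\<Phi>\<in>set \<Phi>s. \<Phi> h)" "\<And>z. f z = (\<Sum>h\<leftarrow>H. h z)" by blast
  have "\<exists>g\<in>Gal. \<forall>z. h z = h 1 * g z" if h: "h \<in> set H" for h
    by (rule semilin_imp_Gal[OF sa gen]) (use H(1)[OF h] in \<open>auto simp: \<Phi>s_def\<close>)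
  hence "\<exists>c. \<forall>z. (\<Sum>h\<leftarrow>H. h z) = (\<Sum>g\<in>Gal. c g * g z)"
  proof (induction H)
    case Nil show ?case by (intro exI[of _ "\<lambda>_. 0"]) simp
  next
    case (Cons h H)
    then obtain c where c: "\<And>z. (\<Sum>h\<leftarrow>H. h z) = (\<Sum>g\<in>Gal. c g * g z)" by auto
    obtain g where g: "g \<in> Gal" "\<And>z. h z = h 1 * g z" using Cons.prems[of h] by auto
    have "(\<Sum>h\<leftarrow>h # H. h z) = (\<Sum>g'\<in>Gal. (c g' + (if g' = g then h 1 else 0)) * g' z)" for z
    proof -
      have "(\<Sum>g'\<in>Gal. (c g' + (if g' = g then h 1 else 0)) * g' z)
        = (\<Sum>g'\<in>Gal. c g' * g' z) + (\<Sum>g'\<in>Gal. if g' = g then h 1 * g' z else 0)"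
        unfolding sum.distrib[symmetric] by (intro sum.cong) (auto simp: distrib_right)
      also have "(\<Sum>g'\<in>Gal. if g' = g then h 1 * g' z else 0) = h 1 * g z" using fin g(1) by simp
      also have "... = h z" by (rule g(2)[symmetric])
      finally show ?thesis using c by simp
    qed
    thus ?case by (intro exI[of _ "\<lambda>g'. c g' + (if g' = g then h 1 else 0)"]) blast
  qed
  thus ?thesis using H(2) by simp
qed

text \<open>If the values of row \<open>i0\<close> did not fill the field, some nonzero linear map
  would vanish on them. It is a combination of automorphisms, whose restrictions to these values are
  distinct by freeness; this contradicts Dedekind independence.\<close>

lemma row_surjective:
  assumes fin: "finite Gal" and sa: "split_alg n B" "split_alg n' B'" and gen: "generates n B n' B'"
    and i0: "i0 < n'" and free: "\<And>g. g \<in> Gal ==> (\<And>v. v \<in> alg_vecs n' B' ==> g (v i0) = v i0) ==> g = id"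
  shows "\<exists>v\<in>alg_vecs n' B'. v i0 = z"
proof (rule ccontr)
  assume z: "\<not> ?thesis"
  define M where "M = (\<lambda>v. v i0) ` alg_vecs n' B'"
  have zM: "z \<notin> M" using z by (auto simp: M_def)
  interpret vs: vector_space "\<lambda>c (z::'b). \<psi> c * z"
    by unfold_locales (auto simp: algebra_simps psi_add psi_mult psi_1)
  interpret vp: vector_space_pair "\<lambda>c (z::'b). \<psi> c * z" "\<lambda>c (z::'b). \<psi> c * z" ..
  have sub: "vs.subspace M"
    unfolding vs.subspace_def
  proof (intro conjI ballI allI)
    show "0 \<in> M" unfolding M_def using alg_vecs_lincomb[of "{}" _ n' B'] by force
    fix x y assume "x \<in> M" "y \<in> M" thus "x + y \<in> M" unfolding M_def using alg_vecs_add by fast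
  next
    fix c x assume "x \<in> M" thus "\<psi> c * x \<in> M" unfolding M_def using alg_vecs_scale by fast
  qed
  obtain Bm where Bm: "Bm \<subseteq> M" "vs.independent Bm" "M \<subseteq> vs.span Bm" using vs.maximal_independent_subset[of M] by blast
  have spanM: "vs.span Bm = M" using Bm sub by (metis order_antisym vs.span_minimal)
  hence "vs.independent (insert z Bm)" using zM Bm by (simp add: vs.independent_insert)
  then obtain f where f: "Vector_Spaces.linear (\<lambda>c z. \<psi> c * z) (\<lambda>c z. \<psi> c * z) f"
    "\<forall>x\<in>insert z Bm. f x = (if x = z then 1 else 0)"
    using vp.linear_independent_extend[of "insert z Bm" "\<lambda>x. if x = z then 1 else 0"] by blast
  interpret f: Vector_Spaces.linear "\<lambda>c (z::'b). \<psi> c * z" "\<lambda>c (z::'b). \<psi> c * z" f by (rule f(1))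
  have linf: "lin f" unfolding lin_def using f.add f.scale by blast
  have f0: "f x = 0" if "x \<in> M" for x
  proof (rule f.eq_0_on_span[of Bm])
    show "f x = 0" if "x \<in> Bm" for x using f(2) that zM Bm(1) by auto
    show "x \<in> vs.span Bm" using that spanM by simp
  qed
  obtain c where c: "\<And>z. f z = (\<Sum>g\<in>Gal. c g * g z)" using lin_in_span_Gal[OF fin sa gen linf] by blast
  have Gal_hom: "g (x * y) = g x * g y" "g 1 = 1" if "g \<in> Gal" for g x y
    using that psi_1 unfolding Gal_def by (blast, metis (mono_tags, lifting) mem_Collect_eq)
  have "c g = 0" if g: "g \<in> Gal" for g
  proof (rule dedekind_independence[where M = M and c = c and i = g and g = "\<lambda>f. f" and mul = "(*)" and u = 1, OF fin])
    show "x * y \<in> M" if "x \<in> M" "y \<in> M" for x y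
      using that alg_vecs_mult[OF sa(2)] unfolding M_def by fast
    show "1 \<in> M" unfolding M_def using alg_vecs_one[OF sa(2)] by force
    show "g (x * y) = g x * g y" if "g \<in> Gal" "x \<in> M" "y \<in> M" for g x y using Gal_hom(1)[OF that(1)] .
    show "g 1 = 1" if "g \<in> Gal" for g using Gal_hom(2)[OF that] .
    show "(\<Sum>g\<in>Gal. c g * g x) = 0" if "x \<in> M" for x using f0[OF that] c by simp
    show "g \<in> Gal" by (rule g)
    fix g h assume gh0: "g \<in> Gal" "h \<in> Gal" "g ~= h"
    show "\<exists>x\<in>M. g x ~= h x"
    proof (rule ccontr)
    assume "\<not> ?thesis"
    hence gh: "g \<in> Gal" "h \<in> Gal" "\<And>x. x \<in> M ==> g x = h x" using gh0 by auto
    have bh: "bij h" using gh(2) by (simp add: Gal_def)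
    have "finv h \<circ> g = id"
    proof (rule free)
      show "finv h \<circ> g \<in> Gal" using Gal_closed(2,3) gh by blast
      fix v assume "v \<in> alg_vecs n' B'"
      hence "g (v i0) = h (v i0)" using gh(3) by (auto simp: M_def)
      thus "(finv h \<circ> g) (v i0) = v i0" using bh by (simp add: bij_is_inj)
    qed
    hence "h \<circ> (finv h \<circ> g) = h" by simp
    moreover have "h \<circ> (finv h \<circ> g) = g" using bh by (simp add: fun_eq_iff bij_is_surj surj_f_inv_f)
    ultimately show False using gh0(3) by simp
    qed
  qed
  hence "f z = 0" using c by simp
  thus False using f(2) by simp
qed

text \<open>In the basis, multiplication has a matrix \<open>C\<close> over the base field, and the
  matrix of conjugates intertwines it with the diagonal matrix of the \<open>v i\<close>.\<close>

lemma mult_matrix_char_poly: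
  assumes sa: "split_alg n B" and C: "\<And>i j. i < n ==> j < n ==> v i * B i j = (\<Sum>k<n. \<psi> (C k j) * B i k)"
  shows "char_poly (mat n n (\<lambda>(k,j). \<psi> (C k j))) = (\<Prod>i<n. [:- v i, 1:])"
    and "\<psi> (\<Sum>j<n. C j j) = (\<Sum>i<n. v i)"
proof -
  obtain A where A: "\<And>j k. j < n ==> k < n ==> (\<Sum>i<n. A j i * B i k) = (if j = k then 1 else 0)"
    "\<And>j k. j < n ==> k < n ==> (\<Sum>i<n. B j i * A i k) = (if j = k then 1 else 0)"
    using split_alg_inverse[OF sa] by blast
  let ?C = "mat n n (\<lambda>(k,j). \<psi> (C k j))" and ?B = "mat n n (\<lambda>(i,j). B i j)" and ?A = "mat n n (\<lambda>(i,j). A i j)"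
    and ?D = "mat n n (\<lambda>(i,j). if i = j then v i else 0)"
  have AB: "?A * ?B = 1\<^sub>m n" "?B * ?A = 1\<^sub>m n"
    using A by (auto intro!: eq_matI simp: scalar_prod_def atLeast0LessThan)
  have BC: "?D * ?B = ?B * ?C"
  proof (rule eq_matI)
    fix i j assume "i < dim_row (?B * ?C)" "j < dim_col (?B * ?C)"
    hence ij: "i < n" "j < n" by auto
    have "(?D * ?B) $$ (i,j) = (\<Sum>k<n. (if i = k then v i else 0) * B k j)"
      using ij by (simp add: scalar_prod_def atLeast0LessThan)
    also have "... = (\<Sum>k<n. if k = i then v i * B k j else 0)" by (intro sum.cong) auto
    also have "... = v i * B i j" using ij by simp
    also have "... = (?B * ?C) $$ (i,j)" using C[OF ij] ij by (simp add: scalar_prod_def atLeast0LessThan mult.commute)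
    finally show "(?D * ?B) $$ (i,j) = (?B * ?C) $$ (i,j)" .
  qed auto
  have "?C = ?A * ?B * ?C" using AB by (simp add: left_mult_one_mat[of ?C n n])
  also have "... = ?A * (?B * ?C)" by (rule assoc_mult_mat[of _ n n _ n _ n]) auto
  also have "... = ?A * (?D * ?B)" using BC by simp
  also have "... = ?A * ?D * ?B" by (rule assoc_mult_mat[of _ n n _ n _ n, symmetric]) auto
  finally have C_eq: "?C = ?A * ?D * ?B" .
  hence "similar_mat ?C ?D" using AB by (intro similar_matI[of _ _ ?A ?B n]) auto
  hence "char_poly ?C = char_poly ?D" by (rule char_poly_similar)
  also have "... = (\<Prod>a\<leftarrow>diag_mat ?D. [:- a, 1:])" by (rule char_poly_upper_triangular[of _ n]) auto
  also have "... = (\<Prod>i<n. [:- v i, 1:])" by (simp add: diag_mat_def prod.list_conv_set_nth atLeast0LessThan)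
  finally show "char_poly ?C = (\<Prod>i<n. [:- v i, 1:])" .
  have "\<psi> (C j j) = (\<Sum>i<n. A j i * (v i * B i j))" if j: "j < n" for j
  proof -
    have "(\<Sum>i<n. A j i * (v i * B i j)) = (\<Sum>i<n. \<Sum>k<n. \<psi> (C k j) * (A j i * B i k))"
      using C j by (intro sum.cong) (auto simp: sum_distrib_left algebra_simps)
    also have "... = (\<Sum>k<n. \<Sum>i<n. \<psi> (C k j) * (A j i * B i k))" by (rule sum.swap)
    also have "... = (\<Sum>k<n. \<psi> (C k j) * (if j = k then 1 else 0))"
      unfolding sum_distrib_left[symmetric] using A(1) j by (intro sum.cong) auto
    also have "... = (\<Sum>k<n. if k = j then \<psi> (C k j) else 0)" by (intro sum.cong) auto
    finally show ?thesis using j by simp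
  qed
  hence "\<psi> (\<Sum>j<n. C j j) = (\<Sum>j<n. \<Sum>i<n. v i * (B i j * A j i))"
    unfolding psi_sum by (intro sum.cong) (auto simp: algebra_simps)
  also have "... = (\<Sum>i<n. \<Sum>j<n. v i * (B i j * A j i))" by (rule sum.swap)
  also have "... = (\<Sum>i<n. v i)" unfolding sum_distrib_left[symmetric] using A(2) by (intro sum.cong) auto
  finally show "\<psi> (\<Sum>j<n. C j j) = (\<Sum>i<n. v i)" .
qed

text \<open>The characteristic polynomial of multiplication is a common monic equation for all
  conjugates. Its coefficients are in the base field because the matrix is, and in \<open>S\<close>
  because it is the product of the \<open>X - v i\<close>.\<close>

lemma alg_vec_integral_equation:
  assumes sa: "split_alg n B" and v: "v \<in> alg_vecs n B" and S: "is_subring S" "\<And>i. i < n ==> v i \<in> S"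
  shows "\<exists>a. (\<forall>k. \<psi> (a k) \<in> S) \<and> (\<forall>i<n. v i ^ n + (\<Sum>k<n. \<psi> (a k) * v i ^ k) = 0)"
proof -
  have "\<forall>j. \<exists>c. j < n --> (\<forall>i<n. v i * B i j = (\<Sum>k<n. \<psi> (c k) * B i k))"
    using alg_vecs_mult[OF sa v alg_vecs_base] by (auto simp: alg_vecs_def)
  then obtain C where C: "\<And>i j. i < n ==> j < n ==> v i * B i j = (\<Sum>k<n. \<psi> (C j k) * B i k)" by metis
  let ?C = "mat n n (\<lambda>(k,j). \<psi> (C j k))"
  define q where "q = char_poly ?C"
  have q: "q = (\<Prod>i<n. [:- v i, 1:])" unfolding q_def by (rule mult_matrix_char_poly(1)[OF sa C])
  have "Polynomial.coeff q k \<in> range \<psi>" for k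
    unfolding q_def by (rule char_poly_coeff_in_subring[OF range_subring, of _ n]) auto
  hence "\<forall>k. \<exists>c. Polynomial.coeff q k = \<psi> c" by blast
  then obtain a where a: "\<And>k. Polynomial.coeff q k = \<psi> (a k)" by metis
  have "q \<in> {q. \<forall>k. Polynomial.coeff q k \<in> S}" unfolding q
    using S by (intro is_subring_prod is_subring_polys)
      (auto simp: coeff_pCons is_subring_closed split: nat.split)
  hence aS: "\<psi> (a k) \<in> S" for k using a by simp
  have deg: "Polynomial.degree q = n" "Polynomial.coeff q n = 1"
    using degree_monic_char_poly[of ?C n] by (auto simp: q_def)
  have "v i ^ n + (\<Sum>k<n. \<psi> (a k) * v i ^ k) = 0" if i: "i < n" for i
  proof -
    have "poly q (v i) = 0" unfolding q poly_prod using i by (intro prod_zero) auto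
    hence "(\<Sum>k\<le>n. \<psi> (a k) * v i ^ k) = 0" unfolding poly_altdef deg a .
    thus ?thesis using deg(2) a[of n] by (simp add: lessThan_Suc_atMost[symmetric] add.commute)
  qed
  thus ?thesis using aS by blast
qed

end

lemma prod_square_swap:
  fixes f :: "nat => nat => real"
  assumes sym: "\<And>k l. k < n ==> l < n ==> f k l = f l k"
  shows "(\<Prod>k<n. \<Prod>l<k. f k l)\<^sup>2 = (\<Prod>k<n. \<Prod>l\<in>{..<n} - {k}. f k l)"
proof -
  have filt: "(\<Prod>l<k. f k l) = (\<Prod>l<n. if l < k then f k l else 1)" if "k < n" for k
  proof -
    have "{..<k} = {l \<in> {..<n}. l < k}" using that by auto
    thus ?thesis using prod.inter_filter[of "{..<n}" "f k" "\<lambda>l. l < k"] by simp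
  qed
  have "(\<Prod>k<n. \<Prod>l<k. f k l) = (\<Prod>k<n. \<Prod>l<n. if l < k then f k l else 1)" using filt by (intro prod.cong[OF refl]) simp
  also have "... = (\<Prod>l<n. \<Prod>k<n. if l < k then f k l else 1)" by (rule prod.swap)
  also have "... = (\<Prod>k<n. \<Prod>l<n. if k < l then f k l else 1)" using sym by (intro prod.cong) auto
  finally have 2: "(\<Prod>k<n. \<Prod>l<k. f k l) = (\<Prod>k<n. \<Prod>l<n. if k < l then f k l else 1)" .
  have "(\<Prod>k<n. \<Prod>l<k. f k l)\<^sup>2 = (\<Prod>k<n. \<Prod>l<n. if l < k then f k l else 1) * (\<Prod>k<n. \<Prod>l<n. if k < l then f k l else 1)"
    unfolding power2_eq_square using 2 filt by (metis (no_types, lifting) lessThan_iff prod.cong)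
  also have "... = (\<Prod>k<n. \<Prod>l<n. if l ~= k then f k l else 1)"
    unfolding prod.distrib[symmetric] by (intro prod.cong) auto
  also have "... = (\<Prod>k<n. \<Prod>l\<in>{..<n} - {k}. f k l)"
  proof (rule prod.cong[OF refl])
    fix k
    have "{..<n} - {k} = {l \<in> {..<n}. l ~= k}" by auto
    thus "(\<Prod>l<n. if l ~= k then f k l else 1) = (\<Prod>l\<in>{..<n} - {k}. f k l)"
      using prod.inter_filter[of "{..<n}" "f k" "\<lambda>l. l ~= k"] by simp
  qed
  finally show ?thesis .
qed

section \<open>The inequality between the valuations of two discriminants\<close>

context field_extension begin

lemma Gal_ints:
  assumes "arith_ring (\<psi> ` R) p" "g \<in> Gal"
  shows "g ` arith_ring.ints (\<psi> ` R) = arith_ring.ints (\<psi> ` R)"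
proof -
  interpret arith_ring "\<psi> ` R" p by fact
  have sub: "g z \<in> ints" if g: "g \<in> Gal" and z: "z \<in> ints" for g z
  proof -
    obtain m a where ma: "\<forall>i<m. a i \<in> \<psi> ` R" "z ^ m + (\<Sum>i<m. a i * z ^ i) = 0"
      using z unfolding ints_def integral_over_def by auto
    have hom: "g (x + y) = g x + g y" "g (x * y) = g x * g y" "g (\<psi> c) = \<psi> c" for x y c using g by (auto simp: Gal_def)
    have g0: "g 0 = 0" using hom(3)[of 0] psi_0 by simp
    have g1: "g 1 = 1" using hom(3)[of 1] psi_1 by simp
    have pow: "g (x ^ k) = g x ^ k" for x k by (induction k) (auto simp: hom g1)
    have sum: "g (sum f I) = (\<Sum>i\<in>I. g (f i))" for f and I :: "nat set"
      by (induction I rule: infinite_finite_induct) (auto simp: hom g0)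
    have ga: "g (a i) = a i" if "i < m" for i using ma(1) that hom(3) by auto
    have "g z ^ m + (\<Sum>i<m. a i * g z ^ i) = g (z ^ m + (\<Sum>i<m. a i * z ^ i))"
      using ga by (simp add: hom pow sum)
    hence "g z ^ m + (\<Sum>i<m. a i * g z ^ i) = 0" using ma(2) g0 by simp
    thus ?thesis unfolding ints_def integral_over_def using ma(1) by blast
  qed
  have "z \<in> g ` ints" if "z \<in> ints" for z
  proof -
    have "bij g" using assms(2) by (simp add: Gal_def)
    hence "z = g (finv g z)" by (simp add: bij_is_surj surj_f_inv_f)
    thus ?thesis using sub[OF Gal_closed(3)[OF assms(2)] that] by blast
  qed
  thus ?thesis using sub[OF assms(2)] by blast
qed

text \<open>The two bases play different roles. The first has to be integral, for an upper bound of
  its discriminant; the second has to express all integral elements with coefficients integral at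
  \<open>P\<close>, for a lower bound. Both bounds are powers of the same number
  \<open>M\<close>.\<close>

theorem valuation_inequality:
  fixes R :: "'a set" and act1 act2 :: "('b => 'b) => nat => nat"
  assumes pl: "arith_place R p P" and ar: "arith_ring (\<psi> ` R) p" and fin: "finite Gal"
    and sa1: "split_alg n1 B1" and sa2: "split_alg n2 B2" and gen: "generates n1 B1 n2 B2"
    and act1: "\<And>g i. g \<in> Gal ==> i < n1 ==> act1 g i < n1"
      "\<And>g i v. g \<in> Gal ==> i < n1 ==> v \<in> alg_vecs n1 B1 ==> g (v i) = v (act1 g i)"
    and act2: "\<And>g i. g \<in> Gal ==> i < n2 ==> act2 g i < n2"
      "\<And>g i v. g \<in> Gal ==> i < n2 ==> v \<in> alg_vecs n2 B2 ==> g (v i) = v (act2 g i)"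
    and fx: "\<And>g. g \<in> Gal ==> g ~= id ==> card {i. i < n1 \<and> act1 g i = i} \<le> fx"
    and free: "\<And>g i. g \<in> Gal ==> g ~= id ==> i < n2 ==> act2 g i ~= i"
    and int1: "\<And>i j. i < n1 ==> j < n1 ==> B1 i j \<in> arith_ring.ints (\<psi> ` R)"
    and span2: "\<And>v. v \<in> alg_vecs n2 B2 ==> (\<And>i. i < n2 ==> v i \<in> arith_ring.ints (\<psi> ` R)) ==>
       \<exists>c. (\<forall>j<n2. arith_place.nv R P (c j) \<le> 1) \<and> (\<forall>i<n2. v i = (\<Sum>j<n2. \<psi> (c j) * B2 i j))"
    and d: "\<psi> d1 = (det (mat n1 n1 (\<lambda>(i,j). B1 i j)))\<^sup>2" "\<psi> d2 = (det (mat n2 n2 (\<lambda>(i,j). B2 i j)))\<^sup>2"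
  shows "int (n1 - fx) * arith_place.val R P d2 \<le> int n2 * arith_place.val R P d1"
proof -
  interpret F: arith_place R p P by (rule pl)
  obtain Q where Q: "arith_place (\<psi> ` R) p Q"
    and PQ: "\<And>x. x \<in> F.ints ==> \<psi> x \<in> arith_ring.ints (\<psi> ` R) \<and> (\<psi> x \<in> Q \<longleftrightarrow> x \<in> P)"
    using ex_place_above[OF pl ar psi_1 psi_add psi_mult] by blast
  interpret L: arith_place "\<psi> ` R" p Q by (rule Q)
  \<comment> \<open>The decomposition group of \<open>Q\<close>; its elements preserve the absolute
    value at \<open>Q\<close>.\<close>
  define D where "D = {g \<in> Gal. g ` Q = Q}"
  have DG: "D \<subseteq> Gal" by (auto simp: D_def)
  have Gb: "bij g" "g (x + y) = g x + g y" "g (x * y) = g x * g y" "g (\<psi> c) = \<psi> c" if "g \<in> Gal" for g x y c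
    using that by (auto simp: Gal_def)
  have Gi: "g (finv g x) = x" "finv g (g x) = x" if "g \<in> Gal" for g x
    using Gb(1)[OF that] by (auto simp: bij_is_surj surj_f_inv_f bij_is_inj)
  obtain \<alpha> where \<alpha>: "\<alpha> \<in> L.ints" "\<And>y N. L.nv y \<le> 1 ==> \<exists>f. (\<forall>i. Polynomial.coeff f i \<in> \<int>) \<and> L.nv (y - poly f \<alpha>) \<le> (1/2) ^ N"
    using L.ex_dense_generator by blast
  interpret dg: decomposition_group "\<psi> ` R" p Q D \<alpha>
  proof unfold_locales
    show "finite D" using finite_subset[OF DG fin] .
    show "id \<in> D" using Gal_closed(1) by (simp add: D_def)
    show "g \<circ> h \<in> D" if "g \<in> D" "h \<in> D" for g h
    proof -
      have "(g \<circ> h) ` Q = g ` (h ` Q)" by (rule image_comp[symmetric])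
      thus ?thesis using that Gal_closed(2) by (simp add: D_def)
    qed
    show "bij g \<and> finv g \<in> D" if g: "g \<in> D" for g
    proof -
      have gG: "g \<in> Gal" "g ` Q = Q" using g by (auto simp: D_def)
      have "finv g ` Q = finv g ` (g ` Q)" using gG(2) by simp
      also have "... = Q" using Gi(2)[OF gG(1)] by (simp add: image_comp comp_def)
      finally show ?thesis using Gal_closed(3)[OF gG(1)] Gb(1)[OF gG(1)] by (simp add: D_def)
    qed
    show "g (x + y) = g x + g y" "g (x * y) = g x * g y" if "g \<in> D" for g x y using that Gb DG by blast+
    show "L.nv (g x) = L.nv x" if "g \<in> D" for g x
    proof (rule L.nv_automorphism)
      show "g (x * y) = g x * g y" for x y using that Gb(3) DG by blast
      show "bij g" using that Gb(1) DG by blast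
      show "g ` L.ints = L.ints" using Gal_ints[OF ar] that DG by blast
      show "g ` Q = Q" using that by (simp add: D_def)
    qed
    show "L.nv \<alpha> \<le> 1" using L.nv_ints[OF \<alpha>(1)] .
    show "\<exists>f. (\<forall>i. Polynomial.coeff f i \<in> \<int>) \<and> L.nv (y - poly f \<alpha>) \<le> (1/2) ^ N" if "L.nv y \<le> 1" for y N
      using \<alpha>(2)[OF that] .
  qed
  define M where "M = (\<Prod>g\<in>D - {id}. dg.m g)"
  have m01: "0 \<le> dg.m g" "dg.m g \<le> 1" if "g \<in> D" for g using dg.m_bounds[OF that] by auto
  have mpos: "0 < dg.m g" if "g \<in> D - {id}" for g
    using that dg.D_faithful[of g] L.nv_pos[of "\<alpha> - g \<alpha>"] by (metis DiffE singletonI dg.m_def right_minus_eq)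
  have M0: "0 < M" "M \<le> 1" using mpos m01 by (auto simp: M_def intro!: prod_pos prod_le_1)
  define is_act where "is_act n B act \<longleftrightarrow> (\<forall>g\<in>Gal. \<forall>i<n. act g i < n \<and> (\<forall>v\<in>alg_vecs n B. g (v i) = v (act g i)))"
    for n B and act :: "('b => 'b) => nat => nat"
  have ia1: "is_act n1 B1 act1" using act1 by (simp add: is_act_def)
  have ia2: "is_act n2 B2 act2" using act2 by (simp add: is_act_def)
  have act_inv: "act (finv g) (act g i) = i" and act_id: "act id i = i"
    if "split_alg n B" and g: "g \<in> Gal" and i: "i < n" and ia: "is_act n B act" for n B act g i
  proof -
    have that: "split_alg n B" "g \<in> Gal" "i < n" "\<And>g i. g \<in> Gal ==> i < n ==> act g i < n"
      "\<And>g i v. g \<in> Gal ==> i < n ==> v \<in> alg_vecs n B ==> g (v i) = v (act g i)"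
      using that ia by (simp_all add: is_act_def)
    have g': "finv g \<in> Gal" using Gal_closed(3)[OF that(2)] .
    show "act (finv g) (act g i) = i"
    proof (rule rows_distinct[OF that(1)])
      show "act (finv g) (act g i) < n" using that(4) that(2,3) g' by blast
      fix v assume v: "v \<in> alg_vecs n B"
      have "v (act (finv g) (act g i)) = finv g (v (act g i))" using that(5)[OF g' that(4)[OF that(2,3)] v] by simp
      also have "... = finv g (g (v i))" using that(5)[OF that(2,3) v] by simp
      finally show "v (act (finv g) (act g i)) = v i" using Gi(2)[OF that(2)] by simp
    qed (rule that(3))
    show "act id i = i"
    proof (rule rows_distinct[OF that(1)])
      show "act id i < n" using that(4)[OF Gal_closed(1) that(3)] .
      fix v assume v: "v \<in> alg_vecs n B"
      show "v (act id i) = v i" using that(5)[OF Gal_closed(1) that(3) v] by simp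
    qed (rule that(3))
  qed
  have d1_bound: "L.nv (\<psi> d1) \<le> M ^ (n1 - fx)"
  proof -
    have "L.nv (\<psi> d1) = (L.nv (det (mat n1 n1 (\<lambda>(i,j). B1 i j))))\<^sup>2" by (simp add: d L.nv_power)
    also have "... \<le> (\<Prod>g\<in>D - {id}. dg.m g ^ card {i. i < n1 \<and> act1 g i ~= i})"
    proof (rule dg.nv_det_upper_bound)
      show "act1 g i < n1" if "g \<in> D" "i < n1" for g i using act1(1) that DG by blast
      show "g (B1 i j) = B1 (act1 g i) j" if "g \<in> D" "i < n1" "j < n1" for g i j
        using act1(2)[of g i "\<lambda>i. B1 i j"] that DG alg_vecs_base by blast
      show "act1 id i = i" if "i < n1" for i using act_id[OF sa1 Gal_closed(1) that ia1] by blast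
      show "act1 (finv g) (act1 g i) = i" if "g \<in> D" "i < n1" for g i
        using act_inv[OF sa1 _ that(2) ia1] that(1) DG by blast
      show "L.nv (B1 i j) \<le> 1" if "i < n1" "j < n1" for i j using L.nv_ints int1 that by blast
    qed
    also have "... \<le> (\<Prod>g\<in>D - {id}. dg.m g ^ (n1 - fx))"
    proof (intro prod_mono conjI)
      fix g assume g: "g \<in> D - {id}"
      show "0 \<le> dg.m g ^ card {i. i < n1 \<and> act1 g i ~= i}" using m01 g by simp
      have "{..<n1} = {i. i < n1 \<and> act1 g i ~= i} \<union> {i. i < n1 \<and> act1 g i = i}" by auto
      hence "n1 = card ({i. i < n1 \<and> act1 g i ~= i} \<union> {i. i < n1 \<and> act1 g i = i})" by (metis card_lessThan)
      also have "... = card {i. i < n1 \<and> act1 g i ~= i} + card {i. i < n1 \<and> act1 g i = i}"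
        by (intro card_Un_disjoint) auto
      finally have "n1 - fx \<le> card {i. i < n1 \<and> act1 g i ~= i}" using fx[of g] g DG by auto
      thus "dg.m g ^ card {i. i < n1 \<and> act1 g i ~= i} \<le> dg.m g ^ (n1 - fx)"
        using m01[of g] g by (intro power_decreasing) auto
    qed
    also have "... = M ^ (n1 - fx)" by (simp add: M_def prod_power_distrib)
    finally show ?thesis .
  qed
  \<comment> \<open>No automorphism other than \<open>id\<close> fixes a row, so every homomorphism
    of the second algebra is onto the big field.\<close>
  have surj: "\<exists>v\<in>alg_vecs n2 B2. v k = z" if k: "k < n2" for k z
  proof (rule row_surjective[OF fin sa1 sa2 gen k])
    fix g assume g: "g \<in> Gal" "\<And>v. v \<in> alg_vecs n2 B2 ==> g (v k) = v k"
    show "g = id"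
    proof (rule ccontr)
      assume "g ~= id"
      moreover have "act2 g k = k"
      proof (rule rows_distinct[OF sa2])
        fix v assume v: "v \<in> alg_vecs n2 B2"
        show "v (act2 g k) = v k" using g(2)[OF v] act2(2)[OF g(1) k v] by simp
      qed (use act2(1)[OF g(1) k] k in auto)
      ultimately show False using free[OF g(1) _ k] by blast
    qed
  qed
  define orb where "orb k = (\<lambda>g. act2 g k) ` Gal" for k
  \<comment> \<open>If every element vanishing at \<open>i\<close> vanished at \<open>k\<close>,
    then sending \<open>v i\<close> to \<open>v k\<close> would be a well-defined automorphism
    moving row \<open>i\<close> to row \<open>k\<close>.\<close>
  have kill: "\<exists>v\<in>alg_vecs n2 B2. v i = 0 \<and> v k ~= 0" if k: "k < n2" and i: "i < n2" and io: "i \<notin> orb k" for i k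
  proof (rule ccontr)
    assume no: "\<not> ?thesis"
    have wd: "v k = w k" if "v \<in> alg_vecs n2 B2" "w \<in> alg_vecs n2 B2" "v i = w i" for v w
    proof -
      define u where "u j = v j + \<psi> (-1) * w j" for j
      have u: "u \<in> alg_vecs n2 B2" unfolding u_def by (intro alg_vecs_add alg_vecs_scale that)
      have "u i = 0" using that(3) psi_uminus[of 1] psi_1 by (simp add: u_def)
      hence "u k = 0" using no u by blast
      thus ?thesis using psi_uminus[of 1] psi_1 by (simp add: u_def)
    qed
    obtain V where V: "\<And>z. V z \<in> alg_vecs n2 B2 \<and> V z i = z" using surj[OF i] by metis
    define g where "g z = V z k" for z
    have gv: "g (v i) = v k" if "v \<in> alg_vecs n2 B2" for v unfolding g_def using wd V that by blast
    have gadd: "g (x + y) = g x + g y" for x y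
      using gv[OF alg_vecs_add[of "V x" n2 B2 "V y"]] V by (simp add: g_def)
    have gmult: "g (x * y) = g x * g y" for x y
      using gv[OF alg_vecs_mult[OF sa2, of "V x" "V y"]] V by (simp add: g_def)
    have gpsi: "g (\<psi> c) = \<psi> c" for c
      using gv[OF alg_vecs_scale[OF alg_vecs_one[OF sa2], of c]] by simp
    have "surj g" unfolding surj_def using surj[OF k] gv by metis
    moreover have "inj g"
    proof (rule injI)
      fix x y assume xy: "g x = g y"
      show "x = y"
      proof (rule ccontr)
        assume "x ~= y"
        have "g x = g (x - y) + g y" using gadd[of "x - y" y] by simp
        hence "g (x - y) = 0" using xy by simp
        moreover have "g (x - y) * g (inverse (x - y)) = 1"
          using gmult[of "x - y" "inverse (x - y)"] \<open>x ~= y\<close> gpsi[of 1] psi_1 by simp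
        ultimately show False by simp
      qed
    qed
    ultimately have g: "g \<in> Gal" using gadd gmult gpsi by (simp add: Gal_def bij_def)
    have "act2 g i = k"
    proof (rule rows_distinct[OF sa2])
      fix v assume v: "v \<in> alg_vecs n2 B2"
      show "v (act2 g i) = v k" using act2(2)[OF g i v] gv[OF v] by simp
    qed (use act2(1)[OF g i] k in auto)
    hence "act2 (finv g) k = i" using act_inv[OF sa2 g i ia2] by blast
    thus False using io Gal_closed(3)[OF g] by (auto simp: orb_def)
  qed
  \<comment> \<open>The idempotent of the factor of the algebra that belongs to the orbit of
    \<open>k\<close>: a product of elements killing the indices outside the orbit, scaled to be 1 at
    \<open>k\<close> and hence, by conjugation, on the whole orbit.\<close>
  have idem: "\<exists>e\<in>alg_vecs n2 B2. \<forall>i<n2. e i = (if i \<in> orb k then 1 else 0)" if k: "k < n2" for k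
  proof -
    have "\<forall>i. \<exists>v. i < n2 --> i \<notin> orb k --> v \<in> alg_vecs n2 B2 \<and> v i = 0 \<and> v k ~= 0" using kill[OF k] by blast
    then obtain v where v: "\<And>i. i < n2 ==> i \<notin> orb k ==> v i \<in> alg_vecs n2 B2 \<and> v i i = 0 \<and> v i k ~= 0" by metis
    have prod: "(\<lambda>j. \<Prod>i\<in>I. v i j) \<in> alg_vecs n2 B2" if "finite I" "I \<subseteq> {i. i < n2 \<and> i \<notin> orb k}" for I
      using that
    proof (induction I rule: finite_induct)
      case empty thus ?case using alg_vecs_one[OF sa2] by simp
    next
      case (insert i I)
      have "(\<lambda>j. v i j * (\<Prod>i\<in>I. v i j)) \<in> alg_vecs n2 B2" using insert v by (intro alg_vecs_mult[OF sa2]) auto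
      thus ?case using insert by simp
    qed
    define I where "I = {i. i < n2 \<and> i \<notin> orb k}"
    have fI: "finite I" by (simp add: I_def)
    define e0 where "e0 j = (\<Prod>i\<in>I. v i j)" for j
    have e0: "e0 \<in> alg_vecs n2 B2" using prod[OF fI] unfolding e0_def I_def by simp
    have e0k: "e0 k ~= 0" unfolding e0_def using v fI by (auto simp: I_def)
    obtain w where w: "w \<in> alg_vecs n2 B2" "w k = inverse (e0 k)" using surj[OF k] by blast
    define e where "e j = e0 j * w j" for j
    have e: "e \<in> alg_vecs n2 B2" unfolding e_def using alg_vecs_mult[OF sa2 e0 w(1)] .
    have "e i = (if i \<in> orb k then 1 else 0)" if i: "i < n2" for i
    proof (cases "i \<in> orb k")
      case True
      then obtain g where g: "g \<in> Gal" "i = act2 g k" by (auto simp: orb_def)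
      have "e i = g (e k)" using act2(2)[OF g(1) k e] g(2) by simp
      also have "e k = \<psi> 1" using w e0k by (simp add: e_def psi_1)
      finally show ?thesis using Gb(4)[OF g(1), of 1] True psi_1 by simp
    next
      case False
      hence "e0 i = 0" unfolding e0_def using i fI v[OF i False] by (intro prod_zero) (auto simp: I_def)
      thus ?thesis using False by (simp add: e_def)
    qed
    thus ?thesis using e by blast
  qed
  define V where "V = {v \<in> alg_vecs n2 B2. \<forall>i<n2. v i \<in> L.ints}"
  \<comment> \<open>An integer \<beta> of the big field is the value at \<open>k\<close> of some
    element; multiplied by the idempotent, this element has coordinate 0 outside the orbit and
    conjugates of \<beta> on it, so it is integral.\<close>
  have lift: "\<exists>v\<in>V. \<forall>g\<in>Gal. v (act2 g k) = g \<beta>" if k: "k < n2" and \<beta>: "\<beta> \<in> L.ints" for k \<beta>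
  proof -
    obtain e where e: "e \<in> alg_vecs n2 B2" "\<And>i. i < n2 ==> e i = (if i \<in> orb k then 1 else 0)" using idem[OF k] by blast
    obtain w where w: "w \<in> alg_vecs n2 B2" "w k = \<beta>" using surj[OF k] by blast
    define v where "v i = e i * w i" for i
    have v: "v \<in> alg_vecs n2 B2" unfolding v_def using alg_vecs_mult[OF sa2 e(1) w(1)] .
    have vo: "v (act2 g k) = g \<beta>" if g: "g \<in> Gal" for g
    proof -
      have "e (act2 g k) = 1" using e(2)[OF act2(1)[OF g k]] g by (auto simp: orb_def)
      thus ?thesis using act2(2)[OF g k w(1)] w(2) by (simp add: v_def)
    qed
    have "v i \<in> L.ints" if i: "i < n2" for i
    proof (cases "i \<in> orb k")
      case True
      then obtain g where g: "g \<in> Gal" "i = act2 g k" by (auto simp: orb_def)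
      have "g \<beta> \<in> L.ints" using Gal_ints[OF ar g(1)] \<beta> by blast
      thus ?thesis using vo[OF g(1)] g(2) by simp
    next
      case False
      thus ?thesis using e(2)[OF i] L.ints_closed(2) by (simp add: v_def)
    qed
    hence "v \<in> V" using v by (simp add: V_def)
    thus ?thesis using vo by blast
  qed
  \<comment> \<open>At most one automorphism moves \<open>k\<close> to \<open>l\<close>, so
    \<open>f k l\<close> has at most one factor; it is 1 if that automorphism is outside
    \<open>D\<close> or does not exist.\<close>
  define f where "f k l = (\<Prod>g\<in>{g \<in> D. act2 g k = l}. dg.m g)" for k l
  have uniq: "g = h" if "g \<in> Gal" "h \<in> Gal" "k < n2" "act2 g k = act2 h k" for g h k
  proof -
    have "act2 (finv h \<circ> g) k = k"
    proof (rule rows_distinct[OF sa2])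
      have hg: "finv h \<circ> g \<in> Gal" using that Gal_closed by blast
      show "act2 (finv h \<circ> g) k < n2" using act2(1)[OF hg that(3)] .
      fix v assume v: "v \<in> alg_vecs n2 B2"
      have "v (act2 (finv h \<circ> g) k) = finv h (g (v k))" using act2(2)[OF hg that(3) v] by simp
      also have "g (v k) = h (v k)" using act2(2)[OF that(1,3) v] act2(2)[OF that(2,3) v] that(4) by simp
      finally show "v (act2 (finv h \<circ> g) k) = v k" unfolding Gi(2)[OF that(2)] .
    qed (rule that(3))
    hence "finv h \<circ> g = id" using free[of "finv h \<circ> g" k] Gal_closed that by blast
    hence "g x = h x" for x using Gi(1)[OF that(2), of "g x"] by (metis comp_apply id_apply)
    thus ?thesis by blast
  qed
  have f_nonneg: "f k l \<ge> 0" for k l unfolding f_def using m01 by (intro prod_nonneg) auto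
  have f_le1: "f k l \<le> 1" for k l unfolding f_def using m01 by (intro prod_le_1) auto
  \<comment> \<open>Different orbits are separated by an idempotent. Within an orbit \<alpha> does
    it if the automorphism relating \<open>k\<close> and \<open>l\<close> is in \<open>D\<close>.
    Otherwise the automorphism moves \<open>Q\<close>, and an integer for which membership in
    \<open>Q\<close> changes differs from its conjugate by a unit at \<open>Q\<close>.\<close>
  have sepV: "\<exists>a\<in>V. f k l \<le> L.nv (a k - a l)" if kl: "l ~= k" "k < n2" "l < n2" for k l
  proof (cases "l \<in> orb k")
    case False
    obtain e where e: "e \<in> alg_vecs n2 B2" "\<And>i. i < n2 ==> e i = (if i \<in> orb k then 1 else 0)" using idem[OF kl(2)] by blast
    have "k \<in> orb k" using act_id[OF sa2 Gal_closed(1) kl(2) ia2] Gal_closed(1) unfolding orb_def by (metis image_eqI)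
    hence "e k - e l = 1" using e(2) kl False by simp
    moreover have "e \<in> V" using e L.ints_closed(1,2) by (auto simp: V_def)
    ultimately show ?thesis using f_le1 by (intro bexI[of _ e]) auto
  next
    case True
    then obtain g where g: "g \<in> Gal" "l = act2 g k" by (auto simp: orb_def)
    have idk: "act2 id k = k" using act_id[OF sa2 Gal_closed(1) kl(2) ia2] by blast
    show ?thesis
    proof (cases "g \<in> D")
      case gD: True
      have "{h \<in> D. act2 h k = l} = {g}" using uniq[OF _ g(1) kl(2)] g(2) gD DG by auto
      hence "f k l = dg.m g" by (simp add: f_def)
      moreover obtain v where v: "v \<in> V" "\<And>h. h \<in> Gal ==> v (act2 h k) = h \<alpha>" using lift[OF kl(2) \<alpha>(1)] by blast
      moreover have "v k - v l = \<alpha> - g \<alpha>" using v(2)[OF g(1)] v(2)[OF Gal_closed(1)] idk g(2) by simp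
      ultimately show ?thesis by (intro bexI[of _ v]) (simp_all add: dg.m_def)
    next
      case gD: False
      have "\<exists>\<beta>\<in>L.ints. (\<beta> \<in> Q) ~= (g \<beta> \<in> Q)"
      proof (rule ccontr)
        assume no: "\<not> ?thesis"
        have "g ` Q = Q"
        proof
          show "g ` Q \<subseteq> Q" using no L.P_ints by blast
          show "Q \<subseteq> g ` Q"
          proof
            fix x assume x: "x \<in> Q"
            have "finv g x \<in> L.ints" using Gal_ints[OF ar Gal_closed(3)[OF g(1)]] x L.P_ints by blast
            hence "finv g x \<in> Q" using no x Gi(1)[OF g(1)] by auto
            thus "x \<in> g ` Q" using Gi(1)[OF g(1), of x] by (metis image_eqI)
          qed
        qed
        thus False using gD g(1) by (simp add: D_def)
      qed
      then obtain \<beta> where \<beta>: "\<beta> \<in> L.ints" "(\<beta> \<in> Q) ~= (g \<beta> \<in> Q)" by blast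
      have g\<beta>: "g \<beta> \<in> L.ints" using Gal_ints[OF ar g(1)] \<beta>(1) by blast
      have "L.nv (\<beta> - g \<beta>) \<ge> 1"
      proof (rule ccontr)
        assume "\<not> L.nv (\<beta> - g \<beta>) \<ge> 1"
        moreover have "\<beta> - g \<beta> \<in> L.ints" using L.ints_closed(3)[OF \<beta>(1) g\<beta>] .
        ultimately have q: "\<beta> - g \<beta> \<in> Q" using L.nv_P_iff[of "\<beta> - g \<beta>"] by simp
        from \<beta>(2) L.P_diff[OF _ q, of \<beta>] L.P_add[OF q, of "g \<beta>"] show False by auto
      qed
      moreover obtain v where v: "v \<in> V" "\<And>h. h \<in> Gal ==> v (act2 h k) = h \<beta>" using lift[OF kl(2) \<beta>(1)] by blast
      moreover have "v k - v l = \<beta> - g \<beta>" using v(2)[OF g(1)] v(2)[OF Gal_closed(1)] idk g(2) by simp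
      ultimately show ?thesis using f_le1[of k l] by (intro bexI[of _ v]) simp_all
    qed
  qed
  have nvpsi: "L.nv (\<psi> c) \<le> 1" if c: "F.nv c \<le> 1" for c
  proof -
    obtain s t where st: "s \<in> F.ints" "t \<in> F.ints - P" "c = s / t" using c[unfolded F.nv_le_one_iff] by blast
    have "\<psi> c = \<psi> s / \<psi> t" using st(3) by (simp add: divide_inverse psi_mult psi_inverse)
    moreover have "\<psi> s \<in> L.ints" "\<psi> t \<in> L.ints - Q" using PQ[of s] PQ[of t] st by auto
    ultimately show ?thesis unfolding L.nv_le_one_iff by blast
  qed
  have d2_bound: "M ^ n2 \<le> L.nv (\<psi> d2)"
  proof -
    have "(\<Prod>k<n2. \<Prod>l<k. f k l) \<le> L.nv (det (mat n2 n2 (\<lambda>(i,j). B2 i j)))"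
    proof (rule L.nv_det_lower_bound[where V = V])
      show "(\<lambda>i. a i * a' i) \<in> V" if "a \<in> V" "a' \<in> V" for a a'
        using that alg_vecs_mult[OF sa2, of a a'] L.ints_closed(4) by (simp add: V_def)
      show "(\<lambda>i. 1) \<in> V" using alg_vecs_one[OF sa2] L.ints_closed(1) by (simp add: V_def)
      show "L.nv (a i) \<le> 1" if "a \<in> V" "i < n2" for a i using that L.nv_ints by (auto simp: V_def)
      show "\<exists>c. (\<forall>j<n2. L.nv (c j) \<le> 1) \<and> (\<forall>i<n2. a i = (\<Sum>j<n2. c j * B2 i j))" if aV: "a \<in> V" for a
      proof -
        obtain c where c: "\<forall>j<n2. F.nv (c j) \<le> 1" "\<forall>i<n2. a i = (\<Sum>j<n2. \<psi> (c j) * B2 i j)"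
          using span2[of a] aV by (auto simp: V_def)
        thus ?thesis using nvpsi by (intro exI[of _ "\<lambda>j. \<psi> (c j)"]) auto
      qed
      show "\<exists>a\<in>V. f k l \<le> L.nv (a k - a l)" if "l < k" "k < n2" for k l using sepV[of l k] that by simp
    qed (rule f_nonneg)
    moreover have "0 \<le> (\<Prod>k<n2. \<Prod>l<k. f k l)" using f_nonneg by (intro prod_nonneg) auto
    ultimately have "(\<Prod>k<n2. \<Prod>l<k. f k l)\<^sup>2 \<le> L.nv (\<psi> d2)"
      using power_mono[of _ "L.nv (det (mat n2 n2 (\<lambda>(i,j). B2 i j)))" 2] by (simp add: d L.nv_power)
    moreover have "(\<Prod>k<n2. \<Prod>l<k. f k l)\<^sup>2 = (\<Prod>k<n2. \<Prod>l\<in>{..<n2} - {k}. f k l)"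
    proof (rule prod_square_swap)
      fix k l assume kl: "k < n2" "l < n2"
      have sub: "finv g \<in> D \<and> act2 (finv g) l = k" if "g \<in> D" "act2 g k = l" "k < n2" for g k l
        using that act_inv[OF sa2 _ that(3) ia2] DG dg.D_inv by blast
      have "bij_betw finv {g \<in> D. act2 g k = l} {g \<in> D. act2 g l = k}"
        by (rule bij_betwI[where g = finv]) (use sub kl dg.inv_inv_D in auto)
      hence "f l k = (\<Prod>g\<in>{g \<in> D. act2 g k = l}. dg.m (finv g))"
        unfolding f_def by (rule prod.reindex_bij_betw[symmetric])
      also have "... = f k l" unfolding f_def using dg.m_inv by (intro prod.cong) auto
      finally show "f k l = f l k" by simp
    qed
    \<comment> \<open>The elements of \<open>D\<close> other than \<open>id\<close> are grouped by
      the image of \<open>k\<close>, which is never \<open>k\<close> itself.\<close>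
    moreover have "(\<Prod>l\<in>{..<n2} - {k}. f k l) = M" if k: "k < n2" for k
    proof -
      have idk: "act2 id k = k" using act_id[OF sa2 Gal_closed(1) k ia2] by blast
      have "f k l = (\<Prod>g\<in>{g \<in> D - {id}. act2 g k = l}. dg.m g)" if "l \<in> {..<n2} - {k}" for l
        unfolding f_def using that idk by (intro prod.cong) auto
      hence "(\<Prod>l\<in>{..<n2} - {k}. f k l) = (\<Prod>l\<in>{..<n2} - {k}. \<Prod>g\<in>{g \<in> D - {id}. act2 g k = l}. dg.m g)"
        by (intro prod.cong) auto
      also have "... = M" unfolding M_def
      proof (rule prod.group)
        show "(\<lambda>g. act2 g k) ` (D - {id}) \<subseteq> {..<n2} - {k}"
        proof
          fix y assume "y \<in> (\<lambda>g. act2 g k) ` (D - {id})"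
          then obtain g where g: "g \<in> D" "g ~= id" "y = act2 g k" by blast
          have gG: "g \<in> Gal" using g(1) DG by blast
          show "y \<in> {..<n2} - {k}" using act2(1)[OF gG k] free[OF gG g(2) k] g(3) by simp
        qed
      qed (use dg.D_finite in auto)
      finally show ?thesis .
    qed
    ultimately show ?thesis by simp
  qed
  have "L.nv (\<psi> d1) ^ n2 \<le> (M ^ (n1 - fx)) ^ n2" using d1_bound L.nv_nonneg by (intro power_mono)
  also have "... = (M ^ n2) ^ (n1 - fx)" by (simp add: power_mult[symmetric] mult.commute)
  also have "... \<le> L.nv (\<psi> d2) ^ (n1 - fx)" using d2_bound M0 by (intro power_mono) auto
  finally have main: "L.nv (\<psi> d1) ^ n2 \<le> L.nv (\<psi> d2) ^ (n1 - fx)" .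
  \<comment> \<open>On the small field the absolute value at \<open>Q\<close> is a power of the one
    at \<open>P\<close>. The exponent depends on the ramification, but it is common to both
    discriminants and cancels.\<close>
  define w where "w = L.nv (\<psi> F.unif)"
  have u0: "F.unif ~= 0" using F.nv_unif by auto
  have w: "0 < w" "w < 1"
  proof -
    show "0 < w" unfolding w_def using L.nv_pos u0 psi_eq_0 by simp
    show "w < 1" unfolding w_def using PQ[OF F.unif(3)] F.unif(1) L.nv_P_iff by blast
  qed
  have cmp: "L.nv (\<psi> z) = w powi (F.val z)" if "z ~= 0" for z
    unfolding w_def
  proof (rule F.multiplicative_compare[where w = "\<lambda>z. L.nv (\<psi> z)"])
    show "L.nv (\<psi> (x * y)) = L.nv (\<psi> x) * L.nv (\<psi> y)" for x y by (simp add: psi_mult L.nv_mult)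
    show "L.nv (\<psi> s) = 1" if "s \<in> F.ints - P" for s
      using PQ[of s] that L.nv_P_iff[of "\<psi> s"] L.nv_ints[of "\<psi> s"] by auto
  qed (rule that)
  have d0: "d1 ~= 0" "d2 ~= 0"
    using d sa1 sa2 psi_eq_0[of d1] psi_eq_0[of d2] by (auto simp: split_alg_def)
  have pw: "(w powi k) ^ m = w powr (real_of_int (int m * k))" for k m
  proof -
    have "w powi k = w powr (real_of_int k)" using w(1) by (simp add: powr_real_of_int')
    hence "(w powi k) ^ m = (w powr (real_of_int k)) powr (real m)" using w(1) by (simp add: powr_realpow)
    also have "... = w powr (real_of_int (int m * k))" by (simp add: powr_powr mult.commute)
    finally show ?thesis .
  qed
  have "w powr (real_of_int (int n2 * F.val d1)) \<le> w powr (real_of_int (int (n1 - fx) * F.val d2))"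
    using main unfolding cmp[OF d0(1)] cmp[OF d0(2)] pw .
  hence "real_of_int (int (n1 - fx) * F.val d2) \<le> real_of_int (int n2 * F.val d1)"
    using w powr_less_mono'[of w] by (meson linorder_not_le)
  thus ?thesis by linarith
qed

end

section \<open>Finite extensions of arithmetic fields\<close>

definition is_subfield :: "'a::field set => bool" where
  "is_subfield k \<longleftrightarrow> is_subring k \<and> (\<forall>x\<in>k. inverse x \<in> k)"

text \<open>Gaussian elimination, one equation and one unknown at a time, stays inside the
  subfield.\<close>

lemma subfield_dependence:
  fixes A :: "'i => 'j => 'a::field"
  assumes k: "is_subfield k" and "finite I" "finite J" "card I < card J"
    and "\<And>i j. i \<in> I ==> j \<in> J ==> A i j \<in> k"
  shows "\<exists>c. (\<forall>j\<in>J. c j \<in> k) \<and> (\<exists>j\<in>J. c j ~= 0) \<and> (\<forall>i\<in>I. (\<Sum>j\<in>J. A i j * c j) = 0)"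
  using assms(2-)
proof (induction I arbitrary: J A rule: finite_induct)
  case empty
  have "is_subring k" using k by (simp add: is_subfield_def)
  then show ?case using empty by (intro exI[of _ "\<lambda>_. 1"]) (auto simp: is_subring_closed(1) card_gt_0_iff)
next
  case (insert i0 I)
  have R: "is_subring k" using k by (simp add: is_subfield_def)
  show ?case
  proof (cases "\<forall>j\<in>J. A i0 j = 0")
    case True
    have "card I < card J" using insert by simp
    then obtain c where "\<forall>j\<in>J. c j \<in> k" "\<exists>j\<in>J. c j ~= 0" "\<forall>i\<in>I. (\<Sum>j\<in>J. A i j * c j) = 0"
      using insert.IH[of J A] insert.prems by auto
    thus ?thesis using True by (intro exI[of _ c]) auto
  next
    case False
    then obtain j0 where j0: "j0 \<in> J" "A i0 j0 ~= 0" by blast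
    define A' where "A' i j = A i j - A i j0 * inverse (A i0 j0) * A i0 j" for i j
    have A'k: "A' i j \<in> k" if "i \<in> I" "j \<in> J - {j0}" for i j
      unfolding A'_def using that insert.prems(3) j0 k
      by (intro is_subring_closed(3,4)[OF R]) (auto simp: is_subfield_def)
    have "card I < card (J - {j0})" using insert j0 by simp
    then obtain c where c: "\<forall>j\<in>J - {j0}. c j \<in> k" "\<exists>j\<in>J - {j0}. c j ~= 0" "\<forall>i\<in>I. (\<Sum>j\<in>J - {j0}. A' i j * c j) = 0"
      using insert.IH[of "J - {j0}" A'] insert.prems A'k by auto
    define s where "s = (\<Sum>j\<in>J - {j0}. A i0 j * c j)"
    define c' where "c' j = (if j = j0 then - (inverse (A i0 j0) * s) else c j)" for j
    have sum: "(\<Sum>j\<in>J. A i j * c' j) = - (A i j0 * inverse (A i0 j0) * s) + (\<Sum>j\<in>J - {j0}. A i j * c j)" for i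
      using j0 insert.prems(1) by (subst sum.remove[of _ j0]) (auto simp: c'_def mult.assoc intro!: sum.cong)
    have "(\<Sum>j\<in>J. A i0 j * c' j) = 0" unfolding sum using j0 by (simp add: s_def)
    moreover have "(\<Sum>j\<in>J. A i j * c' j) = 0" if "i \<in> I" for i
    proof -
      have "0 = (\<Sum>j\<in>J - {j0}. A' i j * c j)" using c(3) that by simp
      also have "... = (\<Sum>j\<in>J - {j0}. A i j * c j) - A i j0 * inverse (A i0 j0) * s"
        unfolding A'_def s_def by (simp add: left_diff_distrib sum_subtractf sum_distrib_left mult.assoc)
      finally show ?thesis unfolding sum by simp
    qed
    moreover have "s \<in> k" unfolding s_def using c(1) insert.prems(3)
      by (intro is_subring_sum[OF R] is_subring_closed(4)[OF R]) auto
    hence "c' j \<in> k" if "j \<in> J" for j using that c(1) k j0 insert.prems(3)[of i0 j0]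
      by (auto simp: c'_def is_subfield_def intro!: is_subring_closed(4,5)[OF R])
    moreover have "\<exists>j\<in>J. c' j ~= 0" using c(2) by (auto simp: c'_def)
    ultimately show ?thesis by (intro exI[of _ c']) auto
  qed
qed

definition fractions :: "'a::field set => 'a set" where
  "fractions R = {a / b | a b. a \<in> R \<and> b \<in> R \<and> b ~= 0}"

lemma is_subfield_fractions: assumes R: "is_subring R" shows "is_subfield (fractions R)"
  unfolding is_subfield_def is_subring_def
proof (intro conjI ballI)
  show "1 \<in> fractions R" unfolding fractions_def using is_subring_closed(1)[OF R]
    by (intro CollectI exI[of _ 1]) simp
  fix x y assume "x \<in> fractions R" "y \<in> fractions R"
  then obtain a b c d where *: "a \<in> R" "b \<in> R" "b ~= 0" "x = a / b" "c \<in> R" "d \<in> R" "d ~= 0" "y = c / d"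
    unfolding fractions_def by blast
  have "x - y = (a * d - c * b) / (b * d)" "x * y = (a * c) / (b * d)" using * by (auto simp: field_simps)
  moreover have "a * d - c * b \<in> R" "a * c \<in> R" "b * d \<in> R" using * is_subring_closed(3,4)[OF R] by auto
  moreover have "b * d ~= 0" using * by simp
  ultimately show "x - y \<in> fractions R" "x * y \<in> fractions R" unfolding fractions_def by blast+
next
  fix x assume "x \<in> fractions R"
  then obtain a b where *: "a \<in> R" "b \<in> R" "b ~= 0" "x = a / b" unfolding fractions_def by blast
  show "inverse x \<in> fractions R"
  proof (cases "a = 0")
    case True
    hence "inverse x = 0 / 1" using * by simp
    thus ?thesis unfolding fractions_def using is_subring_closed(1,2)[OF R] by force
  next
    case False
    hence "inverse x = b / a" using * by simp
    thus ?thesis unfolding fractions_def using * False by blast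
  qed
qed

lemma subset_fractions: "is_subring R ==> R \<subseteq> fractions R"
proof
  fix x assume "is_subring R" "x \<in> R"
  thus "x \<in> fractions R" unfolding fractions_def by (intro CollectI exI[of _ x] exI[of _ 1]) (simp add: is_subring_closed(1))
qed

text \<open>A dependence over the fractions of \<open>R\<close> becomes one over \<open>R\<close>
  after multiplication by the product of its denominators.\<close>

lemma rank_from_span:
  fixes R :: "'a::field set"
  assumes R: "is_subring R" and U: "finite U" "\<And>z. z \<in> lspan (fractions R) U"
  shows "\<exists>d::nat. \<forall>y::nat => 'a. \<exists>r. (\<forall>i\<le>d. r i \<in> R) \<and> (\<exists>i\<le>d. r i ~= 0) \<and> (\<Sum>i\<le>d. r i * y i) = 0"
proof (intro exI[of _ "card U"] allI)
  fix y :: "nat => 'a"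
  define d where "d = card U"
  have "\<forall>i. \<exists>c. (\<forall>u\<in>U. c u \<in> fractions R) \<and> y i = (\<Sum>u\<in>U. c u * u)" using U(2) unfolding lspan_def by blast
  then obtain a where a: "\<And>i u. u \<in> U ==> a i u \<in> fractions R" "\<And>i. y i = (\<Sum>u\<in>U. a i u * u)" by metis
  obtain c where c: "\<forall>j\<in>{..d}. c j \<in> fractions R" "\<exists>j\<in>{..d}. c j ~= 0" "\<forall>u\<in>U. (\<Sum>j\<in>{..d}. a j u * c j) = 0"
    using subfield_dependence[OF is_subfield_fractions[OF R] U(1), of "{..d}" "\<lambda>u j. a j u"] a(1) by (auto simp: d_def)
  have "\<forall>j. \<exists>p q. j \<le> d --> p \<in> R \<and> q \<in> R \<and> q ~= 0 \<and> c j = p / q" using c(1) unfolding fractions_def by blast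
  then obtain p q where pq: "\<And>j. j \<le> d ==> p j \<in> R \<and> q j \<in> R \<and> q j ~= 0 \<and> c j = p j / q j" by metis
  define Q where "Q = (\<Prod>j\<le>d. q j)"
  have Q0: "Q ~= 0" unfolding Q_def using pq by auto
  define r where "r j = c j * Q" for j
  have "r j \<in> R" if "j \<le> d" for j
  proof -
    have "Q = q j * (\<Prod>i\<in>{..d} - {j}. q i)" unfolding Q_def using that by (subst prod.remove[of _ j]) auto
    hence "r j = p j * (\<Prod>i\<in>{..d} - {j}. q i)" using pq[OF that] by (simp add: r_def)
    thus ?thesis using pq that by (auto intro!: is_subring_closed(4)[OF R] is_subring_prod[OF R])
  qed
  moreover have "\<exists>j\<le>d. r j ~= 0" using c(2) Q0 by (auto simp: r_def)
  moreover have "(\<Sum>j\<le>d. r j * y j) = 0"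
  proof -
    have "(\<Sum>j\<le>d. r j * y j) = (\<Sum>j\<le>d. \<Sum>u\<in>U. Q * u * (a j u * c j))"
      unfolding r_def a(2) by (simp add: sum_distrib_left algebra_simps)
    also have "... = (\<Sum>u\<in>U. \<Sum>j\<le>d. Q * u * (a j u * c j))" by (rule sum.swap)
    also have "... = 0" unfolding sum_distrib_left[symmetric] using c(3) by (intro sum.neutral) simp
    finally show ?thesis .
  qed
  ultimately show "\<exists>r. (\<forall>i\<le>card U. r i \<in> R) \<and> (\<exists>i\<le>card U. r i ~= 0) \<and> (\<Sum>i\<le>card U. r i * y i) = 0"
    unfolding d_def by blast
qed

text \<open>An equation of least degree has a nonzero constant term, so it expresses the inverse as
  a polynomial in \<open>z\<close> over \<open>k\<close>.\<close>

lemma integral_inverse: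
  assumes k: "is_subfield k" and S: "is_subring S" "k \<subseteq> S" and z: "z \<in> S" "integral_over k z"
  shows "inverse z \<in> (S :: 'a::field set)"
proof (cases "z = 0")
  case True thus ?thesis using z by simp
next
  case False
  obtain m where m: "\<exists>a. (\<forall>i<m. a i \<in> k) \<and> z ^ m + (\<Sum>i<m. a i * z ^ i) = 0"
    and least: "\<And>m'. m' < m ==> \<not> (\<exists>a. (\<forall>i<m'. a i \<in> k) \<and> z ^ m' + (\<Sum>i<m'. a i * z ^ i) = 0)"
    using z(2) exists_least_iff[of "\<lambda>m. \<exists>a. (\<forall>i<m. a i \<in> k) \<and> z ^ m + (\<Sum>i<m. a i * z ^ i) = 0"]
    unfolding integral_over_def by auto
  then obtain a where a: "\<forall>i<m. a i \<in> k" "z ^ m + (\<Sum>i<m. a i * z ^ i) = 0" by auto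
  obtain m' where m': "m = Suc m'" using a by (cases m) auto
  define w where "w = z ^ m' + (\<Sum>i<m'. a (Suc i) * z ^ i)"
  have eq: "z * w + a 0 = 0"
    using a(2) unfolding m' w_def sum.lessThan_Suc_shift by (simp add: algebra_simps sum_distrib_left)
  have a0: "a 0 ~= 0"
  proof
    assume "a 0 = 0"
    hence "w = 0" using eq False by simp
    moreover have "\<forall>i<m'. a (Suc i) \<in> k" using a(1) m' by simp
    ultimately have "\<exists>b. (\<forall>i<m'. b i \<in> k) \<and> z ^ m' + (\<Sum>i<m'. b i * z ^ i) = 0"
      unfolding w_def by (intro exI[of _ "\<lambda>i. a (Suc i)"]) simp
    thus False using least[of m'] m' by simp
  qed
  have "z * w = - a 0" using eq by (simp add: add_eq_0_iff2)
  hence "inverse z = - (w * inverse (a 0))" using False a0 by (simp add: field_simps)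
  moreover have "inverse (a 0) \<in> S" using k a(1) m' S(2) by (auto simp: is_subfield_def)
  moreover have "w \<in> S" unfolding w_def using z(1) a(1) m' S
    by (intro is_subring_closed(6)[OF S(1)] is_subring_sum[OF S(1)] is_subring_closed(4)[OF S(1)] is_subring_power[OF S(1)]) auto
  ultimately show ?thesis using is_subring_closed(4,5)[OF S(1)] by simp
qed

context field_extension begin

lemma is_subfield_range: "is_subfield (range \<psi>)"
  unfolding is_subfield_def using range_subring psi_inverse[symmetric] by auto

text \<open>The elements that multiply the span of \<open>T\<close> into itself form a ring, closed
  under inverses because its elements are integral over a field. It contains the generators and so
  is everything; as \<open>T\<close> contains 1, the span is everything too.\<close>

lemma finite_span_over_base:
  assumes sa: "split_alg n B" "split_alg n' B'" and gen: "generates n B n' B'"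
  shows "\<exists>T. finite T \<and> (\<forall>z. z \<in> lspan (range \<psi>) T)"
proof -
  let ?k = "range \<psi>"
  have R: "is_subring ?k" by (rule range_subring)
  have int: "integral_over ?k (v i)" if sa: "split_alg m C" and v: "v \<in> alg_vecs m C" "i < m" for m C v i
  proof -
    obtain a where a: "\<forall>k. \<psi> (a k) \<in> UNIV" "\<forall>i<m. v i ^ m + (\<Sum>k<m. \<psi> (a k) * v i ^ k) = 0"
      using alg_vec_integral_equation[OF sa v(1), of UNIV] by (auto simp: is_subring_def)
    thus ?thesis unfolding integral_over_def using v(2) by (intro exI[of _ m] exI[of _ "\<lambda>k. \<psi> (a k)"]) auto
  qed
  define Y where "Y = (\<lambda>(i,j). B i j) ` ({..<n} \<times> {..<n}) \<union> (\<lambda>(i,j). B' i j) ` ({..<n'} \<times> {..<n'})"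
  have "finite Y" by (simp add: Y_def)
  moreover have "integral_over ?k a" if "a \<in> Y" for a
    using that int[OF sa(1) alg_vecs_base] int[OF sa(2) alg_vecs_base] by (auto simp: Y_def)
  ultimately obtain T where T: "finite T" "1 \<in> T" "\<And>a b. a \<in> Y ==> b \<in> T ==> a * b \<in> lspan ?k T"
    using finite_integral_stable_lspan[OF R, of Y] by blast
  define S where "S = {z. \<forall>b\<in>T. z * b \<in> lspan ?k T}"
  have SY: "x \<in> S" if "x \<in> Y" for x using T(3) that by (simp add: S_def)
  have Sk: "?k \<subseteq> S" unfolding S_def using lspan_smult[OF R lspan_base[OF R T(1)]] by blast
  have S: "is_subring S" unfolding is_subring_def
  proof (intro conjI ballI)
    show "1 \<in> S" using Sk is_subring_closed(1)[OF R] by blast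
    fix x y assume xy: "x \<in> S" "y \<in> S"
    show "x - y \<in> S" unfolding S_def
    proof (intro CollectI ballI)
      fix b assume b: "b \<in> T"
      have "(x - y) * b = x * b + (-1) * (y * b)" by (simp add: algebra_simps)
      moreover have "x * b \<in> lspan ?k T" "y * b \<in> lspan ?k T" using xy b by (auto simp: S_def)
      moreover have "-1 \<in> ?k" using is_subring_closed(1,5)[OF R] by blast
      ultimately show "(x - y) * b \<in> lspan ?k T" using lspan_add[OF R] lspan_smult[OF R] by metis
    qed
    show "x * y \<in> S" unfolding S_def
    proof (intro CollectI ballI)
      fix b assume b: "b \<in> T"
      show "x * y * b \<in> lspan ?k T" using lspan_mult[OF R, of "y * b" T x T] xy b by (simp add: S_def mult.assoc)
    qed
  qed
  have "S = UNIV"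
  proof (rule gen[unfolded generates_def, rule_format, of S], intro conjI ballI allI impI)
    show "x - y \<in> S" "x * y \<in> S" if "x \<in> S" "y \<in> S" for x y using is_subring_closed(3,4)[OF S] that by auto
    show "inverse x \<in> S" if x: "x \<in> S" for x
    proof (rule integral_inverse[OF is_subfield_range S Sk x])
      show "integral_over ?k x" using x T(2) by (intro integral_over_if_stable_lspan[OF R T(1)] bexI[of _ 1]) (auto simp: S_def)
    qed
    show "?k \<subseteq> S" by (rule Sk)
    have comb: "v i \<in> S" if v: "v \<in> alg_vecs m C" "i < m" and C: "\<And>j. j < m ==> C i j \<in> S" for m C v i
    proof -
      obtain c where "v i = (\<Sum>j<m. \<psi> (c j) * C i j)" using v by (auto simp: alg_vecs_def)
      thus ?thesis using C Sk by (auto intro!: is_subring_sum[OF S] is_subring_closed(4)[OF S])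
    qed
    show "v i \<in> S" if "v \<in> alg_vecs n B" "i < n" for v i
      using that by (intro comb[of v n B i] SY) (auto simp: Y_def)
    show "v i \<in> S" if "v \<in> alg_vecs n' B'" "i < n'" for v i
      using that by (intro comb[of v n' B' i] SY) (auto simp: Y_def)
  qed
  hence "z * 1 \<in> lspan ?k T" for z using T(2) unfolding S_def by blast
  thus ?thesis using T(1) by auto
qed

text \<open>The dependence property concerns the larger field and comes from the products of two
  spanning sets, as for the degree in a tower. The other properties are transported along
  \<psi>.\<close>

lemma arith_ring_extension:
  assumes R: "arith_ring R p" and U: "finite U" "\<And>z. z \<in> lspan (fractions R) U"
    and sa: "split_alg n B" "split_alg n' B'" and gen: "generates n B n' B'"
  shows "arith_ring (\<psi> ` R) p"
proof -
  interpret F: arith_ring R p by (rule R)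
  have nat: "\<psi> (of_nat k) = of_nat k" for k by (induction k) (auto simp: psi_0 psi_1 psi_add)
  have sub: "is_subring (\<psi> ` R)" unfolding is_subring_def
  proof (intro conjI ballI)
    show "1 \<in> \<psi> ` R" using psi_1 is_subring_closed(1)[OF F.subring] by (metis imageI)
    fix x y assume "x \<in> \<psi> ` R" "y \<in> \<psi> ` R"
    then obtain a b where ab: "a \<in> R" "b \<in> R" "x = \<psi> a" "y = \<psi> b" by blast
    have "x - y = \<psi> (a - b)" "x * y = \<psi> (a * b)" using ab by (simp_all add: psi_diff psi_mult)
    thus "x - y \<in> \<psi> ` R" "x * y \<in> \<psi> ` R" using ab is_subring_closed(3,4)[OF F.subring] by blast+
  qed
  obtain T where T: "finite T" "\<And>z. z \<in> lspan (range \<psi>) T" using finite_span_over_base[OF sa gen] by blast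
  define W where "W = (\<lambda>(u,t). \<psi> u * t) ` (U \<times> T)"
  have fW: "finite W" using U T by (simp add: W_def)
  let ?k = "fractions (\<psi> ` R)"
  have kR: "is_subring ?k" using is_subfield_fractions[OF sub] by (simp add: is_subfield_def)
  have psik: "\<psi> c \<in> ?k" if c: "c \<in> fractions R" for c
  proof -
    obtain a b where ab: "a \<in> R" "b \<in> R" "b ~= 0" "c = a / b" using c unfolding fractions_def by blast
    have "\<psi> c = \<psi> a / \<psi> b" using ab by (simp add: divide_inverse psi_mult psi_inverse)
    moreover have "\<psi> b ~= 0" using psi_eq_0 ab by simp
    ultimately show ?thesis unfolding fractions_def using ab by blast
  qed
  have "z \<in> lspan ?k W" for z
  proof -
    obtain c where c: "\<forall>t\<in>T. c t \<in> range \<psi>" "z = (\<Sum>t\<in>T. c t * t)" using T(2)[of z] unfolding lspan_def by blast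
    have "c t * t \<in> lspan ?k W" if t: "t \<in> T" for t
    proof -
      obtain a where a: "c t = \<psi> a" using c(1) t by blast
      obtain r where r: "\<forall>u\<in>U. r u \<in> fractions R" "a = (\<Sum>u\<in>U. r u * u)" using U(2)[of a] unfolding lspan_def by blast
      have "c t * t = (\<Sum>u\<in>U. \<psi> (r u) * (\<psi> u * t))" unfolding a r(2) by (simp add: psi_sum psi_mult sum_distrib_right mult.assoc)
      also have "... \<in> lspan ?k W"
      proof (rule lspan_sum[OF kR])
        fix u assume u: "u \<in> U"
        have w: "\<psi> u * t \<in> W" using u t by (auto simp: W_def)
        have "\<psi> (r u) \<in> ?k" using psik r(1) u by blast
        thus "\<psi> (r u) * (\<psi> u * t) \<in> lspan ?k W" using lspan_smult[OF kR lspan_base[OF kR fW w]] by blast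
      qed
      finally show ?thesis .
    qed
    thus ?thesis unfolding c(2) by (intro lspan_sum[OF kR])
  qed
  note rk = rank_from_span[OF sub fW this]
  show ?thesis
  proof (rule arith_ring.intro, goal_cases)
    case (3 r)
    then obtain a where a: "a \<in> R" "r = \<psi> a" by blast
    obtain i s where "i < p" "s \<in> R" "a = of_nat i + of_nat p * s" using F.residue[OF a(1)] by blast
    thus ?case using a(2) by (auto simp: psi_add psi_mult nat)
  next
    case (4 r)
    then obtain a where a: "a \<in> R" "r = \<psi> a" by blast
      hence "a ~= 0" using 4(2) psi_0 by auto
      then obtain k where k: "\<forall>s\<in>R. a ~= of_nat p ^ k * s" using F.separated[OF a(1)] by blast
      have "r ~= of_nat p ^ k * \<psi> s" if "s \<in> R" for s
      proof
        assume "r = of_nat p ^ k * \<psi> s"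
        hence "\<psi> a = \<psi> (of_nat p ^ k * s)" using a(2) by (simp add: psi_mult psi_power nat)
        thus False using psi_inj k that by blast
      qed
      thus ?case by blast
  qed (use sub F.prime_p rk in auto)
qed

end

text \<open>The bridge between a field given by a record and a type of class
  \<open>field_char_0\<close>, over which matrices, determinants and polynomials are
  available.\<close>

locale field_copy =
  fixes F :: "('f, 'm) ring_scheme" (structure) and e :: "'f => 'a::field_char_0"
  assumes field_F: "field F"
    and e_bij: "bij_betw e (carrier F) UNIV"
    and e_add: "\<And>x y. x \<in> carrier F ==> y \<in> carrier F ==> e (x \<oplus> y) = e x + e y"
    and e_mult: "\<And>x y. x \<in> carrier F ==> y \<in> carrier F ==> e (x \<otimes> y) = e x * e y"
    and e_one: "e \<one> = 1"
begin

sublocale F: field F by (rule field_F)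

lemma e_inj: "x \<in> carrier F ==> y \<in> carrier F ==> e x = e y ==> x = y"
  using e_bij by (auto simp: bij_betw_def inj_on_def)

lemma e_surj: "\<exists>x\<in>carrier F. e x = z" using e_bij by (metis UNIV_I bij_betw_def imageE)

lemma e_zero: "e \<zero> = 0" using e_add[of \<zero> \<zero>] by simp

lemma e_eq_0: "x \<in> carrier F ==> e x = 0 \<longleftrightarrow> x = \<zero>" using e_inj[of x \<zero>] e_zero by auto

lemma e_minus: assumes "x \<in> carrier F" shows "e (\<ominus> x) = - e x"
proof -
  have "e (x \<oplus> \<ominus> x) = e x + e (\<ominus> x)" using assms by (intro e_add) auto
  thus ?thesis using assms e_zero by (simp add: F.r_neg add_eq_0_iff)
qed

lemma e_inv: assumes "x \<in> carrier F" "x ~= \<zero>" shows "e (inv x) = inverse (e x)"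
proof -
  have u: "x \<in> Units F" using assms F.field_Units by simp
  have "e (x \<otimes> inv x) = e x * e (inv x)" using assms u by (intro e_mult) auto
  thus ?thesis using u e_one by (metis F.Units_r_inv inverse_unique)
qed

lemma e_finsum: "finite I ==> f \<in> I \<rightarrow> carrier F ==> e (\<Oplus>i\<in>I. f i) = (\<Sum>i\<in>I. e (f i))"
proof (induction I rule: finite_induct)
  case empty thus ?case by (simp add: e_zero)
next
  case (insert i I)
  have "(\<Oplus>i\<in>I. f i) \<in> carrier F" using insert by (intro F.finsum_closed) auto
  thus ?case using insert by (simp add: F.finsum_insert e_add Pi_def)
qed

lemma e_finprod: "finite I ==> f \<in> I \<rightarrow> carrier F ==> e (\<Otimes>i\<in>I. f i) = (\<Prod>i\<in>I. e (f i))"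
proof (induction I rule: finite_induct)
  case empty thus ?case by (simp add: e_one)
next
  case (insert i I)
  have "(\<Otimes>i\<in>I. f i) \<in> carrier F" using insert by (intro F.finprod_closed) auto
  thus ?case using insert by (simp add: F.finprod_insert e_mult Pi_def)
qed

lemma e_pow: "x \<in> carrier F ==> e (x [^] (k::nat)) = e x ^ k"
  by (induction k) (auto simp: e_one e_mult mult.commute)

lemma integral_closure_iff:
  assumes "B \<subseteq> carrier F" "x \<in> carrier F"
  shows "x \<in> integral_closure F B \<longleftrightarrow> integral_over (e ` B) (e x)"
proof
  assume "x \<in> integral_closure F B"
  then obtain m a where ma: "\<forall>i<m. a i \<in> B" "x [^] (m::nat) \<oplus> (\<Oplus>i\<in>{..<m}. a i \<otimes> x [^] i) = \<zero>"
    unfolding integral_closure_def by blast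
  have cl: "(\<lambda>i. a i \<otimes> x [^] i) \<in> {..<m} \<rightarrow> carrier F" using ma(1) assms by auto
  have "e x ^ m + (\<Sum>i<m. e (a i) * e x ^ i) = e (x [^] m \<oplus> (\<Oplus>i\<in>{..<m}. a i \<otimes> x [^] i))"
    using assms ma(1) cl F.finsum_closed[OF cl] by (subst e_add) (auto simp: e_finsum e_pow e_mult subset_iff)
  hence "e x ^ m + (\<Sum>i<m. e (a i) * e x ^ i) = 0" using ma(2) e_zero by simp
  thus "integral_over (e ` B) (e x)" unfolding integral_over_def using ma(1)
    by (intro exI[of _ m] exI[of _ "\<lambda>i. e (a i)"]) auto
next
  assume "integral_over (e ` B) (e x)"
  then obtain m c where mc: "\<forall>i<m. c i \<in> e ` B" "e x ^ m + (\<Sum>i<m. c i * e x ^ i) = 0"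
    unfolding integral_over_def by blast
  have "\<forall>i. \<exists>a. i < m --> a \<in> B \<and> c i = e a" using mc(1) by blast
  then obtain a where a: "\<And>i. i < m ==> a i \<in> B \<and> c i = e (a i)" by metis
  have cl: "(\<lambda>i. a i \<otimes> x [^] i) \<in> {..<m} \<rightarrow> carrier F" using a assms by auto
  have "e (x [^] m \<oplus> (\<Oplus>i\<in>{..<m}. a i \<otimes> x [^] i)) = e x ^ m + (\<Sum>i<m. e (a i) * e x ^ i)"
    using assms a cl F.finsum_closed[OF cl] by (subst e_add) (auto simp: e_finsum e_pow e_mult subset_iff)
  also have "... = 0" using mc(2) a by simp
  finally have "x [^] m \<oplus> (\<Oplus>i\<in>{..<m}. a i \<otimes> x [^] i) = \<zero>"
    using e_eq_0 F.finsum_closed[OF cl] assms by simp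
  thus "x \<in> integral_closure F B" unfolding integral_closure_def using a assms by blast
qed

lemma finite_dimension_span:
  assumes H: "H \<subseteq> carrier F" and k: "is_subfield k" "e ` H \<subseteq> k"
    and fd: "F.finite_dimension (generate_field F H) (carrier F)"
  shows "\<exists>U. finite U \<and> (\<forall>z. z \<in> lspan k U)"
proof -
  have kR: "is_subring k" using k by (simp add: is_subfield_def)
  let ?K = "generate_field F H"
  have Kc: "?K \<subseteq> carrier F" by (rule F.generate_field_incl[OF H])
  have Kk: "e x \<in> k" if "x \<in> ?K" for x
    using that
  proof (induction x rule: generate_field.induct)
    case one show ?case using e_one is_subring_closed(1)[OF kR] by simp
  next
    case (incl h) thus ?case using k(2) by blast
  next
    case (a_inv h) thus ?case using e_minus[of h] Kc is_subring_closed(5)[OF kR] by auto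
  next
    case (m_inv h) thus ?case using e_inv[of h] Kc k(1) by (auto simp: is_subfield_def)
  next
    case (eng_add h1 h2)
    have "h1 \<in> carrier F" "h2 \<in> carrier F" using eng_add(1,2) Kc by blast+
    thus ?case using is_subring_closed(6)[OF kR eng_add(3,4)] by (simp add: e_add)
  next
    case (eng_mult h1 h2)
    have "h1 \<in> carrier F" "h2 \<in> carrier F" using eng_mult(1,2) Kc by blast+
    thus ?case using is_subring_closed(4)[OF kR eng_mult(3,4)] by (simp add: e_mult)
  qed
  obtain d where d: "F.dimension d ?K (carrier F)" using fd unfolding F.finite_dimension_def by blast
  obtain Vs where Vs: "set Vs \<subseteq> carrier F" "F.Span ?K Vs = carrier F"
    using F.exists_base[OF F.generate_field_is_subfield[OF H] d] by blast
  have comb: "e (F.combine Ks Us) \<in> lspan k (e ` set Vs) \<and> F.combine Ks Us \<in> carrier F" if "set Ks \<subseteq> ?K" "set Us \<subseteq> set Vs" for Ks Us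
    using that
  proof (induction Ks Us rule: F.combine.induct)
    case (1 c Ks u Us)
    hence IH: "e (F.combine Ks Us) \<in> lspan k (e ` set Vs)" "F.combine Ks Us \<in> carrier F" by auto
    have cu: "c \<in> carrier F" "u \<in> carrier F" "e c \<in> k" "e u \<in> e ` set Vs" using 1(2,3) Kc Kk Vs(1) by auto
    have "e (F.combine (c # Ks) (u # Us)) = e c * e u + e (F.combine Ks Us)"
      using cu IH by (simp add: e_add e_mult)
    also have "... \<in> lspan k (e ` set Vs)"
      by (rule lspan_add[OF kR lspan_smult[OF kR lspan_base[OF kR _ cu(4)] cu(3)] IH(1)]) simp
    finally show ?case using cu IH by simp
  qed (simp_all add: e_zero lspan_zero[OF kR])
  have "z \<in> lspan k (e ` set Vs)" for z
  proof -
    obtain x where x: "x \<in> carrier F" "e x = z" using e_surj by blast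
    then obtain Ks where "set Ks \<subseteq> ?K" "x = F.combine Ks Vs"
      using Vs(2) F.Span_eq_combine_set[OF F.generate_field_is_subfield[OF H] Vs(1)] by blast
    thus ?thesis using comb[of Ks Vs] x by auto
  qed
  thus ?thesis by (intro exI[of _ "e ` set Vs"]) auto
qed

end

section \<open>Primes above the integers and the p-adic integers\<close>

definition typed_prime :: "'a::field set => 'a set => bool" where
  "typed_prime R P \<longleftrightarrow> P \<subseteq> {z. integral_over R z} \<and> (\<forall>x\<in>P. \<forall>y\<in>P. x + y \<in> P) \<and>
     (\<forall>z. integral_over R z --> (\<forall>x\<in>P. z * x \<in> P)) \<and>
     (\<forall>x y. integral_over R x --> integral_over R y --> x * y \<in> P --> x \<in> P \<or> y \<in> P) \<and> 1 \<notin> P \<and> (\<exists>x\<in>P. x ~= 0)"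

lemma typed_primeD:
  assumes "typed_prime R P"
  shows "x \<in> P ==> integral_over R x" "1 \<notin> P"
    "integral_over R z ==> x \<in> P ==> z * x \<in> P"
    "integral_over R x ==> integral_over R y ==> x * y \<in> P ==> x \<in> P \<or> y \<in> P"
proof -
  note P = assms[unfolded typed_prime_def]
  show "x \<in> P ==> integral_over R x" using P by blast
  show "1 \<notin> P" using P by blast
  show "integral_over R z ==> x \<in> P ==> z * x \<in> P" using P[THEN conjunct2, THEN conjunct2, THEN conjunct1] by simp
  show "integral_over R x ==> integral_over R y ==> x * y \<in> P ==> x \<in> P \<or> y \<in> P"
    using P[THEN conjunct2, THEN conjunct2, THEN conjunct2, THEN conjunct1] by simp
qed

lemma arith_placeI:
  assumes "arith_ring R p" "typed_prime R P" "of_nat p \<in> P"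
  shows "arith_place R p P"
proof -
  interpret arith_ring R p by fact
  show ?thesis using assms(2,3) by unfold_locales (auto simp: typed_prime_def ints_def)
qed

lemma typed_prime_meets_R:
  assumes "arith_ring R p" "typed_prime R P" shows "\<exists>r\<in>R \<inter> P. r ~= 0"
proof -
  interpret arith_ring R p by fact
  obtain x where x: "x \<in> P" "x ~= 0" "x \<in> ints" using assms(2) by (auto simp: typed_prime_def ints_def)
  obtain w where w: "w \<in> ints" "x * w \<in> R" "x * w ~= 0" using nonzero_multiple_in_R[OF x(3,2)] by blast
  have "w * x \<in> P" using assms(2) w(1) x(1) by (auto simp: typed_prime_def ints_def)
  hence "x * w \<in> P" by (simp add: mult.commute)
  thus ?thesis using w by blast
qed

lemma arith_ring_Ints:
  assumes p: "Factorial_Ring.prime p"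
    and rk: "\<exists>d::nat. \<forall>y::nat => 'a::field_char_0. \<exists>r. (\<forall>i\<le>d. r i \<in> \<int>) \<and> (\<exists>i\<le>d. r i ~= 0) \<and> (\<Sum>i\<le>d. r i * y i) = 0"
  shows "arith_ring (\<int> :: 'a set) p"
proof unfold_locales
  show "is_subring (\<int> :: 'a set)" by (auto simp: is_subring_def)
  show "Factorial_Ring.prime p" by fact
  show "\<exists>d::nat. \<forall>y::nat => 'a. \<exists>r. (\<forall>i\<le>d. r i \<in> \<int>) \<and> (\<exists>i\<le>d. r i ~= 0) \<and> (\<Sum>i\<le>d. r i * y i) = 0" by fact
  have p0: "int p > 1" using prime_gt_1_nat[OF p] by simp
  fix r :: 'a assume "r \<in> \<int>"
  then obtain k where k: "r = of_int k" by (auto elim: Ints_cases)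
  have "k = int (nat (k mod int p)) + int p * (k div int p)" using p0 by simp
  hence "r = of_int (int (nat (k mod int p)) + int p * (k div int p))" using k by metis
  hence req: "r = of_nat (nat (k mod int p)) + of_nat p * of_int (k div int p)" by simp
  have "nat (k mod int p) < p" using p0 pos_mod_bound[of "int p" k] by linarith
  thus "\<exists>i<p. \<exists>s\<in>\<int>. r = of_nat i + of_nat p * s"
    by (intro exI[of _ "nat (k mod int p)"] conjI bexI[of _ "of_int (k div int p)"] req) auto
  assume "r ~= 0"
  hence k0: "k ~= 0" using k by auto
  \<comment> \<open>\<open>p ^ m\<close> exceeds \<open>m\<close>, the absolute value of
    \<open>k\<close>, and so cannot divide the nonzero integer \<open>k\<close>.\<close>
  define m where "m = nat \<bar>k\<bar>"
  have "r ~= of_nat p ^ m * s" if s: "s \<in> \<int>" for s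
  proof
    assume eq: "r = of_nat p ^ m * s"
    obtain l where l: "s = of_int l" using s by (auto elim: Ints_cases)
    have "of_int k = (of_int (int p ^ m * l) :: 'a)" using eq k l by simp
    hence kl: "k = int p ^ m * l" by (simp only: of_int_eq_iff)
    hence "\<bar>l\<bar> \<ge> 1" using k0 by auto
    hence "int p ^ m * 1 \<le> int p ^ m * \<bar>l\<bar>" using p0 by (intro mult_left_mono) auto
    also have "... = \<bar>k\<bar>" unfolding kl abs_mult by simp
    finally have "int p ^ m \<le> int m" by (simp add: m_def)
    moreover have "m < p ^ m" using prime_gt_1_nat[OF p] by (intro power_gt_expt) auto
    hence "int m < int p ^ m" by (metis of_nat_less_iff of_nat_power)
    ultimately show False by simp
  qed
  thus "\<exists>k. \<forall>s\<in>\<int>. r ~= of_nat p ^ k * s" by blast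
qed

lemma prime_number_in_typed_prime:
  assumes P: "typed_prime R P" and R: "is_subring R" and k: "k > 0" "of_nat k \<in> P"
  shows "\<exists>p. Factorial_Ring.prime p \<and> of_nat p \<in> P"
  using k
proof (induction k rule: less_induct)
  case (less k)
  have "k ~= 1" using less.prems P by (auto simp: typed_prime_def)
  then obtain q where q: "Factorial_Ring.prime q" "q dvd k" using prime_factor_nat by blast
  then obtain l where l: "k = q * l" by blast
  have int: "integral_over R (of_nat j)" for j using integral_over_mem[OF R is_subring_of_nat[OF R]] .
  have "of_nat q * of_nat l \<in> P" using less.prems(2) l by simp
  hence "of_nat q \<in> P \<or> of_nat l \<in> P" by (rule typed_primeD(4)[OF P int int])
  thus ?case
  proof
    assume "of_nat q \<in> P" thus ?thesis using q by blast
  next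
    assume "of_nat l \<in> P"
    moreover have "l > 0" "l < k" using l less.prems(1) prime_gt_1_nat[OF q(1)] by auto
    ultimately show ?thesis using less.IH by blast
  qed
qed

text \<open>A nonzero element of \<open>P\<close> has a nonzero multiple among the integers of the
  ground ring; up to sign it is a positive natural number in \<open>P\<close>, and one of its prime
  factors is in \<open>P\<close>.\<close>

lemma ex_place_Ints:
  fixes P :: "'a::field_char_0 set"
  assumes ar: "\<And>p. Factorial_Ring.prime p ==> arith_ring (\<int> :: 'a set) p" and P: "typed_prime \<int> P"
  shows "\<exists>p. arith_place \<int> p P"
proof -
  have Z: "is_subring (\<int> :: 'a set)" by (auto simp: is_subring_def)
  obtain r where r: "r \<in> \<int>" "r \<in> P" "r ~= 0" using typed_prime_meets_R[OF ar[OF two_is_prime_nat] P] by blast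
  obtain k where k: "r = of_int k" using r(1) by (auto elim: Ints_cases)
  have int: "integral_over \<int> (-1 :: 'a)" using integral_over_mem[OF Z, of "-1"] by simp
  have "(-1) * r \<in> P" by (rule typed_primeD(3)[OF P int r(2)])
  hence "of_nat (nat \<bar>k\<bar>) \<in> P" using r(2) k by (cases "k \<ge> 0") auto
  then obtain p where p: "Factorial_Ring.prime p" "of_nat p \<in> P"
    using prime_number_in_typed_prime[OF P Z, of "nat \<bar>k\<bar>"] r(3) k by auto
  thus ?thesis using arith_placeI[OF ar[OF p(1)] P p(2)] by blast
qed

lemma padic_mod:
  assumes x: "x \<in> carrier (padic_int_ring p)" and "j \<le> k"
  shows "x k mod int p ^ j = x j"
  using assms(2)
proof (induction k rule: dec_induct)
  case base
  have "x j \<in> {0..<int p ^ j}" using x by (simp add: padic_int_ring_def)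
  thus ?case by simp
next
  case (step k)
  have "int p ^ j dvd int p ^ k" using step by (simp add: le_imp_power_dvd)
  hence "x (Suc k) mod int p ^ j = (x (Suc k) mod int p ^ k) mod int p ^ j" by (simp add: mod_mod_cancel)
  also have "x (Suc k) mod int p ^ k = x k" using x by (simp add: padic_int_ring_def)
  finally show ?case using step by simp
qed

lemma padicI:
  assumes p: "p > 0" and "\<And>k. u (Suc k) mod int p ^ k = u k mod int p ^ k"
  shows "(\<lambda>k. u k mod int p ^ k) \<in> carrier (padic_int_ring p)"
proof -
  have "u (Suc k) mod int p ^ Suc k mod int p ^ k = u k mod int p ^ k" for k
    using assms(2)[of k] mod_mod_cancel[of "int p ^ k" "int p ^ Suc k" "u (Suc k)"] by simp
  thus ?thesis using p by (simp add: padic_int_ring_def)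
qed

locale padic_embedding =
  fixes p :: nat and \<theta> :: "(nat => int) => 'a::field_char_0"
  assumes p: "Factorial_Ring.prime p"
    and \<theta>_add: "\<And>x y. x \<in> carrier (padic_int_ring p) ==> y \<in> carrier (padic_int_ring p) ==> \<theta> (x \<oplus>\<^bsub>padic_int_ring p\<^esub> y) = \<theta> x + \<theta> y"
    and \<theta>_mult: "\<And>x y. x \<in> carrier (padic_int_ring p) ==> y \<in> carrier (padic_int_ring p) ==> \<theta> (x \<otimes>\<^bsub>padic_int_ring p\<^esub> y) = \<theta> x * \<theta> y"
    and \<theta>_one: "\<theta> \<one>\<^bsub>padic_int_ring p\<^esub> = 1"
    and \<theta>_inj: "inj_on \<theta> (carrier (padic_int_ring p))"
begin

abbreviation "Zp \<equiv> carrier (padic_int_ring p)"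

lemma p_pos: "p > 0" using prime_gt_0_nat[OF p] .

lemma Zp_range: "x \<in> Zp ==> x k mod int p ^ k = x k"
  by (rule padic_mod) auto

lemma Zp_Suc: "x \<in> Zp ==> x (Suc k) mod int p ^ k = x k"
  by (rule padic_mod) auto

lemma padic_ops: "x \<oplus>\<^bsub>padic_int_ring p\<^esub> y = (\<lambda>k. (x k + y k) mod int p ^ k)"
  "x \<otimes>\<^bsub>padic_int_ring p\<^esub> y = (\<lambda>k. (x k * y k) mod int p ^ k)" "\<one>\<^bsub>padic_int_ring p\<^esub> = (\<lambda>k. 1 mod int p ^ k)"
  by (simp_all add: padic_int_ring_def)

lemma padic_closed:
  assumes "x \<in> Zp" "y \<in> Zp"
  shows "(\<lambda>k. (x k + y k) mod int p ^ k) \<in> Zp" "(\<lambda>k. (x k * y k) mod int p ^ k) \<in> Zp" "(\<lambda>k. (x k - y k) mod int p ^ k) \<in> Zp"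
proof -
  note s = Zp_Suc[OF assms(1)] Zp_Suc[OF assms(2)]
  show "(\<lambda>k. (x k + y k) mod int p ^ k) \<in> Zp" by (rule padicI[OF p_pos]) (metis s mod_add_eq)
  show "(\<lambda>k. (x k * y k) mod int p ^ k) \<in> Zp" by (rule padicI[OF p_pos]) (metis s mod_mult_eq)
  show "(\<lambda>k. (x k - y k) mod int p ^ k) \<in> Zp" by (rule padicI[OF p_pos]) (metis s mod_diff_eq)
qed

lemma padic_nat_closed: "(\<lambda>k. int m mod int p ^ k) \<in> Zp" by (rule padicI[OF p_pos]) simp

lemma \<theta>_diff: assumes "x \<in> Zp" "y \<in> Zp" shows "\<theta> (\<lambda>k. (x k - y k) mod int p ^ k) = \<theta> x - \<theta> y"
proof -
  have "(\<lambda>k. (x k - y k) mod int p ^ k) \<oplus>\<^bsub>padic_int_ring p\<^esub> y = x"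
    unfolding padic_ops using Zp_range[OF assms(1)] by (simp add: fun_eq_iff mod_add_left_eq)
  thus ?thesis using \<theta>_add[OF padic_closed(3)[OF assms] assms(2)] by simp
qed

lemma \<theta>_nat: "\<theta> (\<lambda>k. int m mod int p ^ k) = of_nat m"
proof (induction m)
  case 0
  have "(\<lambda>k. int 0 mod int p ^ k) = (\<lambda>k. (1 mod int p ^ k - 1 mod int p ^ k) mod int p ^ k)" by simp
  moreover have one: "(\<lambda>k. 1 mod int p ^ k) \<in> Zp" using padic_nat_closed[of 1] by simp
  ultimately show ?case using \<theta>_diff[OF one one] by simp
next
  case (Suc m)
  have one: "(\<lambda>k. 1 mod int p ^ k) \<in> Zp" using padic_nat_closed[of 1] by simp
  have "(\<lambda>k. int (Suc m) mod int p ^ k) = (\<lambda>k. int m mod int p ^ k) \<oplus>\<^bsub>padic_int_ring p\<^esub> \<one>\<^bsub>padic_int_ring p\<^esub>"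
    unfolding padic_ops by (simp add: fun_eq_iff mod_add_eq add.commute)
  thus ?case using \<theta>_add[OF padic_nat_closed[of m], of "\<one>\<^bsub>padic_int_ring p\<^esub>"] one Suc \<theta>_one by (simp add: padic_ops)
qed

lemma padic_subring: "is_subring (\<theta> ` Zp)"
  unfolding is_subring_def
proof (intro conjI ballI)
  show "1 \<in> \<theta> ` Zp" using \<theta>_nat[of 1] padic_nat_closed[of 1] by (metis image_eqI of_nat_1)
  fix a b assume "a \<in> \<theta> ` Zp" "b \<in> \<theta> ` Zp"
  then obtain x y where xy: "x \<in> Zp" "y \<in> Zp" "a = \<theta> x" "b = \<theta> y" by blast
  show "a - b \<in> \<theta> ` Zp" using \<theta>_diff[OF xy(1,2)] padic_closed(3)[OF xy(1,2)] xy by (metis image_eqI)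
  have "a * b = \<theta> (x \<otimes>\<^bsub>padic_int_ring p\<^esub> y)" using \<theta>_mult[OF xy(1,2)] xy by simp
  moreover have "x \<otimes>\<^bsub>padic_int_ring p\<^esub> y \<in> Zp" using padic_closed(2)[OF xy(1,2)] by (simp add: padic_ops)
  ultimately show "a * b \<in> \<theta> ` Zp" by blast
qed

lemma padic_residue:
  assumes x: "x \<in> Zp" shows "\<exists>s\<in>Zp. \<theta> x = of_nat (nat (x 1)) + of_nat p * \<theta> s"
proof -
  have x1: "0 \<le> x 1" "x 1 < int p"
    using Zp_range[OF x, of 1] p_pos pos_mod_bound[of "int p" "x 1"] pos_mod_sign[of "int p" "x 1"] by auto
  have xm: "x (Suc k) mod int p = x 1" for k using padic_mod[OF x, of 1 "Suc k"] by simp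
  \<comment> \<open>Division by \<open>p\<close> costs one digit, so level \<open>k\<close> of the
    quotient is computed from level \<open>k + 1\<close> of \<open>x\<close>.\<close>
  define u where "u k = (x (Suc k) - x 1) div int p" for k
  have pu: "int p * u k = x (Suc k) - x 1" for k
  proof -
    have "int p dvd x (Suc k) - x 1" using xm[of k] by (metis dvd_minus_mod)
    thus ?thesis by (simp add: u_def)
  qed
  define s where "s k = u k mod int p ^ k" for k
  have s: "s \<in> Zp" unfolding s_def
  proof (rule padicI[OF p_pos])
    fix k
    have "x (Suc (Suc k)) mod int p ^ Suc k = x (Suc k)" by (rule Zp_Suc[OF x])
    hence "int p ^ Suc k dvd x (Suc (Suc k)) - x (Suc k)" by (metis dvd_minus_mod)
    moreover have "x (Suc (Suc k)) - x (Suc k) = int p * (u (Suc k) - u k)" using pu[of k] pu[of "Suc k"] by (simp add: algebra_simps)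
    ultimately have "int p ^ k dvd u (Suc k) - u k" using p_pos by simp
    thus "u (Suc k) mod int p ^ k = u k mod int p ^ k" by (simp add: mod_eq_dvd_iff)
  qed
  define P where "P = (\<lambda>k. int p mod int p ^ k)"
  define i where "i = (\<lambda>k. int (nat (x 1)) mod int p ^ k)"
  have P: "P \<in> Zp" and i: "i \<in> Zp" unfolding P_def i_def by (rule padic_nat_closed)+
  have Ps: "P \<otimes>\<^bsub>padic_int_ring p\<^esub> s \<in> Zp" using padic_closed(2)[OF P s] by (simp add: padic_ops)
  have "i \<oplus>\<^bsub>padic_int_ring p\<^esub> (P \<otimes>\<^bsub>padic_int_ring p\<^esub> s) = x"
  proof
    fix k
    have "(i \<oplus>\<^bsub>padic_int_ring p\<^esub> (P \<otimes>\<^bsub>padic_int_ring p\<^esub> s)) k = (x 1 + int p * u k) mod int p ^ k"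
      unfolding padic_ops i_def P_def s_def using x1 by (simp add: mod_add_eq mod_mult_eq)
    also have "... = x (Suc k) mod int p ^ k" using pu[of k] by simp
    finally show "(i \<oplus>\<^bsub>padic_int_ring p\<^esub> (P \<otimes>\<^bsub>padic_int_ring p\<^esub> s)) k = x k" using Zp_Suc[OF x] by simp
  qed
  hence "\<theta> x = \<theta> i + \<theta> P * \<theta> s" using \<theta>_add[OF i Ps] \<theta>_mult[OF P s] by simp
  moreover have "\<theta> i = of_nat (nat (x 1))" unfolding i_def by (rule \<theta>_nat)
  moreover have "\<theta> P = of_nat p" unfolding P_def by (rule \<theta>_nat)
  ultimately show ?thesis using s by metis
qed

text \<open>Multiples of \<open>p ^ k\<close> have component 0 at level \<open>k\<close>, so any
  level at which \<open>x\<close> is nonzero gives the exponent.\<close>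

lemma padic_separated:
  assumes x: "x \<in> Zp" "\<theta> x ~= 0" shows "\<exists>k. \<forall>s\<in>Zp. \<theta> x ~= of_nat p ^ k * \<theta> s"
proof -
  have "\<exists>k. x k ~= 0"
  proof (rule ccontr)
    assume "\<not> ?thesis"
    hence "x = (\<lambda>k. int 0 mod int p ^ k)" by auto
    thus False using \<theta>_nat[of 0] x(2) by simp
  qed
  then obtain k where k: "x k ~= 0" by blast
  have "\<theta> x ~= of_nat p ^ k * \<theta> s" if s: "s \<in> Zp" for s
  proof
    assume eq: "\<theta> x = of_nat p ^ k * \<theta> s"
    have "\<theta> x = \<theta> (\<lambda>j. int (p ^ k) mod int p ^ j) * \<theta> s" using eq \<theta>_nat[of "p ^ k"] by simp
    also have "... = \<theta> ((\<lambda>j. int (p ^ k) mod int p ^ j) \<otimes>\<^bsub>padic_int_ring p\<^esub> s)"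
      by (rule \<theta>_mult[OF padic_nat_closed s, symmetric])
    finally have eq: "\<theta> x = \<theta> ((\<lambda>j. int (p ^ k) mod int p ^ j) \<otimes>\<^bsub>padic_int_ring p\<^esub> s)" .
    have "(\<lambda>j. int (p ^ k) mod int p ^ j) \<otimes>\<^bsub>padic_int_ring p\<^esub> s \<in> Zp"
      unfolding padic_ops by (rule padic_closed(2)[OF padic_nat_closed s])
    hence "x = (\<lambda>j. int (p ^ k) mod int p ^ j) \<otimes>\<^bsub>padic_int_ring p\<^esub> s" by (rule inj_onD[OF \<theta>_inj eq x(1)])
    hence "x k = ((\<lambda>j. int (p ^ k) mod int p ^ j) \<otimes>\<^bsub>padic_int_ring p\<^esub> s) k" by (rule fun_cong)
    also have "... = 0" unfolding padic_ops by simp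
    finally show False using k by simp
  qed
  thus ?thesis by blast
qed

lemma padic_unit:
  assumes x: "x \<in> Zp" "x 1 ~= 0" shows "\<exists>y\<in>Zp. \<theta> x * \<theta> y = 1"
proof -
  have cop: "coprime (x k) (int p ^ k)" for k
  proof (cases k)
    case (Suc j)
    have "x k mod int p = x 1" using padic_mod[OF x(1), of 1 k] Suc by simp
    hence "\<not> int p dvd x k" using x(2) by (auto simp: dvd_eq_mod_eq_0)
    hence "coprime (int p) (x k)" using p by (simp add: prime_imp_coprime)
    thus ?thesis by (simp add: coprime_commute)
  qed simp
  have "\<forall>k. \<exists>y. (x k * y) mod int p ^ k = 1 mod int p ^ k"
  proof
    fix k
    obtain a b where "a * x k + b * int p ^ k = gcd (x k) (int p ^ k)" using bezout_int by blast
    hence "a * x k + b * int p ^ k = 1" using cop[of k] by (simp add: coprime_iff_gcd_eq_1)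
    hence "x k * a = 1 - b * int p ^ k" by (simp add: algebra_simps)
    hence "(x k * a) mod int p ^ k = 1 mod int p ^ k" by (metis mod_diff_right_eq mod_mult_self2_is_0 diff_zero)
    thus "\<exists>y. (x k * y) mod int p ^ k = 1 mod int p ^ k" by blast
  qed
  \<comment> \<open>The inverses at the single levels are chosen independently. After reduction they
    are compatible, because an inverse of \<open>x k\<close> modulo \<open>p ^ k\<close> is
    unique.\<close>
  then obtain y where y: "\<And>k. (x k * y k) mod int p ^ k = 1 mod int p ^ k" by metis
  define z where "z k = y k mod int p ^ k" for k
  have z: "z \<in> Zp" unfolding z_def
  proof (rule padicI[OF p_pos])
    fix k
    have "(x (Suc k) * y (Suc k)) mod int p ^ k = 1 mod int p ^ k"
      using arg_cong[OF y[of "Suc k"], of "\<lambda>t. t mod int p ^ k"] by (simp add: mod_mod_cancel)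
    moreover have "(x (Suc k) * y (Suc k)) mod int p ^ k = (x k * y (Suc k)) mod int p ^ k"
      using Zp_Suc[OF x(1), of k] by (metis mod_mult_left_eq)
    ultimately have "(x k * y (Suc k)) mod int p ^ k = (x k * y k) mod int p ^ k" using y[of k] by simp
    hence "int p ^ k dvd x k * y (Suc k) - x k * y k" by (simp add: mod_eq_dvd_iff)
    hence "int p ^ k dvd x k * (y (Suc k) - y k)" by (simp add: right_diff_distrib)
    hence "int p ^ k dvd y (Suc k) - y k" using cop[of k] by (simp add: coprime_commute coprime_dvd_mult_right_iff)
    thus "y (Suc k) mod int p ^ k = y k mod int p ^ k" by (simp add: mod_eq_dvd_iff)
  qed
  have "x \<otimes>\<^bsub>padic_int_ring p\<^esub> z = \<one>\<^bsub>padic_int_ring p\<^esub>"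
    unfolding padic_ops z_def using y by (simp add: fun_eq_iff mod_mult_right_eq)
  thus ?thesis using \<theta>_mult[OF x(1) z] \<theta>_one z by auto
qed

lemma arith_ring_padic:
  assumes rk: "\<exists>d::nat. \<forall>y::nat => 'a. \<exists>r. (\<forall>i\<le>d. r i \<in> \<theta> ` Zp) \<and> (\<exists>i\<le>d. r i ~= 0) \<and> (\<Sum>i\<le>d. r i * y i) = 0"
  shows "arith_ring (\<theta> ` Zp) p"
proof unfold_locales
  show "is_subring (\<theta> ` Zp)" by (rule padic_subring)
  show "Factorial_Ring.prime p" by (rule p)
  show "\<exists>d::nat. \<forall>y::nat => 'a. \<exists>r. (\<forall>i\<le>d. r i \<in> \<theta> ` Zp) \<and> (\<exists>i\<le>d. r i ~= 0) \<and> (\<Sum>i\<le>d. r i * y i) = 0" by fact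
  fix r assume "r \<in> \<theta> ` Zp"
  then obtain x where x: "x \<in> Zp" "r = \<theta> x" by blast
  have "nat (x 1) < p" using Zp_range[OF x(1), of 1] p_pos pos_mod_bound[of "int p" "x 1"] by auto
  thus "\<exists>i<p. \<exists>s\<in>\<theta> ` Zp. r = of_nat i + of_nat p * s" using padic_residue[OF x(1)] x(2) by blast
  assume "r ~= 0"
  thus "\<exists>k. \<forall>s\<in>\<theta> ` Zp. r ~= of_nat p ^ k * s" using padic_separated[OF x(1)] x(2) by blast
qed

text \<open>Every nonzero element of the ground ring is a power of \<open>p\<close> times a unit, so
  a nonzero prime contains a power of \<open>p\<close> and hence \<open>p\<close>.\<close>

lemma ex_place_padic:
  assumes ar: "arith_ring (\<theta> ` Zp) p" and P: "typed_prime (\<theta> ` Zp) P"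
  shows "\<exists>q. arith_place (\<theta> ` Zp) q P"
proof -
  interpret arith_ring "\<theta> ` Zp" p by fact
  obtain r where r: "r \<in> \<theta> ` Zp" "r \<in> P" "r ~= 0" using typed_prime_meets_R[OF ar P] by blast
  obtain K where K: "\<forall>s\<in>\<theta> ` Zp. r ~= of_nat p ^ K * s" and least: "\<And>k. k < K ==> \<not> (\<forall>s\<in>\<theta> ` Zp. r ~= of_nat p ^ k * s)"
    using separated[OF r(1,3)] exists_least_iff[of "\<lambda>K. \<forall>s\<in>\<theta> ` Zp. r ~= of_nat p ^ K * s"] by auto
  have "K ~= 0" using K r(1) by (cases K) auto
  then obtain j where j: "K = Suc j" by (cases K) auto
  obtain z where z: "z \<in> Zp" "r = of_nat p ^ j * \<theta> z" using least[of j] j by auto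
  have "z 1 ~= 0"
  proof
    assume "z 1 = 0"
    then obtain s where "s \<in> Zp" "\<theta> z = of_nat p * \<theta> s" using padic_residue[OF z(1)] by auto
    thus False using K j z(2) by auto
  qed
  then obtain w where w: "w \<in> Zp" "\<theta> z * \<theta> w = 1" using padic_unit[OF z(1)] by blast
  have "integral_over (\<theta> ` Zp) (\<theta> w)" using w(1) by (intro integral_over_mem[OF subring]) simp
  hence "\<theta> w * r \<in> P" by (rule typed_primeD(3)[OF P _ r(2)])
  moreover have "\<theta> w * r = of_nat p ^ j * (\<theta> z * \<theta> w)" unfolding z(2) by (simp only: ac_simps)
  ultimately have pj: "of_nat p ^ j \<in> P" using w(2) by simp
  have int: "integral_over (\<theta> ` Zp) (of_nat p ^ i)" for i using ints_closed(7)[OF ints_closed(8)] by (simp add: ints_def)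
  have "of_nat p \<in> P" using pj
  proof (induction j)
    case 0 thus ?case using P by (simp add: typed_prime_def)
  next
    case (Suc j)
    have "of_nat p \<in> P \<or> of_nat p ^ j \<in> P" using typed_primeD(4)[OF P int[of 1] int[of j]] Suc.prems by simp
    thus ?case using Suc.IH by blast
  qed
  thus ?thesis using arith_placeI[OF ar P] by blast
qed

end

lemma (in field_copy) frac_extension_typed:
  fixes S :: "'s ring"
  assumes \<iota>: "\<iota> \<in> Ring.ring_hom S F" and fd: "F.finite_dimension (generate_field F (\<iota> ` carrier S)) (carrier F)"
    and R: "R = e ` \<iota> ` carrier S" "is_subring R"
  shows "\<exists>U. finite U \<and> (\<forall>z. z \<in> lspan (fractions R) U)"
    "integral_closure F (\<iota> ` carrier S) \<subseteq> carrier F"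
    "e ` integral_closure F (\<iota> ` carrier S) = {z. integral_over R z}"
proof -
  let ?H = "\<iota> ` carrier S"
  have H: "?H \<subseteq> carrier F" using \<iota> by (auto simp: Ring.ring_hom_def)
  show "\<exists>U. finite U \<and> (\<forall>z. z \<in> lspan (fractions R) U)"
    by (rule finite_dimension_span[OF H is_subfield_fractions[OF R(2)] _ fd]) (use subset_fractions[OF R(2)] R(1) in auto)
  show sub: "integral_closure F ?H \<subseteq> carrier F" by (auto simp: integral_closure_def)
  show "e ` integral_closure F ?H = {z. integral_over R z}"
  proof (intro equalityI subsetI)
    fix z assume "z \<in> e ` integral_closure F ?H"
    then obtain x where x: "x \<in> integral_closure F ?H" "z = e x" by blast
    thus "z \<in> {z. integral_over R z}" using integral_closure_iff[OF H, of x] sub R(1) by auto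
  next
    fix z assume z: "z \<in> {z. integral_over R z}"
    obtain x where x: "x \<in> carrier F" "e x = z" using e_surj by blast
    hence "x \<in> integral_closure F ?H" using integral_closure_iff[OF H, of x] z R(1) by simp
    thus "z \<in> e ` integral_closure F ?H" using x by blast
  qed
qed

text \<open>Number fields and p-adic fields meet here in one interface. The prime number
  \<open>p\<close> is quantified separately for each \<open>P\<close>, since over the integers it
  depends on \<open>P\<close>.\<close>

lemma base_field_typed:
  fixes F :: "'f ring" and e :: "'f => 'a::field_char_0"
  assumes "field_copy F e" and bf: "base_field F \<O>"
  shows "\<exists>R U. is_subring R \<and> finite U \<and> (\<forall>z. z \<in> lspan (fractions R) U) \<and> \<O> \<subseteq> carrier F \<and>
     e ` \<O> = {z. integral_over R z} \<and> (\<exists>p. arith_ring R p) \<and> (\<forall>P. typed_prime R P --> (\<exists>p. arith_place R p P))"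
proof -
  interpret field_copy F e by fact
  from bf consider (num) "finite_ext_of_frac int_ring F \<O>"
    | (padic) p where "Factorial_Ring.prime p" "finite_ext_of_frac (padic_int_ring p) F \<O>"
    unfolding base_field_def by blast
  thus ?thesis
  proof cases
    case num
    then obtain \<iota> where \<iota>: "\<iota> \<in> Ring.ring_hom int_ring F"
      and fd: "F.finite_dimension (generate_field F (\<iota> ` carrier int_ring)) (carrier F)"
      and O: "\<O> = integral_closure F (\<iota> ` carrier int_ring)" unfolding finite_ext_of_frac_def by blast
    have cl: "\<iota> k \<in> carrier F" for k using \<iota> by (auto simp: Ring.ring_hom_def)
    have add: "e (\<iota> (k + l)) = e (\<iota> k) + e (\<iota> l)" for k l using \<iota> cl e_add by (simp add: Ring.ring_hom_def)
    have one: "e (\<iota> 1) = 1" using \<iota> e_one by (simp add: Ring.ring_hom_def)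
    have "e (\<iota> k) = of_int k" for k
    proof (induction k rule: int_induct[where k = 0])
      case base show ?case using add[of 0 0] by simp
    next
      case (step1 i) thus ?case using add[of i 1] one by simp
    next
      case (step2 i) thus ?case using add[of "i - 1" 1] one by simp
    qed
    hence Z: "e ` \<iota> ` carrier int_ring = \<int>" by (auto simp: Ints_def image_comp)
    have sr: "is_subring (\<int> :: 'a set)" by (auto simp: is_subring_def)
    note ft = frac_extension_typed[OF \<iota> fd Z[symmetric] sr]
    obtain U where U: "finite U" "\<And>z::'a. z \<in> lspan (fractions \<int>) U" using ft(1) by blast
    have ar: "arith_ring (\<int> :: 'a set) q" if "Factorial_Ring.prime q" for q
      using arith_ring_Ints[OF that rank_from_span[OF sr U]] .
    show ?thesis
    proof (rule exI[of _ "\<int>"], rule exI[of _ U], intro conjI allI impI)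
      show "\<exists>p. arith_ring (\<int> :: 'a set) p" using ar[OF two_is_prime_nat] by blast
      show "\<exists>p. arith_place \<int> p P" if "typed_prime \<int> P" for P :: "'a set" using ex_place_Ints[OF ar that] .
    qed (use sr U ft O in auto)
  next
    case (padic p)
    then obtain \<iota> where \<iota>: "\<iota> \<in> Ring.ring_hom (padic_int_ring p) F" and inj: "inj_on \<iota> (carrier (padic_int_ring p))"
      and fd: "F.finite_dimension (generate_field F (\<iota> ` carrier (padic_int_ring p))) (carrier F)"
      and O: "\<O> = integral_closure F (\<iota> ` carrier (padic_int_ring p))" unfolding finite_ext_of_frac_def by blast
    define \<theta> where "\<theta> x = e (\<iota> x)" for x
    have cl: "\<iota> x \<in> carrier F" if "x \<in> carrier (padic_int_ring p)" for x using \<iota> that by (auto simp: Ring.ring_hom_def)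
    have th: "\<And>x y. x \<in> carrier (padic_int_ring p) ==> y \<in> carrier (padic_int_ring p) ==> \<theta> (x \<oplus>\<^bsub>padic_int_ring p\<^esub> y) = \<theta> x + \<theta> y"
      "\<And>x y. x \<in> carrier (padic_int_ring p) ==> y \<in> carrier (padic_int_ring p) ==> \<theta> (x \<otimes>\<^bsub>padic_int_ring p\<^esub> y) = \<theta> x * \<theta> y"
      "\<theta> \<one>\<^bsub>padic_int_ring p\<^esub> = 1"
      using \<iota> cl e_add e_mult e_one by (simp_all add: Ring.ring_hom_def \<theta>_def)
    have thi: "inj_on \<theta> (carrier (padic_int_ring p))"
      using inj cl e_inj unfolding \<theta>_def inj_on_def by blast
    have R: "\<theta> ` carrier (padic_int_ring p) = e ` \<iota> ` carrier (padic_int_ring p)" unfolding \<theta>_def by (simp add: image_comp comp_def)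
    let ?R = "\<theta> ` carrier (padic_int_ring p)"
    interpret Q: padic_embedding p \<theta> by unfold_locales (fact padic(1) th thi)+
    note sr = Q.padic_subring
    note ft = frac_extension_typed[OF \<iota> fd R sr]
    obtain U where U: "finite U" "\<And>z. z \<in> lspan (fractions ?R) U" using ft(1) by blast
    note ar = Q.arith_ring_padic[OF rank_from_span[OF sr U]]
    note pl = Q.ex_place_padic[OF ar]
    show ?thesis
    proof (rule exI[of _ ?R], rule exI[of _ U], intro conjI allI impI)
      show "\<exists>p. arith_ring ?R p" using ar by blast
      show "\<exists>q. arith_place ?R q P" if "typed_prime ?R P" for P using pl[OF that] .
    qed (use sr U ft O in auto)
  qed
qed

section \<open>Bases and discriminants of etale algebras\<close>

context field_copy begin

definition dec :: "'a => 'f" where "dec a = inv_into (carrier F) e a"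

lemma dec_closed [simp, intro]: "dec a \<in> carrier F"
  unfolding dec_def using e_surj[of a] by (intro inv_into_into) auto

lemma e_dec [simp]: "e (dec a) = a"
  unfolding dec_def using e_surj[of a] by (intro f_inv_into_f) auto

lemma dec_e [simp]: "x \<in> carrier F ==> dec (e x) = x" by (intro e_inj) auto

lemma dec_add: "dec (a + b) = dec a \<oplus> dec b" by (intro e_inj) (auto simp: e_add)

lemma dec_mult: "dec (a * b) = dec a \<otimes> dec b" by (intro e_inj) (auto simp: e_mult)

lemma dec_one: "dec 1 = \<one>" by (intro e_inj) (auto simp: e_one)

lemma dec_zero: "dec 0 = \<zero>" by (intro e_inj) (auto simp: e_zero)

end

locale copy_module = field_copy F e + M: module F K
  for F :: "'f ring" (structure) and e :: "'f => 'a::field_char_0" and K :: "('f, 'k) module"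
begin

lemma abelian_group_K: "abelian_group K" using M.module_axioms by (simp add: module_def)

definition smul :: "'a => 'k => 'k" where "smul a x = dec a \<odot>\<^bsub>K\<^esub> x"

lemma smul_closed [simp, intro]: "x \<in> carrier K ==> smul a x \<in> carrier K" by (simp add: smul_def)

lemma smul_add: "x \<in> carrier K ==> smul (a + b) x = smul a x \<oplus>\<^bsub>K\<^esub> smul b x"
  by (simp add: smul_def dec_add M.smult_l_distr)

lemma smul_plus: "x \<in> carrier K ==> y \<in> carrier K ==> smul a (x \<oplus>\<^bsub>K\<^esub> y) = smul a x \<oplus>\<^bsub>K\<^esub> smul a y"
  by (simp add: smul_def M.smult_r_distr)

lemma smul_mult: "x \<in> carrier K ==> smul (a * b) x = smul a (smul b x)"
  by (simp add: smul_def dec_mult M.smult_assoc1)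

lemma smul_one: "x \<in> carrier K ==> smul 1 x = x" by (simp add: smul_def dec_one)

lemma smul_null: "x \<in> carrier K ==> smul 0 x = \<zero>\<^bsub>K\<^esub>" by (simp add: smul_def dec_zero M.smult_l_null)

lemma smul_zero: "smul a \<zero>\<^bsub>K\<^esub> = \<zero>\<^bsub>K\<^esub>" by (simp add: smul_def M.smult_r_null)

definition comb :: "nat => (nat => 'k) => (nat => 'a) => 'k" where
  "comb m b c = (\<Oplus>\<^bsub>K\<^esub> i\<in>{..<m}. smul (c i) (b i))"

lemma comb_0: "comb 0 b c = \<zero>\<^bsub>K\<^esub>" by (simp add: comb_def)

lemma comb_Suc: "b \<in> {..<Suc m} \<rightarrow> carrier K ==> comb (Suc m) b c = smul (c m) (b m) \<oplus>\<^bsub>K\<^esub> comb m b c"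
  unfolding comb_def lessThan_Suc by (intro M.M.finsum_insert) auto

lemma comb_closed: "b \<in> {..<m} \<rightarrow> carrier K ==> comb m b c \<in> carrier K"
  unfolding comb_def by (intro M.M.finsum_closed) auto

lemma comb_cong: "b \<in> {..<m} \<rightarrow> carrier K ==> (\<And>i. i < m ==> c i = c' i) ==> (\<And>i. i < m ==> b' i = b i) ==> comb m b c = comb m b' c'"
  unfolding comb_def by (intro M.M.finsum_cong') (auto simp: Pi_iff)

lemma comb_add: "b \<in> {..<m} \<rightarrow> carrier K ==> comb m b (\<lambda>i. c i + d i) = comb m b c \<oplus>\<^bsub>K\<^esub> comb m b d"
proof -
  assume b: "b \<in> {..<m} \<rightarrow> carrier K"
  have "comb m b (\<lambda>i. c i + d i) = (\<Oplus>\<^bsub>K\<^esub> i\<in>{..<m}. smul (c i) (b i) \<oplus>\<^bsub>K\<^esub> smul (d i) (b i))"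
    unfolding comb_def using b by (intro M.M.finsum_cong') (auto simp: smul_add Pi_iff)
  also have "... = comb m b c \<oplus>\<^bsub>K\<^esub> comb m b d" unfolding comb_def using b by (intro M.M.finsum_addf) (auto simp: Pi_iff)
  finally show ?thesis .
qed

lemma comb_smul: "b \<in> {..<m} \<rightarrow> carrier K ==> comb m b (\<lambda>i. a * c i) = smul a (comb m b c)"
proof (induction m)
  case (Suc m)
  hence b: "b \<in> {..<m} \<rightarrow> carrier K" "b m \<in> carrier K" by auto
  thus ?case using Suc comb_closed[OF b(1)] by (simp add: comb_Suc smul_mult smul_plus)
qed (simp add: comb_0 smul_zero)

lemma comb_zero: "b \<in> {..<m} \<rightarrow> carrier K ==> comb m b (\<lambda>i. 0) = \<zero>\<^bsub>K\<^esub>"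
  using comb_smul[of b m 0 "\<lambda>i. 0"] smul_null[OF comb_closed] by simp

lemma comb_comb:
  assumes b: "b \<in> {..<m} \<rightarrow> carrier K"
  shows "comb m' (\<lambda>j. comb m b (A j)) c = comb m b (\<lambda>i. \<Sum>j<m'. c j * A j i)"
proof (induction m')
  case 0 show ?case using comb_zero[OF b] by (simp add: comb_0)
next
  case (Suc m')
  have "comb (Suc m') (\<lambda>j. comb m b (A j)) c = smul (c m') (comb m b (A m')) \<oplus>\<^bsub>K\<^esub> comb m' (\<lambda>j. comb m b (A j)) c"
    by (intro comb_Suc) (auto intro: comb_closed[OF b])
  also have "... = comb m b (\<lambda>i. c m' * A m' i + (\<Sum>j<m'. c j * A j i))"
    using comb_add[OF b, of "\<lambda>i. c m' * A m' i" "\<lambda>i. \<Sum>j<m'. c j * A j i"] comb_smul[OF b, of "c m'" "A m'"] Suc by simp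
  finally show ?case by (simp add: add.commute)
qed

lemma comb_unit:
  assumes b: "b \<in> {..<m} \<rightarrow> carrier K" and j: "j < m"
  shows "comb m b (\<lambda>i. if i = j then 1 else 0) = b j"
proof -
  have "comb m b (\<lambda>i. if i = j then 1 else 0) = (\<Oplus>\<^bsub>K\<^esub> i\<in>{..<m}. if j = i then b i else \<zero>\<^bsub>K\<^esub>)"
    unfolding comb_def using b by (intro M.M.finsum_cong') (auto simp: smul_one smul_null Pi_iff)
  also have "... = b j" using b j by (intro M.M.finsum_singleton) auto
  finally show ?thesis .
qed

definition is_basis :: "nat => (nat => 'k) => bool" where
  "is_basis m b \<longleftrightarrow> (\<forall>i<m. b i \<in> carrier K) \<and> (\<forall>x\<in>carrier K. \<exists>c. x = comb m b c) \<and>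
     (\<forall>c. comb m b c = \<zero>\<^bsub>K\<^esub> --> (\<forall>i<m. c i = 0))"

lemma is_basis_inj:
  assumes b: "is_basis m b" and eq: "comb m b c = comb m b d" and i: "i < m"
  shows "c i = d i"
proof -
  have bK: "b \<in> {..<m} \<rightarrow> carrier K" using b by (auto simp: is_basis_def)
  have "comb m b (\<lambda>i. c i - d i) \<oplus>\<^bsub>K\<^esub> comb m b d = comb m b (\<lambda>i. (c i - d i) + d i)" by (rule comb_add[OF bK, symmetric])
  hence "comb m b (\<lambda>i. c i - d i) \<oplus>\<^bsub>K\<^esub> comb m b d = \<zero>\<^bsub>K\<^esub> \<oplus>\<^bsub>K\<^esub> comb m b d"
    using eq comb_closed[OF bK, of d] by simp
  hence "comb m b (\<lambda>i. c i - d i) = \<zero>\<^bsub>K\<^esub>" using comb_closed[OF bK] by (metis M.M.add.right_cancel M.M.zero_closed)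
  thus ?thesis using b i by (auto simp: is_basis_def)
qed

lemma finsum_comb:
  assumes b: "b \<in> {..<m} \<rightarrow> carrier K" and c: "c \<in> {..<m} \<rightarrow> carrier F"
  shows "(\<Oplus>\<^bsub>K\<^esub> i\<in>{..<m}. c i \<odot>\<^bsub>K\<^esub> b i) = comb m b (\<lambda>i. e (c i))"
  unfolding comb_def using b c by (intro M.M.finsum_cong') (auto simp: smul_def Pi_iff)

lemma alg_basis_iff: "alg_basis F K m b \<longleftrightarrow> is_basis m b"
proof
  assume ab: "alg_basis F K m b"
  hence bK: "b \<in> {..<m} \<rightarrow> carrier K" by (auto simp: alg_basis_def)
  show "is_basis m b" unfolding is_basis_def
  proof (intro conjI ballI allI impI)
    show "b i \<in> carrier K" if "i < m" for i using bK that by auto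
    fix x assume "x \<in> carrier K"
    then obtain c where "c \<in> {..<m} \<rightarrow>\<^sub>E carrier F" "x = (\<Oplus>\<^bsub>K\<^esub> i\<in>{..<m}. c i \<odot>\<^bsub>K\<^esub> b i)"
      using ab unfolding alg_basis_def by blast
    thus "\<exists>c. x = comb m b c" using finsum_comb[OF bK] by (auto simp: PiE_def)
  next
    fix c i assume c: "comb m b c = \<zero>\<^bsub>K\<^esub>" and i: "i < m"
    define r where "r c = (\<lambda>i\<in>{..<m}. dec (c i))" for c
    have r: "r c \<in> {..<m} \<rightarrow>\<^sub>E carrier F" "(\<Oplus>\<^bsub>K\<^esub> i\<in>{..<m}. r c i \<odot>\<^bsub>K\<^esub> b i) = comb m b c" for c
    proof -
      show "r c \<in> {..<m} \<rightarrow>\<^sub>E carrier F" by (auto simp: r_def)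
      show "(\<Oplus>\<^bsub>K\<^esub> i\<in>{..<m}. r c i \<odot>\<^bsub>K\<^esub> b i) = comb m b c"
        unfolding comb_def using bK by (intro M.M.finsum_cong') (auto simp: smul_def r_def)
    qed
    have "\<exists>!c. c \<in> {..<m} \<rightarrow>\<^sub>E carrier F \<and> \<zero>\<^bsub>K\<^esub> = (\<Oplus>\<^bsub>K\<^esub> i\<in>{..<m}. c i \<odot>\<^bsub>K\<^esub> b i)" (is "\<exists>!c. ?Q c")
      using ab unfolding alg_basis_def by blast
    moreover have "?Q (r c)" using r[of c] c by simp
    moreover have "?Q (r (\<lambda>i. 0))" using r[of "\<lambda>i. 0"] comb_zero[OF bK] by simp
    ultimately have "r c = r (\<lambda>i. 0)" by blast
    hence "r c i = r (\<lambda>i. 0) i" by (rule fun_cong)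
    hence "dec (c i) = dec 0" using i by (simp add: r_def)
    thus "c i = 0" by (metis e_dec)
  qed
next
  assume ib: "is_basis m b"
  hence bK: "b \<in> {..<m} \<rightarrow> carrier K" by (auto simp: is_basis_def)
  show "alg_basis F K m b" unfolding alg_basis_def
  proof (intro conjI ballI allI impI)
    show "b i \<in> carrier K" if "i < m" for i using bK that by auto
    fix x assume "x \<in> carrier K"
    then obtain c where c: "x = comb m b c" using ib by (auto simp: is_basis_def)
    show "\<exists>!c. c \<in> {..<m} \<rightarrow>\<^sub>E carrier F \<and> x = (\<Oplus>\<^bsub>K\<^esub> i\<in>{..<m}. c i \<odot>\<^bsub>K\<^esub> b i)"
    proof (rule ex1I[of _ "\<lambda>i\<in>{..<m}. dec (c i)"])
      have "(\<Oplus>\<^bsub>K\<^esub> i\<in>{..<m}. (\<lambda>i\<in>{..<m}. dec (c i)) i \<odot>\<^bsub>K\<^esub> b i) = x"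
        unfolding c comb_def using bK by (intro M.M.finsum_cong') (auto simp: smul_def)
      thus "(\<lambda>i\<in>{..<m}. dec (c i)) \<in> {..<m} \<rightarrow>\<^sub>E carrier F \<and> x = (\<Oplus>\<^bsub>K\<^esub> i\<in>{..<m}. (\<lambda>i\<in>{..<m}. dec (c i)) i \<odot>\<^bsub>K\<^esub> b i)" by auto
      fix d assume d: "d \<in> {..<m} \<rightarrow>\<^sub>E carrier F \<and> x = (\<Oplus>\<^bsub>K\<^esub> i\<in>{..<m}. d i \<odot>\<^bsub>K\<^esub> b i)"
      hence dF: "d \<in> {..<m} \<rightarrow> carrier F" by (simp add: PiE_def)
      have "comb m b c = comb m b (\<lambda>i. e (d i))" using d c finsum_comb[OF bK dF] by simp
      hence "d i = dec (c i)" if "i < m" for i using is_basis_inj[OF ib _ that, of c "\<lambda>i. e (d i)"] Pi_mem[OF dF, of i] that by simp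
      thus "d = (\<lambda>i\<in>{..<m}. dec (c i))" using d by (intro extensionalityI[of _ "{..<m}"]) (auto simp: PiE_def)
    qed
  qed
qed

lemma alg_coord_eq:
  assumes b: "alg_basis F K m b" and x: "x \<in> carrier K"
  shows "x = comb m b (\<lambda>i. e (alg_coord F K m b x i))" "i < m ==> alg_coord F K m b x i \<in> carrier F"
proof -
  have "\<exists>!c. c \<in> {..<m} \<rightarrow>\<^sub>E carrier F \<and> x = (\<Oplus>\<^bsub>K\<^esub> i\<in>{..<m}. c i \<odot>\<^bsub>K\<^esub> b i)" using b x unfolding alg_basis_def by blast
  from theI'[OF this] have *: "alg_coord F K m b x \<in> {..<m} \<rightarrow>\<^sub>E carrier F"
    "x = (\<Oplus>\<^bsub>K\<^esub> i\<in>{..<m}. alg_coord F K m b x i \<odot>\<^bsub>K\<^esub> b i)" unfolding alg_coord_def by auto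
  show "i < m ==> alg_coord F K m b x i \<in> carrier F" using *(1) by auto
  have bK: "b \<in> {..<m} \<rightarrow> carrier K" using b by (auto simp: alg_basis_def)
  have "alg_coord F K m b x \<in> {..<m} \<rightarrow> carrier F" using *(1) by (simp add: PiE_def)
  from finsum_comb[OF bK this] show "x = comb m b (\<lambda>i. e (alg_coord F K m b x i))"
    by (subst *(2)) simp
qed

lemma basis_length_le:
  assumes b: "is_basis m b" and b': "is_basis m' b'"
  shows "m' \<le> m"
proof (rule ccontr)
  assume "\<not> m' \<le> m"
  hence lt: "m < m'" by simp
  have bK: "b \<in> {..<m} \<rightarrow> carrier K" using b by (auto simp: is_basis_def)
  have "\<forall>j. \<exists>c. j < m' --> b' j = comb m b c" using b b' by (auto simp: is_basis_def)
  then obtain A where A: "\<And>j. j < m' ==> b' j = comb m b (A j)" by metis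
  have U: "is_subfield (UNIV :: 'a set)" by (simp add: is_subfield_def is_subring_def)
  obtain c where c: "\<exists>j\<in>{..<m'}. c j ~= 0" "\<forall>i\<in>{..<m}. (\<Sum>j\<in>{..<m'}. A j i * c j) = 0"
    using subfield_dependence[OF U, of "{..<m}" "{..<m'}" "\<lambda>i j. A j i"] lt by auto
  have "comb m' b' c = comb m' (\<lambda>j. comb m b (A j)) c"
    using A b' by (intro comb_cong) (auto simp: is_basis_def)
  also have "... = comb m b (\<lambda>i. \<Sum>j<m'. c j * A j i)" by (rule comb_comb[OF bK])
  also have "... = comb m b (\<lambda>i. 0)" using c(2) by (intro comb_cong bK) (auto simp: mult.commute)
  finally have "comb m' b' c = \<zero>\<^bsub>K\<^esub>" using comb_zero[OF bK] by simp
  thus False using c(1) b' by (auto simp: is_basis_def)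
qed

lemma alg_degree_eq: assumes "alg_basis F K m b" shows "alg_degree F K = m"
  unfolding alg_degree_def
proof (rule the_equality)
  fix m' assume "\<exists>b'. alg_basis F K m' b'"
  then obtain b' where "alg_basis F K m' b'" by blast
  thus "m' = m" using basis_length_le assms unfolding alg_basis_iff by (metis order_antisym)
qed (use assms in blast)

lemma basis_exchange:
  assumes b: "is_basis m b" and z: "z = comb m b c" and j: "j < m" "c j ~= 0"
  shows "is_basis m (b(j := z))"
proof -
  have bK: "b \<in> {..<m} \<rightarrow> carrier K" using b by (auto simp: is_basis_def)
  have zK: "z \<in> carrier K" using comb_closed[OF bK] z by simp
  have b'K: "b(j := z) \<in> {..<m} \<rightarrow> carrier K" using bK zK by auto
  have ex: "comb m (b(j := z)) d = comb m b (\<lambda>i. (if i = j then 0 else d i) + d j * c i)" for d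
  proof -
    have "comb m (b(j := z)) d = comb m (\<lambda>k. comb m b (if k = j then c else (\<lambda>i. if i = k then 1 else 0))) d"
      using comb_unit[OF bK] z by (intro comb_cong b'K) auto
    also have "... = comb m b (\<lambda>i. \<Sum>k<m. d k * (if k = j then c else (\<lambda>i. if i = k then 1 else 0)) i)" by (rule comb_comb[OF bK])
    also have "... = comb m b (\<lambda>i. (if i = j then 0 else d i) + d j * c i)"
    proof (intro comb_cong bK refl)
      fix i assume i: "i < m"
      have "(\<Sum>k<m. d k * (if k = j then c else (\<lambda>i. if i = k then 1 else 0)) i)
        = (\<Sum>k<m. (if k = j then d j * c i else 0) + (if k = i then (if i = j then 0 else d i) else 0))"
        by (intro sum.cong) auto
      also have "... = (if i = j then 0 else d i) + d j * c i" using i j(1) by (simp add: sum.distrib)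
      finally show "(\<Sum>k<m. d k * (if k = j then c else (\<lambda>i. if i = k then 1 else 0)) i) = (if i = j then 0 else d i) + d j * c i" .
    qed
    finally show ?thesis .
  qed
  show ?thesis unfolding is_basis_def
  proof (intro conjI ballI allI impI)
    show "(b(j := z)) i \<in> carrier K" if "i < m" for i by (rule Pi_mem[OF b'K]) (use that in simp)
    fix x assume "x \<in> carrier K"
    then obtain a where a: "x = comb m b a" using b by (auto simp: is_basis_def)
    define d where "d i = (if i = j then a j / c j else a i - a j / c j * c i)" for i
    have "comb m (b(j := z)) d = x" unfolding ex a using j by (intro comb_cong bK) (auto simp: d_def)
    thus "\<exists>c. x = comb m (b(j := z)) c" by blast
  next
    fix d i assume "comb m (b(j := z)) d = \<zero>\<^bsub>K\<^esub>" and i: "i < m"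
    hence d: "\<forall>i<m. (if i = j then 0 else d i) + d j * c i = 0"
      using b unfolding ex is_basis_def by blast
    have "d j = 0" using d j by auto
    thus "d i = 0" using d i by (cases "i = j") auto
  qed
qed

lemma basis_scale:
  assumes b: "is_basis m b" and r: "r ~= 0" shows "is_basis m (\<lambda>i. smul r (b i))"
proof -
  have bK: "b \<in> {..<m} \<rightarrow> carrier K" using b by (auto simp: is_basis_def)
  have eq: "comb m (\<lambda>i. smul r (b i)) c = comb m b (\<lambda>i. c i * r)" for c
    unfolding comb_def using bK by (intro M.M.finsum_cong') (auto simp: smul_mult Pi_iff)
  show ?thesis unfolding is_basis_def eq
  proof (intro conjI ballI allI impI)
    fix x assume "x \<in> carrier K"
    then obtain a where "x = comb m b a" using b by (auto simp: is_basis_def)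
    hence "x = comb m b (\<lambda>i. a i / r * r)" using r by simp
    thus "\<exists>c. x = comb m b (\<lambda>i. c i * r)" by (rule exI[of _ "\<lambda>i. a i / r"])
  next
    fix c i assume "comb m b (\<lambda>i. c i * r) = \<zero>\<^bsub>K\<^esub>" "i < m"
    hence "c i * r = 0" using b unfolding is_basis_def by blast
    thus "c i = 0" using r by simp
  qed (use bK in auto)
qed

lemma comb_hom:
  assumes E: "copy_module F e E" and b: "b \<in> {..<m} \<rightarrow> carrier K"
    and cl: "\<And>x. x \<in> carrier K ==> f x \<in> carrier E"
    and add: "\<And>x y. x \<in> carrier K ==> y \<in> carrier K ==> f (x \<oplus>\<^bsub>K\<^esub> y) = f x \<oplus>\<^bsub>E\<^esub> f y"
    and sm: "\<And>c x. c \<in> carrier F ==> x \<in> carrier K ==> f (c \<odot>\<^bsub>K\<^esub> x) = c \<odot>\<^bsub>E\<^esub> f x"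
  shows "f (comb m b c) = copy_module.comb F e E m (\<lambda>i. f (b i)) c"
proof -
  interpret E: copy_module F e E by (rule E)
  have "f \<zero>\<^bsub>K\<^esub> \<oplus>\<^bsub>E\<^esub> f \<zero>\<^bsub>K\<^esub> = \<zero>\<^bsub>E\<^esub> \<oplus>\<^bsub>E\<^esub> f \<zero>\<^bsub>K\<^esub>" using add[of "\<zero>\<^bsub>K\<^esub>" "\<zero>\<^bsub>K\<^esub>"] cl by simp
  hence f0: "f \<zero>\<^bsub>K\<^esub> = \<zero>\<^bsub>E\<^esub>" using cl by (metis E.M.M.add.right_cancel E.M.M.zero_closed M.M.zero_closed)
  show ?thesis using b
  proof (induction m)
    case 0 show ?case by (simp add: comb_0 E.comb_0 f0)
  next
    case (Suc m)
    have bm: "b \<in> {..<m} \<rightarrow> carrier K" "b m \<in> carrier K" using Suc.prems by (auto simp: Pi_iff)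
    have "f (comb (Suc m) b c) = f (smul (c m) (b m)) \<oplus>\<^bsub>E\<^esub> f (comb m b c)"
      using bm comb_closed[OF bm(1), of c] by (subst comb_Suc[OF Suc.prems]) (auto intro: add)
    also have "f (smul (c m) (b m)) = E.smul (c m) (f (b m))" using Suc.prems sm by (auto simp: smul_def E.smul_def)
    also have "f (comb m b c) = E.comb m (\<lambda>i. f (b i)) c" by (rule Suc.IH[OF bm(1)])
    also have "E.smul (c m) (f (b m)) \<oplus>\<^bsub>E\<^esub> E.comb m (\<lambda>i. f (b i)) c = E.comb (Suc m) (\<lambda>i. f (b i)) c"
      using Suc.prems cl by (intro E.comb_Suc[symmetric]) auto
    finally show ?case .
  qed
qed

text \<open>The bases of the factors together form a basis of the product. As bases are indexed by
  initial segments of the natural numbers, the pairs of a factor and an index in its basis are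
  enumerated by \<open>q\<close>, with inverse \<open>q'\<close>.\<close>

lemma etale_has_basis:
  assumes "etale_algebra F K" shows "\<exists>N B. alg_basis F K N B"
proof -
  obtain m :: nat and E :: "nat => ('f, 'k) module" and h where E: "\<forall>i<m. algebra F (E i) \<and> field (E i) \<and> (\<exists>d b. alg_basis F (E i) d b)"
    and h: "h \<in> alg_hom F K (alg_prod {..<m} E)" "bij_betw h (carrier K) (carrier (alg_prod {..<m} E))"
    using assms unfolding etale_algebra_def by blast
  have cm: "copy_module F e (E k)" if "k < m" for k
    using E that by (intro copy_module.intro field_copy_axioms) (auto simp: algebra_def)
  have "\<forall>k. \<exists>d b. k < m --> alg_basis F (E k) d b" using E by blast
  then obtain d b where db: "\<And>k. k < m ==> alg_basis F (E k) (d k) (b k)" by metis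
  have bas: "copy_module.is_basis F e (E k) (d k) (b k)" if "k < m" for k
    using copy_module.alg_basis_iff[OF cm[OF that]] db[OF that] by blast
  have bE: "b k j \<in> carrier (E k)" if "k < m" "j < d k" for k j using db[OF that(1)] that(2) by (simp add: alg_basis_def)
  define I where "I = (SIGMA k:{..<m}. {..<d k})"
  have "finite I" by (simp add: I_def)
  then obtain q where q: "bij_betw q {0..<card I} I" using ex_bij_betw_nat_finite by blast
  define N where "N = card I"
  define q' where "q' = inv_into {..<N} q"
  have qI: "bij_betw q {..<N} I" using q by (simp add: N_def atLeast0LessThan)
  have q1: "q' y < N" "q (q' y) = y" if "y \<in> I" for y
    using that qI unfolding q'_def by (metis bij_betw_def inv_into_into lessThan_iff, metis bij_betw_def f_inv_into_f)
  have q2: "q' (q t) = t" "q t \<in> I" if "t < N" for t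
    using that qI unfolding q'_def by (auto simp: bij_betw_def)
  have qk: "q (q' (k, j)) = (k, j)" if "k < m" "j < d k" for k j using q1(2)[of "(k, j)"] that by (simp add: I_def)
  have bq: "b (fst (q t)) (snd (q t)) \<in> carrier (E (fst (q t)))" if "t < N" for t
    using q2(2)[OF that] bE by (auto simp: I_def)
  define T where "T t = (\<lambda>k\<in>{..<m}. if k = fst (q t) then b k (snd (q t)) else \<zero>\<^bsub>E k\<^esub>)" for t
  have zE: "\<zero>\<^bsub>E k\<^esub> \<in> carrier (E k)" if "k < m" for k
    using copy_module.abelian_group_K[OF cm[OF that]] by (simp add: abelian_group_def abelian_monoid.zero_closed)
  have T: "T t \<in> carrier (alg_prod {..<m} E)" if "t < N" for t
    using q2(2)[OF that] bE zE by (auto simp: T_def alg_prod_def I_def)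
  define B where "B t = inv_into (carrier K) h (T t)" for t
  have B: "B t \<in> carrier K" "h (B t) = T t" if "t < N" for t
    using T[OF that] h(2) unfolding B_def bij_betw_def by (metis inv_into_into, metis f_inv_into_f)
  have hcl: "h x k \<in> carrier (E k)" if "k < m" "x \<in> carrier K" for k x
    using h(2) that by (fastforce simp: bij_betw_def alg_prod_def PiE_def)
  have hadd: "h (x \<oplus>\<^bsub>K\<^esub> y) k = h x k \<oplus>\<^bsub>E k\<^esub> h y k" if "k < m" "x \<in> carrier K" "y \<in> carrier K" for k x y
    using h(1) that by (simp add: alg_hom_def Ring.ring_hom_def alg_prod_def)
  have hsm: "h (c \<odot>\<^bsub>K\<^esub> x) k = c \<odot>\<^bsub>E k\<^esub> h x k" if "k < m" "c \<in> carrier F" "x \<in> carrier K" for k c x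
    using h(1) that by (simp add: alg_hom_def alg_prod_def)
  \<comment> \<open>The component \<open>k\<close> of a combination is the combination, in
    \<open>E k\<close>, of those coefficients whose index belongs to the factor
    \<open>k\<close>.\<close>
  have key: "h (comb N B c) k = copy_module.comb F e (E k) (d k) (b k) (\<lambda>j. c (q' (k, j)))" if k: "k < m" for k c
  proof -
    interpret Ek: copy_module F e "E k" by (rule cm[OF k])
    have "h (comb N B c) k = Ek.comb N (\<lambda>t. h (B t) k) c"
      by (rule comb_hom[where f = "\<lambda>x. h x k", OF cm[OF k]]) (use B hcl hadd hsm k in auto)
    also have "... = (\<Oplus>\<^bsub>E k\<^esub> t\<in>{..<N}. if fst (q t) = k then Ek.smul (c t) (b k (snd (q t))) else \<zero>\<^bsub>E k\<^esub>)"
      unfolding Ek.comb_def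
    proof (rule Ek.M.M.finsum_cong'[OF refl])
      show "(\<lambda>t. if fst (q t) = k then Ek.smul (c t) (b k (snd (q t))) else \<zero>\<^bsub>E k\<^esub>) \<in> {..<N} \<rightarrow> carrier (E k)"
      proof
        fix t assume "t \<in> {..<N}"
        thus "(if fst (q t) = k then Ek.smul (c t) (b k (snd (q t))) else \<zero>\<^bsub>E k\<^esub>) \<in> carrier (E k)"
          using bq[of t] by (cases "fst (q t) = k") simp_all
      qed
      fix t assume "t \<in> {..<N}"
      thus "Ek.smul (c t) (h (B t) k) = (if fst (q t) = k then Ek.smul (c t) (b k (snd (q t))) else \<zero>\<^bsub>E k\<^esub>)"
        using B k by (auto simp: T_def Ek.smul_zero)
    qed
    also have "... = (\<Oplus>\<^bsub>E k\<^esub> t\<in>(\<lambda>j. q' (k, j)) ` {..<d k}. Ek.smul (c t) (b k (snd (q t))))"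
    proof (rule Ek.M.M.add.finprod_mono_neutral_cong_right)
      show "finite {..<N}" by simp
      show "(\<lambda>j. q' (k, j)) ` {..<d k} \<subseteq> {..<N}" using q1(1) k by (auto simp: I_def)
      show "(if fst (q t) = k then Ek.smul (c t) (b k (snd (q t))) else \<zero>\<^bsub>E k\<^esub>) = \<zero>\<^bsub>E k\<^esub>"
        if t: "t \<in> {..<N} - (\<lambda>j. q' (k, j)) ` {..<d k}" for t
      proof -
        have "fst (q t) ~= k"
        proof
          assume f: "fst (q t) = k"
          have tN: "t < N" using t by simp
          have "q t = (k, snd (q t))" using f by (metis prod.collapse)
          moreover have "snd (q t) < d k" using q2(2)[OF tN] f by (auto simp: I_def)
          moreover have "t = q' (q t)" using q2(1)[OF tN] by simp
          ultimately have "t \<in> (\<lambda>j. q' (k, j)) ` {..<d k}" by (metis image_eqI lessThan_iff)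
          thus False using t by blast
        qed
        thus ?thesis by simp
      qed
      show "(if fst (q t) = k then Ek.smul (c t) (b k (snd (q t))) else \<zero>\<^bsub>E k\<^esub>) = Ek.smul (c t) (b k (snd (q t)))"
        if "t \<in> (\<lambda>j. q' (k, j)) ` {..<d k}" for t using that q1(2) k by (auto simp: I_def)
      show "(\<lambda>t. if fst (q t) = k then Ek.smul (c t) (b k (snd (q t))) else \<zero>\<^bsub>E k\<^esub>) \<in> {..<N} \<rightarrow> carrier (E k)"
      proof
        fix t assume "t \<in> {..<N}"
        thus "(if fst (q t) = k then Ek.smul (c t) (b k (snd (q t))) else \<zero>\<^bsub>E k\<^esub>) \<in> carrier (E k)"
          using bq[of t] by (cases "fst (q t) = k") simp_all
      qed
    qed
    also have "... = (\<Oplus>\<^bsub>E k\<^esub> j\<in>{..<d k}. Ek.smul (c (q' (k, j))) (b k (snd (q (q' (k, j))))))"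
    proof (rule Ek.M.M.finsum_reindex)
      show "inj_on (\<lambda>j. q' (k, j)) {..<d k}"
      proof (rule inj_onI)
        fix i j assume ij: "i \<in> {..<d k}" "j \<in> {..<d k}" "q' (k, i) = q' (k, j)"
        have "q (q' (k, i)) = q (q' (k, j))" by (rule arg_cong[OF ij(3)])
        thus "i = j" using qk[OF k, of i] qk[OF k, of j] ij(1,2) by simp
      qed
      show "(\<lambda>t. Ek.smul (c t) (b k (snd (q t)))) \<in> (\<lambda>j. q' (k, j)) ` {..<d k} \<rightarrow> carrier (E k)"
        using qk[OF k] bE[OF k] by auto
    qed
    also have "... = Ek.comb (d k) (b k) (\<lambda>j. c (q' (k, j)))"
      unfolding Ek.comb_def using qk[OF k] bE[OF k] by (intro Ek.M.M.finsum_cong') auto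
    finally show ?thesis .
  qed
  have "is_basis N B" unfolding is_basis_def
  proof (intro conjI ballI allI impI)
    show "B t \<in> carrier K" if "t < N" for t using B(1)[OF that] .
    fix x assume x: "x \<in> carrier K"
    have "\<exists>c. h x k = copy_module.comb F e (E k) (d k) (b k) c" if k: "k < m" for k
      using bas[OF k] hcl[OF k x] unfolding copy_module.is_basis_def[OF cm[OF k]] by blast
    then obtain a where a: "\<And>k. k < m ==> h x k = copy_module.comb F e (E k) (d k) (b k) (a k)" by metis
    define c where "c t = a (fst (q t)) (snd (q t))" for t
    have BK: "comb N B c \<in> carrier K" using B(1) by (intro comb_closed) auto
    have "h (comb N B c) k = h x k" if k: "k < m" for k
      unfolding key[OF k] a[OF k]
      by (rule copy_module.comb_cong[OF cm[OF k]]) (use qk[OF k] bE[OF k] in \<open>auto simp: c_def\<close>)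
    moreover have "h y \<in> extensional {..<m}" if "y \<in> carrier K" for y
    proof -
      have "h y \<in> carrier (alg_prod {..<m} E)" using bij_betwE[OF h(2)] that by blast
      thus ?thesis by (simp add: alg_prod_def PiE_def)
    qed
    ultimately have "h (comb N B c) = h x" using x BK by (intro extensionalityI[of _ "{..<m}"]) auto
    hence "x = comb N B c" using h(2) x BK by (auto simp: bij_betw_def inj_on_def)
    thus "\<exists>c. x = comb N B c" by blast
  next
    fix c t assume c: "comb N B c = \<zero>\<^bsub>K\<^esub>" and t: "t < N"
    obtain k j where kj: "q t = (k, j)" "k < m" "j < d k" using q2(2)[OF t] by (auto simp: I_def)
    interpret Ek: copy_module F e "E k" by (rule cm[OF kj(2)])
    have "h (\<zero> \<odot>\<^bsub>K\<^esub> \<zero>\<^bsub>K\<^esub>) k = \<zero> \<odot>\<^bsub>E k\<^esub> h \<zero>\<^bsub>K\<^esub> k" by (rule hsm[OF kj(2)]) auto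
    hence "h \<zero>\<^bsub>K\<^esub> k = \<zero>\<^bsub>E k\<^esub>" using hcl[OF kj(2)] by (simp add: M.smult_l_null Ek.M.smult_l_null)
    hence "Ek.comb (d k) (b k) (\<lambda>j. c (q' (k, j))) = \<zero>\<^bsub>E k\<^esub>" using key[OF kj(2), of c] c by simp
    hence "c (q' (k, j)) = 0" using bas[OF kj(2)] kj(3) unfolding Ek.is_basis_def by blast
    thus "c t = 0" using q2(1)[OF t] kj(1) by simp
  qed
  thus ?thesis using alg_basis_iff by blast
qed

end

section \<open>Conjugates, traces and discriminants\<close>

locale copy_extension = field_copy F eF + L: field_copy L eL
  for F :: "'f ring" (structure) and eF :: "'f => 'a::field_char_0"
    and L :: "('f, 'l) module" and eL :: "'l => 'b::field_char_0" +
  assumes algFL: "algebra F L"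
begin

definition psi :: "'a => 'b" where "psi a = eL (dec a \<odot>\<^bsub>L\<^esub> \<one>\<^bsub>L\<^esub>)"

lemma eL_smult:
  assumes "c \<in> carrier F" "y \<in> carrier L" shows "eL (c \<odot>\<^bsub>L\<^esub> y) = psi (eF c) * eL y"
proof -
  interpret AL: algebra F L by (rule algFL)
  have "c \<odot>\<^bsub>L\<^esub> y = (c \<odot>\<^bsub>L\<^esub> \<one>\<^bsub>L\<^esub>) \<otimes>\<^bsub>L\<^esub> y" using assms AL.smult_assoc2[of c "\<one>\<^bsub>L\<^esub>" y] by simp
  thus ?thesis using assms by (simp add: psi_def L.e_mult)
qed

sublocale field_extension psi
proof
  interpret AL: algebra F L by (rule algFL)
  show "psi 1 = 1" by (simp add: psi_def dec_one L.e_one)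
  show "psi (a + b) = psi a + psi b" for a b by (simp add: psi_def dec_add AL.smult_l_distr L.e_add)
  show "psi (a * b) = psi a * psi b" for a b
  proof -
    have "psi (a * b) = eL (dec a \<odot>\<^bsub>L\<^esub> (dec b \<odot>\<^bsub>L\<^esub> \<one>\<^bsub>L\<^esub>))" by (simp add: psi_def dec_mult AL.smult_assoc1)
    thus ?thesis using eL_smult[of "dec a" "dec b \<odot>\<^bsub>L\<^esub> \<one>\<^bsub>L\<^esub>"] by (simp add: psi_def)
  qed
qed

end

locale split_algebra = copy_extension F eF L eL + K: copy_module F eF K
  for F :: "'f ring" (structure) and eF :: "'f => 'a::field_char_0"
    and L :: "('f, 'l) module" and eL :: "'l => 'b::field_char_0" and K :: "('f, 'k) module" +
  fixes n :: nat and x :: "nat => 'k => 'l"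
  assumes algK: "algebra F K" and hom_bij: "bij_betw x {..<n} (alg_hom F K L)"
    and ex_basis: "\<exists>b. alg_basis F K n b"
begin

lemma cring_K: "cring K" using algK by (simp add: algebra_def)

sublocale KR: cring K by (rule cring_K)

definition xi :: "nat => 'k => 'b" where "xi i z = eL (x i z)"

lemma hom_x:
  assumes "i < n" shows "x i \<in> extensional (carrier K)" "x i \<in> Ring.ring_hom K L"
    "\<And>c z. c \<in> carrier F ==> z \<in> carrier K ==> x i (c \<odot>\<^bsub>K\<^esub> z) = c \<odot>\<^bsub>L\<^esub> x i z"
  using bij_betwE[OF hom_bij] assms by (auto simp: alg_hom_def)

lemma x_closed: "i < n ==> z \<in> carrier K ==> x i z \<in> carrier L" using hom_x(2) by (auto simp: Ring.ring_hom_def)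

lemma xi_add: "i < n ==> z \<in> carrier K ==> w \<in> carrier K ==> xi i (z \<oplus>\<^bsub>K\<^esub> w) = xi i z + xi i w"
  using hom_x(2)[of i] x_closed by (simp add: Ring.ring_hom_def xi_def L.e_add)

lemma xi_mult: "i < n ==> z \<in> carrier K ==> w \<in> carrier K ==> xi i (z \<otimes>\<^bsub>K\<^esub> w) = xi i z * xi i w"
  using hom_x(2)[of i] x_closed by (simp add: Ring.ring_hom_def xi_def L.e_mult)

lemma xi_one: "i < n ==> xi i \<one>\<^bsub>K\<^esub> = 1"
  using hom_x(2)[of i] by (simp add: Ring.ring_hom_def xi_def L.e_one)

lemma xi_smult: "i < n ==> c \<in> carrier F ==> z \<in> carrier K ==> xi i (c \<odot>\<^bsub>K\<^esub> z) = psi (eF c) * xi i z"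
  using hom_x(3)[of i c z] x_closed eL_smult by (simp add: xi_def)

lemma xi_smul: "i < n ==> z \<in> carrier K ==> xi i (K.smul a z) = psi a * xi i z"
  by (simp add: K.smul_def xi_smult)

lemma xi_zero: "i < n ==> xi i \<zero>\<^bsub>K\<^esub> = 0" using xi_add[of i "\<zero>\<^bsub>K\<^esub>" "\<zero>\<^bsub>K\<^esub>"] by simp

lemma xi_pow: "i < n ==> z \<in> carrier K ==> xi i (z [^]\<^bsub>K\<^esub> (k::nat)) = xi i z ^ k"
  by (induction k) (auto simp: xi_one xi_mult mult.commute)

lemma xi_finsum: "i < n ==> finite I ==> f \<in> I \<rightarrow> carrier K ==> xi i (\<Oplus>\<^bsub>K\<^esub> j\<in>I. f j) = (\<Sum>j\<in>I. xi i (f j))"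
proof (induction I rule: infinite_finite_induct)
  case (insert j I)
  have "(\<Oplus>\<^bsub>K\<^esub> j\<in>I. f j) \<in> carrier K" using insert by (intro K.M.M.finsum_closed) auto
  thus ?case using insert by (simp add: K.M.M.finsum_insert xi_add Pi_def)
qed (auto simp: xi_zero)

lemma xi_comb:
  assumes i: "i < n" and b: "b \<in> {..<m} \<rightarrow> carrier K"
  shows "xi i (K.comb m b c) = (\<Sum>j<m. psi (c j) * xi i (b j))"
  unfolding K.comb_def using b by (subst xi_finsum[OF i]) (auto simp: xi_smul i Pi_iff)

lemma basis_closed: "alg_basis F K n b ==> j < n ==> b j \<in> carrier K" by (simp add: alg_basis_def)

lemma basis_fun: "alg_basis F K n b ==> b \<in> {..<n} \<rightarrow> carrier K" by (auto simp: alg_basis_def)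

lemma basis_expand: "alg_basis F K n b ==> z \<in> carrier K ==> \<exists>c. z = K.comb n b c"
  unfolding K.alg_basis_iff by (simp add: K.is_basis_def)

definition hom_mat :: "(nat => 'k) => nat => nat => 'b" where "hom_mat b i j = xi i (b j)"

text \<open>A vector in the kernel of the transpose is a linear relation between the homomorphisms
  at the basis, hence on all of \<open>K\<close>; distinct homomorphisms admit none.\<close>

lemma det_hom_mat:
  assumes b: "alg_basis F K n b" shows "det (mat n n (\<lambda>(i,j). hom_mat b i j)) ~= 0"
proof
  let ?B = "mat n n (\<lambda>(i,j). hom_mat b i j)"
  assume "det ?B = 0"
  hence "det (transpose_mat ?B) = 0" by (subst det_transpose[of _ n]) auto
  then obtain v where v: "v \<in> carrier_vec n" "v ~= 0\<^sub>v n" "transpose_mat ?B *\<^sub>v v = 0\<^sub>v n"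
    using det_0_iff_vec_prod_zero_field[of "transpose_mat ?B" n] by auto
  have z: "(\<Sum>i<n. v $ i * xi i (b j)) = 0" if j: "j < n" for j
  proof -
    have "(transpose_mat ?B *\<^sub>v v) $ j = (\<Sum>i<n. v $ i * xi i (b j))"
      using j v(1) by (auto simp: scalar_prod_def hom_mat_def atLeast0LessThan mult.commute intro!: sum.cong)
    thus ?thesis using v(3) j by simp
  qed
  have "v $ i = 0" if i: "i < n" for i
  proof (rule dedekind_independence[where M = "carrier K" and mul = "monoid.mult K" and u = "\<one>\<^bsub>K\<^esub>" and g = xi and S = "{..<n}" and c = "\<lambda>i. v $ i" and i = i])
    fix w assume w: "w \<in> carrier K"
    then obtain c where c: "w = K.comb n b c" using basis_expand[OF b] by blast
    have "(\<Sum>i<n. v $ i * xi i w) = (\<Sum>i<n. \<Sum>j<n. psi (c j) * (v $ i * xi i (b j)))"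
      unfolding c by (simp add: xi_comb[OF _ basis_fun[OF b]] sum_distrib_left mult.left_commute)
    also have "... = (\<Sum>j<n. psi (c j) * (\<Sum>i<n. v $ i * xi i (b j)))"
      unfolding sum_distrib_left by (rule sum.swap)
    also have "... = 0" using z by simp
    finally show "(\<Sum>i<n. v $ i * xi i w) = 0" .
  next
    fix i j assume ij: "i \<in> {..<n}" "j \<in> {..<n}" "i ~= j"
    show "\<exists>z\<in>carrier K. xi i z ~= xi j z"
    proof (rule ccontr)
      assume "\<not> ?thesis"
      hence "x i z = x j z" if "z \<in> carrier K" for z using that L.e_inj x_closed ij unfolding xi_def by (metis lessThan_iff)
      hence "x i = x j" using hom_x(1) ij by (intro extensionalityI[of _ "carrier K"]) auto
      thus False using hom_bij ij by (auto simp: bij_betw_def inj_on_def)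
    qed
  qed (use i xi_mult xi_one in auto)
  thus False using v(1,2) by (metis carrier_vecD eq_vecI index_zero_vec(1) index_zero_vec(2))
qed

lemma alg_vecs_iff:
  assumes b: "alg_basis F K n b"
  shows "v \<in> alg_vecs n (hom_mat b) \<longleftrightarrow> (\<exists>z\<in>carrier K. \<forall>i<n. v i = xi i z)"
proof
  assume "v \<in> alg_vecs n (hom_mat b)"
  then obtain c where "\<forall>i<n. v i = (\<Sum>j<n. psi (c j) * hom_mat b i j)" by (auto simp: alg_vecs_def)
  hence "\<forall>i<n. v i = xi i (K.comb n b c)" by (simp add: xi_comb[OF _ basis_fun[OF b]] hom_mat_def)
  thus "\<exists>z\<in>carrier K. \<forall>i<n. v i = xi i z" using K.comb_closed[OF basis_fun[OF b], of c] by blast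
next
  assume "\<exists>z\<in>carrier K. \<forall>i<n. v i = xi i z"
  then obtain z where z: "z \<in> carrier K" "\<forall>i<n. v i = xi i z" by blast
  obtain c where "z = K.comb n b c" using basis_expand[OF b z(1)] by blast
  hence "\<forall>i<n. v i = (\<Sum>j<n. psi (c j) * hom_mat b i j)" using z(2) by (simp add: xi_comb[OF _ basis_fun[OF b]] hom_mat_def)
  thus "v \<in> alg_vecs n (hom_mat b)" by (auto simp: alg_vecs_def)
qed

lemma split_alg_hom_mat: assumes b: "alg_basis F K n b" shows "split_alg n (hom_mat b)"
  unfolding split_alg_def
proof (intro conjI allI impI)
  show "det (mat n n (\<lambda>(i,j). hom_mat b i j)) ~= 0" by (rule det_hom_mat[OF b])
  have "(\<lambda>i. 1) \<in> alg_vecs n (hom_mat b)" unfolding alg_vecs_iff[OF b] using xi_one by (metis KR.one_closed)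
  thus "\<exists>c. \<forall>i<n. 1 = (\<Sum>j<n. psi (c j) * hom_mat b i j)" by (simp add: alg_vecs_def)
  fix j k assume jk: "j < n" "k < n"
  have "(\<lambda>i. hom_mat b i j * hom_mat b i k) \<in> alg_vecs n (hom_mat b)" unfolding alg_vecs_iff[OF b]
    using basis_closed[OF b] jk by (intro bexI[of _ "b j \<otimes>\<^bsub>K\<^esub> b k"]) (auto simp: hom_mat_def xi_mult)
  thus "\<exists>c. \<forall>i<n. hom_mat b i j * hom_mat b i k = (\<Sum>l<n. psi (c l) * hom_mat b i l)" by (simp add: alg_vecs_def)
qed

text \<open>The inverse of the matrix of conjugates recovers the coordinates of an element from its
  conjugates. Identities in \<open>K\<close> can therefore be checked in the big field.\<close>

lemma xi_inj:
  assumes z: "z \<in> carrier K" "w \<in> carrier K" and eq: "\<And>i. i < n ==> xi i z = xi i w"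
  shows "z = w"
proof -
  obtain b where b: "alg_basis F K n b" using ex_basis by blast
  obtain c where c: "z = K.comb n b c" using basis_expand[OF b z(1)] by blast
  obtain d where d: "w = K.comb n b d" using basis_expand[OF b z(2)] by blast
  obtain C where C: "\<And>j k. j < n ==> k < n ==> (\<Sum>i<n. C j i * hom_mat b i k) = (if j = k then 1 else 0)"
    using split_alg_inverse[OF split_alg_hom_mat[OF b]] by blast
  have rec: "(\<Sum>i<n. C j i * xi i (K.comb n b a)) = psi (a j)" if j: "j < n" for a j
  proof -
    have "(\<Sum>i<n. C j i * xi i (K.comb n b a)) = (\<Sum>i<n. \<Sum>k<n. psi (a k) * (C j i * hom_mat b i k))"
      by (simp add: xi_comb[OF _ basis_fun[OF b]] hom_mat_def sum_distrib_left mult.left_commute)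
    also have "... = (\<Sum>k<n. psi (a k) * (\<Sum>i<n. C j i * hom_mat b i k))" unfolding sum_distrib_left by (rule sum.swap)
    also have "... = (\<Sum>k<n. if k = j then psi (a k) else 0)" using C[OF j] by (intro sum.cong) auto
    also have "... = psi (a j)" using j by simp
    finally show ?thesis .
  qed
  have "c j = d j" if j: "j < n" for j
    using rec[OF j, of c] rec[OF j, of d] eq psi_inj unfolding c[symmetric] d[symmetric] by (metis (mono_tags, lifting) lessThan_iff sum.cong)
  thus ?thesis unfolding c d by (intro K.comb_cong basis_fun[OF b]) auto
qed

lemma trace_xi:
  assumes z: "z \<in> carrier K"
  shows "alg_trace F K z \<in> carrier F" "psi (eF (alg_trace F K z)) = (\<Sum>i<n. xi i z)"
proof -
  obtain b0 where b0: "alg_basis F K n b0" using ex_basis by blast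
  define b where "b = (SOME b. alg_basis F K n b)"
  have b: "alg_basis F K n b" unfolding b_def using b0 by (rule someI[where P = "alg_basis F K n"])
  have deg: "alg_degree F K = n" by (rule K.alg_degree_eq[OF b])
  have zb: "z \<otimes>\<^bsub>K\<^esub> b j \<in> carrier K" if "j < n" for j using z basis_closed[OF b that] by simp
  define C where "C k j = eF (alg_coord F K n b (z \<otimes>\<^bsub>K\<^esub> b j) k)" for k j
  have tr: "alg_trace F K z = (\<Oplus>j\<in>{..<n}. alg_coord F K n b (z \<otimes>\<^bsub>K\<^esub> b j) j)"
    unfolding alg_trace_def deg Let_def b_def[symmetric] ..
  have cl: "(\<lambda>j. alg_coord F K n b (z \<otimes>\<^bsub>K\<^esub> b j) j) \<in> {..<n} \<rightarrow> carrier F"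
    using K.alg_coord_eq(2)[OF b zb] by auto
  show "alg_trace F K z \<in> carrier F" unfolding tr by (rule F.finsum_closed[OF cl])
  have "eF (alg_trace F K z) = (\<Sum>j<n. C j j)" unfolding tr C_def by (rule e_finsum[OF _ cl]) simp
  also have "psi ... = (\<Sum>i<n. xi i z)"
  proof (rule mult_matrix_char_poly(2)[OF split_alg_hom_mat[OF b], where C = C and v = "\<lambda>i. xi i z"])
    fix i j assume ij: "i < n" "j < n"
    have "xi i z * hom_mat b i j = xi i (z \<otimes>\<^bsub>K\<^esub> b j)" using xi_mult[OF ij(1) z basis_closed[OF b ij(2)]] by (simp add: hom_mat_def)
    also have "z \<otimes>\<^bsub>K\<^esub> b j = K.comb n b (\<lambda>k. C k j)" unfolding C_def by (rule K.alg_coord_eq(1)[OF b zb[OF ij(2)]])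
    also have "xi i ... = (\<Sum>k<n. psi (C k j) * hom_mat b i k)" unfolding hom_mat_def by (rule xi_comb[OF ij(1) basis_fun[OF b]])
    finally show "xi i z * hom_mat b i j = (\<Sum>k<n. psi (C k j) * hom_mat b i k)" .
  qed
  finally show "psi (eF (alg_trace F K z)) = (\<Sum>i<n. xi i z)" .
qed

lemma ring_det_typed:
  assumes A: "\<And>i j. i < m ==> j < m ==> A i j \<in> carrier F"
  shows "ring_det F m A \<in> carrier F" "eF (ring_det F m A) = det (mat m m (\<lambda>(i,j). eF (A i j)))"
proof -
  let ?t = "\<lambda>p. (if evenperm p then \<one> else \<ominus> \<one>) \<otimes> (\<Otimes>i\<in>{..<m}. A i (p i))"
  have pl: "p i < m" if "p permutes {..<m}" "i < m" for p i using permutes_in_image[OF that(1), of i] that(2) by simp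
  have prod: "(\<Otimes>i\<in>{..<m}. A i (p i)) \<in> carrier F" if "p permutes {..<m}" for p
    using A pl[OF that] by (intro F.finprod_closed) auto
  have cl: "?t \<in> {p. p permutes {..<m}} \<rightarrow> carrier F" using prod by auto
  have fin: "finite {p. p permutes {..<m}}" by (simp add: finite_permutations)
  show "ring_det F m A \<in> carrier F" unfolding ring_det_def by (rule F.finsum_closed[OF cl])
  have "eF (ring_det F m A) = (\<Sum>p\<in>{p. p permutes {..<m}}. eF (?t p))" unfolding ring_det_def by (rule e_finsum[OF fin cl])
  also have "... = (\<Sum>p\<in>{p. p permutes {..<m}}. of_int (sign p) * (\<Prod>i<m. eF (A i (p i))))"
  proof (rule sum.cong[OF refl])
    fix p assume p: "p \<in> {p. p permutes {..<m}}"
    have "eF (\<Otimes>i\<in>{..<m}. A i (p i)) = (\<Prod>i<m. eF (A i (p i)))" using A pl p by (intro e_finprod) auto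
    thus "eF (?t p) = of_int (sign p) * (\<Prod>i<m. eF (A i (p i)))"
      using prod p by (auto simp: e_mult sign_def e_one e_minus)
  qed
  also have "... = det (mat m m (\<lambda>(i,j). eF (A i j)))"
    using pl by (subst det_def'[of _ m]) (auto simp: atLeast0LessThan intro!: sum.cong prod.cong)
  finally show "eF (ring_det F m A) = det (mat m m (\<lambda>(i,j). eF (A i j)))" .
qed

text \<open>The trace is the sum of the conjugates, so the matrix of traces is the product of the
  transposed matrix of conjugates with the matrix itself.\<close>

lemma disc_xi:
  assumes b: "alg_basis F K n b"
  shows "basis_disc F K n b \<in> carrier F" "psi (eF (basis_disc F K n b)) = (det (mat n n (\<lambda>(i,j). hom_mat b i j)))\<^sup>2"
proof -
  have bb: "b i \<otimes>\<^bsub>K\<^esub> b j \<in> carrier K" if "i < n" "j < n" for i j using basis_closed[OF b] that by simp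
  note cl = trace_xi(1)[OF bb]
  show "basis_disc F K n b \<in> carrier F" unfolding basis_disc_def by (rule ring_det_typed(1)[OF cl])
  interpret h: comm_ring_hom psi by unfold_locales (auto simp: psi_0 psi_1 psi_add psi_mult)
  let ?B = "mat n n (\<lambda>(i,j). hom_mat b i j)"
  have "psi (eF (basis_disc F K n b)) = det (map_mat psi (mat n n (\<lambda>(i,j). eF (alg_trace F K (b i \<otimes>\<^bsub>K\<^esub> b j)))))"
    using ring_det_typed(2)[of n "\<lambda>i j. alg_trace F K (b i \<otimes>\<^bsub>K\<^esub> b j)"] cl by (simp add: basis_disc_def)
  also have "map_mat psi (mat n n (\<lambda>(i,j). eF (alg_trace F K (b i \<otimes>\<^bsub>K\<^esub> b j)))) = transpose_mat ?B * ?B"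
  proof (rule eq_matI)
    fix i j assume "i < dim_row (transpose_mat ?B * ?B)" "j < dim_col (transpose_mat ?B * ?B)"
    hence ij: "i < n" "j < n" by auto
    have "psi (eF (alg_trace F K (b i \<otimes>\<^bsub>K\<^esub> b j))) = (\<Sum>k<n. hom_mat b k i * hom_mat b k j)"
      unfolding trace_xi(2)[OF bb[OF ij]] using basis_closed[OF b] ij by (simp add: xi_mult hom_mat_def)
    thus "map_mat psi (mat n n (\<lambda>(i,j). eF (alg_trace F K (b i \<otimes>\<^bsub>K\<^esub> b j)))) $$ (i, j) = (transpose_mat ?B * ?B) $$ (i, j)"
      using ij by (simp add: scalar_prod_def atLeast0LessThan)
  qed auto
  also have "det (transpose_mat ?B * ?B) = (det ?B)\<^sup>2"
    by (subst det_mult[of _ n]) (auto simp: det_transpose[of _ n] power2_eq_square)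
  finally show "psi (eF (basis_disc F K n b)) = (det ?B)\<^sup>2" .
qed

lemma disc_nonzero: assumes b: "alg_basis F K n b" shows "eF (basis_disc F K n b) ~= 0"
  using disc_xi(2)[OF b] det_hom_mat[OF b] psi_0 by auto

text \<open>By Cramer's rule, replacing \<open>b j\<close> by \<open>z\<close> multiplies the
  determinant of conjugates by the image of the coordinate \<open>c j\<close>. For an integral basis
  with least discriminant this will force the coordinates of integral elements to be integral at the
  prime.\<close>

lemma disc_exchange:
  assumes b: "alg_basis F K n b" and z: "z = K.comb n b c" and j: "j < n" "c j ~= 0"
  shows "alg_basis F K n (b(j := z))" "eF (basis_disc F K n (b(j := z))) = (c j)\<^sup>2 * eF (basis_disc F K n b)"
proof -
  show b': "alg_basis F K n (b(j := z))" using K.basis_exchange[OF _ z j] b unfolding K.alg_basis_iff by blast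
  let ?B = "mat n n (\<lambda>(i,k). hom_mat b i k)"
  let ?c = "vec n (\<lambda>k. psi (c k))"
  have "mat n n (\<lambda>(i,k). hom_mat (b(j := z)) i k) = replace_col ?B (?B *\<^sub>v ?c) j"
  proof (rule eq_matI)
    fix i k assume "i < dim_row (replace_col ?B (?B *\<^sub>v ?c) j)" "k < dim_col (replace_col ?B (?B *\<^sub>v ?c) j)"
    hence ik: "i < n" "k < n" by (auto simp: replace_col_def)
    have "xi i z = (\<Sum>l<n. psi (c l) * xi i (b l))" unfolding z by (rule xi_comb[OF ik(1) basis_fun[OF b]])
    thus "mat n n (\<lambda>(i,k). hom_mat (b(j := z)) i k) $$ (i, k) = replace_col ?B (?B *\<^sub>v ?c) j $$ (i, k)"
      using ik by (auto simp: replace_col_def hom_mat_def scalar_prod_def atLeast0LessThan mult.commute)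
  qed (auto simp: replace_col_def)
  hence "det (mat n n (\<lambda>(i,k). hom_mat (b(j := z)) i k)) = psi (c j) * det ?B"
    using cramer_lemma_mat[of ?B n ?c j] j(1) by simp
  hence "psi (eF (basis_disc F K n (b(j := z)))) = psi ((c j)\<^sup>2 * eF (basis_disc F K n b))"
    unfolding disc_xi(2)[OF b'] by (simp add: psi_mult psi_power disc_xi(2)[OF b] power_mult_distrib)
  thus "eF (basis_disc F K n (b(j := z))) = (c j)\<^sup>2 * eF (basis_disc F K n b)" by (rule psi_inj)
qed

lemma integral_psi: "integral_over (psi ` R) (psi a) \<longleftrightarrow> integral_over R a"
proof
  assume "integral_over (psi ` R) (psi a)"
  then obtain m d where md: "\<forall>i<m. d i \<in> psi ` R" "psi a ^ m + (\<Sum>i<m. d i * psi a ^ i) = 0" unfolding integral_over_def by blast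
  have "\<forall>i. \<exists>r. i < m --> r \<in> R \<and> d i = psi r" using md(1) by blast
  then obtain r where r: "\<And>i. i < m ==> r i \<in> R \<and> d i = psi (r i)" by metis
  have "psi (a ^ m + (\<Sum>i<m. r i * a ^ i)) = psi a ^ m + (\<Sum>i<m. d i * psi a ^ i)"
    using r by (simp add: psi_add psi_sum psi_mult psi_power)
  hence "a ^ m + (\<Sum>i<m. r i * a ^ i) = 0" using md(2) psi_eq_0 by simp
  thus "integral_over R a" unfolding integral_over_def using r by blast
next
  assume "integral_over R a"
  then obtain m r where r: "\<forall>i<m. r i \<in> R" "a ^ m + (\<Sum>i<m. r i * a ^ i) = 0" unfolding integral_over_def by blast
  have "psi a ^ m + (\<Sum>i<m. psi (r i) * psi a ^ i) = psi (a ^ m + (\<Sum>i<m. r i * a ^ i))"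
    by (simp add: psi_add psi_sum psi_mult psi_power)
  also have "... = 0" using r(2) psi_0 by simp
  finally show "integral_over (psi ` R) (psi a)" unfolding integral_over_def
    using r(1) by (intro exI[of _ m] exI[of _ "\<lambda>i. psi (r i)"]) auto
qed

text \<open>An equation for \<open>z\<close> over \<O> makes its conjugates integral, by
  transitivity. Conversely, integral conjugates have a common monic equation with coefficients in
  \<O>, which holds in \<open>K\<close> because the homomorphisms are jointly injective.\<close>

lemma integers_iff:
  assumes R: "is_subring (psi ` R)" and O: "\<O> \<subseteq> carrier F" "eF ` \<O> = {z. integral_over R z}" and z: "z \<in> carrier K"
  shows "z \<in> integers_of \<O> K \<longleftrightarrow> (\<forall>i<n. integral_over (psi ` R) (xi i z))"
proof
  interpret AK: algebra F K by (rule algK)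
  assume "z \<in> integers_of \<O> K"
  then obtain m a where ma: "\<forall>i<m. a i \<in> (\<lambda>c. c \<odot>\<^bsub>K\<^esub> \<one>\<^bsub>K\<^esub>) ` \<O>" "z [^]\<^bsub>K\<^esub> (m::nat) \<oplus>\<^bsub>K\<^esub> (\<Oplus>\<^bsub>K\<^esub> i\<in>{..<m}. a i \<otimes>\<^bsub>K\<^esub> z [^]\<^bsub>K\<^esub> i) = \<zero>\<^bsub>K\<^esub>"
    unfolding integers_of_def integral_closure_def by blast
  have aK: "a k \<in> carrier K" if k: "k < m" for k
  proof -
    obtain c where "c \<in> \<O>" "a k = c \<odot>\<^bsub>K\<^esub> \<one>\<^bsub>K\<^esub>" using ma(1) k by blast
    thus ?thesis using O(1) K.M.smult_closed[of c "\<one>\<^bsub>K\<^esub>"] KR.one_closed by auto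
  qed
  show "\<forall>i<n. integral_over (psi ` R) (xi i z)"
  proof (intro allI impI)
    fix i assume i: "i < n"
    have cl: "(\<lambda>k. a k \<otimes>\<^bsub>K\<^esub> z [^]\<^bsub>K\<^esub> k) \<in> {..<m} \<rightarrow> carrier K" using aK z by auto
    have "xi i z ^ m + (\<Sum>k<m. xi i (a k) * xi i z ^ k) = xi i (z [^]\<^bsub>K\<^esub> m \<oplus>\<^bsub>K\<^esub> (\<Oplus>\<^bsub>K\<^esub> i\<in>{..<m}. a i \<otimes>\<^bsub>K\<^esub> z [^]\<^bsub>K\<^esub> i))"
      using i z aK K.M.M.finsum_closed[OF cl] by (simp add: xi_add xi_finsum[OF i _ cl] xi_mult xi_pow)
    also have "... = 0" using ma(2) xi_zero[OF i] by simp
    finally have eq: "xi i z ^ m + (\<Sum>k<m. xi i (a k) * xi i z ^ k) = 0" .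
    have "xi i (a k) \<in> {y. integral_over (psi ` R) y}" if k: "k < m" for k
    proof -
      obtain c where c: "c \<in> \<O>" "a k = c \<odot>\<^bsub>K\<^esub> \<one>\<^bsub>K\<^esub>" using ma(1) k by blast
      have "xi i (a k) = psi (eF c)" using c O(1) i by (auto simp: xi_smult xi_one)
      moreover have "integral_over R (eF c)" using O(2) c(1) by blast
      ultimately show ?thesis using integral_psi by simp
    qed
    hence "integral_over {y. integral_over (psi ` R) y} (xi i z)" unfolding integral_over_def using eq
      by (intro exI[of _ m] exI[of _ "\<lambda>k. xi i (a k)"]) auto
    thus "integral_over (psi ` R) (xi i z)" by (rule integral_over_trans[OF R])
  qed
next
  interpret AK: algebra F K by (rule algK)
  assume int: "\<forall>i<n. integral_over (psi ` R) (xi i z)"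
  obtain b where b: "alg_basis F K n b" using ex_basis by blast
  have v: "(\<lambda>i. xi i z) \<in> alg_vecs n (hom_mat b)" unfolding alg_vecs_iff[OF b] using z by blast
  obtain a where a: "\<forall>k. psi (a k) \<in> {y. integral_over (psi ` R) y}" "\<forall>i<n. xi i z ^ n + (\<Sum>k<n. psi (a k) * xi i z ^ k) = 0"
    using alg_vec_integral_equation[OF split_alg_hom_mat[OF b] v is_subring_integral_closure[OF R]] int by auto
  have "\<forall>k. \<exists>c\<in>\<O>. eF c = a k" using a(1) O(2) integral_psi by (metis (no_types, lifting) image_iff mem_Collect_eq)
  then obtain c where c: "\<And>k. c k \<in> \<O>" "\<And>k. eF (c k) = a k" by metis
  have cF: "c k \<in> carrier F" for k using c(1) O(1) by blast
  have cl: "(\<lambda>k. (c k \<odot>\<^bsub>K\<^esub> \<one>\<^bsub>K\<^esub>) \<otimes>\<^bsub>K\<^esub> z [^]\<^bsub>K\<^esub> k) \<in> {..<n} \<rightarrow> carrier K" using cF z by auto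
  have "z [^]\<^bsub>K\<^esub> n \<oplus>\<^bsub>K\<^esub> (\<Oplus>\<^bsub>K\<^esub> k\<in>{..<n}. (c k \<odot>\<^bsub>K\<^esub> \<one>\<^bsub>K\<^esub>) \<otimes>\<^bsub>K\<^esub> z [^]\<^bsub>K\<^esub> k) = \<zero>\<^bsub>K\<^esub>"
  proof (rule xi_inj)
    fix i assume i: "i < n"
    have "xi i (z [^]\<^bsub>K\<^esub> n \<oplus>\<^bsub>K\<^esub> (\<Oplus>\<^bsub>K\<^esub> k\<in>{..<n}. (c k \<odot>\<^bsub>K\<^esub> \<one>\<^bsub>K\<^esub>) \<otimes>\<^bsub>K\<^esub> z [^]\<^bsub>K\<^esub> k)) = xi i z ^ n + (\<Sum>k<n. psi (a k) * xi i z ^ k)"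
      using i z cF K.M.M.finsum_closed[OF cl] by (simp add: xi_add xi_finsum[OF i _ cl] xi_mult xi_pow xi_smult xi_one c(2))
    thus "xi i (z [^]\<^bsub>K\<^esub> n \<oplus>\<^bsub>K\<^esub> (\<Oplus>\<^bsub>K\<^esub> k\<in>{..<n}. (c k \<odot>\<^bsub>K\<^esub> \<one>\<^bsub>K\<^esub>) \<otimes>\<^bsub>K\<^esub> z [^]\<^bsub>K\<^esub> k)) = xi i \<zero>\<^bsub>K\<^esub>"
      using a(2) i xi_zero by simp
  qed (use K.M.M.finsum_closed[OF cl] z in auto)
  thus "z \<in> integers_of \<O> K" unfolding integers_of_def integral_closure_def using z c(1)
    by (intro CollectI conjI exI[of _ n] exI[of _ "\<lambda>k. c k \<odot>\<^bsub>K\<^esub> \<one>\<^bsub>K\<^esub>"]) auto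
qed

text \<open>Any basis becomes integral when multiplied by a common denominator from \<open>R\<close>
  of all its conjugates.\<close>

lemma ex_integral_basis:
  assumes ar: "arith_ring (psi ` R) p" and O: "\<O> \<subseteq> carrier F" "eF ` \<O> = {z. integral_over R z}"
  shows "\<exists>b. alg_basis F K n b \<and> (\<forall>j<n. b j \<in> integers_of \<O> K)"
proof -
  interpret A: arith_ring "psi ` R" p by (rule ar)
  obtain b where b: "alg_basis F K n b" using ex_basis by blast
  have "\<forall>y. \<exists>r\<in>R. psi r ~= 0 \<and> psi r * y \<in> A.ints" using A.integral_multiple by blast
  then obtain r where r: "\<And>y. r y \<in> R \<and> psi (r y) ~= 0 \<and> psi (r y) * y \<in> A.ints" by metis
  define Y where "Y = (\<lambda>(i,j). xi i (b j)) ` ({..<n} \<times> {..<n})"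
  have fY: "finite Y" by (simp add: Y_def)
  define s where "s = (\<Prod>y\<in>Y. r y)"
  have sp: "psi s = (\<Prod>y\<in>Y. psi (r y))" unfolding s_def using fY
    by (induction Y rule: finite_induct) (auto simp: psi_1 psi_mult)
  have s0: "s ~= 0" using sp r fY psi_0 by auto
  have si: "psi s * y \<in> A.ints" if y: "y \<in> Y" for y
  proof -
    have e1: "psi s * y = (\<Prod>y\<in>Y - {y}. psi (r y)) * (psi (r y) * y)" unfolding sp using fY y by (subst prod.remove[of _ y]) auto
    have "(\<Prod>y\<in>Y - {y}. psi (r y)) \<in> psi ` R" using r by (intro is_subring_prod[OF A.subring]) auto
    hence e2: "(\<Prod>y\<in>Y - {y}. psi (r y)) \<in> A.ints" using A.R_ints by blast
    show ?thesis unfolding e1 using r by (intro A.ints_closed(4)[OF e2]) blast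
  qed
  define b' where "b' j = K.smul s (b j)" for j
  have "alg_basis F K n b'" using K.basis_scale[OF _ s0] b unfolding K.alg_basis_iff b'_def by blast
  moreover have "b' j \<in> integers_of \<O> K" if j: "j < n" for j
  proof (subst integers_iff[OF A.subring O])
    show "b' j \<in> carrier K" using basis_closed[OF b j] by (simp add: b'_def)
    show "\<forall>i<n. integral_over (psi ` R) (xi i (b' j))"
      using si basis_closed[OF b j] j by (auto simp: b'_def xi_smul Y_def A.ints_def)
  qed
  ultimately show ?thesis by blast
qed

end

section \<open>Exponents of ideals\<close>

context copy_extension begin

definition sig :: "('b => 'b) => 'l => 'l" where "sig g = (\<lambda>y\<in>carrier L. L.dec (g (eL y)))"

lemma sig_closed: "y \<in> carrier L ==> sig g y \<in> carrier L" by (simp add: sig_def)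

lemma eL_sig: "y \<in> carrier L ==> eL (sig g y) = g (eL y)" by (simp add: sig_def)

lemma sig_hom:
  assumes g: "g \<in> Gal" shows "sig g \<in> alg_hom F L L"
proof -
  interpret AL: algebra F L by (rule algFL)
  have hom: "g (y + z) = g y + g z" "g (y * z) = g y * g z" "g (psi c) = psi c" for y z c using g by (auto simp: Gal_def)
  have g1: "g 1 = 1" using hom(3)[of 1] psi_1 by simp
  have "sig g \<in> Ring.ring_hom L L"
  proof (rule ring_hom_memI)
    fix y z assume yz: "y \<in> carrier L" "z \<in> carrier L"
    show "sig g (y \<otimes>\<^bsub>L\<^esub> z) = sig g y \<otimes>\<^bsub>L\<^esub> sig g z"
      using yz by (intro L.e_inj) (auto simp: sig_closed eL_sig L.e_mult hom)
    show "sig g (y \<oplus>\<^bsub>L\<^esub> z) = sig g y \<oplus>\<^bsub>L\<^esub> sig g z"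
      using yz by (intro L.e_inj) (auto simp: sig_closed eL_sig L.e_add hom)
  next
    show "sig g \<one>\<^bsub>L\<^esub> = \<one>\<^bsub>L\<^esub>" by (intro L.e_inj) (auto simp: sig_closed eL_sig L.e_one g1)
  qed (rule sig_closed)
  moreover have "sig g (c \<odot>\<^bsub>L\<^esub> y) = c \<odot>\<^bsub>L\<^esub> sig g y" if "c \<in> carrier F" "y \<in> carrier L" for c y
    using that by (intro L.e_inj) (auto simp: sig_closed eL_sig eL_smult hom)
  moreover have "sig g \<in> extensional (carrier L)" by (simp add: sig_def)
  ultimately show ?thesis by (simp add: alg_hom_def)
qed

lemma sig_galois:
  assumes g: "g \<in> Gal" shows "sig g \<in> carrier (galois_group F L)"
proof -
  have b: "bij g" using g by (simp add: Gal_def)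
  have "bij_betw (sig g) (carrier L) (carrier L)"
  proof (rule bij_betwI[where g = "sig (finv g)"])
    show "sig (finv g) (sig g y) = y" if "y \<in> carrier L" for y
      using that b by (intro L.e_inj) (auto simp: sig_closed eL_sig bij_is_inj)
    show "sig g (sig (finv g) y) = y" if "y \<in> carrier L" for y
      using that b by (intro L.e_inj) (auto simp: sig_closed eL_sig bij_is_surj surj_f_inv_f)
  qed (auto simp: sig_closed)
  thus ?thesis using sig_hom[OF g] by (simp add: galois_group_def Bij_def alg_hom_def)
qed

lemma sig_inj: assumes "sig g = sig h" shows "g = h"
proof
  fix z
  obtain y where y: "y \<in> carrier L" "eL y = z" using L.e_surj by blast
  show "g z = h z" using eL_sig[OF y(1), of g] eL_sig[OF y(1), of h] y(2) assms by simp
qed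

text \<open>In a group only the unit is idempotent, so this equation suffices to see that a
  multiplicative map into a group sends \<open>sig id\<close> to the unit.\<close>

lemma sig_id_idem: "sig id \<otimes>\<^bsub>galois_group F L\<^esub> sig id = sig id"
proof -
  have sI: "sig id = (\<lambda>y\<in>carrier L. y)" by (auto simp: sig_def restrict_def fun_eq_iff)
  have "sig id \<in> Bij (carrier L)" using sig_galois[OF Gal_closed(1)] by (simp add: galois_group_def)
  thus ?thesis by (auto simp: galois_group_def BijGroup_def compose_def sI fun_eq_iff)
qed

end

context split_algebra begin

definition act :: "('b => 'b) => nat => nat" where
  "act g i = inv_into {..<n} x (compose (carrier K) (sig g) (x i))"

lemma compose_sig: assumes g: "g \<in> Gal" and i: "i < n" shows "compose (carrier K) (sig g) (x i) \<in> alg_hom F K L"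
proof -
  note s = sig_hom[OF g, unfolded alg_hom_def]
  note xi = hom_x(2,3)[OF i]
  have "compose (carrier K) (sig g) (x i) \<in> Ring.ring_hom K L"
    using s xi(1) x_closed[OF i] by (auto simp: compose_def Ring.ring_hom_def)
  moreover have "compose (carrier K) (sig g) (x i) (c \<odot>\<^bsub>K\<^esub> z) = c \<odot>\<^bsub>L\<^esub> compose (carrier K) (sig g) (x i) z"
    if "c \<in> carrier F" "z \<in> carrier K" for c z using s xi(2)[OF that] x_closed[OF i that(2)] that by (simp add: compose_def)
  ultimately show ?thesis by (simp add: alg_hom_def compose_def)
qed

lemma act_props:
  assumes g: "g \<in> Gal" and i: "i < n"
  shows "act g i < n" "x (act g i) = compose (carrier K) (sig g) (x i)"
  using compose_sig[OF assms] hom_bij unfolding act_def bij_betw_def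
  by (metis inv_into_into lessThan_iff, metis f_inv_into_f)

lemma act_xi: assumes "g \<in> Gal" "i < n" "z \<in> carrier K" shows "g (xi i z) = xi (act g i) z"
  using act_props(2)[OF assms(1,2)] assms(3) x_closed[OF assms(2,3)] by (simp add: xi_def compose_def eL_sig)

lemma card_act_fixed:
  assumes g: "g \<in> Gal" shows "card {i. i < n \<and> act g i = i} = perm_char (hom_rep F K L) (sig g)"
proof -
  have "bij_betw x {i. i < n \<and> act g i = i} {h \<in> alg_hom F K L. compose (carrier K) (sig g) h = h}"
  proof -
    have "x ` {i. i < n \<and> act g i = i} = {h \<in> alg_hom F K L. compose (carrier K) (sig g) h = h}"
    proof (intro equalityI subsetI)
      fix h assume "h \<in> x ` {i. i < n \<and> act g i = i}"
      then obtain i where i: "i < n" "act g i = i" "h = x i" by blast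
      have "compose (carrier K) (sig g) h = h" using act_props(2)[OF g i(1)] i by simp
      thus "h \<in> {h \<in> alg_hom F K L. compose (carrier K) (sig g) h = h}" using bij_betwE[OF hom_bij] i by auto
    next
      fix h assume h: "h \<in> {h \<in> alg_hom F K L. compose (carrier K) (sig g) h = h}"
      then obtain i where i: "i < n" "h = x i" using hom_bij by (auto simp: bij_betw_def)
      have "x (act g i) = x i" using act_props(2)[OF g i(1)] h i by simp
      hence "act g i = i" using hom_bij act_props(1)[OF g i(1)] i(1) by (auto simp: bij_betw_def inj_on_def)
      thus "h \<in> x ` {i. i < n \<and> act g i = i}" using i by blast
    qed
    moreover have "inj_on x {i. i < n \<and> act g i = i}" using hom_bij by (auto simp: bij_betw_def inj_on_def)
    ultimately show ?thesis by (simp add: bij_betw_def)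
  qed
  thus ?thesis unfolding perm_char_def invariants_def hom_rep_def
    by (subst bij_betw_same_card) (auto cong: conj_cong)
qed

end

section \<open>Ideals of the ring of integers and powers of a prime\<close>

locale ring_of_integers = field_copy F e
  for F :: "'f ring" (structure) and e :: "'f => 'a::field_char_0" +
  fixes \<O> :: "'f set" and R :: "'a set"
  assumes subring_R: "is_subring R" and O_carrier: "\<O> \<subseteq> carrier F" and O_image: "e ` \<O> = {z. integral_over R z}"
begin

abbreviation "Or \<equiv> F\<lparr>carrier := \<O>\<rparr>"

lemma mem_O: "y \<in> \<O> \<longleftrightarrow> y \<in> carrier F \<and> integral_over R (e y)"
proof
  assume "y \<in> carrier F \<and> integral_over R (e y)"
  moreover from this obtain z where "z \<in> \<O>" "e y = e z" using O_image by (metis (no_types, lifting) imageE mem_Collect_eq)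
  ultimately show "y \<in> \<O>" using e_inj[of y z] O_carrier by auto
qed (use O_carrier O_image in auto)

lemma O_car [simp, intro]: "y \<in> \<O> ==> y \<in> carrier F" using O_carrier by blast

lemma O_pre: assumes "integral_over R z" shows "\<exists>b\<in>\<O>. z = e b"
proof -
  have "z \<in> e ` \<O>" unfolding O_image using assms by simp
  thus ?thesis by blast
qed

lemma integral_subring: "is_subring {z. integral_over R z}" by (rule is_subring_integral_closure[OF subring_R])

lemma O_closed: "y \<in> \<O> ==> z \<in> \<O> ==> y \<oplus> z \<in> \<O>" "y \<in> \<O> ==> z \<in> \<O> ==> y \<otimes> z \<in> \<O>" "y \<in> \<O> ==> \<ominus> y \<in> \<O>" "\<one> \<in> \<O>" "\<zero> \<in> \<O>"
  using is_subring_closed[OF integral_subring] by (auto simp: mem_O e_add e_mult e_minus e_one e_zero)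

lemma cring_Or: "cring Or"
proof -
  have "subring \<O> F" by (rule F.subringI) (use O_carrier O_closed in auto)
  thus ?thesis using F.subcringI' F.subcring_iff[OF O_carrier] by blast
qed

sublocale Or: cring Or by (rule cring_Or)

lemma ideal_OrI:
  assumes S: "S \<subseteq> \<O>" "\<zero> \<in> S" and add: "\<And>y z. y \<in> S ==> z \<in> S ==> y \<oplus> z \<in> S"
    and mult: "\<And>a y. a \<in> \<O> ==> y \<in> S ==> a \<otimes> y \<in> S"
  shows "ideal S Or"
proof (rule idealI)
  show "ring Or" by (rule Or.ring_axioms)
  show "subgroup S (add_monoid Or)"
  proof (rule Or.add.subgroupI)
    fix y assume y: "y \<in> S"
    have yO: "y \<in> carrier Or" using y S by auto
    have "\<ominus>\<^bsub>Or\<^esub> y = \<ominus>\<^bsub>Or\<^esub> \<one>\<^bsub>Or\<^esub> \<otimes>\<^bsub>Or\<^esub> y" using yO by (simp only: Or.l_minus[OF Or.one_closed yO] Or.l_one)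
    moreover have "\<ominus>\<^bsub>Or\<^esub> \<one>\<^bsub>Or\<^esub> \<in> \<O>" using Or.a_inv_closed[OF Or.one_closed] by simp
    ultimately show "\<ominus>\<^bsub>Or\<^esub> y \<in> S" using mult[OF _ y] by simp
  qed (use S add in auto)
  show "y \<otimes>\<^bsub>Or\<^esub> a \<in> S" if "a \<in> S" "y \<in> carrier Or" for a y using mult[of y a] that by simp
  show "a \<otimes>\<^bsub>Or\<^esub> y \<in> S" if "a \<in> S" "y \<in> carrier Or" for a y
  proof -
    have "a \<in> \<O>" using S(1) that(1) by blast
    thus ?thesis using mult[of y a] that F.m_comm[of a y] by simp
  qed
qed

lemma ideal_OrD:
  assumes "ideal S Or" shows "S \<subseteq> \<O>" "\<zero> \<in> S" "\<And>y z. y \<in> S ==> z \<in> S ==> y \<oplus> z \<in> S" "\<And>a y. a \<in> \<O> ==> y \<in> S ==> a \<otimes> y \<in> S"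
proof -
  interpret ideal S Or by fact
  show "S \<subseteq> \<O>" using Icarr by auto
  show "\<zero> \<in> S" using zero_closed by simp
  show "\<And>y z. y \<in> S ==> z \<in> S ==> y \<oplus> z \<in> S" using a_closed by simp
  show "\<And>a y. a \<in> \<O> ==> y \<in> S ==> a \<otimes> y \<in> S" using I_l_closed by simp
qed

lemma typed_prime_image:
  assumes "prime_of F \<O> P" shows "typed_prime R (e ` P)"
proof -
  have pr: "primeideal P Or" and nz: "P ~= {\<zero>}" using assms by (auto simp: prime_of_def)
  interpret P: primeideal P Or by (rule pr)
  note I = ideal_OrD[OF P.is_ideal]
  have mem: "e y \<in> e ` P \<longleftrightarrow> y \<in> P" if "y \<in> carrier F" for y using that e_inj I(1) O_carrier by blast
  have PF: "a \<in> carrier F" if "a \<in> P" for a using I(1) that by blast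
  have one: "\<one> \<notin> P" using P.one_imp_carrier P.I_notcarr by auto
  show ?thesis unfolding typed_prime_def
  proof (intro conjI allI ballI impI)
    show "e ` P \<subseteq> {z. integral_over R z}" unfolding O_image[symmetric] using I(1) by blast
    show "1 \<notin> e ` P" using mem[of \<one>] one e_one by simp
    show "\<exists>z\<in>e ` P. z ~= 0"
    proof -
      obtain a where a: "a \<in> P" "a ~= \<zero>" using nz I(2) by blast
      have "e a ~= 0" using e_eq_0[OF PF[OF a(1)]] a(2) by simp
      thus ?thesis using a(1) by blast
    qed
    show "y + z \<in> e ` P" if yz: "y \<in> e ` P" "z \<in> e ` P" for y z
    proof -
      obtain a b where ab: "a \<in> P" "b \<in> P" "y = e a" "z = e b" using yz by blast
      have "y + z = e (a \<oplus> b)" using ab PF by (simp add: e_add)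
      thus ?thesis using I(3)[OF ab(1,2)] by blast
    qed
    show "z * y \<in> e ` P" if yz: "integral_over R z" "y \<in> e ` P" for y z
    proof -
      obtain a where a: "a \<in> P" "y = e a" using yz by blast
      obtain b where b: "b \<in> \<O>" "z = e b" using O_pre[OF yz(1)] by blast
      have "z * y = e (b \<otimes> a)" using a b PF by (simp add: e_mult)
      thus ?thesis using I(4)[OF b(1) a(1)] by blast
    qed
    show "y \<in> e ` P \<or> z \<in> e ` P" if yz: "integral_over R y" "integral_over R z" "y * z \<in> e ` P" for y z
    proof -
      obtain a where a: "a \<in> \<O>" "y = e a" using O_pre[OF yz(1)] by blast
      obtain b where b: "b \<in> \<O>" "z = e b" using O_pre[OF yz(2)] by blast
      have "e (a \<otimes> b) \<in> e ` P" using yz(3) a b by (simp add: e_mult)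
      hence "a \<otimes> b \<in> P" using mem[of "a \<otimes> b"] a(1) b(1) by simp
      hence "a \<in> P \<or> b \<in> P" using P.I_prime[of a b] a(1) b(1) by simp
      thus ?thesis using a b by blast
    qed
  qed
qed

end

locale integers_place = ring_of_integers F e \<O> R + pl: arith_place R p "e ` P"
  for F :: "'f ring" (structure) and e :: "'f => 'a::field_char_0" and \<O> :: "'f set" and R :: "'a set"
    and p :: nat and P :: "'f set" +
  assumes ideal_P: "ideal P Or"
begin

lemma mem_O': "y \<in> carrier F ==> y \<in> \<O> \<longleftrightarrow> e y \<in> pl.ints" by (simp add: mem_O pl.ints_def)

text \<open>The ideal of elements of valuation at least \<open>k\<close>. It stands in for the
  \<open>k\<close>-th power of \<open>P\<close>: being contained in it will be equivalent to
  divisibility by that power.\<close>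

definition lev :: "nat => 'f set" where "lev k = {y \<in> \<O>. pl.nv (e y) \<le> (1/2) ^ k}"

lemma lev_ideal: "ideal (lev k) Or"
proof (rule ideal_OrI)
  show "lev k \<subseteq> \<O>" by (auto simp: lev_def)
  show "\<zero> \<in> lev k" using O_closed(5) by (simp add: lev_def e_zero pl.nv_zero)
  show "y \<oplus> z \<in> lev k" if "y \<in> lev k" "z \<in> lev k" for y z
    using that O_closed(1)[of y z] by (auto simp: lev_def e_add intro: order_trans[OF pl.nv_add])
  show "a \<otimes> y \<in> lev k" if a: "a \<in> \<O>" and y: "y \<in> lev k" for a y
  proof -
    have "e a \<in> pl.ints" using a by (simp add: mem_O pl.ints_def)
    hence "pl.nv (e a) \<le> 1" by (rule pl.nv_ints)
    hence "pl.nv (e a) * pl.nv (e y) \<le> 1 * (1/2) ^ k" using y pl.nv_nonneg by (intro mult_mono) (auto simp: lev_def)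
    thus ?thesis using a y O_closed(2)[of a y] by (simp add: lev_def pl.nv_mult e_mult)
  qed
qed

abbreviation "Is \<equiv> ideals_set Or"

lemma monoid_Is: "comm_monoid Is" by (rule Or.ideals_set_is_comm_monoid)

sublocale Is: comm_monoid Is by (rule monoid_Is)

lemma Is_simps: "carrier Is = {I. ideal I Or}" "I \<otimes>\<^bsub>Is\<^esub> J = ideal_prod Or I J" "\<one>\<^bsub>Is\<^esub> = \<O>"
  by (simp_all add: ideals_set_def)

lemma P_Is: "P \<in> carrier Is" using ideal_P by (simp add: Is_simps)

lemma nv_P_le: assumes "y \<in> P" shows "pl.nv (e y) \<le> 1/2"
  using pl.nv_P[of "e y"] assms by simp

lemma pow_subset_lev: "P [^]\<^bsub>Is\<^esub> k \<subseteq> lev k"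
proof (induction k)
  case 0 thus ?case using pl.nv_ints by (auto simp: lev_def Is_simps mem_O pl.ints_def)
next
  case (Suc k)
  have "y \<in> lev (Suc k)" if "y \<in> ideal_prod Or (P [^]\<^bsub>Is\<^esub> k) P" for y
    using that
  proof (induction rule: ideal_prod.induct)
    case (prod i j)
    have i: "i \<in> lev k" using prod Suc by blast
    have ij: "i \<in> \<O>" "j \<in> \<O>" using i prod ideal_OrD(1)[OF ideal_P] by (auto simp: lev_def)
    have "pl.nv (e i) * pl.nv (e j) \<le> (1/2) ^ k * (1/2)"
      using i nv_P_le[OF prod(2)] pl.nv_nonneg by (intro mult_mono) (auto simp: lev_def)
    thus ?case using ij O_closed(2)[OF ij] by (simp add: lev_def pl.nv_mult e_mult)
  next
    case (sum s1 s2) thus ?case using ideal_OrD(3)[OF lev_ideal] by simp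
  qed
  thus ?case by (auto simp: Is_simps)
qed

text \<open>The module generated by 1 and \<open>c\<close>, where \<open>c\<close> corresponds to
  \<open>pl.cc\<close>, is the inverse of \<open>P\<close>. So \<open>J = I + c I\<close> satisfies
  \<open>I = P J\<close>, and multiplication by \<open>c\<close> lowers valuations by one, which
  lets the induction continue with \<open>J\<close>.\<close>

lemma divides_if_subset_lev:
  assumes "ideal I Or" "I \<subseteq> lev k"
  shows "\<exists>J. ideal J Or \<and> I = P [^]\<^bsub>Is\<^esub> k \<otimes>\<^bsub>Is\<^esub> J"
  using assms
proof (induction k arbitrary: I)
  case 0 thus ?case using Is.l_one[of I] by (intro exI[of _ I]) (simp add: Is_simps(1))
next
  case (Suc k)
  note I = ideal_OrD[OF Suc.prems(1)]
  define c where "c = dec pl.cc"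
  have cF: "c \<in> carrier F" "e c = pl.cc" by (auto simp: c_def)
  have IF: "y \<in> carrier F" if "y \<in> I" for y using I(1) O_carrier that by blast
  have IP: "e y \<in> e ` P" if "y \<in> I" for y
  proof -
    have "pl.nv (e y) \<le> (1/2) ^ Suc k" using Suc.prems(2) that by (auto simp: lev_def)
    also have "(1/2::real) ^ Suc k \<le> 1/2" by (simp add: power_le_one)
    finally have "pl.nv (e y) < 1" by simp
    moreover have "e y \<in> pl.ints" using I(1) that mem_O by (auto simp: pl.ints_def)
    ultimately show ?thesis using pl.nv_P_iff by blast
  qed
  have cI: "c \<otimes> y \<in> \<O>" if y: "y \<in> I" for y
  proof -
    have "e y \<in> pl.ints" using I(1) y mem_O by (auto simp: pl.ints_def)
    hence "pl.cc * e y \<in> pl.ints" using pl.cc_iff IP[OF y] by blast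
    thus ?thesis using IF[OF y] cF by (simp add: mem_O' e_mult)
  qed
  have cP: "y \<otimes> c \<in> \<O>" if y: "y \<in> P" for y
  proof -
    have yF: "y \<in> carrier F" "e y \<in> pl.ints" using y ideal_OrD(1)[OF ideal_P] mem_O by (auto simp: pl.ints_def)
    have "pl.cc * e y \<in> pl.ints" using pl.cc_iff[OF yF(2)] y by blast
    thus ?thesis using yF cF by (simp add: mem_O' e_mult mult.commute)
  qed
  define J where "J = {y \<oplus> c \<otimes> z | y z. y \<in> I \<and> z \<in> I}"
  have JI: "ideal J Or"
  proof (rule ideal_OrI)
    show "J \<subseteq> \<O>" unfolding J_def using I(1) cI O_closed(1) by blast
    have "\<zero> = \<zero> \<oplus> c \<otimes> \<zero>" using cF by simp
    thus "\<zero> \<in> J" unfolding J_def using I(2) by blast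
    fix u v assume u: "u \<in> J"
    then obtain y z where yz: "y \<in> I" "z \<in> I" "u = y \<oplus> c \<otimes> z" unfolding J_def by blast
    show "u \<oplus> v \<in> J" if v: "v \<in> J"
    proof -
      obtain y' z' where yz': "y' \<in> I" "z' \<in> I" "v = y' \<oplus> c \<otimes> z'" using v unfolding J_def by blast
      have "u \<oplus> v = (y \<oplus> y') \<oplus> c \<otimes> (z \<oplus> z')"
        by (rule e_inj) (use yz yz' IF cF in \<open>auto simp: e_add e_mult algebra_simps\<close>)
      thus ?thesis unfolding J_def using I(3) yz yz' by blast
    qed
    show "v \<otimes> u \<in> J" if v: "v \<in> \<O>"
    proof -
      have "v \<otimes> u = v \<otimes> y \<oplus> c \<otimes> (v \<otimes> z)"
        by (rule e_inj) (use yz IF cF v O_carrier in \<open>auto simp: e_add e_mult algebra_simps\<close>)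
      thus ?thesis unfolding J_def using I(4)[OF v] yz by blast
    qed
  qed
  have "J \<subseteq> lev k"
  proof
    fix u assume "u \<in> J"
    then obtain y z where yz: "y \<in> I" "z \<in> I" "u = y \<oplus> c \<otimes> z" unfolding J_def by blast
    have le: "pl.nv (e y) \<le> (1/2) ^ Suc k" "pl.nv (e z) \<le> (1/2) ^ Suc k" using Suc.prems(2) yz by (auto simp: lev_def)
    have "(1/2::real) ^ Suc k \<le> (1/2) ^ k" by simp
    hence "pl.nv (e y) \<le> (1/2) ^ k" using le by linarith
    moreover have "pl.nv (pl.cc * e z) \<le> (1/2) ^ k" using le(2) by (simp add: pl.nv_mult pl.nv_cc)
    ultimately have "pl.nv (e y + pl.cc * e z) \<le> (1/2) ^ k" using pl.nv_add[of "e y" "pl.cc * e z"] by linarith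
    moreover have "e u = e y + pl.cc * e z" using yz IF cF by (simp add: e_add e_mult)
    moreover have "u \<in> \<O>" using yz I(1) cI O_closed(1) by blast
    ultimately show "u \<in> lev k" by (simp add: lev_def)
  qed
  then obtain J' where J': "ideal J' Or" "J = P [^]\<^bsub>Is\<^esub> k \<otimes>\<^bsub>Is\<^esub> J'" using Suc.IH[OF JI] by blast
  have "I = P \<otimes>\<^bsub>Is\<^esub> J"
  proof (intro equalityI subsetI)
    fix y assume y: "y \<in> I"
    \<comment> \<open>The decomposition of 1 multiplied by \<open>y\<close> reads
      \<open>y = a * y + b * (c * y)\<close>, with \<open>a\<close> and \<open>b\<close> in
      \<open>P\<close> and both \<open>y\<close> and \<open>c * y\<close> in
      \<open>J\<close>.\<close>
    obtain a' b' where ab': "a' \<in> e ` P" "b' \<in> e ` P" "a' + pl.cc * b' = 1" using pl.one_split by blast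
    obtain a b where ab: "a \<in> P" "b \<in> P" "a' = e a" "b' = e b" using ab'(1,2) by blast
    have PF: "w \<in> carrier F" if "w \<in> P" for w using that ideal_OrD(1)[OF ideal_P] O_carrier by blast
    have "e y = (e a + pl.cc * e b) * e y" using ab'(3) ab by simp
    hence "y = a \<otimes> y \<oplus> b \<otimes> (c \<otimes> y)"
      by (intro e_inj) (use ab y IF cF PF in \<open>auto simp: e_add e_mult algebra_simps\<close>)
    moreover have "y = y \<oplus> c \<otimes> \<zero>" "c \<otimes> y = \<zero> \<oplus> c \<otimes> y" using y IF cF by auto
    hence "y \<in> J" "c \<otimes> y \<in> J" unfolding J_def using I(2) y by blast+
    hence "a \<otimes> y \<oplus> b \<otimes> (c \<otimes> y) \<in> ideal_prod Or P J"
      using ideal_prod.sum[OF ideal_prod.prod[of a P y J Or] ideal_prod.prod[of b P "c \<otimes> y" J Or]] ab by simp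
    ultimately show "y \<in> P \<otimes>\<^bsub>Is\<^esub> J" by (simp add: Is_simps)
  next
    fix y assume "y \<in> P \<otimes>\<^bsub>Is\<^esub> J"
    hence "y \<in> ideal_prod Or P J" by (simp add: Is_simps)
    thus "y \<in> I"
    proof (induction rule: ideal_prod.induct)
      case (prod i j)
      obtain y z where yz: "y \<in> I" "z \<in> I" "j = y \<oplus> c \<otimes> z" using prod(2) unfolding J_def by blast
      have iO: "i \<in> \<O>" using prod(1) ideal_OrD(1)[OF ideal_P] by blast
      have "i \<otimes> j = i \<otimes> y \<oplus> (i \<otimes> c) \<otimes> z"
        by (rule e_inj) (use yz IF cF iO O_carrier in \<open>auto simp: e_add e_mult algebra_simps\<close>)
      moreover have "... \<in> I" using I(3)[OF I(4)[OF iO yz(1)] I(4)[OF cP[OF prod(1)] yz(2)]] .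
      ultimately show ?case by simp
    next
      case (sum s1 s2) thus ?case using I(3) by simp
    qed
  qed
  also have "... = P \<otimes>\<^bsub>Is\<^esub> (P [^]\<^bsub>Is\<^esub> k \<otimes>\<^bsub>Is\<^esub> J')" using J'(2) by simp
  also have "... = P [^]\<^bsub>Is\<^esub> Suc k \<otimes>\<^bsub>Is\<^esub> J'"
  proof -
    have J'c: "J' \<in> carrier Is" using J'(1) by (simp add: Is_simps)
    have "P \<otimes>\<^bsub>Is\<^esub> (P [^]\<^bsub>Is\<^esub> k \<otimes>\<^bsub>Is\<^esub> J') = (P \<otimes>\<^bsub>Is\<^esub> P [^]\<^bsub>Is\<^esub> k) \<otimes>\<^bsub>Is\<^esub> J'"
      by (rule Is.m_assoc[symmetric]) (use P_Is J'c in auto)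
    also have "P \<otimes>\<^bsub>Is\<^esub> P [^]\<^bsub>Is\<^esub> k = P [^]\<^bsub>Is\<^esub> Suc k" using Is.m_comm[OF P_Is Is.nat_pow_closed[OF P_Is]] by simp
    finally show ?thesis .
  qed
  finally show ?case using J'(1) by blast
qed

lemma nv_le_power_iff: assumes "z ~= 0" shows "pl.nv z \<le> (1/2) ^ k \<longleftrightarrow> int k \<le> pl.val z"
proof -
  have "(1/2::real) ^ k = 2 powr (- real k)" by (simp add: powr_minus powr_realpow power_one_over inverse_eq_divide)
  moreover have "pl.nv z = 2 powr (- real_of_int (pl.val z))" using assms by (simp add: pl.nv_def)
  ultimately show ?thesis using of_int_le_iff[of "int k" "pl.val z", where ?'a = real] by simp
qed

text \<open>Divisibility by a power of \<open>P\<close> means that all generators have at least that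
  valuation, and \<open>d0\<close> attains the minimum.\<close>

lemma ideal_exponent_eq:
  assumes S: "S \<subseteq> \<O>" and d0: "d0 \<in> S" "e d0 ~= 0" and min: "\<And>d. d \<in> S ==> e d ~= 0 \<and> pl.val (e d0) \<le> pl.val (e d)"
  shows "ideal_exponent Or P (Idl\<^bsub>Or\<^esub> S) = nat (pl.val (e d0))" "0 \<le> pl.val (e d0)"
proof -
  have "e d0 \<in> pl.ints" using S d0 mem_O by (auto simp: pl.ints_def)
  thus v0: "0 \<le> pl.val (e d0)" using pl.nv_ints[of "e d0"] nv_le_power_iff[OF d0(2), of 0] by simp
  have SO: "S \<subseteq> carrier Or" using S by simp
  have idl: "ideal (Idl\<^bsub>Or\<^esub> S) Or" by (rule Or.genideal_ideal[OF SO])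
  have "P [^]\<^bsub>Is\<^esub> k divides\<^bsub>Is\<^esub> (Idl\<^bsub>Or\<^esub> S) \<longleftrightarrow> k \<le> nat (pl.val (e d0))" for k :: nat
  proof
    assume "P [^]\<^bsub>Is\<^esub> k divides\<^bsub>Is\<^esub> (Idl\<^bsub>Or\<^esub> S)"
    then obtain J where J: "ideal J Or" "Idl\<^bsub>Or\<^esub> S = ideal_prod Or (P [^]\<^bsub>Is\<^esub> k) J" by (auto simp: factor_def Is_simps)
    have "y \<in> lev k" if "y \<in> ideal_prod Or (P [^]\<^bsub>Is\<^esub> k) J" for y
      using that
    proof (induction rule: ideal_prod.induct)
      case (prod i j)
      have i: "i \<in> lev k" using prod(1) pow_subset_lev by blast
      have j: "j \<in> \<O>" using prod(2) ideal_OrD(1)[OF J(1)] by blast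
      have "i \<otimes> j = j \<otimes> i" using i j O_carrier by (intro F.m_comm) (auto simp: lev_def)
      thus ?case using ideal_OrD(4)[OF lev_ideal j i] by simp
    next
      case (sum s1 s2) thus ?case using ideal_OrD(3)[OF lev_ideal] by simp
    qed
    hence "d0 \<in> lev k" using Or.genideal_self[OF SO] d0(1) J(2) by blast
    thus "k \<le> nat (pl.val (e d0))" using nv_le_power_iff[OF d0(2)] by (auto simp: lev_def)
  next
    assume k: "k \<le> nat (pl.val (e d0))"
    have "S \<subseteq> lev k"
    proof
      fix d assume d: "d \<in> S"
      have "int k \<le> pl.val (e d)" using k v0 min[OF d] by linarith
      thus "d \<in> lev k" using nv_le_power_iff[of "e d" k] min[OF d] d S by (auto simp: lev_def)
    qed
    hence "Idl\<^bsub>Or\<^esub> S \<subseteq> lev k" by (rule Or.genideal_minimal[OF lev_ideal])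
    thus "P [^]\<^bsub>Is\<^esub> k divides\<^bsub>Is\<^esub> (Idl\<^bsub>Or\<^esub> S)" using divides_if_subset_lev[OF idl] by (auto simp: factor_def Is_simps)
  qed
  hence eq: "{k::nat. P [^]\<^bsub>Is\<^esub> k divides\<^bsub>Is\<^esub> (Idl\<^bsub>Or\<^esub> S)} = {..nat (pl.val (e d0))}" by auto
  show "ideal_exponent Or P (Idl\<^bsub>Or\<^esub> S) = nat (pl.val (e d0))" unfolding ideal_exponent_def eq by (rule Max_eqI) auto
qed

end

section \<open>Cycles and fixed points in permutation groups\<close>

text \<open>\<open>Orbits.orbit\<close> collects the positive iterates; the period brings
  \<open>x\<close> itself in.\<close>

lemma orbit_eq_funpow_image:
  assumes m: "m > 0" "(f ^^ m) x = x"
  shows "Orbits.orbit f x = (\<lambda>k. (f ^^ k) x) ` {..<m}"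
proof -
  have per: "(f ^^ k) x = (f ^^ (k mod m)) x" for k using funpow_mod_eq[OF m(2), of k] by simp
  show ?thesis
  proof
    show "Orbits.orbit f x \<subseteq> (\<lambda>k. (f ^^ k) x) ` {..<m}"
    proof
      fix y assume "y \<in> Orbits.orbit f x"
      then obtain k where "y = (f ^^ k) x" unfolding orbit_altdef by blast
      thus "y \<in> (\<lambda>k. (f ^^ k) x) ` {..<m}" using per[of k] m(1) by (intro image_eqI[of _ _ "k mod m"]) auto
    qed
    show "(\<lambda>k. (f ^^ k) x) ` {..<m} \<subseteq> Orbits.orbit f x"
    proof
      fix y assume "y \<in> (\<lambda>k. (f ^^ k) x) ` {..<m}"
      then obtain k where "y = (f ^^ k) x" by blast
      hence "y = (f ^^ (k + m)) x" using m(2) by (simp add: funpow_add)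
      thus "y \<in> Orbits.orbit f x" unfolding orbit_altdef using m(1) by blast
    qed
  qed
qed

text \<open>The exponents below \<open>m\<close> are spread evenly over the orbit: shifting by
  \<open>j\<close> modulo \<open>m\<close> matches those that fix \<open>x\<close> with those that
  lead to its \<open>j\<close>-th iterate.\<close>

lemma card_orbit_times_stabilizer:
  assumes m: "m > 0" "(f ^^ m) x = x"
  shows "card (Orbits.orbit f x) * card {k. k < m \<and> (f ^^ k) x = x} = m"
proof -
  have per: "(f ^^ k) x = (f ^^ (k mod m)) x" for k using funpow_mod_eq[OF m(2), of k] by simp
  have same: "card {k. k < m \<and> (f ^^ k) x = y} = card {k. k < m \<and> (f ^^ k) x = x}" if y: "y \<in> Orbits.orbit f x" for y
  proof -
    obtain j where j: "j < m" "y = (f ^^ j) x" using y unfolding orbit_eq_funpow_image[OF m] by auto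
    have bk: "(f ^^ (m - j)) y = x" using j m by (simp add: funpow_add[symmetric, THEN fun_cong, unfolded comp_def])
    have "bij_betw (\<lambda>k. (k + j) mod m) {k. k < m \<and> (f ^^ k) x = x} {k. k < m \<and> (f ^^ k) x = y}"
    proof (rule bij_betwI[where g = "\<lambda>l. (l + (m - j)) mod m"])
      show "(\<lambda>k. (k + j) mod m) \<in> {k. k < m \<and> (f ^^ k) x = x} \<rightarrow> {k. k < m \<and> (f ^^ k) x = y}"
      proof
        fix k assume "k \<in> {k. k < m \<and> (f ^^ k) x = x}"
        hence "(f ^^ (j + k)) x = y" using j by (simp add: funpow_add)
        thus "(k + j) mod m \<in> {k. k < m \<and> (f ^^ k) x = y}" using m(1) per[of "k + j"] by (simp add: add.commute)
      qed
      show "(\<lambda>l. (l + (m - j)) mod m) \<in> {k. k < m \<and> (f ^^ k) x = y} \<rightarrow> {k. k < m \<and> (f ^^ k) x = x}"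
      proof
        fix k assume "k \<in> {k. k < m \<and> (f ^^ k) x = y}"
        hence "(f ^^ ((m - j) + k)) x = x" using bk by (simp add: funpow_add)
        thus "(k + (m - j)) mod m \<in> {k. k < m \<and> (f ^^ k) x = x}" using m(1) per[of "k + (m - j)"] by (simp add: add.commute)
      qed
      show "((k + j) mod m + (m - j)) mod m = k" if "k \<in> {k. k < m \<and> (f ^^ k) x = x}" for k
      proof -
        have "((k + j) mod m + (m - j)) mod m = (k + j + (m - j)) mod m" by (rule mod_add_left_eq)
        also have "k + j + (m - j) = k + m" using j by simp
        finally show ?thesis using that by simp
      qed
      show "((l + (m - j)) mod m + j) mod m = l" if "l \<in> {k. k < m \<and> (f ^^ k) x = y}" for l
      proof -
        have "((l + (m - j)) mod m + j) mod m = (l + (m - j) + j) mod m" by (rule mod_add_left_eq)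
        also have "l + (m - j) + j = l + m" using j by simp
        finally show ?thesis using that by simp
      qed
    qed
    thus ?thesis by (rule bij_betw_same_card[symmetric])
  qed
  have "m = (\<Sum>k<m. 1::nat)" by simp
  also have "... = (\<Sum>y\<in>Orbits.orbit f x. \<Sum>k\<in>{k \<in> {..<m}. (f ^^ k) x = y}. 1)"
  proof (rule sum.group[symmetric])
    show "finite (Orbits.orbit f x)" unfolding orbit_eq_funpow_image[OF m] by simp
    show "(\<lambda>k. (f ^^ k) x) ` {..<m} \<subseteq> Orbits.orbit f x" unfolding orbit_eq_funpow_image[OF m] by simp
  qed simp
  also have "... = (\<Sum>y\<in>Orbits.orbit f x. card {k. k < m \<and> (f ^^ k) x = x})" using same by (intro sum.cong) auto
  finally show ?thesis by simp
qed

lemma orbit_eqI: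
  assumes m: "m > 0" "\<And>x. x \<in> E ==> (f ^^ m) x = x" and f: "\<And>x. x \<in> E ==> f x \<in> E" and x: "x \<in> E"
  shows "{y \<in> E. Orbits.orbit f y = Orbits.orbit f x} = Orbits.orbit f x"
proof -
  have fk: "(f ^^ k) x \<in> E" if "x \<in> E" for k x using that f by (induction k) auto
  have self: "y \<in> Orbits.orbit f y" if "y \<in> E" for y
    unfolding orbit_eq_funpow_image[OF m(1) m(2)[OF that]] using m(1) by (intro image_eqI[of _ _ 0]) auto
  have sub: "Orbits.orbit f y \<subseteq> Orbits.orbit f x" if "y \<in> Orbits.orbit f x" for x y
  proof
    fix z assume "z \<in> Orbits.orbit f y"
    thus "z \<in> Orbits.orbit f x" using that by (metis orbit_trans)
  qed
  show ?thesis
  proof (intro equalityI subsetI)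
    fix y assume "y \<in> {y \<in> E. Orbits.orbit f y = Orbits.orbit f x}"
    thus "y \<in> Orbits.orbit f x" using self by blast
  next
    fix y assume y: "y \<in> Orbits.orbit f x"
    then obtain k where k: "k < m" "y = (f ^^ k) x" unfolding orbit_eq_funpow_image[OF m(1) m(2)[OF x]] by auto
    have yE: "y \<in> E" using fk x k by simp
    have xy: "x = (f ^^ (m - k)) y" using k m(2)[OF x] by (simp add: funpow_add[symmetric, THEN fun_cong, unfolded comp_def])
    have "0 < m - k" using k(1) by simp
    hence "x \<in> Orbits.orbit f y" unfolding orbit_altdef by (intro CollectI exI[of _ "m - k"] conjI xy)
    thus "y \<in> {y \<in> E. Orbits.orbit f y = Orbits.orbit f x}" using sub[OF y] sub[of x y] yE by blast
  qed
qed

text \<open>Burnside's count for the cyclic group of exponents modulo \<open>m\<close>. Any common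
  period may serve as \<open>m\<close>, so that elements of different orders can be compared with
  the same \<open>m\<close>.\<close>

lemma card_orbits_times_period:
  assumes m: "m > 0" "\<And>x. x \<in> E ==> (f ^^ m) x = x" and f: "\<And>x. x \<in> E ==> f x \<in> E" and E: "finite E"
  shows "m * card (Orbits.orbit f ` E) = (\<Sum>k<m. card {x \<in> E. (f ^^ k) x = x})"
proof -
  have "(\<Sum>k<m. card {x \<in> E. (f ^^ k) x = x}) = (\<Sum>k<m. \<Sum>x\<in>E. if (f ^^ k) x = x then 1 else 0)"
    using E by (simp add: sum.inter_filter[symmetric])
  also have "... = (\<Sum>x\<in>E. \<Sum>k<m. if (f ^^ k) x = x then 1 else 0)" by (rule sum.swap)
  also have "... = (\<Sum>x\<in>E. card {k. k < m \<and> (f ^^ k) x = x})"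
    by (simp add: sum.inter_filter[symmetric])
  also have "... = (\<Sum>W\<in>Orbits.orbit f ` E. \<Sum>x\<in>{x \<in> E. Orbits.orbit f x = W}. card {k. k < m \<and> (f ^^ k) x = x})"
    by (rule sum.group[symmetric]) (use E in auto)
  also have "... = (\<Sum>W\<in>Orbits.orbit f ` E. m)"
  proof (rule sum.cong[OF refl])
    fix W assume "W \<in> Orbits.orbit f ` E"
    then obtain x where x: "x \<in> E" "W = Orbits.orbit f x" by blast
    have eq: "{y \<in> E. Orbits.orbit f y = W} = W" unfolding x(2) by (rule orbit_eqI[OF m f x(1)])
    have finO: "finite W" 
    proof -
      have "finite {y \<in> E. Orbits.orbit f y = W}" using E by simp
      thus ?thesis by (simp only: eq)
    qed
    have ne: "card W > 0"
    proof -
      have "x \<in> W" using eq x by blast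
      thus ?thesis using finO by (auto simp: card_gt_0_iff)
    qed
    have "card {k. k < m \<and> (f ^^ k) y = y} = m div card W" if "y \<in> {y \<in> E. Orbits.orbit f y = W}" for y
    proof -
      define c where "c = card {k. k < m \<and> (f ^^ k) y = y}"
      have "card W * c = m" using card_orbit_times_stabilizer[OF m(1) m(2)[of y]] that by (simp add: c_def)
      thus ?thesis using ne unfolding c_def[symmetric] by (metis less_numeral_extra(3) nonzero_mult_div_cancel_left)
    qed
    hence "(\<Sum>x\<in>{x \<in> E. Orbits.orbit f x = W}. card {k. k < m \<and> (f ^^ k) x = x}) = card W * (m div card W)"
      using eq by simp
    moreover have "card W dvd m" using card_orbit_times_stabilizer[OF m(1) m(2)[OF x(1)]] x(2) by (metis dvd_triv_left)
    ultimately show "(\<Sum>x\<in>{x \<in> E. Orbits.orbit f x = W}. card {k. k < m \<and> (f ^^ k) x = x}) = m" by simp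
  qed
  finally show ?thesis by simp
qed

section \<open>Numbers of cycles and permutation characters\<close>

definition is_action :: "'g monoid => ('g, 'x) perm_rep => bool" where
  "is_action G \<rho> \<longleftrightarrow> finite (fst \<rho>) \<and> (\<forall>x\<in>fst \<rho>. snd \<rho> \<one>\<^bsub>G\<^esub> x = x) \<and>
     (\<forall>g\<in>carrier G. \<forall>x\<in>fst \<rho>. snd \<rho> g x \<in> fst \<rho>) \<and>
     (\<forall>g\<in>carrier G. \<forall>h\<in>carrier G. \<forall>x\<in>fst \<rho>. snd \<rho> (g \<otimes>\<^bsub>G\<^esub> h) x = snd \<rho> g (snd \<rho> h x))"

locale monoid_group = group G for G :: "'a monoid" (structure)
begin

lemma action_funpow:
  assumes "is_action G \<rho>" "g \<in> carrier G" "x \<in> fst \<rho>"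
  shows "(snd \<rho> g ^^ k) x = snd \<rho> (g [^] k) x"
proof (induction k)
  case 0 show ?case using assms by (simp add: is_action_def)
next
  case (Suc k)
  have "(snd \<rho> g ^^ Suc k) x = snd \<rho> g (snd \<rho> (g [^] k) x)" using Suc by simp
  also have "... = snd \<rho> (g \<otimes> g [^] k) x" using assms by (simp add: is_action_def)
  also have "g \<otimes> g [^] k = g [^] Suc k" using assms(2) nat_pow_Suc2 by simp
  finally show ?case .
qed

lemma num_cycles_times_period:
  assumes ac: "is_action G \<rho>" and g: "g \<in> carrier G" and m: "m > 0" "g [^] m = \<one>"
  shows "m * num_cycles \<rho> g = (\<Sum>k<m. perm_char \<rho> (g [^] k))"
proof -
  have "m * num_cycles \<rho> g = (\<Sum>k<m. card {x \<in> fst \<rho>. (snd \<rho> g ^^ k) x = x})"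
    unfolding num_cycles_def
  proof (rule card_orbits_times_period[OF m(1)])
    show "(snd \<rho> g ^^ m) x = x" if "x \<in> fst \<rho>" for x
      using action_funpow[OF ac g that] m(2) ac that by (simp add: is_action_def)
  qed (use ac g in \<open>auto simp: is_action_def\<close>)
  also have "... = (\<Sum>k<m. perm_char \<rho> (g [^] k))"
    unfolding perm_char_def invariants_def using action_funpow[OF ac g]
    by (intro sum.cong arg_cong[where f = card]) auto
  finally show ?thesis .
qed

lemma perm_char_conj:
  assumes ac: "is_action G \<rho>" and x: "x \<in> carrier G" and h: "h \<in> carrier G"
  shows "perm_char \<rho> (x \<otimes> h \<otimes> inv x) = perm_char \<rho> h"
  unfolding perm_char_def invariants_def
proof (rule bij_betw_same_card[OF bij_betwI[where f = "snd \<rho> (inv x)" and g = "snd \<rho> x"]])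
  have mul: "snd \<rho> (a \<otimes> b) y = snd \<rho> a (snd \<rho> b y)" "snd \<rho> b y \<in> fst \<rho>" "snd \<rho> \<one> y = y"
    if "a \<in> carrier G" "b \<in> carrier G" "y \<in> fst \<rho>" for a b y using ac that by (auto simp: is_action_def)
  have xi: "snd \<rho> x (snd \<rho> (inv x) y) = y" "snd \<rho> (inv x) (snd \<rho> x y) = y" if "y \<in> fst \<rho>" for y
    using mul(1)[of x "inv x" y] mul(1)[of "inv x" x y] mul(3)[of x x y] that x by auto
  have conj: "snd \<rho> (x \<otimes> h \<otimes> inv x) y = snd \<rho> x (snd \<rho> h (snd \<rho> (inv x) y))" if "y \<in> fst \<rho>" for y
    using mul(1)[of "x \<otimes> h" "inv x" y] mul(1)[of x h "snd \<rho> (inv x) y"] mul(2)[of x "inv x" y] that x h by simp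
  show "snd \<rho> (inv x) \<in> {y \<in> fst \<rho>. snd \<rho> (x \<otimes> h \<otimes> inv x) y = y} \<rightarrow> {y \<in> fst \<rho>. snd \<rho> h y = y}"
  proof
    fix y assume y: "y \<in> {y \<in> fst \<rho>. snd \<rho> (x \<otimes> h \<otimes> inv x) y = y}"
    have yE: "snd \<rho> (inv x) y \<in> fst \<rho>" "snd \<rho> h (snd \<rho> (inv x) y) \<in> fst \<rho>" using mul(2) y x h by auto
    have "snd \<rho> (inv x) y = snd \<rho> (inv x) (snd \<rho> x (snd \<rho> h (snd \<rho> (inv x) y)))" using conj y by auto
    also have "... = snd \<rho> h (snd \<rho> (inv x) y)" using xi(2)[OF yE(2)] .
    finally show "snd \<rho> (inv x) y \<in> {y \<in> fst \<rho>. snd \<rho> h y = y}" using yE by simp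
  qed
  show "snd \<rho> x \<in> {y \<in> fst \<rho>. snd \<rho> h y = y} \<rightarrow> {y \<in> fst \<rho>. snd \<rho> (x \<otimes> h \<otimes> inv x) y = y}"
  proof
    fix y assume y: "y \<in> {y \<in> fst \<rho>. snd \<rho> h y = y}"
    have yE: "snd \<rho> x y \<in> fst \<rho>" using mul(2) y x by auto
    thus "snd \<rho> x y \<in> {y \<in> fst \<rho>. snd \<rho> (x \<otimes> h \<otimes> inv x) y = y}" using conj[OF yE] xi(2)[of y] y by simp
  qed
  show "\<And>y. y \<in> {y \<in> fst \<rho>. snd \<rho> (x \<otimes> h \<otimes> inv x) y = y} ==> snd \<rho> x (snd \<rho> (inv x) y) = y" using xi(1) by auto
  show "\<And>y. y \<in> {y \<in> fst \<rho>. snd \<rho> h y = y} ==> snd \<rho> (inv x) (snd \<rho> x y) = y" using xi(2) by auto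
qed

lemma conj_pow:
  assumes "x \<in> carrier G" "h \<in> carrier G"
  shows "(x \<otimes> h \<otimes> inv x) [^] (k::nat) = x \<otimes> h [^] k \<otimes> inv x"
proof (induction k)
  case 0 show ?case using assms by simp
next
  case (Suc k)
  have cancel: "inv x \<otimes> (x \<otimes> y) = y" if "y \<in> carrier G" for y using assms that by (simp add: m_assoc[symmetric])
  have "(x \<otimes> h \<otimes> inv x) [^] Suc k = (x \<otimes> h [^] k \<otimes> inv x) \<otimes> (x \<otimes> h \<otimes> inv x)" using Suc by (simp add: nat_pow_Suc)
  also have "... = x \<otimes> (h [^] k \<otimes> h) \<otimes> inv x" using assms cancel by (simp add: m_assoc)
  finally show ?case by (simp add: nat_pow_Suc)
qed

text \<open>Conjugation preserves the characters of all powers, so \<open>g\<close> has as many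
  cycles as the power \<open>y\<close> of \<open>h\<close>, and each cycle of \<open>h\<close> is a
  union of cycles of \<open>y\<close>. Used in both directions, this makes the number of cycles
  constant on a power-conjugacy class.\<close>

lemma num_cycles_conj_power_ge:
  assumes ac: "is_action G \<rho>" and fin: "finite (carrier G)" and g: "g \<in> carrier G" and h: "h \<in> carrier G"
    and gh: "conj_to_power G g h"
  shows "num_cycles \<rho> h \<le> num_cycles \<rho> g"
proof -
  obtain x k where xk: "x \<in> carrier G" "g = x \<otimes> h [^] (k::nat) \<otimes> inv x" using gh by (auto simp: conj_to_power_def)
  define m where "m = Coset.order G"
  have m: "m > 0" "\<And>a. a \<in> carrier G ==> a [^] m = \<one>"
    using fin pow_order_eq_1 by (auto simp: m_def order_gt_0_iff_finite)
  define y where "y = h [^] k"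
  have y: "y \<in> carrier G" using h by (simp add: y_def)
  have "m * num_cycles \<rho> g = m * num_cycles \<rho> y"
    unfolding num_cycles_times_period[OF ac g m(1) m(2)[OF g]] num_cycles_times_period[OF ac y m(1) m(2)[OF y]]
    using xk conj_pow[OF xk(1) y] perm_char_conj[OF ac xk(1)] y by (simp add: y_def[symmetric])
  hence eq: "num_cycles \<rho> g = num_cycles \<rho> y" using m(1) by simp
  have E: "finite (fst \<rho>)" using ac by (simp add: is_action_def)
  \<comment> \<open>Sends a cycle of \<open>y\<close> to the cycle of \<open>h\<close> that contains
    it; every cycle of \<open>h\<close> arises in this way.\<close>
  define \<Theta> where "\<Theta> W = (\<Union>z\<in>W. Orbits.orbit (snd \<rho> h) z)" for W
  have "Orbits.orbit (snd \<rho> h) ` fst \<rho> \<subseteq> \<Theta> ` (Orbits.orbit (snd \<rho> y) ` fst \<rho>)"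
  proof
    fix W assume "W \<in> Orbits.orbit (snd \<rho> h) ` fst \<rho>"
    then obtain z where z: "z \<in> fst \<rho>" "W = Orbits.orbit (snd \<rho> h) z" by blast
    have per: "(snd \<rho> a ^^ m) w = w" if "a \<in> carrier G" "w \<in> fst \<rho>" for a w
      using action_funpow[OF ac that] m(2)[OF that(1)] ac that by (simp add: is_action_def)
    have stab: "snd \<rho> h w \<in> fst \<rho>" if "w \<in> fst \<rho>" for w using ac h that by (simp add: is_action_def)
    have "Orbits.orbit (snd \<rho> y) z \<subseteq> Orbits.orbit (snd \<rho> h) z"
    proof
      fix w assume "w \<in> Orbits.orbit (snd \<rho> y) z"
      then obtain i where i: "i > 0" "w = (snd \<rho> y ^^ i) z" unfolding orbit_altdef by blast
      hence "w = snd \<rho> (y [^] i) z" using action_funpow[OF ac y z(1)] by simp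
      also have "y [^] i = h [^] (k * i + m)" using h m(2)[OF h] by (simp add: y_def nat_pow_pow nat_pow_mult[symmetric])
      finally have "w = (snd \<rho> h ^^ (k * i + m)) z" using action_funpow[OF ac h z(1)] by simp
      thus "w \<in> Orbits.orbit (snd \<rho> h) z" unfolding orbit_altdef using m(1) by blast
    qed
    moreover have "Orbits.orbit (snd \<rho> h) w = W" if "w \<in> W" for w
      using orbit_eqI[OF m(1) per[OF h] stab z(1)] that z(2) by blast
    moreover have "z \<in> Orbits.orbit (snd \<rho> y) z"
      unfolding orbit_eq_funpow_image[OF m(1) per[OF y z(1)]] using m(1) by (intro image_eqI[of _ _ 0]) auto
    ultimately have "\<Theta> (Orbits.orbit (snd \<rho> y) z) = W" unfolding \<Theta>_def using z by blast
    thus "W \<in> \<Theta> ` (Orbits.orbit (snd \<rho> y) ` fst \<rho>)" using z(1) by blast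
  qed
  hence "card (Orbits.orbit (snd \<rho> h) ` fst \<rho>) \<le> card (Orbits.orbit (snd \<rho> y) ` fst \<rho>)"
    using E by (meson card_image_le card_mono finite_imageI order_trans)
  thus ?thesis using eq by (simp add: num_cycles_def)
qed

lemma power_conj_refl: "g \<in> carrier G ==> conj_to_power G g g"
proof -
  assume "g \<in> carrier G"
  hence "g = \<one> \<otimes> g [^] (1::nat) \<otimes> inv \<one>" by simp
  thus ?thesis unfolding conj_to_power_def by blast
qed

lemma c_class_eq:
  assumes ac: "is_action G \<rho>" and fin: "finite (carrier G)" and g: "g \<in> carrier G"
  shows "c_class \<rho> (power_conj_rel G `` {g}) = card (fst \<rho>) - num_cycles \<rho> g"
proof -
  have "num_cycles \<rho> h = num_cycles \<rho> g" if "h \<in> power_conj_rel G `` {g}" for h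
    using that num_cycles_conj_power_ge[OF ac fin] by (auto simp: power_conj_rel_def intro!: antisym)
  moreover have "g \<in> power_conj_rel G `` {g}" using g power_conj_refl by (auto simp: power_conj_rel_def)
  ultimately have "(\<lambda>g. card (fst \<rho>) - num_cycles \<rho> g) ` (power_conj_rel G `` {g}) = {card (fst \<rho>) - num_cycles \<rho> g}" (is "?f ` ?A = {?v}")
  proof -
    assume nc: "\<And>h. h \<in> ?A ==> num_cycles \<rho> h = num_cycles \<rho> g" and gA: "g \<in> ?A"
    have "?f ` ?A = (\<lambda>_. ?v) ` ?A" by (rule image_cong[OF refl]) (simp only: nc)
    also have "... = {?v}" using gA by (simp add: image_constant_conv) blast
    finally show ?thesis .
  qed
  thus ?thesis by (simp add: c_class_def)
qed

lemma power_conj_class_one: "power_conj_rel G `` {\<one>} = {\<one>}"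
proof (intro equalityI subsetI)
  fix h assume "h \<in> power_conj_rel G `` {\<one>}"
  then obtain x k where "x \<in> carrier G" "h = x \<otimes> \<one> [^] (k::nat) \<otimes> inv x" by (auto simp: power_conj_rel_def conj_to_power_def)
  thus "h \<in> {\<one>}" by simp
next
  fix h assume "h \<in> {\<one>}"
  thus "h \<in> power_conj_rel G `` {\<one>}" using power_conj_refl[OF one_closed] by (simp add: power_conj_rel_def)
qed

lemma regular_rep_action: assumes "finite (carrier G)" shows "is_action G (regular_rep G)"
  using assms by (simp add: is_action_def regular_rep_def m_assoc)

lemma regular_rep_char: "g \<in> carrier G ==> perm_char (regular_rep G) g = (if g = \<one> then card (carrier G) else 0)"
proof -
  assume g: "g \<in> carrier G"
  have "{x \<in> carrier G. g \<otimes> x = x} = (if g = \<one> then carrier G else {})" using g by auto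
  thus ?thesis by (simp add: perm_char_def invariants_def regular_rep_def cong: conj_cong)
qed

end

lemma permutation_groupD:
  assumes "permutation_group n G"
  shows "group G" "finite (carrier G)" "\<And>g. g \<in> carrier G ==> g permutes {1..n}" "\<one>\<^bsub>G\<^esub> = id"
    "\<And>g h. g \<otimes>\<^bsub>G\<^esub> h = g \<circ> h" "is_action G (given_rep n)"
    "\<And>g. perm_char (given_rep n) g = card {x \<in> {1..n}. g x = x}"
proof -
  have sub: "subgroup (carrier G) (sym_group n)" and G: "G = (sym_group n)\<lparr>carrier := carrier G\<rparr>"
    using assms by (auto simp: permutation_group_def)
  show "group G" using subgroup.subgroup_is_group[OF sub sym_group_is_group] G by simp
  have sc: "carrier G \<subseteq> {p. p permutes {1..n}}" using subgroup.subset[OF sub] by (simp add: sym_group_def)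
  thus "finite (carrier G)" by (rule finite_subset) (simp add: finite_permutations)
  show perm: "\<And>g. g \<in> carrier G ==> g permutes {1..n}" using sc by auto
  show one: "\<one>\<^bsub>G\<^esub> = id" by (subst G) (simp add: sym_group_def)
  show mul: "\<And>g h. g \<otimes>\<^bsub>G\<^esub> h = g \<circ> h" by (subst G) (simp add: sym_group_def)
  show "is_action G (given_rep n)" unfolding is_action_def given_rep_def
    using one mul permutes_in_image[OF perm] by (auto simp: permutes_in_image[OF perm, of _ _] split: if_splits)
  show "\<And>g. perm_char (given_rep n) g = card {x \<in> {1..n}. g x = x}"
    by (simp add: perm_char_def invariants_def given_rep_def cong: conj_cong)
qed

text \<open>Let \<open>g\<close> have order \<open>m\<close>, and let \<open>S\<close> be the sum of
  the numbers of fixed points of \<open>g ^ k\<close> for \<open>0 < k < m\<close>. Then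
  \<open>m\<close> times the value of \<open>c\<close> is \<open>(m - 1) * n - S\<close> for the
  given representation and \<open>m - 1\<close> times the order of \<open>G\<close> for the regular
  one. Each term of \<open>S\<close> is at most the maximal number of fixed points, with equality
  throughout if \<open>g\<close> itself attains it.\<close>

lemma tw_alpha_given_regular:
  assumes pg: "permutation_group n G" and nt: "carrier G ~= {\<one>\<^bsub>G\<^esub>}"
  shows "tw_alpha G (given_rep n) (regular_rep G) = (of_nat n - of_nat (max_fixed_points n G)) / of_nat (card (carrier G))"
    and "max_fixed_points n G \<le> n" "n > 0" "card (carrier G) > 0"
    and "\<And>g. g \<in> carrier G ==> g ~= \<one>\<^bsub>G\<^esub> ==> perm_char (given_rep n) g \<le> max_fixed_points n G"
proof -
  interpret monoid_group G using permutation_groupD(1)[OF pg] by (simp add: monoid_group_def)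
  have fin: "finite (carrier G)" by (rule permutation_groupD(2)[OF pg])
  note ac = permutation_groupD(6)[OF pg]
  note ch = permutation_groupD(7)[OF pg]
  define fx where "fx = max_fixed_points n G"
  define N where "N = card (carrier G)"
  show N0: "card (carrier G) > 0" using fin by (auto simp: card_gt_0_iff)
  have ex: "carrier G - {\<one>\<^bsub>G\<^esub>} ~= {}" using nt one_closed by blast
  have fx_eq: "fx = Max ((\<lambda>g. perm_char (given_rep n) g) ` (carrier G - {\<one>\<^bsub>G\<^esub>}))"
    unfolding fx_def max_fixed_points_def ch by simp
  have fx_ge: "perm_char (given_rep n) g \<le> fx" if "g \<in> carrier G" "g ~= \<one>\<^bsub>G\<^esub>" for g
    unfolding fx_eq using that fin by (intro Max_ge) auto
  thus "\<And>g. g \<in> carrier G ==> g ~= \<one>\<^bsub>G\<^esub> ==> perm_char (given_rep n) g \<le> max_fixed_points n G" by (simp add: fx_def)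
  have "fx \<in> (\<lambda>g. perm_char (given_rep n) g) ` (carrier G - {\<one>\<^bsub>G\<^esub>})" unfolding fx_eq using fin ex by (intro Max_in) auto
  then obtain g0 where g0: "g0 \<in> carrier G" "g0 ~= \<one>\<^bsub>G\<^esub>" "perm_char (given_rep n) g0 = fx" by auto
  have pcn: "perm_char (given_rep n) g \<le> n" for g
    unfolding ch by (rule order_trans[OF card_mono[of "{1..n}"]]) auto
  show fxn: "max_fixed_points n G \<le> n" using pcn[of g0] g0(3) by (simp add: fx_def)
  show n0: "n > 0"
  proof (rule ccontr)
    assume "\<not> n > 0"
    hence "g0 = id" using permutation_groupD(3)[OF pg g0(1)] by simp
    thus False using g0(2) permutation_groupD(4)[OF pg] by simp
  qed
  have one_ch: "perm_char (given_rep n) \<one>\<^bsub>G\<^esub> = n" unfolding ch permutation_groupD(4)[OF pg] id_apply by (simp only: simp_thms Collect_mem_eq card_atLeastAtMost)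
  have val: "of_nat (c_class (given_rep n) (power_conj_rel G `` {g})) / of_nat (c_class (regular_rep G) (power_conj_rel G `` {g}))
      \<ge> (of_nat n - of_nat fx) / (of_nat N :: rat) \<and>
      ((\<forall>k::nat. g [^]\<^bsub>G\<^esub> k ~= \<one>\<^bsub>G\<^esub> --> perm_char (given_rep n) (g [^]\<^bsub>G\<^esub> k) = fx) -->
      of_nat (c_class (given_rep n) (power_conj_rel G `` {g})) / of_nat (c_class (regular_rep G) (power_conj_rel G `` {g}))
      = (of_nat n - of_nat fx) / (of_nat N :: rat))" if g: "g \<in> carrier G" "g ~= \<one>\<^bsub>G\<^esub>" for g
  proof -
    define m where "m = ord g"
    have m0: "m > 0" using ord_ge_1[OF fin g(1)] by (simp add: m_def)
    have m1: "m ~= 1" using ord_eq_1[OF g(1)] g(2) by (simp add: m_def)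
    have gm: "g [^]\<^bsub>G\<^esub> m = \<one>\<^bsub>G\<^esub>" using pow_ord_eq_1[OF g(1)] by (simp add: m_def)
    have gk: "g [^]\<^bsub>G\<^esub> k ~= \<one>\<^bsub>G\<^esub>" if "0 < k" "k < m" for k
      using that pow_eq_id[OF g(1), of k] by (auto simp: m_def dest: dvd_imp_le)
    have split: "{..<m} = insert 0 {1..<m}" using m0 by auto
    define c1 where "c1 = c_class (given_rep n) (power_conj_rel G `` {g})"
    define c2 where "c2 = c_class (regular_rep G) (power_conj_rel G `` {g})"
    have c1: "c1 = n - num_cycles (given_rep n) g" unfolding c1_def c_class_eq[OF ac fin g(1)] by (simp add: given_rep_def)
    have c2: "c2 = N - num_cycles (regular_rep G) g"
      unfolding c2_def c_class_eq[OF regular_rep_action[OF fin] fin g(1)] by (simp add: regular_rep_def N_def)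
    have cyc1: "m * num_cycles (given_rep n) g = n + (\<Sum>k\<in>{1..<m}. perm_char (given_rep n) (g [^]\<^bsub>G\<^esub> k))"
      unfolding num_cycles_times_period[OF ac g(1) m0 gm] split using one_ch by simp
    have "m * num_cycles (regular_rep G) g = N + (\<Sum>k\<in>{1..<m}. perm_char (regular_rep G) (g [^]\<^bsub>G\<^esub> k))"
      unfolding num_cycles_times_period[OF regular_rep_action[OF fin] g(1) m0 gm] split
      using regular_rep_char[OF one_closed] by (simp add: N_def)
    also have "(\<Sum>k\<in>{1..<m}. perm_char (regular_rep G) (g [^]\<^bsub>G\<^esub> k)) = 0"
      using gk regular_rep_char g(1) by (intro sum.neutral) auto
    finally have cyc2: "m * num_cycles (regular_rep G) g = N" by simp
    have le1: "num_cycles (given_rep n) g \<le> n" unfolding num_cycles_def given_rep_def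
      using card_image_le[of "{1..n}"] by simp
    have "num_cycles (regular_rep G) g \<le> m * num_cycles (regular_rep G) g" using m0 by simp
    hence le2: "num_cycles (regular_rep G) g \<le> N" using cyc2 by simp
    let ?S = "\<Sum>k\<in>{1..<m}. perm_char (given_rep n) (g [^]\<^bsub>G\<^esub> k)"
    have S: "?S \<le> (m - 1) * fx" using sum_bounded_above[of "{1..<m}" "\<lambda>k. perm_char (given_rep n) (g [^]\<^bsub>G\<^esub> k)" fx] fx_ge gk g(1) by auto
    have r1: "of_nat m * (of_nat c1 :: rat) = of_nat m * of_nat n - (of_nat n + of_nat ?S)"
      using arg_cong[OF cyc1, of "of_nat :: nat => rat"] le1 by (simp add: c1 of_nat_diff algebra_simps)
    have r2: "of_nat m * (of_nat c2 :: rat) = (of_nat m - 1) * of_nat N"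
      using arg_cong[OF cyc2, of "of_nat :: nat => rat"] le2 by (simp add: c2 of_nat_diff algebra_simps)
    have mpos: "(of_nat m :: rat) > 1" using m0 m1 by simp
    have Npos: "(of_nat N :: rat) > 0" using N0 by (simp add: N_def)
    have c2pos: "(of_nat c2 :: rat) > 0"
    proof -
      have "of_nat m * (of_nat c2 :: rat) > 0" unfolding r2 using mpos Npos by simp
      thus ?thesis using mpos by (simp add: zero_less_mult_iff)
    qed
    have S': "(of_nat ?S :: rat) \<le> (of_nat m - 1) * of_nat fx"
    proof -
      have "(of_nat ?S :: rat) \<le> of_nat ((m - 1) * fx)" using S of_nat_le_iff by blast
      thus ?thesis using m0 by (simp add: of_nat_diff)
    qed
    have "of_nat m * (of_nat c1 :: rat) = (of_nat m - 1) * of_nat n - of_nat ?S" using r1 by (simp add: algebra_simps)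
    \<comment> \<open>The difference of the two sides of the claimed inequality, cleared of
      denominators. It is nonnegative, and 0 exactly when the sum of fixed points is as large as
      possible.\<close>
    hence key: "of_nat m * ((of_nat c1 :: rat) * of_nat N - (of_nat n - of_nat fx) * of_nat c2) = of_nat N * ((of_nat m - 1) * of_nat fx - of_nat ?S)"
    proof -
      assume a: "of_nat m * (of_nat c1 :: rat) = (of_nat m - 1) * of_nat n - of_nat ?S"
      have "of_nat m * ((of_nat c1 :: rat) * of_nat N - (of_nat n - of_nat fx) * of_nat c2)
         = (of_nat m * of_nat c1) * of_nat N - (of_nat n - of_nat fx) * (of_nat m * of_nat c2)" by (simp add: algebra_simps)
      thus ?thesis unfolding a r2 by (simp add: algebra_simps)
    qed
    have "0 \<le> of_nat m * ((of_nat c1 :: rat) * of_nat N - (of_nat n - of_nat fx) * of_nat c2)"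
      unfolding key using S' Npos by simp
    hence "(of_nat n - of_nat fx) * of_nat c2 \<le> (of_nat c1 :: rat) * of_nat N" using mpos by (simp add: zero_le_mult_iff)
    hence ge: "(of_nat n - of_nat fx) / (of_nat N :: rat) \<le> of_nat c1 / of_nat c2"
      using Npos c2pos by (simp add: field_simps)
    moreover have "of_nat c1 / of_nat c2 = (of_nat n - of_nat fx) / (of_nat N :: rat)"
      if all: "\<forall>k::nat. g [^]\<^bsub>G\<^esub> k ~= \<one>\<^bsub>G\<^esub> --> perm_char (given_rep n) (g [^]\<^bsub>G\<^esub> k) = fx"
    proof -
      have "?S = (m - 1) * fx" using gk all by (subst sum.cong[of _ "{1..<m}" _ "\<lambda>_. fx"]) auto
      hence "(of_nat ?S :: rat) = (of_nat m - 1) * of_nat fx" using m0 by (simp add: of_nat_diff)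
      hence "of_nat m * ((of_nat c1 :: rat) * of_nat N - (of_nat n - of_nat fx) * of_nat c2) = 0" unfolding key by simp
      hence "(of_nat c1 :: rat) * of_nat N = (of_nat n - of_nat fx) * of_nat c2" using mpos by simp
      thus ?thesis using Npos c2pos by (simp add: field_simps)
    qed
    ultimately show ?thesis unfolding c1_def[symmetric] c2_def[symmetric] by blast
  qed
  have cls: "nonid_power_conj_classes G = (\<lambda>g. power_conj_rel G `` {g}) ` (carrier G - {\<one>\<^bsub>G\<^esub>})"
  proof -
    have "power_conj_rel G `` {g} ~= {\<one>\<^bsub>G\<^esub>}" if "g \<in> carrier G" "g ~= \<one>\<^bsub>G\<^esub>" for g
      using that power_conj_refl[OF that(1)] by (auto simp: power_conj_rel_def)
    thus ?thesis unfolding nonid_power_conj_classes_def quotient_def using power_conj_class_one by auto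
  qed
  show "tw_alpha G (given_rep n) (regular_rep G) = (of_nat n - of_nat (max_fixed_points n G)) / of_nat (card (carrier G))"
    unfolding tw_alpha_def cls fx_def[symmetric] N_def[symmetric]
  proof (rule Min_eqI)
    show "finite ((\<lambda>\<tau>. of_nat (c_class (given_rep n) \<tau>) / (of_nat (c_class (regular_rep G) \<tau>) :: rat)) ` (\<lambda>g. power_conj_rel G `` {g}) ` (carrier G - {\<one>\<^bsub>G\<^esub>}))"
      using fin by simp
    fix y assume "y \<in> (\<lambda>\<tau>. of_nat (c_class (given_rep n) \<tau>) / (of_nat (c_class (regular_rep G) \<tau>) :: rat)) ` (\<lambda>g. power_conj_rel G `` {g}) ` (carrier G - {\<one>\<^bsub>G\<^esub>})"
    thus "(of_nat n - of_nat fx) / of_nat N \<le> y" using val by auto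
  next
    \<comment> \<open>Powers of \<open>g0\<close> fix all points that \<open>g0\<close> fixes, and
      the nontrivial ones no more than the maximum; so the minimum is attained at the class of
      \<open>g0\<close>.\<close>
    have "perm_char (given_rep n) (g0 [^]\<^bsub>G\<^esub> k) = fx" if k: "g0 [^]\<^bsub>G\<^esub> k ~= \<one>\<^bsub>G\<^esub>" for k :: nat
    proof (rule antisym)
      show "perm_char (given_rep n) (g0 [^]\<^bsub>G\<^esub> k) \<le> fx" using fx_ge k g0(1) by simp
      have "{x \<in> {1..n}. g0 x = x} \<subseteq> {x \<in> {1..n}. (g0 [^]\<^bsub>G\<^esub> k) x = x}"
      proof
        fix x assume x: "x \<in> {x \<in> {1..n}. g0 x = x}"
        have "(g0 [^]\<^bsub>G\<^esub> k) x = x"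
        proof (induction k)
          case 0 show ?case using permutation_groupD(4)[OF pg] by simp
        next
          case (Suc k) thus ?case using x by (simp add: nat_pow_Suc permutation_groupD(5)[OF pg])
        qed
        thus "x \<in> {x \<in> {1..n}. (g0 [^]\<^bsub>G\<^esub> k) x = x}" using x by simp
      qed
      hence "perm_char (given_rep n) g0 \<le> perm_char (given_rep n) (g0 [^]\<^bsub>G\<^esub> k)" unfolding ch by (intro card_mono) auto
      thus "fx \<le> perm_char (given_rep n) (g0 [^]\<^bsub>G\<^esub> k)" using g0(3) by simp
    qed
    hence "(of_nat n - of_nat fx) / (of_nat N :: rat) = of_nat (c_class (given_rep n) (power_conj_rel G `` {g0})) / of_nat (c_class (regular_rep G) (power_conj_rel G `` {g0}))"
      using val[OF g0(1,2)] by simp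
    thus "(of_nat n - of_nat fx) / of_nat N \<in> (\<lambda>\<tau>. of_nat (c_class (given_rep n) \<tau>) / (of_nat (c_class (regular_rep G) \<tau>) :: rat)) ` (\<lambda>g. power_conj_rel G `` {g}) ` (carrier G - {\<one>\<^bsub>G\<^esub>})"
      using g0 by blast
  qed
qed

section \<open>The discriminant inequality\<close>

text \<open>The valuations of discriminants of integral bases are natural numbers, so one is least.
  As these discriminants generate the discriminant ideal, the least valuation is its
  exponent.\<close>

lemma ex_minimal_integral_basis:
  assumes sa: "split_algebra F eF L eL K n x" and ip: "integers_place F eF \<O> R p P"
    and ar: "arith_ring (copy_extension.psi F eF L eL ` R) p"
  shows "\<exists>b. alg_basis F K n b \<and> (\<forall>j<n. b j \<in> integers_of \<O> K) \<and>
    int (disc_exponent F \<O> P K) = arith_place.val R (eF ` P) (eF (basis_disc F K n b)) \<and>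
    (\<forall>b'. alg_basis F K n b' --> (\<forall>j<n. b' j \<in> integers_of \<O> K) -->
      arith_place.val R (eF ` P) (eF (basis_disc F K n b)) \<le> arith_place.val R (eF ` P) (eF (basis_disc F K n b')))"
proof -
  interpret S: split_algebra F eF L eL K n x by (rule sa)
  interpret I: integers_place F eF \<O> R p P by (rule ip)
  interpret A: arith_ring "S.psi ` R" p by (rule ar)
  define ib where "ib b \<longleftrightarrow> alg_basis F K n b \<and> (\<forall>j<n. b j \<in> integers_of \<O> K)" for b
  define D where "D b = basis_disc F K n b" for b
  obtain b0 where b0: "ib b0" using S.ex_integral_basis[OF ar I.O_carrier I.O_image] by (auto simp: ib_def)
  have DO: "D b \<in> \<O>" "eF (D b) ~= 0" if b: "ib b" for b
  proof -
    have ba: "alg_basis F K n b" using b by (simp add: ib_def)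
    let ?B = "mat n n (\<lambda>(i,j). S.hom_mat b i j)"
    have "det ?B \<in> {z. integral_over (S.psi ` R) z}"
    proof (rule det_in_subring[OF is_subring_integral_closure[OF A.subring], of _ n])
      fix i j assume ij: "i < n" "j < n"
      have "integral_over (S.psi ` R) (S.xi i (b j))"
        using S.integers_iff[OF A.subring I.O_carrier I.O_image S.basis_closed[OF ba ij(2)]] b ij by (simp add: ib_def)
      thus "?B $$ (i, j) \<in> {z. integral_over (S.psi ` R) z}" using ij by (simp add: S.hom_mat_def)
    qed simp
    hence "S.psi (eF (D b)) \<in> {z. integral_over (S.psi ` R) z}"
      unfolding D_def S.disc_xi(2)[OF ba] by (rule is_subring_power[OF is_subring_integral_closure[OF A.subring]])
    thus "D b \<in> \<O>" using S.integral_psi[of R "eF (D b)"] I.mem_O S.disc_xi(1)[OF ba] by (simp add: D_def)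
    show "eF (D b) ~= 0" using S.disc_nonzero[OF ba] by (simp add: D_def)
  qed
  have v0: "0 \<le> I.pl.val (eF (D b))" if "ib b" for b
    using I.ideal_exponent_eq(2)[of "{D b}" "D b"] DO[OF that] by simp
  obtain b where b: "ib b" and le: "\<And>b'. ib b' ==> nat (I.pl.val (eF (D b))) \<le> nat (I.pl.val (eF (D b')))"
    using ex_has_least_nat[of ib b0 "\<lambda>b. nat (I.pl.val (eF (D b)))"] b0 by blast
  have le': "I.pl.val (eF (D b)) \<le> I.pl.val (eF (D b'))" if "ib b'" for b' using le[OF that] v0[OF that] v0[OF b] by linarith
  have "{basis_disc F K m b | m b. alg_basis F K m b \<and> (\<forall>i<m. b i \<in> integers_of \<O> K)} = D ` {b. ib b}" (is "?X = _")
  proof (intro equalityI subsetI)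
    fix d assume "d \<in> ?X"
    then obtain m b' where mb: "d = basis_disc F K m b'" "alg_basis F K m b'" "\<forall>i<m. b' i \<in> integers_of \<O> K" by blast
    have "m = n" using S.K.alg_degree_eq[OF mb(2)] S.K.alg_degree_eq[of n b] b by (simp add: ib_def)
    thus "d \<in> D ` {b. ib b}" using mb by (auto simp: ib_def D_def)
  next
    fix d assume "d \<in> D ` {b. ib b}" thus "d \<in> ?X" unfolding ib_def D_def by blast
  qed
  hence de: "disc_exponent F \<O> P K = ideal_exponent I.Or P (Idl\<^bsub>I.Or\<^esub> (D ` {b. ib b}))"
    unfolding disc_exponent_def disc_ideal_def by simp
  have "disc_exponent F \<O> P K = nat (I.pl.val (eF (D b)))"
    unfolding de by (rule I.ideal_exponent_eq(1)) (use DO b le' in auto)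
  hence "int (disc_exponent F \<O> P K) = I.pl.val (eF (D b))" using v0[OF b] by simp
  thus ?thesis using b le' unfolding ib_def D_def by blast
qed

lemma etale_split_algebra:
  assumes ce: "copy_extension F eF L eL" and et: "etale_algebra F K"
    and hom: "finite (alg_hom F K L)" "card (alg_hom F K L) = alg_degree F K"
  shows "\<exists>x. split_algebra F eF L eL K (alg_degree F K) x"
proof -
  interpret copy_extension F eF L eL by (rule ce)
  have alg: "algebra F K" using et by (simp add: etale_algebra_def)
  have cm: "copy_module F eF K" using alg by (intro copy_module.intro field_copy_axioms) (simp add: algebra_def)
  obtain N B where B: "alg_basis F K N B" using copy_module.etale_has_basis[OF cm et] by blast
  have N: "alg_degree F K = N" by (rule copy_module.alg_degree_eq[OF cm B])
  obtain x where x: "bij_betw x {0..<card (alg_hom F K L)} (alg_hom F K L)" using ex_bij_betw_nat_finite[OF hom(1)] by blast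
  have "split_algebra F eF L eL K N x"
    by (intro split_algebra.intro split_algebra_axioms.intro ce cm alg) (use x B hom N in \<open>auto simp: atLeast0LessThan\<close>)
  thus ?thesis using N by blast
qed

lemma joint_splitting_generates:
  assumes s1: "split_algebra F eF L eL K1 n1 x1" and s2: "split_algebra F eF L eL K2 n2 x2"
    and b1: "alg_basis F K1 n1 b1" and b2: "alg_basis F K2 n2 b2"
    and gen: "carrier L = generate_field L ((\<lambda>c. c \<odot>\<^bsub>L\<^esub> \<one>\<^bsub>L\<^esub>) ` carrier F \<union> (\<Union>K\<in>{K1, K2}. \<Union>h\<in>alg_hom F K L. h ` carrier K))"
  shows "field_extension.generates (copy_extension.psi F eF L eL) n1 (split_algebra.hom_mat eL x1 b1) n2 (split_algebra.hom_mat eL x2 b2)"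
proof -
  interpret S1: split_algebra F eF L eL K1 n1 x1 by (rule s1)
  interpret S2: split_algebra F eF L eL K2 n2 x2 by (rule s2)
  let ?H = "(\<lambda>c. c \<odot>\<^bsub>L\<^esub> \<one>\<^bsub>L\<^esub>) ` carrier F \<union> (\<Union>K\<in>{K1, K2}. \<Union>h\<in>alg_hom F K L. h ` carrier K)"
  interpret AL: algebra F L by (rule S1.algFL)
  have Hc: "generate_field L ?H \<subseteq> carrier L" using gen by simp
  show ?thesis unfolding S1.generates_def
  proof (intro allI impI)
    fix S assume S: "(\<forall>x\<in>S. \<forall>y\<in>S. x - y \<in> S \<and> x * y \<in> S) \<and> (\<forall>x\<in>S. inverse x \<in> S) \<and> range S1.psi \<subseteq> S \<and>
     (\<forall>v\<in>S1.alg_vecs n1 (S1.hom_mat b1). \<forall>i<n1. v i \<in> S) \<and> (\<forall>v\<in>S1.alg_vecs n2 (S2.hom_mat b2). \<forall>i<n2. v i \<in> S)"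
    note SB = S[THEN conjunct2, THEN conjunct1, rule_format]
    note SD = S[THEN conjunct2, THEN conjunct2, THEN conjunct2, THEN conjunct1, rule_format]
    note SE = S[THEN conjunct2, THEN conjunct2, THEN conjunct2, THEN conjunct2, rule_format]
    have cl: "x - y \<in> S" "x * y \<in> S" if "x \<in> S" "y \<in> S" for x y using S that by auto
    have c0: "0 \<in> S" "1 \<in> S" using S S1.psi_0 S1.psi_1 by (metis rangeI subsetD)+
    have neg: "- y \<in> S" if "y \<in> S" for y using cl(1)[OF c0(1) that] by simp
    have mem: "eL y \<in> S" if "y \<in> generate_field L ?H" for y
      using that
    proof (induction y rule: generate_field.induct)
      case one show ?case using S1.L.e_one c0 by simp
    next
      case (incl h)
      consider c where "c \<in> carrier F" "h = c \<odot>\<^bsub>L\<^esub> \<one>\<^bsub>L\<^esub>" | f z where "f \<in> alg_hom F K1 L" "z \<in> carrier K1" "h = f z"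
        | f z where "f \<in> alg_hom F K2 L" "z \<in> carrier K2" "h = f z" using incl by blast
      thus ?case
      proof cases
        case 1 thus ?thesis using S1.eL_smult[OF 1(1), of "\<one>\<^bsub>L\<^esub>"] S S1.L.e_one by auto
      next
        case 2
        then obtain i where i: "i < n1" "f = x1 i" using S1.hom_bij by (auto simp: bij_betw_def)
        have "(\<lambda>i. S1.xi i z) \<in> S1.alg_vecs n1 (S1.hom_mat b1)" using S1.alg_vecs_iff[OF b1] 2(2) by blast
        from SD[OF this i(1)] have "S1.xi i z \<in> S" .
        thus ?thesis using 2(3) i(2) by (simp add: S1.xi_def)
      next
        case 3
        then obtain i where i: "i < n2" "f = x2 i" using S2.hom_bij by (auto simp: bij_betw_def)
        have "(\<lambda>i. S2.xi i z) \<in> S1.alg_vecs n2 (S2.hom_mat b2)" using S2.alg_vecs_iff[OF b2] 3(2) by blast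
        from SE[OF this i(1)] have "S2.xi i z \<in> S" .
        thus ?thesis using 3(3) i(2) by (simp add: S2.xi_def)
      qed
    next
      case (a_inv h) thus ?case using S1.L.e_minus[of h] Hc neg by auto
    next
      case (m_inv h) thus ?case using S1.L.e_inv[of h] Hc SB by auto
    next
      case (eng_add h1 h2)
      have "eL (h1 \<oplus>\<^bsub>L\<^esub> h2) = eL h1 - (- eL h2)" using S1.L.e_add[of h1 h2] eng_add(1,2) Hc by auto
      thus ?case using cl(1)[OF eng_add(3) neg[OF eng_add(4)]] by simp
    next
      case (eng_mult h1 h2)
      have "eL (h1 \<otimes>\<^bsub>L\<^esub> h2) = eL h1 * eL h2" using S1.L.e_mult[of h1 h2] eng_mult(1,2) Hc by auto
      thus ?case using cl(2)[OF eng_mult(3,4)] by simp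
    qed
    have "z \<in> S" for z
    proof -
      obtain y where y: "y \<in> carrier L" "eL y = z" using S1.L.e_surj by blast
      have "y \<in> generate_field L ?H" using y(1) by (subst gen[symmetric])
      thus ?thesis using mem[of y] y(2) by simp
    qed
    thus "S = UNIV" by blast
  qed
qed

lemma typed_inequality:
  fixes F :: "'f ring" and eF :: "'f => 'a::field_char_0" and eL :: "'l => 'b::field_char_0" and G :: "'g monoid"
  assumes cF: "field_copy F eF" and cL: "field_copy L eL" and bf: "base_field F \<O>" and P: "prime_of F \<O> P"
    and ty: "has_type G [\<phi>1, \<phi>2] F [K1, K2] L" and G: "group G" "finite (carrier G)"
    and fx: "\<And>g. g \<in> carrier G ==> g ~= \<one>\<^bsub>G\<^esub> ==> \<phi>1 g \<le> fx" and free: "\<And>g. g \<in> carrier G ==> g ~= \<one>\<^bsub>G\<^esub> ==> \<phi>2 g = 0"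
  shows "(alg_degree F K1 - fx) * disc_exponent F \<O> P K2 \<le> alg_degree F K2 * disc_exponent F \<O> P K1"
proof -
  define n1 where "n1 = alg_degree F K1"
  define n2 where "n2 = alg_degree F K2"
  have et: "etale_algebra F K1" "etale_algebra F K2" and js: "joint_splitting_field F [K1, K2] L" using ty by (auto simp: has_type_def)
  obtain \<iota> where \<iota>: "\<iota> \<in> hom (galois_group F L) G" "inj_on \<iota> (carrier (galois_group F L))"
    and ch: "\<And>\<sigma>. \<sigma> \<in> carrier (galois_group F L) ==> perm_char (hom_rep F K1 L) \<sigma> = \<phi>1 (\<iota> \<sigma>)"
      "\<And>\<sigma>. \<sigma> \<in> carrier (galois_group F L) ==> perm_char (hom_rep F K2 L) \<sigma> = \<phi>2 (\<iota> \<sigma>)"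
    using ty by (auto simp: has_type_def)
  have ce: "copy_extension F eF L eL" using cF cL js by (intro copy_extension.intro copy_extension_axioms.intro) (auto simp: joint_splitting_field_def)
  obtain x1 where s1: "split_algebra F eF L eL K1 n1 x1" using etale_split_algebra[OF ce et(1)] js by (auto simp: joint_splitting_field_def n1_def)
  obtain x2 where s2: "split_algebra F eF L eL K2 n2 x2" using etale_split_algebra[OF ce et(2)] js by (auto simp: joint_splitting_field_def n2_def)
  interpret S1: split_algebra F eF L eL K1 n1 x1 by (rule s1)
  interpret S2: split_algebra F eF L eL K2 n2 x2 by (rule s2)
  obtain R U where R: "is_subring R" "finite U" "\<And>z. z \<in> lspan (fractions R) U" "\<O> \<subseteq> carrier F"
    "eF ` \<O> = {z. integral_over R z}" "\<And>P. typed_prime R P ==> \<exists>p. arith_place R p P"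
    using base_field_typed[OF cF bf] by blast
  interpret Oi: ring_of_integers F eF \<O> R
    using R(1,4,5) by (intro ring_of_integers.intro ring_of_integers_axioms.intro cF)
  obtain p where pl: "arith_place R p (eF ` P)" using R(6)[OF Oi.typed_prime_image[OF P]] by blast
  have ip: "integers_place F eF \<O> R p P"
    by (intro integers_place.intro integers_place_axioms.intro Oi.ring_of_integers_axioms pl)
      (use P in \<open>simp add: prime_of_def primeideal_def\<close>)
  obtain c1 c2 where c: "alg_basis F K1 n1 c1" "alg_basis F K2 n2 c2" using S1.ex_basis S2.ex_basis by blast
  have gen: "S1.generates n1 (S1.hom_mat b1) n2 (S2.hom_mat b2)" if "alg_basis F K1 n1 b1" "alg_basis F K2 n2 b2" for b1 b2
    by (rule joint_splitting_generates[OF s1 s2 that]) (use js in \<open>simp add: joint_splitting_field_def\<close>)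
  have ar: "arith_ring (S1.psi ` R) p"
    using S1.arith_ring_extension[OF arith_place.axioms(1)[OF pl] R(2,3) S1.split_alg_hom_mat[OF c(1)] S2.split_alg_hom_mat[OF c(2)] gen[OF c]] .
  interpret A: arith_ring "S1.psi ` R" p by (rule ar)
  interpret Pl: arith_place R p "eF ` P" by (rule pl)
  obtain b1 where b1: "alg_basis F K1 n1 b1" "\<And>j. j < n1 ==> b1 j \<in> integers_of \<O> K1"
    "int (disc_exponent F \<O> P K1) = Pl.val (eF (basis_disc F K1 n1 b1))"
    using ex_minimal_integral_basis[OF s1 ip ar] by blast
  obtain b2 where b2: "alg_basis F K2 n2 b2" "\<And>j. j < n2 ==> b2 j \<in> integers_of \<O> K2"
    "int (disc_exponent F \<O> P K2) = Pl.val (eF (basis_disc F K2 n2 b2))"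
    "\<And>b'. alg_basis F K2 n2 b' ==> (\<And>j. j < n2 ==> b' j \<in> integers_of \<O> K2) ==>
      Pl.val (eF (basis_disc F K2 n2 b2)) \<le> Pl.val (eF (basis_disc F K2 n2 b'))"
    using ex_minimal_integral_basis[OF s2 ip ar] by blast
  interpret G: group G by (rule G(1))
  have \<iota>G: "\<iota> (S1.sig g) \<in> carrier G" if "g \<in> S1.Gal" for g using \<iota>(1) S1.sig_galois[OF that] by (auto simp: hom_def)
  have "\<iota> (S1.sig id) \<otimes>\<^bsub>G\<^esub> \<iota> (S1.sig id) = \<iota> (S1.sig id)"
    using \<iota>(1) S1.sig_galois[OF S1.Gal_closed(1)] S1.sig_id_idem by (metis (no_types, lifting) hom_mult)
  hence \<iota>1: "\<iota> (S1.sig id) = \<one>\<^bsub>G\<^esub>" using \<iota>G[OF S1.Gal_closed(1)] by (metis G.l_cancel_one)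
  have \<iota>inj: "g = h" if "g \<in> S1.Gal" "h \<in> S1.Gal" "\<iota> (S1.sig g) = \<iota> (S1.sig h)" for g h
    using inj_onD[OF \<iota>(2) that(3) S1.sig_galois[OF that(1)] S1.sig_galois[OF that(2)]] S1.sig_inj by blast
  have \<iota>ne: "\<iota> (S1.sig g) ~= \<one>\<^bsub>G\<^esub>" if "g \<in> S1.Gal" "g ~= id" for g
    using \<iota>inj[OF that(1) S1.Gal_closed(1)] \<iota>1 that(2) by auto
  have finG: "finite S1.Gal"
  proof (rule inj_on_finite[OF _ _ G(2)])
    show "inj_on (\<lambda>g. \<iota> (S1.sig g)) S1.Gal" using \<iota>inj by (auto intro: inj_onI)
    show "(\<lambda>g. \<iota> (S1.sig g)) ` S1.Gal \<subseteq> carrier G" using \<iota>G by blast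
  qed
  have "int (n1 - fx) * Pl.val (eF (basis_disc F K2 n2 b2)) \<le> int n2 * Pl.val (eF (basis_disc F K1 n1 b1))"
  proof (rule S1.valuation_inequality[OF pl ar finG S1.split_alg_hom_mat[OF b1(1)] S2.split_alg_hom_mat[OF b2(1)] gen[OF b1(1) b2(1)], where ?act1.0 = S1.act and ?act2.0 = S2.act])
    show "S1.act g i < n1" if "g \<in> S1.Gal" "i < n1" for g i using S1.act_props(1)[OF that] .
    show "S2.act g i < n2" if "g \<in> S1.Gal" "i < n2" for g i using S2.act_props(1)[OF that] .
    show "g (v i) = v (S1.act g i)" if g: "g \<in> S1.Gal" "i < n1" and v: "v \<in> S1.alg_vecs n1 (S1.hom_mat b1)" for g i v
    proof -
      obtain z where "z \<in> carrier K1" "\<forall>i<n1. v i = S1.xi i z" using v S1.alg_vecs_iff[OF b1(1)] by blast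
      thus ?thesis using S1.act_xi[OF g] S1.act_props(1)[OF g] g(2) by simp
    qed
    show "g (v i) = v (S2.act g i)" if g: "g \<in> S1.Gal" "i < n2" and v: "v \<in> S1.alg_vecs n2 (S2.hom_mat b2)" for g i v
    proof -
      obtain z where "z \<in> carrier K2" "\<forall>i<n2. v i = S2.xi i z" using v S2.alg_vecs_iff[OF b2(1)] by blast
      thus ?thesis using S2.act_xi[OF g] S2.act_props(1)[OF g] g(2) by simp
    qed
    show "card {i. i < n1 \<and> S1.act g i = i} \<le> fx" if "g \<in> S1.Gal" "g ~= id" for g
      unfolding S1.card_act_fixed[OF that(1)] ch(1)[OF S1.sig_galois[OF that(1)]] by (rule fx[OF \<iota>G[OF that(1)] \<iota>ne[OF that]])
    show "S2.act g i ~= i" if "g \<in> S1.Gal" "g ~= id" "i < n2" for g i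
    proof -
      have "card {i. i < n2 \<and> S2.act g i = i} = 0"
        unfolding S2.card_act_fixed[OF that(1)] ch(2)[OF S1.sig_galois[OF that(1)]] by (rule free[OF \<iota>G[OF that(1)] \<iota>ne[OF that(1,2)]])
      thus ?thesis using that(3) by auto
    qed
    show "S1.hom_mat b1 i j \<in> A.ints" if "i < n1" "j < n1" for i j
      using S1.integers_iff[OF A.subring R(4,5) S1.basis_closed[OF b1(1) that(2)]] b1(2)[OF that(2)] that
      by (simp add: S1.hom_mat_def A.ints_def)
    show "S1.psi (eF (basis_disc F K1 n1 b1)) = (det (mat n1 n1 (\<lambda>(i,j). S1.hom_mat b1 i j)))\<^sup>2" by (rule S1.disc_xi(2)[OF b1(1)])
    show "S1.psi (eF (basis_disc F K2 n2 b2)) = (det (mat n2 n2 (\<lambda>(i,j). S2.hom_mat b2 i j)))\<^sup>2" by (rule S2.disc_xi(2)[OF b2(1)])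
    show "\<exists>c. (\<forall>j<n2. Pl.nv (c j) \<le> 1) \<and> (\<forall>i<n2. v i = (\<Sum>j<n2. S1.psi (c j) * S2.hom_mat b2 i j))"
      if v: "v \<in> S1.alg_vecs n2 (S2.hom_mat b2)" and vi: "\<And>i. i < n2 ==> v i \<in> A.ints" for v
    proof -
      obtain z where z: "z \<in> carrier K2" "\<forall>i<n2. v i = S2.xi i z" using v S2.alg_vecs_iff[OF b2(1)] by blast
      have zi: "z \<in> integers_of \<O> K2" using S2.integers_iff[OF A.subring R(4,5) z(1)] z(2) vi by (simp add: A.ints_def)
      obtain c where c: "z = S2.K.comb n2 b2 c" using S2.basis_expand[OF b2(1) z(1)] by blast
      \<comment> \<open>Exchanging \<open>b2 j\<close> for \<open>z\<close> gives another integral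
        basis and adds twice the valuation of \<open>c j\<close> to that of the discriminant;
        minimality makes this nonnegative.\<close>
      have "Pl.nv (c j) \<le> 1" if j: "j < n2" for j
      proof (cases "c j = 0")
        case False
        note ex = S2.disc_exchange[OF b2(1) c j False]
        have "Pl.val (eF (basis_disc F K2 n2 b2)) \<le> Pl.val (eF (basis_disc F K2 n2 (b2(j := z))))"
          by (rule b2(4)[OF ex(1)]) (use b2(2) zi in auto)
        also have "... = 2 * Pl.val (c j) + Pl.val (eF (basis_disc F K2 n2 b2))"
          unfolding ex(2) using False S2.disc_nonzero[OF b2(1)] by (simp add: Pl.val_mult power2_eq_square)
        finally have "0 \<le> Pl.val (c j)" by simp
        thus ?thesis using False by (simp add: Pl.nv_def powr_le_cancel_iff[of 2 _ 0, simplified])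
      qed simp
      moreover have "\<forall>i<n2. v i = (\<Sum>j<n2. S1.psi (c j) * S2.hom_mat b2 i j)"
        using z(2) S2.xi_comb[OF _ S2.basis_fun[OF b2(1)]] unfolding c S2.hom_mat_def by simp
      ultimately show ?thesis by blast
    qed
  qed
  hence "int (n1 - fx) * int (disc_exponent F \<O> P K2) \<le> int n2 * int (disc_exponent F \<O> P K1)" using b1(3) b2(3) by simp
  hence "int ((n1 - fx) * disc_exponent F \<O> P K2) \<le> int (n2 * disc_exponent F \<O> P K1)" by simp
  thus ?thesis unfolding n1_def n2_def by linarith
qed

section \<open>Passage from records to types\<close>

definition char0_field :: "('x, 'm) ring_scheme => bool" where
  "char0_field R \<longleftrightarrow> field R \<and> (\<forall>k::nat. k > 0 --> [k] \<cdot>\<^bsub>R\<^esub> \<one>\<^bsub>R\<^esub> ~= \<zero>\<^bsub>R\<^esub>)"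

lemma char0_field_image:
  assumes R: "char0_field R" and f: "inj_on f (carrier R)" shows "char0_field (image_ring f R)"
proof -
  interpret R: field R using R by (simp add: char0_field_def)
  have fld: "field (image_ring f R)" by (rule R.inj_imp_image_ring_is_field[OF f])
  interpret I: field "image_ring f R" by (rule fld)
  have iso: "f \<in> QuotRing.ring_iso R (image_ring f R)" by (rule inj_imp_image_ring_iso[OF f])
  have hom: "f (x \<oplus>\<^bsub>R\<^esub> y) = f x \<oplus>\<^bsub>image_ring f R\<^esub> f y" if "x \<in> carrier R" "y \<in> carrier R" for x y
    using iso that by (simp add: QuotRing.ring_iso_def Ring.ring_hom_def)
  have "[k] \<cdot>\<^bsub>image_ring f R\<^esub> \<one>\<^bsub>image_ring f R\<^esub> = f ([k] \<cdot>\<^bsub>R\<^esub> \<one>\<^bsub>R\<^esub>)" for k :: nat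
    by (induction k) (auto simp: image_ring_one image_ring_zero hom)
  moreover have "f ([k] \<cdot>\<^bsub>R\<^esub> \<one>\<^bsub>R\<^esub>) ~= f \<zero>\<^bsub>R\<^esub>" if "k > 0" for k :: nat
    using R that f by (auto simp: char0_field_def inj_on_def)
  ultimately show ?thesis using fld by (simp add: char0_field_def image_ring_zero)
qed

definition rat_ring :: "rat ring" where
  "rat_ring = \<lparr>carrier = UNIV, monoid.mult = (*), monoid.one = 1, ring.zero = 0, ring.add = (+)\<rparr>"

lemma char0_field_rat: "char0_field rat_ring"
proof -
  have ab: "abelian_group rat_ring"
    by (rule abelian_groupI) (auto simp: rat_ring_def intro: exI[of _ "- _"] add.left_inverse)
  have cm: "comm_monoid rat_ring" by (rule comm_monoidI) (auto simp: rat_ring_def)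
  have cr: "cring rat_ring" by (rule cringI[OF ab cm]) (simp add: rat_ring_def distrib_right)
  interpret cring rat_ring by (rule cr)
  have "\<exists>y\<in>carrier rat_ring. x \<otimes>\<^bsub>rat_ring\<^esub> y = \<one>\<^bsub>rat_ring\<^esub>" if "x ~= 0" for x
    using that by (intro bexI[of _ "inverse x"]) (auto simp: rat_ring_def)
  hence fld: "field rat_ring" by (intro cring_fieldI2) (auto simp: rat_ring_def)
  have r: "x \<oplus>\<^bsub>rat_ring\<^esub> y = x + y" "\<one>\<^bsub>rat_ring\<^esub> = 1" "\<zero>\<^bsub>rat_ring\<^esub> = 0" "carrier rat_ring = UNIV" for x y
    by (simp_all add: rat_ring_def)
  have "[k] \<cdot>\<^bsub>rat_ring\<^esub> \<one>\<^bsub>rat_ring\<^esub> = of_nat k" for k :: nat by (induction k) (simp_all add: r)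
  thus ?thesis using fld by (simp add: char0_field_def r)
qed

lemma char0_base_field:
  assumes "base_field F \<O>" shows "char0_field F"
proof -
  \<comment> \<open>\<open>c\<close> lists the natural multiples of the unit of \<open>S\<close>.
    Its term at 0 is described by being idempotent for addition, which forces its image in
    \<open>F\<close> to be zero.\<close>
  have main: "char0_field F" if fe: "finite_ext_of_frac S F \<O>"
    and c: "\<And>k. c k \<in> carrier S" "\<And>k. c (Suc k) = c k \<oplus>\<^bsub>S\<^esub> \<one>\<^bsub>S\<^esub>" "\<And>k. k > 0 ==> c k ~= c 0"
    and c0: "c 0 \<oplus>\<^bsub>S\<^esub> c 0 = c 0" and one: "\<one>\<^bsub>S\<^esub> \<in> carrier S" for S :: "'s ring" and c :: "nat => 's"
  proof -
    obtain \<iota> where \<iota>: "\<iota> \<in> Ring.ring_hom S F" "inj_on \<iota> (carrier S)" and fld: "field F"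
      using fe unfolding finite_ext_of_frac_def by blast
    interpret field F by (rule fld)
    have cl: "\<iota> y \<in> carrier F" if "y \<in> carrier S" for y using \<iota>(1) that by (auto simp: Ring.ring_hom_def)
    have add: "\<iota> (y \<oplus>\<^bsub>S\<^esub> z) = \<iota> y \<oplus>\<^bsub>F\<^esub> \<iota> z" if "y \<in> carrier S" "z \<in> carrier S" for y z
      using \<iota>(1) that by (auto simp: Ring.ring_hom_def)
    have "\<iota> (c 0) \<oplus>\<^bsub>F\<^esub> \<iota> (c 0) = \<zero>\<^bsub>F\<^esub> \<oplus>\<^bsub>F\<^esub> \<iota> (c 0)" using add[OF c(1) c(1), of 0 0] c0 cl[OF c(1), of 0] by simp
    hence i0: "\<iota> (c 0) = \<zero>\<^bsub>F\<^esub>" using cl[OF c(1), of 0] by (metis add.right_cancel zero_closed)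
    have i1: "\<iota> \<one>\<^bsub>S\<^esub> = \<one>\<^bsub>F\<^esub>" using \<iota>(1) by (auto simp: Ring.ring_hom_def)
    have "[k] \<cdot>\<^bsub>F\<^esub> \<one>\<^bsub>F\<^esub> = \<iota> (c k)" for k :: nat
      by (induction k) (auto simp: i0 i1 c(2) add[OF c(1) one])
    moreover have "\<iota> (c k) ~= \<iota> (c 0)" if "k > 0" for k using c(1,3) that \<iota>(2) by (auto simp: inj_on_def)
    ultimately show ?thesis using fld i0 by (simp add: char0_field_def)
  qed
  from assms consider "finite_ext_of_frac int_ring F \<O>"
    | p where "Factorial_Ring.prime p" "finite_ext_of_frac (padic_int_ring p) F \<O>" unfolding base_field_def by blast
  thus ?thesis
  proof cases
    case 1
    show ?thesis by (rule main[OF 1, of int]) auto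
  next
    case (2 p)
    have p: "p > 0" "p > 1" using prime_gt_1_nat[OF 2(1)] by auto
    have cl: "(\<lambda>j. int k mod int p ^ j) \<in> carrier (padic_int_ring p)" for k by (rule padicI[OF p(1)]) simp
    show ?thesis
    proof (rule main[OF 2(2), of "\<lambda>k j. int k mod int p ^ j"])
      show "\<one>\<^bsub>padic_int_ring p\<^esub> \<in> carrier (padic_int_ring p)" using cl[of 1] by (simp add: padic_int_ring_def)
      show "(\<lambda>j. int (Suc k) mod int p ^ j) = (\<lambda>j. int k mod int p ^ j) \<oplus>\<^bsub>padic_int_ring p\<^esub> \<one>\<^bsub>padic_int_ring p\<^esub>" for k
        by (simp add: padic_int_ring_def fun_eq_iff mod_add_eq add.commute)
      show "(\<lambda>j. int k mod int p ^ j) ~= (\<lambda>j. int 0 mod int p ^ j)" if "k > 0" for k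
      proof
        assume "(\<lambda>j. int k mod int p ^ j) = (\<lambda>j. int 0 mod int p ^ j)"
        hence "int k mod int p ^ k = int 0 mod int p ^ k" by (rule fun_cong)
        moreover have "k < p ^ k" using p(2) by (intro power_gt_expt) auto
        hence "int k < int p ^ k" by (metis of_nat_less_iff of_nat_power)
        ultimately show False using that by simp
      qed
    qed (use cl in \<open>auto simp: padic_int_ring_def\<close>)
  qed
qed

lemma char0_algebra:
  assumes F: "char0_field F" and L: "algebra F L" "field L" shows "char0_field L"
proof -
  interpret F: field F using F by (simp add: char0_field_def)
  interpret AL: algebra F L by (rule L(1))
  interpret L: field L by (rule L(2))
  have eq: "[k] \<cdot>\<^bsub>L\<^esub> \<one>\<^bsub>L\<^esub> = ([k] \<cdot>\<^bsub>F\<^esub> \<one>\<^bsub>F\<^esub>) \<odot>\<^bsub>L\<^esub> \<one>\<^bsub>L\<^esub>" for k :: nat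
    by (induction k) (auto simp: AL.smult_l_null AL.smult_l_distr)
  have "[k] \<cdot>\<^bsub>L\<^esub> \<one>\<^bsub>L\<^esub> ~= \<zero>\<^bsub>L\<^esub>" if k: "k > 0" for k :: nat
  proof
    let ?c = "[k] \<cdot>\<^bsub>F\<^esub> \<one>\<^bsub>F\<^esub>"
    assume "[k] \<cdot>\<^bsub>L\<^esub> \<one>\<^bsub>L\<^esub> = \<zero>\<^bsub>L\<^esub>"
    hence z: "?c \<odot>\<^bsub>L\<^esub> \<one>\<^bsub>L\<^esub> = \<zero>\<^bsub>L\<^esub>" using eq by simp
    have u: "?c \<in> Units F" using F k by (auto simp: char0_field_def F.field_Units)
    have "\<one>\<^bsub>L\<^esub> = (inv\<^bsub>F\<^esub> ?c \<otimes>\<^bsub>F\<^esub> ?c) \<odot>\<^bsub>L\<^esub> \<one>\<^bsub>L\<^esub>" using u by simp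
    also have "... = inv\<^bsub>F\<^esub> ?c \<odot>\<^bsub>L\<^esub> (?c \<odot>\<^bsub>L\<^esub> \<one>\<^bsub>L\<^esub>)" using u by (intro AL.smult_assoc1) auto
    also have "... = \<zero>\<^bsub>L\<^esub>" using z u by (simp add: AL.smult_r_null)
    finally show False using L.one_not_zero by simp
  qed
  thus ?thesis using L(2) by (simp add: char0_field_def)
qed

text \<open>Type classes cannot be instantiated at a field that is fixed inside a proof. Hence the types
  below are copies of the base field and of the splitting field of one fixed hypothetical
  counterexample; the parameter \<open>'t\<close> tells the two apart, and the rationals are a default.\<close>

definition counterexample :: "'f ring \<times> 'f set \<times> ('f, 'k) module \<times> ('f, 'k) module \<times> ('f, 'l) module \<times> 'f set \<times> nat => bool" where
  "counterexample = (\<lambda>(F, \<O>, K1, K2, L, P, fx). base_field F \<O> \<and> prime_of F \<O> P \<and>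
     (\<exists>(G :: (nat => nat) monoid) \<phi>1 \<phi>2. group G \<and> finite (carrier G) \<and> has_type G [\<phi>1, \<phi>2] F [K1, K2] L \<and>
        (\<forall>g\<in>carrier G - {\<one>\<^bsub>G\<^esub>}. \<phi>1 g \<le> fx \<and> \<phi>2 g = 0)) \<and>
     \<not> (alg_degree F K1 - fx) * disc_exponent F \<O> P K2 \<le> alg_degree F K2 * disc_exponent F \<O> P K1)"

definition copied_field :: "('f \<times> 'k \<times> 'l \<times> 't) itself => ('f + 'l + rat) ring" where
  "copied_field _ = (case SOME t. counterexample (t :: 'f ring \<times> 'f set \<times> ('f, 'k) module \<times> ('f, 'k) module \<times> ('f, 'l) module \<times> 'f set \<times> nat) of
     (F, \<O>, K1, K2, L, P, fx) =>
       let R = (if card (UNIV :: 't set) = 1 then image_ring Inl F else image_ring (Inr \<circ> Inl) L)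
       in if char0_field R then R else image_ring (Inr \<circ> Inr) rat_ring)"

lemma char0_copied_field: "char0_field (copied_field T)"
proof -
  have "char0_field (image_ring (Inr \<circ> Inr) rat_ring :: ('f + 'l + rat) ring)"
    by (rule char0_field_image[OF char0_field_rat]) (auto simp: inj_on_def)
  thus ?thesis unfolding copied_field_def by (auto simp: Let_def split: prod.splits)
qed

lemma field_copied_field: "field (copied_field T)" using char0_copied_field[of T] by (simp add: char0_field_def)

typedef ('f, 'k, 'l, 't) field_type = "carrier (copied_field TYPE('f \<times> 'k \<times> 'l \<times> 't))"
  using field.is_ring[OF field_copied_field] ring.ring_simprules(6) by blast

instantiation field_type :: (type, type, type, type) field
begin

definition "0 = Abs_field_type \<zero>\<^bsub>copied_field TYPE('a \<times> 'b \<times> 'c \<times> 'd)\<^esub>"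
definition "1 = Abs_field_type \<one>\<^bsub>copied_field TYPE('a \<times> 'b \<times> 'c \<times> 'd)\<^esub>"
definition "x + y = Abs_field_type (Rep_field_type x \<oplus>\<^bsub>copied_field TYPE('a \<times> 'b \<times> 'c \<times> 'd)\<^esub> Rep_field_type y)"
definition "x * y = Abs_field_type (Rep_field_type x \<otimes>\<^bsub>copied_field TYPE('a \<times> 'b \<times> 'c \<times> 'd)\<^esub> Rep_field_type y)"
definition "- x = Abs_field_type (\<ominus>\<^bsub>copied_field TYPE('a \<times> 'b \<times> 'c \<times> 'd)\<^esub> Rep_field_type x)"
definition "x - y = x + - (y :: ('a, 'b, 'c, 'd) field_type)"
definition "inverse x = (if x = 0 then 0 else Abs_field_type (inv\<^bsub>copied_field TYPE('a \<times> 'b \<times> 'c \<times> 'd)\<^esub> Rep_field_type x))"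
definition "x div y = x * inverse (y :: ('a, 'b, 'c, 'd) field_type)"

instance
proof
  let ?R = "copied_field TYPE('a \<times> 'b \<times> 'c \<times> 'd)"
  interpret R: field ?R by (rule field_copied_field)
  note Rep = Rep_field_type[where 'f = 'a and 'k = 'b and 'l = 'c and 't = 'd]
  have rep0: "Rep_field_type (0 :: ('a, 'b, 'c, 'd) field_type) = \<zero>\<^bsub>?R\<^esub>"
    and rep1: "Rep_field_type (1 :: ('a, 'b, 'c, 'd) field_type) = \<one>\<^bsub>?R\<^esub>"
    by (simp_all add: zero_field_type_def one_field_type_def Abs_field_type_inverse)
  have rep_add: "Rep_field_type (x + y) = Rep_field_type x \<oplus>\<^bsub>?R\<^esub> Rep_field_type y"
    and rep_mult: "Rep_field_type (x * y) = Rep_field_type x \<otimes>\<^bsub>?R\<^esub> Rep_field_type y"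
    and rep_uminus: "Rep_field_type (- x) = \<ominus>\<^bsub>?R\<^esub> Rep_field_type x" for x y :: "('a, 'b, 'c, 'd) field_type"
    using Rep[of x] Rep[of y]
    by (simp_all add: plus_field_type_def times_field_type_def uminus_field_type_def Abs_field_type_inverse)
  note reps = Rep_field_type_inject[symmetric] rep0 rep1 rep_add rep_mult rep_uminus
  fix a b c :: "('a, 'b, 'c, 'd) field_type"
  show "a + b + c = a + (b + c)" using Rep by (simp add: reps R.a_assoc)
  show "a + b = b + a" using Rep[of a] Rep[of b] by (simp add: reps R.a_comm)
  show "0 + a = a" using Rep[of a] by (simp add: reps)
  show "- a + a = 0" using Rep[of a] by (simp add: reps R.l_neg)
  show "a - b = a + - b" by (rule minus_field_type_def)
  show "a * b * c = a * (b * c)" using Rep by (simp add: reps R.m_assoc)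
  show "a * b = b * a" using Rep[of a] Rep[of b] by (simp add: reps R.m_comm)
  show "1 * a = a" using Rep[of a] by (simp add: reps)
  show "(a + b) * c = a * c + b * c" using Rep by (simp add: reps R.l_distr)
  show "(0 :: ('a, 'b, 'c, 'd) field_type) ~= 1" by (simp add: reps)
  show "inverse (0 :: ('a, 'b, 'c, 'd) field_type) = 0" by (simp add: inverse_field_type_def)
  show "a div b = a * inverse b" by (rule divide_field_type_def)
  show "inverse a * a = 1" if "a ~= 0"
  proof -
    have u: "Rep_field_type a \<in> Units ?R" using that Rep[of a] by (simp add: reps R.field_Units)
    have "Rep_field_type (inverse a) = inv\<^bsub>?R\<^esub> Rep_field_type a"
      using that u by (simp add: inverse_field_type_def Abs_field_type_inverse)
    thus ?thesis using u by (simp add: reps)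
  qed
qed

end

instance field_type :: (type, type, type, type) field_char_0
proof
  let ?R = "copied_field TYPE('a \<times> 'b \<times> 'c \<times> 'd)"
  interpret R: field ?R by (rule field_copied_field)
  note Rep = Rep_field_type[where 'f = 'a and 'k = 'b and 'l = 'c and 't = 'd]
  have rep0: "Rep_field_type (0 :: ('a, 'b, 'c, 'd) field_type) = \<zero>\<^bsub>?R\<^esub>"
    and rep1: "Rep_field_type (1 :: ('a, 'b, 'c, 'd) field_type) = \<one>\<^bsub>?R\<^esub>"
    by (simp_all add: zero_field_type_def one_field_type_def Abs_field_type_inverse)
  have rep_add: "Rep_field_type (x + y) = Rep_field_type x \<oplus>\<^bsub>?R\<^esub> Rep_field_type y" for x y :: "('a, 'b, 'c, 'd) field_type"
    using Rep[of x] Rep[of y] by (simp add: plus_field_type_def Abs_field_type_inverse)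
  have "Rep_field_type (of_nat k :: ('a, 'b, 'c, 'd) field_type) = [k] \<cdot>\<^bsub>?R\<^esub> \<one>\<^bsub>?R\<^esub>" for k
    by (induction k) (auto simp: rep0 rep1 rep_add R.a_comm)
  hence nz: "of_nat k ~= (0 :: ('a, 'b, 'c, 'd) field_type)" if "k > 0" for k
    using char0_copied_field[of "TYPE('a \<times> 'b \<times> 'c \<times> 'd)"] that by (simp add: Rep_field_type_inject[symmetric] rep0 char0_field_def)
  have "i = j" if ij: "of_nat i = (of_nat j :: ('a, 'b, 'c, 'd) field_type)" "i \<le> j" for i j
  proof (rule ccontr)
    assume "i ~= j"
    hence "of_nat (j - i) ~= (0 :: ('a, 'b, 'c, 'd) field_type)" using ij(2) by (intro nz) simp
    thus False using ij by (simp add: of_nat_diff)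
  qed
  thus "inj (of_nat :: nat => ('a, 'b, 'c, 'd) field_type)" by (metis injI linorder_linear)
qed

lemma field_copy_field_type:
  fixes F :: "('x, 'm) ring_scheme" and f :: "'x => 'f + 'l + rat"
  assumes F: "field F" and f: "inj_on f (carrier F)" and R: "copied_field TYPE('f \<times> 'k \<times> 'l \<times> 't) = image_ring f F"
  shows "field_copy F (\<lambda>x. Abs_field_type (f x) :: ('f, 'k, 'l, 't) field_type)"
proof -
  let ?R = "copied_field TYPE('f \<times> 'k \<times> 'l \<times> 't)"
  interpret F: field F by (rule F)
  have iso: "f \<in> QuotRing.ring_iso F ?R" unfolding R by (rule inj_imp_image_ring_iso[OF f])
  have cl: "f x \<in> carrier ?R" if "x \<in> carrier F" for x using iso that by (auto simp: QuotRing.ring_iso_def Ring.ring_hom_def)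
  have hom: "f (x \<oplus>\<^bsub>F\<^esub> y) = f x \<oplus>\<^bsub>?R\<^esub> f y" "f (x \<otimes>\<^bsub>F\<^esub> y) = f x \<otimes>\<^bsub>?R\<^esub> f y"
    if "x \<in> carrier F" "y \<in> carrier F" for x y using iso that by (auto simp: QuotRing.ring_iso_def Ring.ring_hom_def)
  have one: "f \<one>\<^bsub>F\<^esub> = \<one>\<^bsub>?R\<^esub>" using iso by (auto simp: QuotRing.ring_iso_def Ring.ring_hom_def)
  show ?thesis
  proof
    have "bij_betw f (carrier F) (carrier ?R)" using iso by (simp add: QuotRing.ring_iso_def)
    moreover have "bij_betw (Abs_field_type :: _ => ('f, 'k, 'l, 't) field_type) (carrier ?R) UNIV"
      by (rule bij_betwI[where g = Rep_field_type]) (auto simp: Rep_field_type Rep_field_type_inverse Abs_field_type_inverse)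
    ultimately show "bij_betw (\<lambda>x. Abs_field_type (f x) :: ('f, 'k, 'l, 't) field_type) (carrier F) UNIV"
      using bij_betw_trans[of f "carrier F" "carrier ?R" Abs_field_type UNIV] by (simp add: comp_def)
  qed (use F cl hom one in \<open>auto simp: plus_field_type_def times_field_type_def one_field_type_def Abs_field_type_inverse\<close>)
qed

text \<open>The copied types refer to one fixed choice of counterexample. If the inequality failed
  for the given data, that choice would be a genuine counterexample and the types would be copies of
  its two fields; the typed inequality refutes it.\<close>

theorem discriminant_exponent_inequality:
  fixes F :: "'f ring" and K1 K2 :: "('f, 'k) module" and L :: "('f, 'l) module" and G :: "(nat => nat) monoid"
  assumes "base_field F \<O>" "prime_of F \<O> P" "has_type G [\<phi>1, \<phi>2] F [K1, K2] L" "group G" "finite (carrier G)"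
    and "\<And>g. g \<in> carrier G ==> g ~= \<one>\<^bsub>G\<^esub> ==> \<phi>1 g \<le> fx" "\<And>g. g \<in> carrier G ==> g ~= \<one>\<^bsub>G\<^esub> ==> \<phi>2 g = 0"
  shows "(alg_degree F K1 - fx) * disc_exponent F \<O> P K2 \<le> alg_degree F K2 * disc_exponent F \<O> P K1"
proof (rule ccontr)
  assume "\<not> ?thesis"
  hence "counterexample (F, \<O>, K1, K2, L, P, fx)" unfolding counterexample_def using assms by blast
  hence cex: "counterexample (SOME t. counterexample (t :: 'f ring \<times> 'f set \<times> ('f, 'k) module \<times> ('f, 'k) module \<times> ('f, 'l) module \<times> 'f set \<times> nat))"
    by (rule someI)
  obtain F' \<O>' K1' K2' L' P' fx' where t: "(SOME t. counterexample (t :: 'f ring \<times> 'f set \<times> ('f, 'k) module \<times> ('f, 'k) module \<times> ('f, 'l) module \<times> 'f set \<times> nat))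
    = (F', \<O>', K1', K2', L', P', fx')" by (metis prod_cases7)
  have "counterexample (F', \<O>', K1', K2', L', P', fx')" using cex unfolding t .
  note c = this[unfolded counterexample_def prod.case]
  have bf: "base_field F' \<O>'" "prime_of F' \<O>' P'"
    "\<not> (alg_degree F' K1' - fx') * disc_exponent F' \<O>' P' K2' \<le> alg_degree F' K2' * disc_exponent F' \<O>' P' K1'" using c by blast+
  obtain G' :: "(nat => nat) monoid" and \<psi>1 \<psi>2 where G': "group G'" "finite (carrier G')" "has_type G' [\<psi>1, \<psi>2] F' [K1', K2'] L'"
    "\<forall>g\<in>carrier G' - {\<one>\<^bsub>G'\<^esub>}. \<psi>1 g \<le> fx' \<and> \<psi>2 g = 0" using c by blast
  have F': "char0_field F'" by (rule char0_base_field[OF bf(1)])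
  have L': "char0_field L'"
    by (rule char0_algebra[OF F']) (use G'(3) in \<open>auto simp: has_type_def joint_splitting_field_def\<close>)
  \<comment> \<open>\<open>unit\<close> has one element and \<open>bool\<close> has two; this
    selects the base field here and the splitting field below.\<close>
  have "copied_field TYPE('f \<times> 'k \<times> 'l \<times> unit) = image_ring Inl F'"
    unfolding copied_field_def t using char0_field_image[OF F', of "Inl :: 'f => 'f + 'l + rat"] by (simp add: Let_def)
  hence cF: "field_copy F' (\<lambda>x. Abs_field_type (Inl x) :: ('f, 'k, 'l, unit) field_type)"
    using F' by (intro field_copy_field_type) (auto simp: char0_field_def)
  have eqL: "copied_field TYPE('f \<times> 'k \<times> 'l \<times> bool) = image_ring (Inr \<circ> Inl) L'"
    unfolding copied_field_def t using char0_field_image[OF L', of "Inr \<circ> Inl :: 'l => 'f + 'l + rat"] by (simp add: Let_def inj_on_def)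
  have cL: "field_copy L' (\<lambda>x. Abs_field_type ((Inr \<circ> Inl) x) :: ('f, 'k, 'l, bool) field_type)"
    by (rule field_copy_field_type[OF _ _ eqL]) (use L' in \<open>auto simp: char0_field_def inj_on_def\<close>)
  have "(alg_degree F' K1' - fx') * disc_exponent F' \<O>' P' K2' \<le> alg_degree F' K2' * disc_exponent F' \<O>' P' K1'"
    by (rule typed_inequality[OF cF cL bf(1,2) G'(3,1,2)]) (use G'(4) in auto)
  thus False using bf(3) by blast
qed

text \<open>The identity of \<open>L\<close> fixes every homomorphism and, being idempotent, is sent
  to the unit of \<open>G\<close>. So the character at the unit counts all homomorphisms, and there
  are as many as the degree by splitting.\<close>

lemma alg_degree_of_type:
  fixes F :: "'f ring" and K1 K2 :: "('f, 'k) module" and L :: "('f, 'l) module"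
  assumes ty: "has_type G [\<phi>1, \<phi>2] F [K1, K2] L" and G: "group G"
  shows "alg_degree F K1 = \<phi>1 \<one>\<^bsub>G\<^esub>" "alg_degree F K2 = \<phi>2 \<one>\<^bsub>G\<^esub>"
proof -
  have js: "joint_splitting_field F [K1, K2] L" using ty by (simp add: has_type_def)
  obtain \<iota> where \<iota>: "\<iota> \<in> hom (galois_group F L) G"
    and ch: "\<And>\<sigma>. \<sigma> \<in> carrier (galois_group F L) ==> perm_char (hom_rep F K1 L) \<sigma> = \<phi>1 (\<iota> \<sigma>)"
      "\<And>\<sigma>. \<sigma> \<in> carrier (galois_group F L) ==> perm_char (hom_rep F K2 L) \<sigma> = \<phi>2 (\<iota> \<sigma>)"
    using ty by (auto simp: has_type_def)
  interpret G: group G by (rule G)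
  interpret AL: algebra F L using js by (simp add: joint_splitting_field_def)
  define u where "u = (\<lambda>y\<in>carrier L. y)"
  have uB: "u \<in> Bij (carrier L)" by (auto simp: u_def Bij_def bij_betw_def inj_on_def)
  have u: "u \<in> carrier (galois_group F L)"
    using uB by (auto simp: galois_group_def alg_hom_def u_def Ring.ring_hom_def)
  have "u \<otimes>\<^bsub>galois_group F L\<^esub> u = u" using uB by (auto simp: galois_group_def BijGroup_def compose_def u_def fun_eq_iff)
  hence "\<iota> u \<otimes>\<^bsub>G\<^esub> \<iota> u = \<iota> u" using \<iota> u by (metis (no_types, lifting) hom_mult)
  moreover have "\<iota> u \<in> carrier G" using \<iota> u by (auto simp: hom_def)
  ultimately have \<iota>u: "\<iota> u = \<one>\<^bsub>G\<^esub>" by (metis G.l_cancel_one)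
  have "perm_char (hom_rep F K L) u = card (alg_hom F K L)" for K :: "('f, 'k) module"
  proof -
    have "compose (carrier K) u h = h" if "h \<in> alg_hom F K L" for h
      using that by (intro extensionalityI[of _ "carrier K"]) (auto simp: compose_def u_def alg_hom_def Ring.ring_hom_def)
    hence "{h \<in> alg_hom F K L. (\<lambda>h\<in>alg_hom F K L. compose (carrier K) u h) h = h} = alg_hom F K L" by auto
    thus ?thesis by (simp add: perm_char_def invariants_def hom_rep_def)
  qed
  thus "alg_degree F K1 = \<phi>1 \<one>\<^bsub>G\<^esub>" "alg_degree F K2 = \<phi>2 \<one>\<^bsub>G\<^esub>"
    using ch[OF u] \<iota>u js by (auto simp: joint_splitting_field_def)
qed

text \<open>Nontriviality of \<open>G\<close> makes the sets nonempty whose \<open>Max\<close> and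
  \<open>Min\<close> are taken. The divisibility of root discriminants is the inequality of
  exponents divided by the product of the two degrees, \<open>n\<close> and the order of
  \<open>G\<close>.\<close>

theorem theorem7p3:
  fixes n :: nat and G :: "(nat \<Rightarrow> nat) monoid"
  assumes "permutation_group n G"
    and "carrier G \<noteq> {\<one>\<^bsub>G\<^esub>}"
  shows "left_tame_wild_principle TYPE('f \<times> 'k \<times> 'l) G (given_rep n) (regular_rep G) \<and>
    tw_alpha_bar G (given_rep n) (regular_rep G) = 1 - of_nat (max_fixed_points n G) / of_nat n \<and>
    (\<forall>(F :: 'f ring) \<O> (K :: ('f, 'k) module) (Kgal :: ('f, 'k) module) (L :: ('f, 'l) module).
       base_field F \<O> \<longrightarrow>
       has_type G [perm_char (given_rep n), perm_char (regular_rep G)] F [K, Kgal] L \<longrightarrow>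
       rat_ideal_dvd F \<O>
         (rat_ideal_pow (root_disc F \<O> Kgal) (1 - of_nat (max_fixed_points n G) / of_nat n))
         (root_disc F \<O> K))"
proof -
  define fx where "fx = max_fixed_points n G"
  define N where "N = card (carrier G)"
  note pg = permutation_groupD[OF assms(1)]
  note tw = tw_alpha_given_regular[OF assms]
  interpret monoid_group G using pg(1) by (simp add: monoid_group_def)
  have fxn: "fx \<le> n" and n0: "n > 0" and N0: "N > 0" using tw(2-4) by (auto simp: fx_def N_def)
  have alpha: "tw_alpha G (given_rep n) (regular_rep G) = (of_nat n - of_nat fx) / of_nat N" using tw(1) by (simp add: fx_def N_def)
  have ch1: "perm_char (given_rep n) \<one>\<^bsub>G\<^esub> = n"
    unfolding pg(7) pg(4) id_apply by (simp only: simp_thms Collect_mem_eq card_atLeastAtMost)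
  have ch2: "perm_char (regular_rep G) g = (if g = \<one>\<^bsub>G\<^esub> then N else 0)" if "g \<in> carrier G" for g
    using regular_rep_char[OF that] by (simp add: N_def)
  have deg: "alg_degree F K1 = n" "alg_degree F K2 = N"
    if "has_type G [perm_char (given_rep n), perm_char (regular_rep G)] F [K1, K2] L"
    for F :: "'f ring" and K1 K2 :: "('f, 'k) module" and L :: "('f, 'l) module"
    using alg_degree_of_type[OF that pg(1)] ch1 ch2[OF one_closed] by auto
  have ineq: "(of_nat n - of_nat fx) * of_nat (disc_exponent F \<O> P K2) \<le> of_nat N * (of_nat (disc_exponent F \<O> P K1) :: rat)"
    if h: "base_field F \<O>" "has_type G [perm_char (given_rep n), perm_char (regular_rep G)] F [K1, K2] L" "prime_of F \<O> P"
    for F :: "'f ring" and \<O> P and K1 K2 :: "('f, 'k) module" and L :: "('f, 'l) module"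
  proof -
    have "(n - fx) * disc_exponent F \<O> P K2 \<le> N * disc_exponent F \<O> P K1"
      using discriminant_exponent_inequality[OF h(1,3,2) pg(1,2), of fx] tw(5) ch2 unfolding deg[OF h(2)] fx_def by simp
    hence "(of_nat ((n - fx) * disc_exponent F \<O> P K2) :: rat) \<le> of_nat (N * disc_exponent F \<O> P K1)" using of_nat_le_iff by blast
    thus ?thesis using fxn by (simp add: of_nat_diff)
  qed
  have "left_tame_wild_principle TYPE('f \<times> 'k \<times> 'l) G (given_rep n) (regular_rep G)"
    unfolding left_tame_wild_principle_def alpha
  proof (intro allI impI)
    fix F :: "'f ring" and \<O> and K1 K2 :: "('f, 'k) module" and L :: "('f, 'l) module" and P
    assume "base_field F \<O>" "has_type G [perm_char (given_rep n), perm_char (regular_rep G)] F [K1, K2] L" "prime_of F \<O> P"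
    from ineq[OF this] show "(of_nat n - of_nat fx) / of_nat N * of_nat (disc_exponent F \<O> P K2) \<le> (of_nat (disc_exponent F \<O> P K1) :: rat)"
      using N0 by (simp add: field_simps)
  qed
  moreover have "tw_alpha_bar G (given_rep n) (regular_rep G) = 1 - of_nat fx / of_nat n"
    unfolding tw_alpha_bar_def alpha ch1 ch2[OF one_closed] using n0 N0 by (simp add: field_simps)
  moreover have "rat_ideal_dvd F \<O> (rat_ideal_pow (root_disc F \<O> K2) (1 - of_nat fx / of_nat n)) (root_disc F \<O> K1)"
    if h: "base_field F \<O>" "has_type G [perm_char (given_rep n), perm_char (regular_rep G)] F [K1, K2] L"
    for F :: "'f ring" and \<O> and K1 K2 :: "('f, 'k) module" and L :: "('f, 'l) module"
    unfolding rat_ideal_dvd_def rat_ideal_pow_def root_disc_def to_rat_ideal_def disc_exponent_def[symmetric] deg[OF h(2)]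
  proof (intro allI impI)
    fix P assume P: "prime_of F \<O> P"
    let ?d1 = "of_nat (disc_exponent F \<O> P K1) :: rat" and ?d2 = "of_nat (disc_exponent F \<O> P K2) :: rat"
    have "(1 - of_nat fx / of_nat n) * (1 / of_nat N * ?d2) = ((of_nat n - of_nat fx) * ?d2) / (of_nat n * of_nat N)"
      using n0 N0 by (simp add: field_simps)
    also have "... \<le> (of_nat N * ?d1) / (of_nat n * of_nat N)" using ineq[OF h P] by (intro divide_right_mono) auto
    also have "... = 1 / of_nat n * ?d1" using n0 N0 by simp
    finally show "(1 - of_nat fx / of_nat n) * (1 / of_nat N * ?d2) \<le> 1 / of_nat n * ?d1" .
  qed
  ultimately show ?thesis unfolding fx_def by blast
qed

end
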